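(* Let $R$ (red points) and $B$ (blue points) be independent Poisson point processes of intensity $1$ on $\mathbb{R}$. Almost surely: (i) If $\gamma,\gamma'\in(1,\infty]\cup\{1^+\}$ and $a,a'\in(0,\infty)$, the set of $(\gamma,a)$-minimal matchings is identical to the set of $(\gamma',a')$-minimal matchings. (ii) For $\gamma\in\{-\infty,1^-,\infty\}$, the set of $(\gamma,a)$-minimal matchings is identical to the set of $(\gamma,a')$-minimal matchings for any $a\neq a'\in(0,\infty)$. (iii) If $\gamma\in[-\infty,1)$, $\gamma'\in[-\infty,1)\cup\{1^-\}$ and $a,a'\in(0,\infty)$, then the unique $(\gamma,a)$-minimal matching has finite difference with the unique $(\gamma',a')$-minimal matching if $\gamma'\neq1^-$, and with any one of the countably many $(1^-,a')$-minimal matchings if $\gamma'=1^-$.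
   Context: A matching $M$ between $R$ (red) and $B$ (blue) is a set of edges $\langle x,y\rangle$, $x\in R$, $y\in B$, with each point in at most one edge; $M(x)$ is the partner of $x$, and $|x-M(x)|=\infty$ if $x$ is unmatched. With cost function $f$, the edge $\langle x,y\rangle$ costs $f(y-x)$, and the cost of a finite matching is the sum over its edges; unmatched points count as infinite cost. For finite $R,B$ an $f$-minimal matching minimizes total cost among the matchings with as few unmatched points as possible. For countable $R,B$, call a finite set $S\subset R\cup B$ admissible for $M$ if it is a union of edges of $M$ and unmatched points; $M$ is $f$-minimal if for every admissible $S$ the restriction $M|_S$ is an $f$-minimal matching between $R\cap S$ and $B\cap S$. For $a\in(0,\infty)$ and $\gamma\in\mathbb{R}$ define, for $x\neq0$: if $\gamma>0$, $f_{\gamma,a}(x)=a|x|^\gamma$ for $x<0$ and $x^\gamma$ for $x>0$; if $\gamma=0$, $f_{0,a}(x)=\log(a|x|)$ for $x<0$ and $\log x$ for $x>0$; if $\gamma<0$, $f_{\gamma,a}(x)=-a|x|^{\gamma}$ for $x<0$ and $-x^{\gamma}$ for $x>0$. A $(\gamma,a)$-minimal matching is an $f_{\gamma,a}$-minimal matching. Limiting values of $\gamma$ (with $a$ fixed): $M$ is $(1^+,a)$-minimal (resp. $(1^-,a)$-minimal) if for every admissible $S$, $M|_S$ is $f_{\gamma,a}$-minimal between $R\cap S$ and $B\cap S$ for all $\gamma>1$ (resp. $\gamma<1$) sufficiently close to $1$. $M$ is $(-\infty,a)$-minimal if it is stable: $\min(|x-M(x)|,|y-M(y)|)\le|x-y|$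 for all $x,y$ of opposite colour. $M$ is $(\infty,a)$-minimal if it is altruistic: for every admissible $S$, among matchings of $R\cap S$ and $B\cap S$ with as few unmatched points as possible, $M|_S$ minimizes in lexicographic order the sequence of edge lengths arranged in descending order. Two matchings $M,M'$ between $R$ and $B$ have finite difference if the multigraph on $R\cup B$ formed by the union of their edges has no infinite connected component. *)

theory Defs
  imports "HOL-Probability.Probability"
begin

section \<open>Poisson point processes on the line\<close>

(* A point process is a random locally finite subset of the line.  Local finiteness is part of the
   definition, so card below never takes its default value 0 on an infinite set. *)
definition point_process :: "'w measure \<Rightarrow> ('w \<Rightarrow> real set) \<Rightarrow> bool" where
  "point_process P X \<longleftrightarrow>
     (\<forall>\<omega>\<in>space P. \<forall>A. bounded A \<longrightarrow> finite (X \<omega> \<inter> A)) \<and>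
     (\<forall>A\<in>sets borel. bounded A \<longrightarrow>
        (\<lambda>\<omega>. card (X \<omega> \<inter> A)) \<in> measurable P (count_space UNIV))"

definition poisson_process :: "'w measure \<Rightarrow> real \<Rightarrow> ('w \<Rightarrow> real set) \<Rightarrow> bool" where
  "poisson_process P r X \<longleftrightarrow>
     point_process P X \<and>
     (\<forall>A\<in>sets borel. bounded A \<longrightarrow>
        (\<forall>k. measure P {\<omega> \<in> space P. card (X \<omega> \<inter> A) = k}
              = exp (- (r * measure lborel A)) * (r * measure lborel A) ^ k / fact k)) \<and>
     (\<forall>(n::nat) A. (\<forall>i<n. A i \<in> sets borel \<and> bounded (A i)) \<longrightarrow> disjoint_family_on A {..<n} \<longrightarrow>
        prob_space.indep_vars P (\<lambda>_. count_space UNIV) (\<lambda>i \<omega>. card (X \<omega> \<inter> A i)) {..<n})"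

definition process_events :: "'w measure \<Rightarrow> ('w \<Rightarrow> real set) \<Rightarrow> 'w set set" where
  "process_events P X = sigma_sets (space P)
     {{\<omega> \<in> space P. card (X \<omega> \<inter> A) = k} | A k. A \<in> sets borel \<and> bounded A}"

definition indep_processes ::
  "'w measure \<Rightarrow> ('w \<Rightarrow> real set) \<Rightarrow> ('w \<Rightarrow> real set) \<Rightarrow> bool" where
  "indep_processes P X Y \<longleftrightarrow>
     prob_space.indep_set P (process_events P X) (process_events P Y)"


section \<open>Matchings\<close>

(* An edge is a pair (x, y) with x red and y blue. *)
type_synonym matching = "(real \<times> real) set"

definition is_matching :: "real set \<Rightarrow> real set \<Rightarrow> matching \<Rightarrow> bool" where
  "is_matching R B M \<longleftrightarrow> M \<subseteq> R \<times> B \<and>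
     (\<forall>x y y'. (x, y) \<in> M \<longrightarrow> (x, y') \<in> M \<longrightarrow> y = y') \<and>
     (\<forall>x x' y. (x, y) \<in> M \<longrightarrow> (x', y) \<in> M \<longrightarrow> x = x')"

definition unmatched :: "real set \<Rightarrow> real set \<Rightarrow> matching \<Rightarrow> real set" where
  "unmatched R B M = (R - fst ` M) \<union> (B - snd ` M)"

definition fewest_unmatched :: "real set \<Rightarrow> real set \<Rightarrow> matching \<Rightarrow> bool" where
  "fewest_unmatched R B M \<longleftrightarrow> is_matching R B M \<and>
     (\<forall>M'. is_matching R B M' \<longrightarrow> card (unmatched R B M) \<le> card (unmatched R B M'))"

definition cost :: "(real \<Rightarrow> real) \<Rightarrow> matching \<Rightarrow> real" where
  "cost f M = (\<Sum>(x, y)\<in>M. f (y - x))"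

definition minimal_finite :: "(real \<Rightarrow> real) \<Rightarrow> real set \<Rightarrow> real set \<Rightarrow> matching \<Rightarrow> bool" where
  "minimal_finite f R B M \<longleftrightarrow> fewest_unmatched R B M \<and>
     (\<forall>M'. fewest_unmatched R B M' \<longrightarrow> cost f M \<le> cost f M')"

definition admissible :: "real set \<Rightarrow> real set \<Rightarrow> matching \<Rightarrow> real set \<Rightarrow> bool" where
  "admissible R B M S \<longleftrightarrow> finite S \<and>
     (\<exists>E U. E \<subseteq> M \<and> U \<subseteq> unmatched R B M \<and> S = fst ` E \<union> snd ` E \<union> U)"

definition restrict_matching :: "matching \<Rightarrow> real set \<Rightarrow> matching" where
  "restrict_matching M S = M \<inter> (S \<times> S)"

definition minimal_on :: "(real \<Rightarrow> real) \<Rightarrow> real set \<Rightarrow> real set \<Rightarrow> matching \<Rightarrow> real set \<Rightarrow> bool" where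
  "minimal_on f R B M S \<longleftrightarrow> minimal_finite f (R \<inter> S) (B \<inter> S) (restrict_matching M S)"

definition minimal :: "(real \<Rightarrow> real) \<Rightarrow> real set \<Rightarrow> real set \<Rightarrow> matching \<Rightarrow> bool" where
  "minimal f R B M \<longleftrightarrow> is_matching R B M \<and>
     (\<forall>S. admissible R B M S \<longrightarrow> minimal_on f R B M S)"

(* The cost is only meaningful for x \<noteq> 0; almost surely no red point is also a blue point. *)
definition power_cost :: "real \<Rightarrow> real \<Rightarrow> real \<Rightarrow> real" where
  "power_cost \<gamma> a x =
     (if \<gamma> > 0 then (if x < 0 then a * \<bar>x\<bar> powr \<gamma> else x powr \<gamma>)
      else if \<gamma> = 0 then (if x < 0 then ln (a * \<bar>x\<bar>) else ln x)
      else (if x < 0 then - (a * \<bar>x\<bar> powr \<gamma>) else - (x powr \<gamma>)))"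

(* Length of the edge at a red (resp. blue) point, infinite if the point is unmatched. *)
definition red_dist :: "matching \<Rightarrow> real \<Rightarrow> ereal" where
  "red_dist M x = (if x \<in> fst ` M then ereal \<bar>x - (THE y. (x, y) \<in> M)\<bar> else \<infinity>)"

definition blue_dist :: "matching \<Rightarrow> real \<Rightarrow> ereal" where
  "blue_dist M y = (if y \<in> snd ` M then ereal \<bar>y - (THE x. (x, y) \<in> M)\<bar> else \<infinity>)"

definition stable :: "real set \<Rightarrow> real set \<Rightarrow> matching \<Rightarrow> bool" where
  "stable R B M \<longleftrightarrow> is_matching R B M \<and>
     (\<forall>x\<in>R. \<forall>y\<in>B. min (red_dist M x) (blue_dist M y) \<le> ereal \<bar>x - y\<bar>)"

definition descending_lengths :: "matching \<Rightarrow> real list" where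
  "descending_lengths M =
     rev (sorted_list_of_multiset (image_mset (\<lambda>(x, y). \<bar>x - y\<bar>) (mset_set M)))"

definition lex_le :: "real list \<Rightarrow> real list \<Rightarrow> bool" where
  "lex_le xs ys \<longleftrightarrow> xs = ys \<or> (xs, ys) \<in> lexord {(u, v). u < v}"

definition altruistic :: "real set \<Rightarrow> real set \<Rightarrow> matching \<Rightarrow> bool" where
  "altruistic R B M \<longleftrightarrow> is_matching R B M \<and>
     (\<forall>S. admissible R B M S \<longrightarrow>
        fewest_unmatched (R \<inter> S) (B \<inter> S) (restrict_matching M S) \<and>
        (\<forall>M'. fewest_unmatched (R \<inter> S) (B \<inter> S) M' \<longrightarrow>
           lex_le (descending_lengths (restrict_matching M S)) (descending_lengths M')))"

datatype exponent = Minus_Infinity | Exponent real | One_Minus | One_Plus | Plus_Infinity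

(* In the cases 1+ and 1-, how close to 1 the exponent has to be may depend on S. *)
fun minimal_matching :: "exponent \<Rightarrow> real \<Rightarrow> real set \<Rightarrow> real set \<Rightarrow> matching \<Rightarrow> bool" where
  "minimal_matching (Exponent \<gamma>) a R B M \<longleftrightarrow> minimal (power_cost \<gamma> a) R B M"
| "minimal_matching One_Plus a R B M \<longleftrightarrow> is_matching R B M \<and>
     (\<forall>S. admissible R B M S \<longrightarrow>
        (\<forall>\<^sub>F \<gamma> in at_right 1. minimal_on (power_cost \<gamma> a) R B M S))"
| "minimal_matching One_Minus a R B M \<longleftrightarrow> is_matching R B M \<and>
     (\<forall>S. admissible R B M S \<longrightarrow>
        (\<forall>\<^sub>F \<gamma> in at_left 1. minimal_on (power_cost \<gamma> a) R B M S))"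
| "minimal_matching Minus_Infinity a R B M \<longleftrightarrow> stable R B M"
| "minimal_matching Plus_Infinity a R B M \<longleftrightarrow> altruistic R B M"

definition minimal_matchings :: "exponent \<Rightarrow> real \<Rightarrow> real set \<Rightarrow> real set \<Rightarrow> matching set" where
  "minimal_matchings \<gamma> a R B = {M. minimal_matching \<gamma> a R B M}"

definition finite_difference :: "real set \<Rightarrow> real set \<Rightarrow> matching \<Rightarrow> matching \<Rightarrow> bool" where
  "finite_difference R B M M' \<longleftrightarrow>
     (\<forall>v \<in> R \<union> B. finite (((M \<union> M') \<union> (M \<union> M')\<inverse>)\<^sup>* `` {v}))"

end

theory Submission
  imports Defs
begin

text \<open>Every case is minimality along a filter of exponents \<open>\<gamma>\<close>; for stable (\<open>\<gamma> \<rightarrow> -\<infinity>\<close>) and altruistic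
  (\<open>\<gamma> \<rightarrow> \<infinity>\<close>) matchings one may take \<open>a = 1\<close>, since a single edge length decides each comparison.

  Let the level of \<open>t\<close> be the signed surplus of red over blue points between 0 and \<open>t\<close>. For \<open>\<gamma> < 1\<close> the
  cost is concave on either side of 0, so minimal matchings are noncrossing and join points of equal
  level. Almost surely the level dips: there are \<open>s < 0 < t\<close> such that it stays low on stretches beyond
  \<open>s\<close> and \<open>t\<close> that are \<open>K\<close> times longer than \<open>t - s\<close>. The points of a given higher level between \<open>s\<close> and \<open>t\<close>
  are balanced, and an edge leaving them would be so long that rematching them among themselves is
  cheaper. Hence minimal matchings are perfect on these finite blocks, which exhaust the line. This gives
  existence, finite difference, and also uniqueness, because different finite matchings almost surely
  have different costs. As \<open>\<gamma>\<close> tends to 1 from below, minimality only requires that the edges of a level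
  all point in the same direction, and if a level points to the right then so do all higher ones;
  this leaves countably many matchings.

  For \<open>\<gamma> > 1\<close> the cost is convex, so minimal matchings are monotone. Almost surely there are surges, long
  stretches on which blue points come early and red points late (or vice versa); there it pays to shift
  the partners along the line so as to match a point that was left unmatched. So the minimal matchings
  are the perfect monotone ones, whatever \<open>\<gamma>\<close> and \<open>a\<close>.

  Dips and surges occur infinitely often because independent blocks of rapidly growing length drift in
  the required direction with probability bounded below, by the central limit theorem and Kolmogorov's
  maximal inequality.\<close>

section \<open>Matchings and exchanges\<close>

text \<open>In the limit cases, how close \<gamma> must come to its limit depends on the finite set
  \<open>S\<close>. \<open>weakly_minimal\<close> therefore lets the cost vary with \<open>S\<close>
  inside a family; structural facts that rest on a single exchange need no more, so one proof serves
  fixed and limiting exponents. On blocks one constant \<open>K\<close> must serve all exponents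
  near the limit. For 1- there is none: for fixed \<open>K\<close>, reconnecting two long edges
  across a block eventually stops paying as \<gamma> tends to 1. Hence 1- gets its own
  classification. Coincidences of costs are excluded for each fixed \<gamma> and \<open>a\<close>
  only, so uniqueness is asserted with a null set depending on them. Flanks that are long compared
  with the middle come from scaling: climbing to height about \<open>A * s * u\<close> takes about
  \<open>A * s\<close> pieces of duration \<open>u\<^sup>2\<close>, while a single piece of duration
  \<open>(s * u)\<^sup>2\<close> moves the walk by less than \<open>A * s * u\<close>. The ratio of
  durations is of order \<open>s / A\<close>, as large as desired, and for fixed \<open>s\<close>
  the probability stays bounded below.\<close>

lemma is_matching_inj:
  assumes "is_matching R B M"
  shows "inj_on fst M" "inj_on snd M"
proof -
  show "inj_on fst M" using assms unfolding is_matching_def inj_on_def by (metis prod.collapse)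
  show "inj_on snd M" using assms unfolding is_matching_def inj_on_def by (metis prod.collapse)
qed

lemma is_matching_subset:
  assumes "is_matching R B M" "E \<subseteq> M" "fst ` E \<subseteq> R'" "snd ` E \<subseteq> B'"
  shows "is_matching R' B' E"
proof -
  have "E \<subseteq> R' \<times> B'" using assms(3,4) by force
  then show ?thesis using assms(1,2) unfolding is_matching_def by blast
qed

lemma is_matching_unique:
  assumes "is_matching R B M"
  shows "(x, y) \<in> M \<Longrightarrow> (x, y') \<in> M \<Longrightarrow> y = y'" "(x, y) \<in> M \<Longrightarrow> (x', y) \<in> M \<Longrightarrow> x = x'"
    "(x, y) \<in> M \<Longrightarrow> x \<in> R" "(x, y) \<in> M \<Longrightarrow> y \<in> B"
  using assms unfolding is_matching_def by auto

lemma finite_matching: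
  assumes "is_matching R B M" "finite R" "finite B"
  shows "finite M"
  using assms finite_subset[of M "R \<times> B"] unfolding is_matching_def by auto

lemma card_unmatched:
  assumes "is_matching R B M" "finite R" "finite B" "R \<inter> B = {}"
  shows "card (unmatched R B M) + 2 * card M = card R + card B"
proof -
  have sub: "fst ` M \<subseteq> R" "snd ` M \<subseteq> B" using assms(1) unfolding is_matching_def by auto
  have fM: "finite M" using finite_matching assms by blast
  have c: "card (fst ` M) = card M" "card (snd ` M) = card M"
    using is_matching_inj[OF assms(1)] by (auto simp: card_image)
  have "card (unmatched R B M) = card (R - fst ` M) + card (B - snd ` M)"
    unfolding unmatched_def using assms by (intro card_Un_disjoint) auto
  also have "\<dots> = (card R - card M) + (card B - card M)"
    using sub fM assms c by (simp add: card_Diff_subset)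
  finally show ?thesis
    using card_mono[OF assms(2) sub(1)] card_mono[OF assms(3) sub(2)] c by linarith
qed

lemma ex_matching_card:
  assumes "finite R" "finite B"
  shows "\<exists>M. is_matching R B M \<and> card M = min (card R) (card B)"
proof -
  obtain R' where R': "R' \<subseteq> R" "card R' = min (card R) (card B)" "finite R'"
    by (metis assms(1) finite_subset min.cobounded1 obtain_subset_with_card_n)
  obtain B' where B': "B' \<subseteq> B" "card B' = min (card R) (card B)" "finite B'"
    by (metis assms(2) finite_subset min.cobounded2 obtain_subset_with_card_n)
  obtain g where g: "bij_betw g R' B'"
    using R' B' by (metis finite_same_card_bij)
  define M where "M = (\<lambda>x. (x, g x)) ` R'"
  have "is_matching R B M"
    using g R' B' unfolding is_matching_def M_def bij_betw_def by (auto dest: inj_onD)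
  moreover have "card M = card R'" unfolding M_def by (intro card_image) (auto simp: inj_on_def)
  ultimately show ?thesis using R' by auto
qed

lemma card_matching_le:
  assumes "is_matching R B M" "finite R" "finite B"
  shows "card M \<le> min (card R) (card B)"
proof -
  have sub: "fst ` M \<subseteq> R" "snd ` M \<subseteq> B" using assms(1) unfolding is_matching_def by auto
  show ?thesis
    using card_mono[OF assms(2) sub(1)] card_mono[OF assms(3) sub(2)] is_matching_inj[OF assms(1)]
    by (simp add: card_image)
qed

text \<open>Each edge takes two points out of the unmatched set, so leaving the fewest points
  unmatched means having as many edges as the smaller colour permits.\<close>

lemma fewest_unmatched_iff:
  assumes "finite R" "finite B" "R \<inter> B = {}"
  shows "fewest_unmatched R B M \<longleftrightarrow> is_matching R B M \<and> card M = min (card R) (card B)"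
proof -
  have *: "card (unmatched R B M1) \<le> card (unmatched R B M2) \<longleftrightarrow> card M2 \<le> card M1"
    if "is_matching R B M1" "is_matching R B M2" for M1 M2
    using card_unmatched[OF that(1) assms] card_unmatched[OF that(2) assms] by linarith
  obtain M0 where M0: "is_matching R B M0" "card M0 = min (card R) (card B)"
    using ex_matching_card assms by blast
  show ?thesis
  proof
    assume f: "fewest_unmatched R B M"
    then have m: "is_matching R B M" unfolding fewest_unmatched_def by auto
    have "card M0 \<le> card M" using f M0 *[OF m M0(1)] unfolding fewest_unmatched_def by blast
    then show "is_matching R B M \<and> card M = min (card R) (card B)"
      using m M0 card_matching_le[OF m assms(1,2)] by auto
  next
    assume m: "is_matching R B M \<and> card M = min (card R) (card B)"
    then show "fewest_unmatched R B M"
      unfolding fewest_unmatched_def using * card_matching_le assms by metis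
  qed
qed

lemma minimal_finite_iff:
  assumes "finite R" "finite B" "R \<inter> B = {}"
  shows "minimal_finite f R B M \<longleftrightarrow> is_matching R B M \<and> card M = min (card R) (card B) \<and>
    (\<forall>M'. is_matching R B M' \<longrightarrow> card M' = card M \<longrightarrow> cost f M \<le> cost f M')"
  unfolding minimal_finite_def fewest_unmatched_iff[OF assms] by auto

lemma finite_matchings: "finite R \<Longrightarrow> finite B \<Longrightarrow> finite {M. is_matching R B M}"
  by (rule finite_subset[of _ "Pow (R \<times> B)"]) (auto simp: is_matching_def)

lemma ex_minimal_finite:
  assumes "finite R" "finite B" "R \<inter> B = {}"
  shows "\<exists>M. minimal_finite f R B M"
proof -
  let ?A = "{M. is_matching R B M \<and> card M = min (card R) (card B)}"
  have "finite ?A" using finite_matchings[OF assms(1,2)] by (rule rev_finite_subset) auto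
  moreover have "?A \<noteq> {}" using ex_matching_card[OF assms(1,2)] by simp
  ultimately have "arg_min_on (cost f) ?A \<in> ?A"
    "\<And>M'. M' \<in> ?A \<Longrightarrow> cost f (arg_min_on (cost f) ?A) \<le> cost f M'"
    by (rule arg_min_if_finite(1), rule arg_min_least)
  then show ?thesis unfolding minimal_finite_iff[OF assms] by auto
qed

text \<open>An admissible set determines its own edges: a red point of \<open>S\<close> that is
  matched in \<open>M\<close> must be an endpoint of an edge in \<open>E\<close>, since it is
  neither blue nor unmatched.\<close>

lemma admissible_parts:
  assumes "is_matching R B M" "R \<inter> B = {}" "E \<subseteq> M" "U \<subseteq> unmatched R B M"
    "S = fst ` E \<union> snd ` E \<union> U"
  shows "R \<inter> S = fst ` E \<union> (U \<inter> R)" "B \<inter> S = snd ` E \<union> (U \<inter> B)" "restrict_matching M S = E"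
proof -
  have s: "fst ` E \<subseteq> R" "snd ` E \<subseteq> B" "U \<subseteq> R \<union> B"
    using assms unfolding is_matching_def unmatched_def by auto
  show "R \<inter> S = fst ` E \<union> (U \<inter> R)" "B \<inter> S = snd ` E \<union> (U \<inter> B)" using s assms by auto
  show "restrict_matching M S = E"
  proof
    show "E \<subseteq> restrict_matching M S"
      unfolding restrict_matching_def assms(5) using assms(3) by force
    show "restrict_matching M S \<subseteq> E"
    proof
      fix e assume "e \<in> restrict_matching M S"
      then obtain x y where e: "e = (x, y)" "(x, y) \<in> M" "x \<in> S"
        unfolding restrict_matching_def by auto
      have x: "x \<in> R" "x \<in> fst ` M" using e(2) is_matching_unique(3)[OF assms(1)] by force+
      have "x \<notin> snd ` E" using x(1) s(2) assms(2) by blast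
      moreover have "x \<notin> U" using x assms(2,4) unfolding unmatched_def by blast
      ultimately have "x \<in> fst ` E" using e(3) assms(5) by blast
      then obtain y' where "(x, y') \<in> E" by auto
      then show "e \<in> E" using e assms(1,3) is_matching_unique(1)[OF assms(1)] by blast
    qed
  qed
qed

lemma admissibleI:
  assumes "E \<subseteq> M" "U \<subseteq> unmatched R B M" "finite E" "finite U"
  shows "admissible R B M (fst ` E \<union> snd ` E \<union> U)"
  using assms unfolding admissible_def by auto

text \<open>The working form of local minimality: a competitor \<open>E'\<close> may use points of
  \<open>U\<close> in place of endpoints of \<open>E\<close>, as long as the number of edges is
  kept. A red and a blue point in \<open>U\<close> together could be joined, which would lower the
  number of unmatched points.\<close>

lemma exchange:
  assumes M: "is_matching R B M" "R \<inter> B = {}" and E: "E \<subseteq> M" "U \<subseteq> unmatched R B M" "finite E" "finite U"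
    and min: "minimal_on f R B M (fst ` E \<union> snd ` E \<union> U)"
  shows "U \<inter> R = {} \<or> U \<inter> B = {}"
    "\<And>E'. is_matching (fst ` E \<union> (U \<inter> R)) (snd ` E \<union> (U \<inter> B)) E' \<Longrightarrow> card E' = card E \<Longrightarrow>
       cost f E \<le> cost f E'"
proof -
  note parts = admissible_parts[OF M E(1,2) refl]
  have mm: "minimal_finite f (fst ` E \<union> (U \<inter> R)) (snd ` E \<union> (U \<inter> B)) E"
    using min unfolding minimal_on_def parts .
  have s: "fst ` E \<subseteq> R" "snd ` E \<subseteq> B" using E M unfolding is_matching_def by auto
  have fin: "finite (fst ` E \<union> (U \<inter> R))" "finite (snd ` E \<union> (U \<inter> B))" using E by auto
  have dis: "(fst ` E \<union> (U \<inter> R)) \<inter> (snd ` E \<union> (U \<inter> B)) = {}" using s M(2) by auto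
  note mm = mm[unfolded minimal_finite_iff[OF fin dis]]
  then show "\<And>E'. is_matching (fst ` E \<union> (U \<inter> R)) (snd ` E \<union> (U \<inter> B)) E' \<Longrightarrow> card E' = card E \<Longrightarrow>
       cost f E \<le> cost f E'" by blast
  have "is_matching R B E" using is_matching_subset[OF M(1) E(1)] s by auto
  note inj = is_matching_inj[OF this]
  have d: "fst ` E \<inter> (U \<inter> R) = {}" "snd ` E \<inter> (U \<inter> B) = {}"
    using E M s unfolding unmatched_def by blast+
  have "card (fst ` E \<union> (U \<inter> R)) = card E + card (U \<inter> R)"
    "card (snd ` E \<union> (U \<inter> B)) = card E + card (U \<inter> B)"
    using d E inj by (simp_all add: card_Un_disjoint card_image)
  then have "card (U \<inter> R) = 0 \<or> card (U \<inter> B) = 0" using mm by linarith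
  then show "U \<inter> R = {} \<or> U \<inter> B = {}" using E by auto
qed

text \<open>A cheaper matching of an admissible part could be spliced into \<open>M\<close> in place
  of \<open>E\<close>. Thus finite minimizers are subject to all results on
  \<open>weakly_minimal\<close>.\<close>

lemma minimal_finite_imp_minimal_on:
  assumes fin: "finite R" "finite B" and dis: "R \<inter> B = {}" and min: "minimal_finite f R B M"
    and adm: "admissible R B M S"
  shows "minimal_on f R B M S"
proof -
  note m = min[unfolded minimal_finite_iff[OF fin dis]]
  have M: "is_matching R B M" using m by auto
  obtain E U where EU: "E \<subseteq> M" "U \<subseteq> unmatched R B M" "S = fst ` E \<union> snd ` E \<union> U"
    using adm unfolding admissible_def by auto
  note parts = admissible_parts[OF M dis EU]
  have s: "fst ` E \<subseteq> R" "snd ` E \<subseteq> B" using EU M unfolding is_matching_def by auto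
  have finM: "finite M" using finite_matching[OF M fin] .
  have finE: "finite E" "finite U"
    using finM EU fin by (auto simp: unmatched_def intro: finite_subset)
  have E: "is_matching R B E" using is_matching_subset[OF M EU(1) s] .
  have fin': "finite (fst ` E \<union> (U \<inter> R))" "finite (snd ` E \<union> (U \<inter> B))" using finE by auto
  have dis': "(fst ` E \<union> (U \<inter> R)) \<inter> (snd ` E \<union> (U \<inter> B)) = {}" using s dis by auto
  have d: "fst ` E \<inter> (U \<inter> R) = {}" "snd ` E \<inter> (U \<inter> B) = {}"
    using EU M s dis unfolding unmatched_def by blast+
  \<comment> \<open>A matching of maximal size exhausts one colour, so \<open>U\<close> has a single
    colour and \<open>E\<close> is of maximal size on its own points.\<close>
  have one: "U \<inter> R = {} \<or> U \<inter> B = {}"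
  proof -
    have "card M = card R \<or> card M = card B" using m by linarith
    moreover have "fst ` M = R" if "card M = card R"
      using that is_matching_inj[OF M] M fin(1) by (intro card_subset_eq) (auto simp: card_image is_matching_def)
    moreover have "snd ` M = B" if "card M = card B"
      using that is_matching_inj[OF M] M fin(2) by (intro card_subset_eq) (auto simp: card_image is_matching_def)
    ultimately show ?thesis using EU dis unfolding unmatched_def by blast
  qed
  have cards: "card (fst ` E \<union> (U \<inter> R)) = card E + card (U \<inter> R)"
    "card (snd ` E \<union> (U \<inter> B)) = card E + card (U \<inter> B)"
    using d finE is_matching_inj[OF E] by (simp_all add: card_Un_disjoint card_image)
  show ?thesis unfolding minimal_on_def parts minimal_finite_iff[OF fin' dis']
  proof (intro conjI allI impI)
    show "is_matching (fst ` E \<union> U \<inter> R) (snd ` E \<union> U \<inter> B) E"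
      using is_matching_subset[OF M EU(1)] by auto
    show "card E = min (card (fst ` E \<union> U \<inter> R)) (card (snd ` E \<union> U \<inter> B))"
      using one cards by auto
    fix E' assume E': "is_matching (fst ` E \<union> U \<inter> R) (snd ` E \<union> U \<inter> B) E'" "card E' = card E"
    have fE': "finite E'" using finite_matching[OF E'(1) fin'] .
    \<comment> \<open>The remaining edges of \<open>M\<close> share no endpoint with
      \<open>E'\<close>; this makes the spliced set a matching with as many edges as
      \<open>M\<close>.\<close>
    have fd: "fst ` E' \<inter> fst ` (M - E) = {}" "snd ` E' \<inter> snd ` (M - E) = {}"
    proof -
      have "fst ` (M - E) \<inter> fst ` E = {}"
        using is_matching_inj(1)[OF M] EU(1) by (auto simp: inj_on_def)
      moreover have "fst ` (M - E) \<inter> (U \<inter> R) = {}" using EU dis unfolding unmatched_def by auto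
      moreover have "fst ` E' \<subseteq> fst ` E \<union> U \<inter> R" using is_matching_unique(3)[OF E'(1)] by force
      ultimately show "fst ` E' \<inter> fst ` (M - E) = {}" by blast
      have "snd ` (M - E) \<inter> snd ` E = {}"
        using is_matching_inj(2)[OF M] EU(1) by (auto simp: inj_on_def)
      moreover have "snd ` (M - E) \<inter> (U \<inter> B) = {}" using EU dis unfolding unmatched_def by auto
      moreover have "snd ` E' \<subseteq> snd ` E \<union> U \<inter> B" using is_matching_unique(4)[OF E'(1)] by force
      ultimately show "snd ` E' \<inter> snd ` (M - E) = {}" by blast
    qed
    define M' where "M' = (M - E) \<union> E'"
    have "is_matching R B M'"
      unfolding is_matching_def
    proof (intro conjI allI impI)
      show "M' \<subseteq> R \<times> B" proof -
        have "fst ` E \<union> U \<inter> R \<subseteq> R" "snd ` E \<union> U \<inter> B \<subseteq> B" using s by auto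
        then have "E' \<subseteq> R \<times> B" using E'(1) unfolding is_matching_def by (meson Sigma_mono order_trans)
        then show ?thesis unfolding M'_def using M unfolding is_matching_def by auto
      qed
      show "y = y'" if "(x, y) \<in> M'" "(x, y') \<in> M'" for x y y'
      proof -
        have "\<not> ((x, v) \<in> E' \<and> (x, w) \<in> M - E)" for v w using fd(1) by force
        then show ?thesis using that is_matching_unique(1)[OF M] is_matching_unique(1)[OF E'(1)]
          unfolding M'_def by blast
      qed
      show "x = x'" if "(x, y) \<in> M'" "(x', y) \<in> M'" for x x' y
      proof -
        have "\<not> ((v, y) \<in> E' \<and> (w, y) \<in> M - E)" for v w using fd(2) by force
        then show ?thesis using that is_matching_unique(2)[OF M] is_matching_unique(2)[OF E'(1)]
          unfolding M'_def by blast
      qed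
    qed
    moreover have dj: "(M - E) \<inter> E' = {}" using fd by blast
    then have "card M' = card M"
      unfolding M'_def using finM fE' EU(1) finE E'(2) card_mono[OF finM EU(1)]
      by (simp add: card_Un_disjoint card_Diff_subset)
    ultimately have "cost f M \<le> cost f M'" using m by blast
    moreover have "cost f M' = cost f (M - E) + cost f E'"
      unfolding M'_def cost_def using finM fE' dj by (intro sum.union_disjoint) auto
    moreover have "cost f M = cost f (M - E) + cost f E"
      unfolding cost_def using finM EU(1) by (intro sum.subset_diff) auto
    ultimately show "cost f E \<le> cost f E'" by linarith
  qed
qed

text \<open>The cost is chosen after \<open>S\<close>. For a singleton family this is ordinary
  minimality; for a limiting exponent the family consists of the costs near the limit.\<close>

definition weakly_minimal :: "(real \<Rightarrow> real) set \<Rightarrow> real set \<Rightarrow> real set \<Rightarrow> matching \<Rightarrow> bool" where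
  "weakly_minimal Fs R B M \<longleftrightarrow> is_matching R B M \<and>
     (\<forall>S. admissible R B M S \<longrightarrow> (\<exists>f\<in>Fs. minimal_on f R B M S))"

lemma weakly_minimal_finite:
  assumes "finite R" "finite B" "R \<inter> B = {}" "minimal_finite f R B M"
  shows "weakly_minimal {f} R B M"
  using assms minimal_finite_imp_minimal_on minimal_finite_iff unfolding weakly_minimal_def by auto

section \<open>Elementary exchanges in a weakly minimal matching\<close>

context
  fixes Fs R B M
  assumes wm: "weakly_minimal Fs R B M" and dis: "R \<inter> B = {}"
begin

lemma weakly_minimal_exchange:
  assumes "E \<subseteq> M" "U \<subseteq> unmatched R B M" "finite E" "finite U"
    "is_matching (fst ` E \<union> (U \<inter> R)) (snd ` E \<union> (U \<inter> B)) E'" "card E' = card E"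
  shows "\<exists>f\<in>Fs. cost f E \<le> cost f E'"
proof -
  obtain f where "f \<in> Fs" "minimal_on f R B M (fst ` E \<union> snd ` E \<union> U)"
    using wm admissibleI[OF assms(1-4)] unfolding weakly_minimal_def by blast
  then show ?thesis using exchange(2)[OF _ dis assms(1-4) _ assms(5,6)] wm
    unfolding weakly_minimal_def by blast
qed

lemma weakly_minimal_swap:
  assumes "(x, y) \<in> M" "(x', y') \<in> M" "x \<noteq> x'"
  shows "\<exists>f\<in>Fs. f (y - x) + f (y' - x') \<le> f (y' - x) + f (y - x')"
proof -
  have m: "is_matching R B M" using wm unfolding weakly_minimal_def by auto
  have "y \<noteq> y'" using is_matching_unique(2)[OF m] assms by blast
  have "\<exists>f\<in>Fs. cost f {(x, y), (x', y')} \<le> cost f {(x, y'), (x', y)}"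
    using assms \<open>y \<noteq> y'\<close>
    by (intro weakly_minimal_exchange[where U = "{}"]) (auto simp: is_matching_def)
  then show ?thesis using assms \<open>y \<noteq> y'\<close> unfolding cost_def by simp
qed

lemma weakly_minimal_red:
  assumes "u \<in> R - fst ` M" "(x, y) \<in> M"
  shows "\<exists>f\<in>Fs. f (y - x) \<le> f (y - u)"
proof -
  have "\<exists>f\<in>Fs. cost f {(x, y)} \<le> cost f {(u, y)}"
    using assms
    by (intro weakly_minimal_exchange[where U = "{u}"]) (auto simp: is_matching_def unmatched_def)
  then show ?thesis unfolding cost_def by simp
qed

lemma weakly_minimal_blue:
  assumes "u \<in> B - snd ` M" "(x, y) \<in> M"
  shows "\<exists>f\<in>Fs. f (y - x) \<le> f (u - x)"
proof -
  have "\<exists>f\<in>Fs. cost f {(x, y)} \<le> cost f {(x, u)}"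
    using assms
    by (intro weakly_minimal_exchange[where U = "{u}"]) (auto simp: is_matching_def unmatched_def)
  then show ?thesis unfolding cost_def by simp
qed

text \<open>For a red \<open>u\<close> and a blue \<open>v\<close>, both unmatched, the admissible
  set \<open>{u, v}\<close> carries no edge of \<open>M\<close>, although joining the two would
  leave nothing unmatched.\<close>

lemma weakly_minimal_one_colour: "R \<subseteq> fst ` M \<or> B \<subseteq> snd ` M"
proof (rule ccontr)
  assume "\<not> ?thesis"
  then obtain u v where uv: "u \<in> R - fst ` M" "v \<in> B - snd ` M" by auto
  have a: "{u, v} \<subseteq> unmatched R B M" using uv unfolding unmatched_def by auto
  have m: "is_matching R B M" using wm unfolding weakly_minimal_def by auto
  let ?S = "fst ` ({} :: matching) \<union> snd ` ({} :: matching) \<union> {u, v}"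
  have "admissible R B M ?S" by (rule admissibleI[OF _ a]) auto
  then obtain f where "f \<in> Fs" and f: "minimal_on f R B M ?S"
    using wm unfolding weakly_minimal_def by blast
  have "{u, v} \<inter> R = {} \<or> {u, v} \<inter> B = {}"
    by (rule exchange(1)[OF m dis _ a _ _ f]) auto
  then show False using uv by auto
qed

end

section \<open>Exchange of the two colours\<close>

lemma converse_matching: "is_matching B R (M\<inverse>) \<longleftrightarrow> is_matching R B M"
proof -
  have "M\<inverse> \<subseteq> B \<times> R \<longleftrightarrow> M \<subseteq> R \<times> B" by auto
  then show ?thesis unfolding is_matching_def by blast
qed

lemma unmatched_converse: "unmatched B R (M\<inverse>) = unmatched R B M"
  unfolding unmatched_def by force

text \<open>Reversing an edge changes the sign of its displacement. Statements on blue points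
  thereby follow from those on red points, with the reflected cost.\<close>

lemma cost_converse: "cost f (M\<inverse>) = cost (\<lambda>z. f (- z)) M"
proof -
  have "M\<inverse> = prod.swap ` M" by force
  then have "cost f (M\<inverse>) = cost f (prod.swap ` M)" by simp
  also have "\<dots> = cost (\<lambda>z. f (- z)) M"
    unfolding cost_def by (subst sum.reindex) (auto simp: inj_on_def case_prod_unfold)
  finally show ?thesis .
qed

lemma fewest_unmatched_converse: "fewest_unmatched B R (M\<inverse>) \<longleftrightarrow> fewest_unmatched R B M"
  unfolding fewest_unmatched_def converse_matching unmatched_converse
  by (metis converse_converse converse_matching unmatched_converse)

lemma minimal_finite_converse:
  "minimal_finite f B R (M\<inverse>) \<longleftrightarrow> minimal_finite (\<lambda>z. f (- z)) R B M"
  unfolding minimal_finite_def fewest_unmatched_converse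
  by (metis converse_converse cost_converse fewest_unmatched_converse)

lemma minimal_on_converse: "minimal_on f B R (M\<inverse>) S \<longleftrightarrow> minimal_on (\<lambda>z. f (- z)) R B M S"
proof -
  have "restrict_matching (M\<inverse>) S = (restrict_matching M S)\<inverse>"
    unfolding restrict_matching_def by auto
  then show ?thesis unfolding minimal_on_def by (simp add: minimal_finite_converse)
qed

lemma admissible_converse: "admissible B R (M\<inverse>) S \<longleftrightarrow> admissible R B M S"
proof -
  have "admissible B R (M\<inverse>) S" if adm: "admissible R B M S" for R B and M :: matching
  proof -
    obtain E U where EU: "finite S" "E \<subseteq> M" "U \<subseteq> unmatched R B M" "S = fst ` E \<union> snd ` E \<union> U"
      using adm unfolding admissible_def by blast
    have "fst ` (E\<inverse>) = snd ` E" "snd ` (E\<inverse>) = fst ` E" by force+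
    then have "E\<inverse> \<subseteq> M\<inverse>" "S = fst ` (E\<inverse>) \<union> snd ` (E\<inverse>) \<union> U" using EU by auto
    then show ?thesis unfolding admissible_def unmatched_converse using EU by blast
  qed
  from this[of R B M] this[of B R "M\<inverse>"] show ?thesis by auto
qed

lemma weakly_minimal_converse:
  "weakly_minimal Fs B R (M\<inverse>) \<longleftrightarrow> weakly_minimal ((\<lambda>f z. f (- z)) ` Fs) R B M"
  unfolding weakly_minimal_def converse_matching admissible_converse by (simp add: minimal_on_converse)

text \<open>\<open>principal {\<gamma>}\<close> gives a single exponent, the one-sided filters at 1
  give the two limits there, and \<open>at_bot\<close> and \<open>at_top\<close> with
  \<open>a = 1\<close> will describe stable and altruistic matchings. \<open>S\<close> is quantified
  outside the filter, so the required closeness may depend on it.\<close>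

definition eventually_minimal ::
    "real filter \<Rightarrow> real \<Rightarrow> real set \<Rightarrow> real set \<Rightarrow> matching \<Rightarrow> bool" where
  "eventually_minimal F a R B M \<longleftrightarrow> is_matching R B M \<and>
     (\<forall>S. admissible R B M S \<longrightarrow> (\<forall>\<^sub>F \<gamma> in F. minimal_on (power_cost \<gamma> a) R B M S))"

text \<open>A proper filter contains an exponent that meets both requirements for the given
  \<open>S\<close>; it may change with \<open>S\<close>, which weak minimality allows.\<close>

lemma eventually_minimal_weakly:
  assumes "eventually_minimal F a R B M" "eventually P F" "F \<noteq> bot"
  shows "weakly_minimal {power_cost \<gamma> a |\<gamma>. P \<gamma>} R B M"
  unfolding weakly_minimal_def
proof (intro conjI allI impI)
  show "is_matching R B M" using assms unfolding eventually_minimal_def by auto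
  fix S assume "admissible R B M S"
  then have "\<forall>\<^sub>F \<gamma> in F. minimal_on (power_cost \<gamma> a) R B M S \<and> P \<gamma>"
    using assms unfolding eventually_minimal_def by (auto intro: eventually_conj)
  then obtain \<gamma> where "minimal_on (power_cost \<gamma> a) R B M S" "P \<gamma>"
    using assms(3) eventually_happens' by blast
  then show "\<exists>f\<in>{power_cost \<gamma> a |\<gamma>. P \<gamma>}. minimal_on f R B M S" by blast
qed

lemma eventually_minimal_finite:
  assumes "finite R" "finite B" "R \<inter> B = {}" "is_matching R B M"
    "\<forall>\<^sub>F \<gamma> in F. minimal_finite (power_cost \<gamma> a) R B M"
  shows "eventually_minimal F a R B M"
  unfolding eventually_minimal_def
  using assms minimal_finite_imp_minimal_on by (auto elim!: eventually_mono)

section \<open>Levels\<close>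

text \<open>Half-open intervals make the walk right-continuous, so that differences of levels count
  the points of \<open>{p<..q}\<close> whatever the signs of \<open>p\<close> and
  \<open>q\<close>.\<close>

definition lev :: "real set \<Rightarrow> real set \<Rightarrow> real \<Rightarrow> int" where
  "lev R B t = (if 0 \<le> t then int (card (R \<inter> {0<..t})) - int (card (B \<inter> {0<..t}))
     else int (card (B \<inter> {t<..0})) - int (card (R \<inter> {t<..0})))"

text \<open>The lower of the two values of the walk just before and at \<open>p\<close>. A point of
  level \<open>h\<close> is thus a crossing between \<open>h\<close> and \<open>h + 1\<close>,
  upwards if red and downwards if blue.\<close>

definition plev :: "real set \<Rightarrow> real set \<Rightarrow> real \<Rightarrow> int" where
  "plev R B p = (if p \<in> R then lev R B p - 1 else lev R B p)"

definition noncrossing :: "matching \<Rightarrow> bool" where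
  "noncrossing M \<longleftrightarrow> (\<forall>(x, y)\<in>M. \<forall>(x', y')\<in>M.
     \<not> (min x y < min x' y' \<and> min x' y' < max x y \<and> max x y < max x' y'))"

text \<open>Forbidding edges over unmatched points as well guarantees that the points beneath an
  edge are matched among themselves.\<close>

definition planar :: "real set \<Rightarrow> real set \<Rightarrow> matching \<Rightarrow> bool" where
  "planar R B M \<longleftrightarrow> is_matching R B M \<and> noncrossing M \<and>
     (\<forall>(x, y)\<in>M. \<forall>p\<in>unmatched R B M. \<not> (min x y < p \<and> p < max x y))"

lemma noncrossingD:
  "noncrossing M \<Longrightarrow> (x, y) \<in> M \<Longrightarrow> (x', y') \<in> M \<Longrightarrow>
   min x y < min x' y' \<Longrightarrow> min x' y' < max x y \<Longrightarrow> max x y < max x' y' \<Longrightarrow> False"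
  unfolding noncrossing_def by (metis (no_types, lifting) case_prodD)

text \<open>\<open>M\<close> restricts to a bijection between the red and the blue points of
  \<open>C\<close>.\<close>

lemma closed_balanced:
  assumes M: "is_matching R B M"
    and r: "\<And>p. p \<in> R \<inter> C \<Longrightarrow> \<exists>y\<in>C. (p, y) \<in> M"
    and b: "\<And>p. p \<in> B \<inter> C \<Longrightarrow> \<exists>x\<in>C. (x, p) \<in> M"
  shows "card (R \<inter> C) = card (B \<inter> C)"
proof -
  let ?E = "M \<inter> (C \<times> C)"
  have "fst ` ?E = R \<inter> C"
  proof
    show "fst ` ?E \<subseteq> R \<inter> C" using is_matching_unique(3)[OF M] by force
    show "R \<inter> C \<subseteq> fst ` ?E" using r by force
  qed
  moreover have "snd ` ?E = B \<inter> C"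
  proof
    show "snd ` ?E \<subseteq> B \<inter> C" using is_matching_unique(4)[OF M] by force
    show "B \<inter> C \<subseteq> snd ` ?E" using b by force
  qed
  moreover have "card (fst ` ?E) = card ?E" "card (snd ` ?E) = card ?E"
    using is_matching_inj[OF M] by (auto intro!: card_image elim: inj_on_subset)
  ultimately show ?thesis by simp
qed

locale points =
  fixes R B :: "real set"
  assumes finR: "finite (R \<inter> {a..b})" and finB: "finite (B \<inter> {a..b})" and disjoint: "R \<inter> B = {}"
begin

abbreviation "L \<equiv> lev R B"
abbreviation "PL \<equiv> plev R B"

lemma finite_points: "finite (R \<inter> {a<..b})" "finite (B \<inter> {a<..b})" "finite (R \<inter> {a<..<b})"
  "finite (B \<inter> {a<..<b})" "finite ((R \<union> B) \<inter> {a..b})"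
proof -
  show "finite (R \<inter> {a<..b})" "finite (R \<inter> {a<..<b})" by (rule finite_subset[OF _ finR[of a b]]; auto)+
  show "finite (B \<inter> {a<..b})" "finite (B \<inter> {a<..<b})" by (rule finite_subset[OF _ finB[of a b]]; auto)+
  show "finite ((R \<union> B) \<inter> {a..b})" using finR[of a b] finB[of a b] by (simp add: Int_Un_distrib2)
qed

lemma card_split:
  assumes "p \<le> q" "q \<le> r"
  shows "card (R \<inter> {p<..r}) = card (R \<inter> {p<..q}) + card (R \<inter> {q<..r})"
    "card (B \<inter> {p<..r}) = card (B \<inter> {p<..q}) + card (B \<inter> {q<..r})"
proof -
  have "X \<inter> {p<..r} = (X \<inter> {p<..q}) \<union> (X \<inter> {q<..r})" for X using assms by auto
  then show "card (R \<inter> {p<..r}) = card (R \<inter> {p<..q}) + card (R \<inter> {q<..r})"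
    "card (B \<inter> {p<..r}) = card (B \<inter> {p<..q}) + card (B \<inter> {q<..r})"
    by (metis (no_types, lifting) card_Un_disjoint disjoint_iff finite_points(1,2) Int_iff greaterThanAtMost_iff not_le)+
qed

lemma lev_diff:
  assumes "p \<le> q"
  shows "L q = L p + int (card (R \<inter> {p<..q})) - int (card (B \<inter> {p<..q}))"
proof -
  consider "0 \<le> p" | "q < 0" | "p < 0" "0 \<le> q" by linarith
  then show ?thesis
  proof cases
    case 1
    then show ?thesis using assms card_split[of 0 p q] unfolding lev_def by auto
  next
    case 2
    then show ?thesis using assms card_split[of p q 0] unfolding lev_def by auto
  next
    case 3
    then show ?thesis using assms card_split[of p 0 q] unfolding lev_def by auto
  qed
qed

lemma lev_const:
  assumes "s \<le> t" "\<And>p. p \<in> R \<union> B \<Longrightarrow> s < p \<Longrightarrow> p \<le> t \<Longrightarrow> False"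
  shows "L t = L s"
proof -
  have "R \<inter> {s<..t} = {}" "B \<inter> {s<..t} = {}" using assms(2) by (meson Int_iff Un_iff disjoint_iff greaterThanAtMost_iff)+
  then show ?thesis using lev_diff[OF assms(1)] by simp
qed

lemma gap_before:
  assumes "s < p"
  shows "\<exists>q. s \<le> q \<and> q < p \<and> (\<forall>r\<in>R \<union> B. \<not> (q < r \<and> r < p))"
proof -
  \<comment> \<open>The maximum is the last point before \<open>p\<close>, or \<open>s\<close> if no
    point lies in between.\<close>
  let ?A = "insert s ((R \<union> B) \<inter> {s<..<p})"
  have fin: "finite ?A" using finite_points(3,4)[of s p] by (simp add: Int_Un_distrib2)
  have m: "Max ?A \<in> ?A" using fin by (intro Max_in) auto
  have "\<not> (Max ?A < r \<and> r < p)" if "r \<in> R \<union> B" for r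
  proof
    assume r: "Max ?A < r \<and> r < p"
    moreover have "s \<le> Max ?A" using fin by (intro Max_ge) auto
    ultimately have "r \<in> ?A" using that by auto
    then show False using Max_ge[OF fin] r by fastforce
  qed
  moreover have "s \<le> Max ?A" using fin by (intro Max_ge) auto
  moreover have "Max ?A < p" using m assms by auto
  ultimately show ?thesis by blast
qed

lemma lev_before:
  assumes "s < p" "p \<in> R \<union> B"
  shows "\<exists>q. s \<le> q \<and> q < p \<and> (\<forall>t. q \<le> t \<longrightarrow> t < p \<longrightarrow> L t = (if p \<in> R then L p - 1 else L p + 1))"
proof -
  obtain q where q: "s \<le> q" "q < p" "\<forall>r\<in>R \<union> B. \<not> (q < r \<and> r < p)"
    using gap_before[OF assms(1)] by blast
  have "L t = (if p \<in> R then L p - 1 else L p + 1)" if t: "q \<le> t" "t < p" for t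
  proof -
    have *: "X \<inter> {t<..p} = (if p \<in> X then {p} else {})" if "X \<subseteq> R \<union> B" for X
    proof -
      have f: "r = p" if "r \<in> X" "t < r" "r \<le> p" for r
        using q(3) \<open>X \<subseteq> R \<union> B\<close> that t by (metis less_eq_real_def order_le_less_trans subsetD)
      have "X \<inter> {t<..p} \<subseteq> {p}"
      proof
        fix x assume "x \<in> X \<inter> {t<..p}"
        then show "x \<in> {p}" using f[of x] by simp
      qed
      moreover have "p \<in> {t<..p}" using t by simp
      ultimately show ?thesis by (simp add: set_eq_iff subset_iff) blast
    qed
    show ?thesis
      using lev_diff[of t p] t *[of R] *[of B] assms(2) disjoint by (auto split: if_splits)
  qed
  then show ?thesis using q by blast
qed

text \<open>Up-crossings and down-crossings of one height alternate, so their numbers differ by what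
  the two end values dictate. The induction removes the last point.\<close>

lemma card_level:
  assumes "s \<le> t"
  shows "int (card {p \<in> R. s < p \<and> p \<le> t \<and> PL p = h}) - int (card {p \<in> B. s < p \<and> p \<le> t \<and> PL p = h})
    = (if L t > h then 1 else 0) - (if L s > h then 1 else 0)"
  using assms
proof (induction "card ((R \<union> B) \<inter> {s<..t})" arbitrary: t rule: less_induct)
  case less
  let ?A = "(R \<union> B) \<inter> {s<..t}"
  have fin: "finite ((R \<union> B) \<inter> {s<..t'})" for t' using finite_points(1,2)[of s t'] by (simp add: Int_Un_distrib2)
  show ?case
  proof (cases "?A = {}")
    case True
    then have "L t = L s" using less.prems by (intro lev_const) auto
    moreover have "{p \<in> R. s < p \<and> p \<le> t \<and> PL p = h} = {}" "{p \<in> B. s < p \<and> p \<le> t \<and> PL p = h} = {}"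
      using True by auto
    ultimately show ?thesis by (simp only: card.empty)
  next
    case False
    define p where "p = Max ?A"
    have p: "p \<in> ?A" "\<And>r. r \<in> ?A \<Longrightarrow> r \<le> p" unfolding p_def using Max_in[OF fin False] Max_ge[OF fin] by auto
    have ps: "s < p" "p \<le> t" "p \<in> R \<union> B" using p by auto
    have Lt: "L t = L p" using ps p(2) by (intro lev_const) fastforce+
    obtain q where q: "s \<le> q" "q < p" "\<forall>r\<in>R \<union> B. \<not> (q < r \<and> r < p)"
      using gap_before[OF ps(1)] by blast
    obtain q' where q': "q \<le> q'" "q' < p" "\<forall>t. q' \<le> t \<longrightarrow> t < p \<longrightarrow> L t = (if p \<in> R then L p - 1 else L p + 1)"
      using lev_before[OF q(2) ps(3)] by blast
    have qq: "s \<le> q'" "L q' = (if p \<in> R then L p - 1 else L p + 1)" using q' q by auto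
    have pq: "r \<le> q' \<or> r = p" if "r \<in> R \<union> B" "r \<le> t" "s < r" for r
      using q(3) p(2)[of r] that q'(1) by (cases "r < p") force+
    have A: "?A = insert p ((R \<union> B) \<inter> {s<..q'})"
    proof
      show "?A \<subseteq> insert p ((R \<union> B) \<inter> {s<..q'})" 
      proof
        fix x assume "x \<in> ?A"
        then show "x \<in> insert p ((R \<union> B) \<inter> {s<..q'})" using pq[of x] by auto
      qed
      show "insert p ((R \<union> B) \<inter> {s<..q'}) \<subseteq> ?A" using ps q'(2) by auto
    qed
    have "p \<notin> (R \<union> B) \<inter> {s<..q'}" using q'(2) by auto
    then have "card ((R \<union> B) \<inter> {s<..q'}) < card ?A" unfolding A using fin by simp
    note IH = less.hyps[OF this qq(1)]
    have set: "{r \<in> X. s < r \<and> r \<le> t \<and> PL r = h} =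
        (if p \<in> X \<and> PL p = h then insert p {r \<in> X. s < r \<and> r \<le> q' \<and> PL r = h} else {r \<in> X. s < r \<and> r \<le> q' \<and> PL r = h})"
      if X: "X \<subseteq> R \<union> B" for X
    proof -
      have "r \<in> X \<and> s < r \<and> r \<le> t \<longleftrightarrow> r \<in> X \<and> s < r \<and> r \<le> q' \<or> r \<in> X \<and> r = p" for r
        using pq[of r] X ps q'(2) by fastforce
      then have "{r \<in> X. s < r \<and> r \<le> t \<and> PL r = h} =
        {r. (r \<in> X \<and> s < r \<and> r \<le> q' \<or> r \<in> X \<and> r = p) \<and> PL r = h}" by blast
      then show ?thesis by auto
    qed
    have notin: "p \<notin> {r \<in> X. s < r \<and> r \<le> q' \<and> PL r = h}" for X using q'(2) by auto
    have f: "finite {r \<in> R. s < r \<and> r \<le> q' \<and> PL r = h}" "finite {r \<in> B. s < r \<and> r \<le> q' \<and> PL r = h}"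
    proof -
      show "finite {r \<in> R. s < r \<and> r \<le> q' \<and> PL r = h}"
        by (rule finite_subset[OF _ finite_points(1)[of s q']]) auto
      show "finite {r \<in> B. s < r \<and> r \<le> q' \<and> PL r = h}"
        by (rule finite_subset[OF _ finite_points(2)[of s q']]) auto
    qed
    have "card {r \<in> R. s < r \<and> r \<le> t \<and> PL r = h} =
        card {r \<in> R. s < r \<and> r \<le> q' \<and> PL r = h} + (if p \<in> R \<and> PL p = h then 1 else 0)"
      "card {r \<in> B. s < r \<and> r \<le> t \<and> PL r = h} =
        card {r \<in> B. s < r \<and> r \<le> q' \<and> PL r = h} + (if p \<in> B \<and> PL p = h then 1 else 0)"
      using set[of R] set[of B] card_insert_disjoint[OF f(1) notin] card_insert_disjoint[OF f(2) notin]
      by (simp_all del: card_insert_if)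
    note cards = this
    show ?thesis
    proof (cases "p \<in> R")
      case True
      then have "p \<notin> B" "PL p = L p - 1" "L q' = L p - 1" using disjoint qq(2) unfolding plev_def by auto
      then show ?thesis using IH unfolding cards Lt using True by (simp split: if_splits)
    next
      case False
      then have "p \<in> B" "PL p = L p" "L q' = L p + 1" using ps(3) qq(2) unfolding plev_def by auto
      then show ?thesis using IH unfolding cards Lt using False by (simp split: if_splits)
    qed
  qed
qed


text \<open>A partner outside would create a crossing, and being unmatched beneath an edge is
  excluded by planarity.\<close>

lemma planar_partner:
  assumes pl: "planar R B M" and e: "(x, y) \<in> M" and p: "min x y < p" "p < max x y"
  shows "p \<in> R \<Longrightarrow> \<exists>y'. (p, y') \<in> M \<and> min x y < y' \<and> y' < max x y"
    "p \<in> B \<Longrightarrow> \<exists>x'. (x', p) \<in> M \<and> min x y < x' \<and> x' < max x y"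
proof -
  have M: "is_matching R B M" and nc: "noncrossing M" using pl unfolding planar_def by auto
  have um: "p \<notin> unmatched R B M" using pl e p unfolding planar_def by fast
  have pxy: "p \<noteq> x" "p \<noteq> y" using p by auto
  show "\<exists>y'. (p, y') \<in> M \<and> min x y < y' \<and> y' < max x y" if pR: "p \<in> R"
  proof -
    obtain y' where y': "(p, y') \<in> M" using um pR unfolding unmatched_def by force
    have "y' \<noteq> y" using is_matching_unique(2)[OF M] e y' pxy by blast
    moreover have "y' \<noteq> x" using is_matching_unique(3,4)[OF M] e y' disjoint by blast
    ultimately show ?thesis
      using noncrossingD[OF nc e y'] noncrossingD[OF nc y' e] p y' by (smt (verit))
  qed
  show "\<exists>x'. (x', p) \<in> M \<and> min x y < x' \<and> x' < max x y" if pB: "p \<in> B"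
  proof -
    obtain x' where x': "(x', p) \<in> M" using um pB unfolding unmatched_def by force
    have "x' \<noteq> x" using is_matching_unique(1)[OF M] e x' pxy by blast
    moreover have "x' \<noteq> y" using is_matching_unique(3,4)[OF M] e x' disjoint by blast
    ultimately show ?thesis
      using noncrossingD[OF nc e x'] noncrossingD[OF nc x' e] p x' by (smt (verit))
  qed
qed

text \<open>The points strictly beneath the edge are matched among themselves, hence balanced, so
  only the endpoints change the level.\<close>

lemma planar_level:
  assumes pl: "planar R B M" and e: "(x, y) \<in> M"
  shows "PL x = PL y" "x < y \<Longrightarrow> L y = L x - 1" "y < x \<Longrightarrow> L x = L y + 1"
proof -
  have M: "is_matching R B M" using pl unfolding planar_def by auto
  have xy: "x \<in> R" "y \<in> B" "x \<notin> B" "y \<notin> R" using is_matching_unique(3,4)[OF M] e disjoint by blast+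
  let ?C = "{min x y<..<max x y}"
  have "card (R \<inter> ?C) = card (B \<inter> ?C)"
  proof (rule closed_balanced[OF M])
    show "\<exists>y\<in>?C. (p, y) \<in> M" if "p \<in> R \<inter> ?C" for p
      using planar_partner(1)[OF pl e, of p] that by (metis Int_iff greaterThanLessThan_iff)
    show "\<exists>x\<in>?C. (x, p) \<in> M" if "p \<in> B \<inter> ?C" for p
      using planar_partner(2)[OF pl e, of p] that by (metis Int_iff greaterThanLessThan_iff)
  qed
  note bal = this
  show 1: "L y = L x - 1" if "x < y"
  proof -
    have "R \<inter> {x<..y} = R \<inter> ?C" "B \<inter> {x<..y} = insert y (B \<inter> ?C)" using that xy by (auto simp: less_le)
    moreover have "y \<notin> B \<inter> ?C" by auto
    ultimately show ?thesis using lev_diff[of x y] bal that finite_points(4)[of "min x y" "max x y"] by simp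
  qed
  show 2: "L x = L y + 1" if "y < x"
  proof -
    have "B \<inter> {y<..x} = B \<inter> ?C" "R \<inter> {y<..x} = insert x (R \<inter> ?C)" using that xy by (auto simp: less_le)
    moreover have "x \<notin> R \<inter> ?C" by auto
    ultimately show ?thesis using lev_diff[of y x] bal that finite_points(3)[of "min x y" "max x y"] by simp
  qed
  show "PL x = PL y" using 1 2 xy unfolding plev_def by (cases x y rule: linorder_cases) auto
qed

end

section \<open>Concave costs\<close>

text \<open>\<open>a\<close>, \<open>i\<close>, \<open>c\<close> are the successive gaps between
  four points: two nested edges of equal direction are strictly cheaper than the crossing pair on
  the same endpoints. No clause compares positive with negative arguments, as the weight acts on one
  side only.\<close>

definition concave_cost :: "(real \<Rightarrow> real) \<Rightarrow> bool" where
  "concave_cost f \<longleftrightarrow>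
     (\<forall>u v. 0 < u \<longrightarrow> u < v \<longrightarrow> f u < f v \<and> f (- u) < f (- v)) \<and>
     (\<forall>a i c. 0 < a \<longrightarrow> 0 < i \<longrightarrow> 0 < c \<longrightarrow> f (a + i + c) + f i < f (a + i) + f (i + c) \<and>
        f (- (a + i + c)) + f (- i) < f (- (a + i)) + f (- (i + c)))"

lemma concave_cost_mono:
  assumes "concave_cost f" "0 < u" "u < v"
  shows "f u < f v" "f (- u) < f (- v)"
  using assms unfolding concave_cost_def by auto

lemma concave_cost_nested:
  assumes "concave_cost f" "p < q" "q < r" "r < s"
  shows "f (s - p) + f (r - q) < f (r - p) + f (s - q)" "f (p - s) + f (q - r) < f (p - r) + f (q - s)"
proof -
  have "0 < q - p" "0 < r - q" "0 < s - r" using assms by auto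
  then have "f ((q - p) + (r - q) + (s - r)) + f (r - q) < f ((q - p) + (r - q)) + f ((r - q) + (s - r)) \<and>
        f (- ((q - p) + (r - q) + (s - r))) + f (- (r - q)) < f (- ((q - p) + (r - q))) + f (- ((r - q) + (s - r)))"
    using assms(1) unfolding concave_cost_def by blast
  then show "f (s - p) + f (r - q) < f (r - p) + f (s - q)" "f (p - s) + f (q - r) < f (p - r) + f (q - s)"
    by (simp_all add: algebra_simps)
qed

lemma weakly_minimal_planar:
  assumes wm: "weakly_minimal Fs R B M" and dis: "R \<inter> B = {}" and cc: "\<And>f. f \<in> Fs \<Longrightarrow> concave_cost f"
  shows "planar R B M"
proof -
  have M: "is_matching R B M" using wm unfolding weakly_minimal_def by auto
  have "noncrossing M"
    unfolding noncrossing_def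
  proof clarify
    fix x y x' y'
    assume e: "(x, y) \<in> M" "(x', y') \<in> M"
      and c: "min x y < min x' y'" "min x' y' < max x y" "max x y < max x' y'"
    have "x \<noteq> x'" using c is_matching_unique(1)[OF M] e by (metis less_irrefl)
    then obtain f where f: "f \<in> Fs" "f (y - x) + f (y' - x') \<le> f (y' - x) + f (y - x')"
      using weakly_minimal_swap[OF wm dis e] by blast
    note cf = cc[OF f(1)]
    have ne: "x \<noteq> y" "x' \<noteq> y'" using is_matching_unique(3,4)[OF M] e dis by blast+
    \<comment> \<open>Crossing edges of equal direction are exchanged into nested ones. For opposite
      directions the exchanged pair has the same two directions and each edge is shorter.\<close>
    consider "x < y" "x' < y'" | "y < x" "y' < x'" | "x < y" "y' < x'" | "y < x" "x' < y'"
      using ne by linarith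
    then show False
    proof cases
      case 1
      then show False using concave_cost_nested(1)[OF cf, of x x' y y'] c f(2) by simp
    next
      case 2
      then show False using concave_cost_nested(2)[OF cf, of y y' x x'] c f(2) by simp
    next
      case 3
      then have "f (y' - x) < f (y - x)" "f (- (x' - y)) < f (- (x' - y'))"
        using c concave_cost_mono(1)[OF cf, of "y' - x" "y - x"] concave_cost_mono(2)[OF cf, of "x' - y" "x' - y'"]
        by auto
      then show False using f(2) by simp
    next
      case 4
      then have "f (y' - x) < f (y' - x')" "f (- (x' - y)) < f (- (x - y))"
        using c concave_cost_mono(1)[OF cf, of "y' - x" "y' - x'"] concave_cost_mono(2)[OF cf, of "x' - y" "x - y"]
        by auto
      then show False using f(2) by simp
    qed
  qed
  moreover have "\<not> (min x y < p \<and> p < max x y)" if e: "(x, y) \<in> M" and p: "p \<in> unmatched R B M" for x y p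
  proof
    assume b: "min x y < p \<and> p < max x y"
    consider "p \<in> R - fst ` M" | "p \<in> B - snd ` M" using p unfolding unmatched_def by auto
    then show False
    proof cases
      case 1
      obtain f where f: "f \<in> Fs" "f (y - x) \<le> f (y - p)" using weakly_minimal_red[OF wm dis 1 e] by blast
      show False
      proof (cases "x < y")
        case True
        then have "f (y - p) < f (y - x)" using b by (intro concave_cost_mono[OF cc[OF f(1)]]) auto
        then show False using f by simp
      next
        case False
        then have "f (- (p - y)) < f (- (x - y))" using b by (intro concave_cost_mono[OF cc[OF f(1)]]) auto
        then show False using f by simp
      qed
    next
      case 2
      obtain f where f: "f \<in> Fs" "f (y - x) \<le> f (p - x)" using weakly_minimal_blue[OF wm dis 2 e] by blast
      show False
      proof (cases "x < y")
        case True
        then have "f (p - x) < f (y - x)" using b by (intro concave_cost_mono[OF cc[OF f(1)]]) auto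
        then show False using f by simp
      next
        case False
        then have "f (- (x - p)) < f (- (x - y))" using b by (intro concave_cost_mono[OF cc[OF f(1)]]) auto
        then show False using f by simp
      qed
    qed
  qed
  ultimately show ?thesis using M unfolding planar_def by blast
qed

text \<open>Length outweighs direction as soon as the lengths differ by the factor
  \<open>K\<close>.\<close>

definition gap_dominated :: "real \<Rightarrow> (real \<Rightarrow> real) \<Rightarrow> bool" where
  "gap_dominated K f \<longleftrightarrow> (\<forall>w l. 0 < w \<longrightarrow> K * w \<le> l \<longrightarrow>
     f w < f l \<and> f w < f (- l) \<and> f (- w) < f l \<and> f (- w) < f (- l))"

text \<open>Two successive edges of equal direction at distance \<open>w\<close> are replaced by an
  edge across the gap, in the opposite direction, and one edge over everything. This is the exchange
  available when edges leave a block on both sides.\<close>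

definition gap_subadditive :: "real \<Rightarrow> (real \<Rightarrow> real) \<Rightarrow> bool" where
  "gap_subadditive K f \<longleftrightarrow> (\<forall>w l l'. 0 < w \<longrightarrow> K * w \<le> l \<longrightarrow> K * w \<le> l' \<longrightarrow>
     f (- w) + f (l + w + l') < f l + f l' \<and> f w + f (- (l + w + l')) < f (- l) + f (- l'))"

text \<open>On the flanks the walk never crosses between \<open>h\<close> and \<open>h + 1\<close>,
  so they carry no point of level \<open>h\<close>. That both flanks lie on the same side makes the
  block between them balanced.\<close>

definition window :: "real set \<Rightarrow> real set \<Rightarrow> int \<Rightarrow> real \<Rightarrow> real \<Rightarrow> real \<Rightarrow> bool" where
  "window R B h s t G \<longleftrightarrow> s < t \<and> 0 < G \<and>
     ((\<forall>\<tau>. s - G \<le> \<tau> \<and> \<tau> \<le> s \<or> t \<le> \<tau> \<and> \<tau> \<le> t + G \<longrightarrow> lev R B \<tau> \<le> h) \<or>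
      (\<forall>\<tau>. s - G \<le> \<tau> \<and> \<tau> \<le> s \<or> t \<le> \<tau> \<and> \<tau> \<le> t + G \<longrightarrow> lev R B \<tau> > h))"

definition block :: "real set \<Rightarrow> real set \<Rightarrow> int \<Rightarrow> real \<Rightarrow> real \<Rightarrow> real set" where
  "block R B h s t = {p \<in> R \<union> B. s < p \<and> p \<le> t \<and> plev R B p = h}"

section \<open>Blocks of one level inside a window\<close>

context points
begin

text \<open>A point of level \<open>h\<close> in a flank would make the walk cross between
  \<open>h\<close> and \<open>h + 1\<close> there.\<close>

lemma block_far:
  assumes w: "window R B h s t G" and p: "p \<in> R \<union> B" "PL p = h" "p \<notin> block R B h s t"
  shows "p \<le> s - G \<or> t + G < p"
proof (rule ccontr)
  assume n: "\<not> ?thesis"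
  then have "s - G < p \<and> p \<le> s \<or> t < p \<and> p \<le> t + G"
    using p unfolding block_def by auto
  \<comment> \<open>The value just before \<open>p\<close> must also be taken inside the flank, so
    the flanks have to reach a little to the left of \<open>p\<close>; this excludes
    \<open>p = s - G\<close>.\<close>
  then obtain u where u: "u < p" "\<And>\<tau>. u \<le> \<tau> \<Longrightarrow> \<tau> \<le> p \<Longrightarrow> s - G \<le> \<tau> \<and> \<tau> \<le> s \<or> t \<le> \<tau> \<and> \<tau> \<le> t + G"
    by (metis order.trans less_imp_le)
  obtain q where q: "u \<le> q" "q < p" "L q = (if p \<in> R then L p - 1 else L p + 1)"
    using lev_before[OF u(1) p(1)] by auto
  have "(L q \<le> h \<and> L p \<le> h) \<or> (L q > h \<and> L p > h)"
    using w u(2)[of q] u(2)[of p] q u(1) unfolding window_def by (meson less_imp_le order_refl)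
  then show False using q(3) p(2) unfolding plev_def by (auto split: if_splits)
qed

lemma finite_block: "finite (block R B h s t)"
  by (rule finite_subset[OF _ finite_points(5)[of s t]]) (auto simp: block_def)

lemma block_balanced:
  assumes w: "window R B h s t G"
  shows "card (R \<inter> block R B h s t) = card (B \<inter> block R B h s t)"
proof -
  have st: "s \<le> t" "s - G \<le> s" "t \<le> t + G" using w unfolding window_def by auto
  have "(L t > h) = (L s > h)" using w st unfolding window_def by (metis linorder_not_less order_refl)
  moreover have "R \<inter> block R B h s t = {p \<in> R. s < p \<and> p \<le> t \<and> PL p = h}"
    "B \<inter> block R B h s t = {p \<in> B. s < p \<and> p \<le> t \<and> PL p = h}" unfolding block_def by auto
  ultimately show ?thesis using card_level[OF st(1), of h] by simp
qed

text \<open>By balance the edges inside the block miss equally many points of each colour. A point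
  is missed if it is unmatched and also if its partner lies outside.\<close>

lemma block_exits:
  assumes w: "window R B h s t G" and M: "is_matching R B M"
  defines "C \<equiv> block R B h s t"
  shows "(\<exists>r\<in>R \<inter> C. \<forall>y\<in>C. (r, y) \<notin> M) \<longleftrightarrow> (\<exists>b\<in>B \<inter> C. \<forall>x\<in>C. (x, b) \<notin> M)"
proof -
  let ?E = "M \<inter> (C \<times> C)"
  have c: "card (fst ` ?E) = card (snd ` ?E)"
    using is_matching_inj[OF M] by (subst (1 2) card_image) (auto elim: inj_on_subset)
  have s: "fst ` ?E \<subseteq> R \<inter> C" "snd ` ?E \<subseteq> B \<inter> C"
    using is_matching_unique(3,4)[OF M] by force+
  have fin: "finite (R \<inter> C)" "finite (B \<inter> C)" using finite_block unfolding C_def by auto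
  have "fst ` ?E = R \<inter> C \<longleftrightarrow> snd ` ?E = B \<inter> C"
    using c s fin block_balanced[OF w] unfolding C_def by (metis card_subset_eq)
  moreover have "fst ` ?E = R \<inter> C \<longleftrightarrow> \<not> (\<exists>r\<in>R \<inter> C. \<forall>y\<in>C. (r, y) \<notin> M)"
  proof
    assume l: "fst ` ?E = R \<inter> C"
    show "\<not> (\<exists>r\<in>R \<inter> C. \<forall>y\<in>C. (r, y) \<notin> M)"
    proof clarify
      fix r assume "r \<in> R" "r \<in> C" "\<forall>y\<in>C. (r, y) \<notin> M"
      moreover have "r \<in> fst ` ?E" using l calculation by blast
      ultimately show False by auto
    qed
  next
    assume "\<not> (\<exists>r\<in>R \<inter> C. \<forall>y\<in>C. (r, y) \<notin> M)"
    then have "R \<inter> C \<subseteq> fst ` ?E" by force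
    then show "fst ` ?E = R \<inter> C" using s by blast
  qed
  moreover have "snd ` ?E = B \<inter> C \<longleftrightarrow> \<not> (\<exists>b\<in>B \<inter> C. \<forall>x\<in>C. (x, b) \<notin> M)"
  proof
    assume l: "snd ` ?E = B \<inter> C"
    show "\<not> (\<exists>b\<in>B \<inter> C. \<forall>x\<in>C. (x, b) \<notin> M)"
    proof clarify
      fix r assume "r \<in> B" "r \<in> C" "\<forall>y\<in>C. (y, r) \<notin> M"
      moreover have "r \<in> snd ` ?E" using l calculation by blast
      ultimately show False by auto
    qed
  next
    assume "\<not> (\<exists>b\<in>B \<inter> C. \<forall>x\<in>C. (x, b) \<notin> M)"
    then have "B \<inter> C \<subseteq> snd ` ?E" by force
    then show "snd ` ?E = B \<inter> C" using s by blast
  qed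
  ultimately show ?thesis by blast
qed

context
  fixes M Fs K h s t G
  assumes wm: "weakly_minimal Fs R B M" and cc: "\<And>f. f \<in> Fs \<Longrightarrow> concave_cost f"
    and gd: "\<And>f. f \<in> Fs \<Longrightarrow> gap_dominated K f"
    and w: "window R B h s t G" and KG: "K * (t - s) \<le> G" and K: "1 \<le> K"
begin

text \<open>Planarity gives the partner the same level, so it lies beyond the flanks. The edge then
  has length at least \<open>G\<close>, hence at least \<open>K\<close> times the distance of any
  two points of the block.\<close>

lemma partner_outside_block:
  assumes "(x, y) \<in> M" "x \<in> block R B h s t \<longleftrightarrow> y \<notin> block R B h s t"
    "u \<in> block R B h s t" "v \<in> block R B h s t"
  shows "K * \<bar>u - v\<bar> \<le> \<bar>x - y\<bar>"
    "y \<in> block R B h s t \<Longrightarrow> x \<le> s - G \<or> t + G < x" "x \<in> block R B h s t \<Longrightarrow> y \<le> s - G \<or> t + G < y"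
proof -
  have pl: "planar R B M" using weakly_minimal_planar[OF wm disjoint cc] .
  have M: "is_matching R B M" using wm unfolding weakly_minimal_def by auto
  have xy: "x \<in> R" "y \<in> B" using is_matching_unique(3,4)[OF M assms(1)] by auto
  have "K * \<bar>u - v\<bar> \<le> K * (t - s)" using assms(3,4) K unfolding block_def by (intro mult_left_mono) auto
  then have uv: "K * \<bar>u - v\<bar> \<le> G" using KG by simp
  show 1: "x \<le> s - G \<or> t + G < x" if "y \<in> block R B h s t"
    using block_far[OF w, of x] that assms(2) planar_level(1)[OF pl assms(1)] xy unfolding block_def by auto
  show 2: "y \<le> s - G \<or> t + G < y" if "x \<in> block R B h s t"
    using block_far[OF w, of y] that assms(2) planar_level(1)[OF pl assms(1)] xy unfolding block_def by auto
  have "G \<le> \<bar>x - y\<bar>"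
  proof (cases "x \<in> block R B h s t")
    case True
    then show ?thesis using 2 unfolding block_def by fastforce
  next
    case False
    then have "y \<in> block R B h s t" using assms(2) by blast
    then show ?thesis using 1 unfolding block_def by fastforce
  qed
  then show "K * \<bar>u - v\<bar> \<le> \<bar>x - y\<bar>" using uv by linarith
qed

lemma gap_dominatedD:
  assumes "f \<in> Fs" "K * \<bar>u - v\<bar> \<le> \<bar>x - y\<bar>" "u \<noteq> v"
  shows "f (u - v) < f (x - y)"
proof -
  have "0 < \<bar>u - v\<bar>" using assms(3) by simp
  then have "f \<bar>u - v\<bar> < f \<bar>x - y\<bar> \<and> f \<bar>u - v\<bar> < f (- \<bar>x - y\<bar>) \<and> f (- \<bar>u - v\<bar>) < f \<bar>x - y\<bar> \<and> f (- \<bar>u - v\<bar>) < f (- \<bar>x - y\<bar>)"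
    using gd[OF assms(1)] assms(2) unfolding gap_dominated_def by blast
  then show ?thesis by (cases "u < v"; cases "x < y"; simp add: abs_if)
qed

text \<open>If \<open>p\<close> is unmatched, a point \<open>b\<close> of the other colour is missed
  inside the block too. It has a partner outside, since only one colour has unmatched points, and
  giving \<open>b\<close> to \<open>p\<close> instead replaces an edge by one shorter by the factor
  \<open>K\<close>.\<close>

lemma block_matched:
  assumes p: "p \<in> block R B h s t"
  shows "p \<notin> unmatched R B M"
proof
  assume um: "p \<in> unmatched R B M"
  let ?C = "block R B h s t"
  have M: "is_matching R B M" using wm unfolding weakly_minimal_def by auto
  note ex = block_exits[OF w M]
  have one: "R \<subseteq> fst ` M \<or> B \<subseteq> snd ` M" using weakly_minimal_one_colour[OF wm disjoint] .
  consider "p \<in> R - fst ` M" | "p \<in> B - snd ` M" using um unfolding unmatched_def by auto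
  then show False
  proof cases
    case 1
    then have "\<forall>y\<in>?C. (p, y) \<notin> M" by force
    then have "\<exists>b\<in>B \<inter> ?C. \<forall>x\<in>?C. (x, b) \<notin> M" using 1 p ex by blast
    then obtain b where b: "b \<in> B" "b \<in> ?C" "\<forall>x\<in>?C. (x, b) \<notin> M" by blast
    then obtain x where x: "(x, b) \<in> M" using one 1 by force
    have "K * \<bar>b - p\<bar> \<le> \<bar>b - x\<bar>"
      using partner_outside_block(1)[OF x _ b(2) p] b x by (auto simp: abs_minus_commute)
    moreover have "b \<noteq> p" using 1 b disjoint by blast
    ultimately have "f (b - p) < f (b - x)" if "f \<in> Fs" for f using gap_dominatedD[OF that] by blast
    then show False using weakly_minimal_red[OF wm disjoint 1 x] by (metis not_le)
  next
    case 2
    then have "\<forall>y\<in>?C. (y, p) \<notin> M" by force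
    then have "\<exists>b\<in>R \<inter> ?C. \<forall>x\<in>?C. (b, x) \<notin> M" using 2 p ex by blast
    then obtain b where b: "b \<in> R" "b \<in> ?C" "\<forall>x\<in>?C. (b, x) \<notin> M" by blast
    then obtain x where x: "(b, x) \<in> M" using one 2 by force
    have "K * \<bar>p - b\<bar> \<le> \<bar>x - b\<bar>"
      using partner_outside_block(1)[OF x _ p b(2)] b x by (auto simp: abs_minus_commute)
    moreover have "p \<noteq> b" using 2 b disjoint by blast
    ultimately have "f (p - b) < f (x - b)" if "f \<in> Fs" for f using gap_dominatedD[OF that] by blast
    then show False using weakly_minimal_blue[OF wm disjoint 2 x] by (metis not_le)
  qed
qed

text \<open>A red \<open>r\<close> and a blue \<open>b\<close> of the block would both have partners
  outside. Joining \<open>r\<close> with \<open>b\<close> and the two partners with each other is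
  cheaper: by nesting and monotonicity for partners on the same side, by
  \<open>gap_subadditive\<close> for partners on different sides.\<close>

lemma block_closed:
  assumes gs: "\<And>f. f \<in> Fs \<Longrightarrow> gap_subadditive K f" and e: "(x, y) \<in> M"
  shows "x \<in> block R B h s t \<longleftrightarrow> y \<in> block R B h s t"
proof (rule ccontr)
  let ?C = "block R B h s t"
  assume n: "\<not> ?thesis"
  have M: "is_matching R B M" using wm unfolding weakly_minimal_def by auto
  have pl: "planar R B M" using weakly_minimal_planar[OF wm disjoint cc] .
  then have nc: "noncrossing M" unfolding planar_def by auto
  note ex = block_exits[OF w M]
  have exr: "\<exists>r\<in>R \<inter> ?C. \<forall>y\<in>?C. (r, y) \<notin> M"
  proof (cases "x \<in> ?C")
    case True
    then have "y \<notin> ?C" "x \<in> R" using n is_matching_unique(3)[OF M e] by auto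
    then show ?thesis using True is_matching_unique(1)[OF M e] by blast
  next
    case False
    then have "y \<in> ?C" "y \<in> B" using n is_matching_unique(4)[OF M e] by auto
    then have "\<exists>b\<in>B \<inter> ?C. \<forall>x\<in>?C. (x, b) \<notin> M" using False is_matching_unique(2)[OF M e] by blast
    then show ?thesis using ex by blast
  qed
  then obtain r where r: "r \<in> R" "r \<in> ?C" "\<forall>y\<in>?C. (r, y) \<notin> M" by blast
  obtain b where b: "b \<in> B" "b \<in> ?C" "\<forall>x\<in>?C. (x, b) \<notin> M" using exr ex by blast
  obtain y' where y': "(r, y') \<in> M" using block_matched[OF r(2)] r(1) unfolding unmatched_def by force
  obtain x' where x': "(x', b) \<in> M" using block_matched[OF b(2)] b(1) unfolding unmatched_def by force
  have out: "y' \<notin> ?C" "x' \<notin> ?C" using r(3) b(3) y' x' by auto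
  have ne: "r \<noteq> b" "r \<noteq> x'" using r b disjoint out by blast+
  have far: "y' \<le> s - G \<or> t + G < y'" "x' \<le> s - G \<or> t + G < x'"
    "K * \<bar>r - b\<bar> \<le> \<bar>r - y'\<bar>" "K * \<bar>r - b\<bar> \<le> \<bar>x' - b\<bar>"
    using partner_outside_block(1,3)[OF y' _ r(2) b(2)] partner_outside_block(1,2)[OF x' _ r(2) b(2)] r(2) b(2) out
    by blast+
  have G: "G > 0" using w unfolding window_def by auto
  have rs: "s < r" "r \<le> t" "s < b" "b \<le> t" using r b unfolding block_def by auto
  obtain f where f: "f \<in> Fs" "f (y' - r) + f (b - x') \<le> f (b - r) + f (y' - x')"
    using weakly_minimal_swap[OF wm disjoint y' x' ne(2)] by blast
  note cf = cc[OF f(1)]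
  have fd: "f (b - r) < f (b - x')" "f (b - r) < f (y' - r)"
    using gap_dominatedD[OF f(1), of b r b x'] gap_dominatedD[OF f(1), of b r y' r] ne far(3,4)
    by (auto simp: abs_minus_commute)
  have xy: "x' \<noteq> y'" using is_matching_unique(3)[OF M x'] is_matching_unique(4)[OF M y'] disjoint by blast
  have nc1: "\<not> (min r y' < min x' b \<and> min x' b < max r y' \<and> max r y' < max x' b)"
    using noncrossingD[OF nc y' x'] by blast
  have nc2: "\<not> (min x' b < min r y' \<and> min r y' < max x' b \<and> max x' b < max r y')"
    using noncrossingD[OF nc x' y'] by blast
  note gsf = gs[OF f(1), unfolded gap_subadditive_def, rule_format]
  consider "t < y'" "t < x'" | "y' < s" "x' < s" | "t < y'" "x' < s" | "y' < s" "t < x'"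
    using far(1,2) G by linarith
  then show False
  proof cases
    case 1
    show False
    proof (cases "r < b")
      case True
      then have "x' < y'" using nc1 nc2 xy 1 rs by auto
      then have "f (y' - x') < f (y' - r)" using 1 rs by (intro concave_cost_mono(1)[OF cf]) auto
      then show False using f(2) fd by linarith
    next
      case False
      then have "y' < x'" using nc1 nc2 xy ne 1 rs by auto
      then have "f (- (x' - y')) < f (- (x' - b))" using 1 rs by (intro concave_cost_mono(2)[OF cf]) auto
      then show False using f(2) fd by simp
    qed
  next
    case 2
    show False
    proof (cases "r < b")
      case True
      then have "x' < y'" using nc1 nc2 xy 2 rs by auto
      then have "f (y' - x') < f (b - x')" using 2 rs by (intro concave_cost_mono(1)[OF cf]) auto
      then show False using f(2) fd by linarith
    next
      case False
      then have "y' < x'" using nc1 nc2 xy ne 2 rs by auto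
      then have "f (- (x' - y')) < f (- (r - y'))" using 2 rs by (intro concave_cost_mono(2)[OF cf]) auto
      then show False using f(2) fd by simp
    qed
  next
    case 3
    \<comment> \<open>In the other order \<open>x' < r < b < y'\<close>, and the two edges would
      cross.\<close>
    have "b < r"
    proof (rule ccontr)
      assume "\<not> b < r"
      then show False using nc2 ne 3 rs by auto
    qed
    then have "f (- (r - b)) + f ((b - x') + (r - b) + (y' - r)) < f (b - x') + f (y' - r)"
      using far(3,4) 3 rs by (intro gsf[THEN conjunct1]) auto
    then show False using f(2) by simp
  next
    case 4
    have "r < b"
    proof (rule ccontr)
      assume "\<not> r < b"
      then show False using nc1 ne 4 rs by auto
    qed
    then have "f (b - r) + f (- ((r - y') + (b - r) + (x' - b))) < f (- (r - y')) + f (- (x' - b))"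
      using far(3,4) 4 rs by (intro gsf[THEN conjunct2]) auto
    then show False using f(2) by simp
  qed
qed

end

end

text \<open>\<open>K\<close> and \<open>N\<close> come before the scale: the flanks exceed the
  middle by any prescribed factor, and the same \<open>N\<close> moves them past any given point and
  below any given level.\<close>

definition dips :: "real set \<Rightarrow> real set \<Rightarrow> bool" where
  "dips R B \<longleftrightarrow> (\<forall>(K::real) (N::nat). \<exists>s t G. s < - real N \<and> real N < t \<and> 0 < G \<and> K * (t - s) \<le> G \<and>
     (\<forall>\<tau>. s - G \<le> \<tau> \<and> \<tau> \<le> s \<or> t \<le> \<tau> \<and> \<tau> \<le> t + G \<longrightarrow> lev R B \<tau> < - int N))"

text \<open>The block is chosen before the exponent, so a single \<open>K\<close> must be good for
  eventually all exponents of the filter.\<close>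

definition tame :: "real filter \<Rightarrow> real \<Rightarrow> bool" where
  "tame F a \<longleftrightarrow> F \<noteq> bot \<and> (\<exists>K\<ge>1. \<forall>\<^sub>F \<gamma> in F. concave_cost (power_cost \<gamma> a) \<and>
     gap_dominated K (power_cost \<gamma> a) \<and> gap_subadditive K (power_cost \<gamma> a))"

text \<open>The order of two costs must be strict and must settle along the filter. Uniqueness rests
  on this; existence rests on \<open>comparable\<close>, which admits ties and also compares
  matchings of different point sets.\<close>

definition separated :: "real filter \<Rightarrow> real \<Rightarrow> real set \<Rightarrow> real set \<Rightarrow> bool" where
  "separated F a R B \<longleftrightarrow> (\<forall>E E'. finite E \<longrightarrow> is_matching R B E \<longrightarrow> is_matching R B E' \<longrightarrow>
     fst ` E = fst ` E' \<longrightarrow> snd ` E = snd ` E' \<longrightarrow> E \<noteq> E' \<longrightarrow>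
     (\<forall>\<^sub>F \<gamma> in F. cost (power_cost \<gamma> a) E < cost (power_cost \<gamma> a) E') \<or>
     (\<forall>\<^sub>F \<gamma> in F. cost (power_cost \<gamma> a) E' < cost (power_cost \<gamma> a) E))"

definition comparable :: "real filter \<Rightarrow> real \<Rightarrow> real set \<Rightarrow> real set \<Rightarrow> bool" where
  "comparable F a R B \<longleftrightarrow> (\<forall>E E'. finite E \<longrightarrow> finite E' \<longrightarrow> is_matching R B E \<longrightarrow> is_matching R B E' \<longrightarrow>
     (\<forall>\<^sub>F \<gamma> in F. cost (power_cost \<gamma> a) E \<le> cost (power_cost \<gamma> a) E') \<or>
     (\<forall>\<^sub>F \<gamma> in F. cost (power_cost \<gamma> a) E' \<le> cost (power_cost \<gamma> a) E))"

section \<open>Uniqueness and finite difference on blocks\<close>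

lemma eventually_exchange:
  assumes "eventually_minimal F a R B M" "R \<inter> B = {}" "E \<subseteq> M" "finite E"
    "is_matching (fst ` E) (snd ` E) E'" "card E' = card E"
  shows "\<forall>\<^sub>F \<gamma> in F. cost (power_cost \<gamma> a) E \<le> cost (power_cost \<gamma> a) E'"
proof -
  have M: "is_matching R B M" using assms(1) unfolding eventually_minimal_def by auto
  have "admissible R B M (fst ` E \<union> snd ` E \<union> {})" by (rule admissibleI) (use assms in auto)
  then have "\<forall>\<^sub>F \<gamma> in F. minimal_on (power_cost \<gamma> a) R B M (fst ` E \<union> snd ` E \<union> {})"
    using assms(1) unfolding eventually_minimal_def by blast
  then show ?thesis
  proof (rule eventually_mono)
    fix \<gamma> assume "minimal_on (power_cost \<gamma> a) R B M (fst ` E \<union> snd ` E \<union> {})"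
    note ex = exchange(2)[OF M assms(2,3) _ assms(4) _ this]
    show "cost (power_cost \<gamma> a) E \<le> cost (power_cost \<gamma> a) E'"
      by (rule ex) (use assms in auto)
  qed
qed

lemma separated_unique:
  assumes "separated F a R B" "F \<noteq> bot" "finite E" "is_matching R B E" "is_matching R B E'"
    "fst ` E = fst ` E'" "snd ` E = snd ` E'"
    "\<forall>\<^sub>F \<gamma> in F. cost (power_cost \<gamma> a) E \<le> cost (power_cost \<gamma> a) E'"
    "\<forall>\<^sub>F \<gamma> in F. cost (power_cost \<gamma> a) E' \<le> cost (power_cost \<gamma> a) E"
  shows "E = E'"
proof (rule ccontr)
  assume "E \<noteq> E'"
  then consider "\<forall>\<^sub>F \<gamma> in F. cost (power_cost \<gamma> a) E < cost (power_cost \<gamma> a) E'"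
    | "\<forall>\<^sub>F \<gamma> in F. cost (power_cost \<gamma> a) E' < cost (power_cost \<gamma> a) E"
    using assms unfolding separated_def by blast
  then have "\<forall>\<^sub>F \<gamma> in F. False"
  proof cases
    case 1
    from eventually_conj[OF 1 assms(9)] show ?thesis by (rule eventually_mono) linarith
  next
    case 2
    from eventually_conj[OF 2 assms(8)] show ?thesis by (rule eventually_mono) linarith
  qed
  then show False using assms(2) by (simp add: eventually_False)
qed

text \<open>A set that no edge of either matching enters or leaves contains the whole component of
  each of its points.\<close>

lemma finite_differenceI:
  assumes "\<And>v. v \<in> R \<union> B \<Longrightarrow> \<exists>C. v \<in> C \<and> finite C \<and> (\<forall>(x, y)\<in>M \<union> M'. x \<in> C \<longleftrightarrow> y \<in> C)"
  shows "finite_difference R B M M'"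
  unfolding finite_difference_def
proof
  fix v assume "v \<in> R \<union> B"
  then obtain C where C: "v \<in> C" "finite C" "\<forall>(x, y)\<in>M \<union> M'. x \<in> C \<longleftrightarrow> y \<in> C" using assms by blast
  have "w \<in> C" if "(v, w) \<in> ((M \<union> M') \<union> (M \<union> M')\<inverse>)\<^sup>*" for w
    using that
  proof (induction rule: rtrancl_induct)
    case base
    then show ?case using C by simp
  next
    case (step y z)
    then show ?case using C(3) by blast
  qed
  then have "((M \<union> M') \<union> (M \<union> M')\<inverse>)\<^sup>* `` {v} \<subseteq> C" by blast
  then show "finite (((M \<union> M') \<union> (M \<union> M')\<inverse>)\<^sup>* `` {v})" using C(2) finite_subset by blast
qed

context points
begin

lemma dips_block:
  assumes d: "dips R B" and p: "p \<in> R \<union> B"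
  shows "\<exists>s t G. window R B (PL p) s t G \<and> K * (t - s) \<le> G \<and> p \<in> block R B (PL p) s t \<and>
    L s \<le> PL p \<and> L t \<le> PL p"
proof -
  \<comment> \<open>\<open>N\<close> exceeds both the modulus of \<open>p\<close> and that of its
    level: \<open>p\<close> falls between the flanks, and the flanks lie below its level.\<close>
  obtain N :: nat where N: "\<bar>p\<bar> < real N" "\<bar>PL p\<bar> < int N"
  proof -
    obtain N1 :: nat where "\<bar>p\<bar> < real N1" using reals_Archimedean2 by blast
    moreover have "\<bar>PL p\<bar> < int (nat (\<bar>PL p\<bar> + 1))" by simp
    ultimately show ?thesis
      by (intro that[of "max N1 (nat (\<bar>PL p\<bar> + 1))"]) (auto simp: of_nat_max less_max_iff_disj)
  qed
  obtain s t G where stG: "s < - real N" "real N < t" "0 < G" "K * (t - s) \<le> G"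
    "\<And>\<tau>. s - G \<le> \<tau> \<and> \<tau> \<le> s \<or> t \<le> \<tau> \<and> \<tau> \<le> t + G \<Longrightarrow> lev R B \<tau> < - int N"
    using d unfolding dips_def by blast
  have low: "L \<tau> \<le> PL p" if "s - G \<le> \<tau> \<and> \<tau> \<le> s \<or> t \<le> \<tau> \<and> \<tau> \<le> t + G" for \<tau>
    using stG(5)[OF that] N(2) by linarith
  then have "window R B (PL p) s t G" unfolding window_def using stG N by auto
  moreover have "p \<in> block R B (PL p) s t" unfolding block_def using stG N p by auto
  moreover have "L s \<le> PL p" "L t \<le> PL p" using low[of s] low[of t] stG(3) by auto
  ultimately show ?thesis using stG(4) by blast
qed

text \<open>\<open>gap_dominated\<close> alone suffices for perfectness, which makes the result
  available at 1-.\<close>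

lemma no_unmatched:
  assumes d: "dips R B" and "weakly_minimal Fs R B M" "\<And>f. f \<in> Fs \<Longrightarrow> concave_cost f"
    "\<And>f. f \<in> Fs \<Longrightarrow> gap_dominated K f" "1 \<le> K"
  shows "unmatched R B M = {}"
proof (rule ccontr)
  assume "unmatched R B M \<noteq> {}"
  then obtain p where p: "p \<in> unmatched R B M" by blast
  then have "p \<in> R \<union> B" unfolding unmatched_def by auto
  from dips_block[OF d this, of K]
  obtain s t G where w: "window R B (PL p) s t G" "K * (t - s) \<le> G" "p \<in> block R B (PL p) s t" by blast
  from block_matched[OF assms(2-4) w(1,2) assms(5) w(3)] p show False by blast
qed

definition perfect_on :: "matching \<Rightarrow> real set \<Rightarrow> bool" where
  "perfect_on M C \<longleftrightarrow> fst ` (M \<inter> C \<times> C) = R \<inter> C \<and> snd ` (M \<inter> C \<times> C) = B \<inter> C \<and> (\<forall>(x, y)\<in>M. x \<in> C \<longleftrightarrow> y \<in> C)"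

lemma tame_perfect_on_block:
  assumes em: "eventually_minimal F a R B M" and F: "F \<noteq> bot"
    and ev: "\<forall>\<^sub>F \<gamma> in F. concave_cost (power_cost \<gamma> a) \<and> gap_dominated K (power_cost \<gamma> a) \<and> gap_subadditive K (power_cost \<gamma> a)"
    and K: "1 \<le> K" and w: "window R B h s t G" "K * (t - s) \<le> G"
  shows "perfect_on M (block R B h s t)"
proof -
  let ?C = "block R B h s t"
  have M: "is_matching R B M" using em unfolding eventually_minimal_def by auto
  note wm = eventually_minimal_weakly[OF em ev F]
  have cl: "x \<in> ?C \<longleftrightarrow> y \<in> ?C" if "(x, y) \<in> M" for x y
    by (rule block_closed[OF wm _ _ w(1,2) K _ that]) auto
  have um: "p \<notin> unmatched R B M" if "p \<in> ?C" for p
    by (rule block_matched[OF wm _ _ w(1,2) K that]) auto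
  have "fst ` (M \<inter> ?C \<times> ?C) = R \<inter> ?C"
  proof
    show "fst ` (M \<inter> ?C \<times> ?C) \<subseteq> R \<inter> ?C" using is_matching_unique(3)[OF M] by force
    show "R \<inter> ?C \<subseteq> fst ` (M \<inter> ?C \<times> ?C)"
    proof
      fix x assume x: "x \<in> R \<inter> ?C"
      then obtain y where y: "(x, y) \<in> M" using um unfolding unmatched_def by force
      then have "(x, y) \<in> M \<inter> ?C \<times> ?C" using cl x by blast
      then show "x \<in> fst ` (M \<inter> ?C \<times> ?C)" by force
    qed
  qed
  moreover have "snd ` (M \<inter> ?C \<times> ?C) = B \<inter> ?C"
  proof
    show "snd ` (M \<inter> ?C \<times> ?C) \<subseteq> B \<inter> ?C" using is_matching_unique(4)[OF M] by force
    show "B \<inter> ?C \<subseteq> snd ` (M \<inter> ?C \<times> ?C)"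
    proof
      fix x assume x: "x \<in> B \<inter> ?C"
      then obtain y where y: "(y, x) \<in> M" using um unfolding unmatched_def by force
      then have "(y, x) \<in> M \<inter> ?C \<times> ?C" using cl x by blast
      then show "x \<in> snd ` (M \<inter> ?C \<times> ?C)" by force
    qed
  qed
  ultimately show ?thesis unfolding perfect_on_def using cl by blast
qed

end

text \<open>Both configurations may be restrictions of one and the same configuration to windows.\<close>

lemma perfect_on_unique:
  assumes em: "eventually_minimal F a R1 B1 M1" "eventually_minimal F a R2 B2 M2"
    and dis: "R1 \<inter> B1 = {}" "R2 \<inter> B2 = {}"
    and sep: "separated F a R B" "F \<noteq> bot" and sub: "R1 \<subseteq> R" "R2 \<subseteq> R" "B1 \<subseteq> B" "B2 \<subseteq> B"
    and po: "fst ` (M1 \<inter> C \<times> C) = fst ` (M2 \<inter> C \<times> C)" "snd ` (M1 \<inter> C \<times> C) = snd ` (M2 \<inter> C \<times> C)"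
    and C: "finite C"
  shows "M1 \<inter> C \<times> C = M2 \<inter> C \<times> C"
proof -
  let ?E1 = "M1 \<inter> C \<times> C" and ?E2 = "M2 \<inter> C \<times> C"
  have M: "is_matching R1 B1 M1" "is_matching R2 B2 M2" using em unfolding eventually_minimal_def by auto
  have fin: "finite ?E1" "finite ?E2" using C by auto
  have inj: "inj_on fst ?E1" "inj_on fst ?E2" using is_matching_inj(1)[OF M(1)] is_matching_inj(1)[OF M(2)]
    by (auto elim: inj_on_subset)
  have "is_matching (fst ` ?E1) (snd ` ?E1) ?E1" "is_matching (fst ` ?E2) (snd ` ?E2) ?E2"
    using is_matching_subset[OF M(1), of ?E1] is_matching_subset[OF M(2), of ?E2] by auto
  note m = this
  have c: "card ?E1 = card ?E2" using po(1) inj by (metis card_image)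
  have "\<forall>\<^sub>F \<gamma> in F. cost (power_cost \<gamma> a) ?E1 \<le> cost (power_cost \<gamma> a) ?E2"
    by (rule eventually_exchange[OF em(1) dis(1)]) (use fin m c po in auto)
  moreover have "\<forall>\<^sub>F \<gamma> in F. cost (power_cost \<gamma> a) ?E2 \<le> cost (power_cost \<gamma> a) ?E1"
    by (rule eventually_exchange[OF em(2) dis(2)]) (use fin m c po in auto)
  moreover have "is_matching R B M1" "is_matching R B M2" using M sub unfolding is_matching_def by blast+
  then have "is_matching R B ?E1" "is_matching R B ?E2"
    unfolding is_matching_def by blast+
  ultimately show ?thesis using separated_unique[OF sep fin(1)] po by blast
qed

context points
begin

text \<open>On a block around an endpoint both matchings are perfect and optimal for the same
  points, and \<open>separated\<close> leaves only one such matching. Equality of \<open>M\<close>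
  and \<open>M'\<close> follows by symmetry.\<close>

lemma tame_subset:
  assumes em: "eventually_minimal F a R B M" "eventually_minimal F a R B M'" and tame: "tame F a"
    and sep: "separated F a R B" and d: "dips R B"
  shows "M \<subseteq> M'"
proof
  fix e assume e: "e \<in> M"
  obtain x y where xy: "e = (x, y)" by (cases e)
  have M: "is_matching R B M" using em unfolding eventually_minimal_def by auto
  have x: "x \<in> R \<union> B" using is_matching_unique(3)[OF M] e xy by blast
  obtain K where K: "1 \<le> K" "\<forall>\<^sub>F \<gamma> in F. concave_cost (power_cost \<gamma> a) \<and>
     gap_dominated K (power_cost \<gamma> a) \<and> gap_subadditive K (power_cost \<gamma> a)" and F: "F \<noteq> bot"
    using tame unfolding tame_def by auto
  from dips_block[OF d x, of K]
  obtain s t G where w: "window R B (PL x) s t G" "K * (t - s) \<le> G" "x \<in> block R B (PL x) s t" by blast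
  let ?C = "block R B (PL x) s t"
  have po: "perfect_on M ?C" "perfect_on M' ?C"
    using tame_perfect_on_block[OF em(1) F K(2,1) w(1,2)] tame_perfect_on_block[OF em(2) F K(2,1) w(1,2)] .
  have eq: "M \<inter> ?C \<times> ?C = M' \<inter> ?C \<times> ?C"
    by (rule perfect_on_unique[OF em disjoint disjoint sep F]) (use po finite_block in \<open>auto simp: perfect_on_def\<close>)
  have "y \<in> ?C" using po(1) e w(3) xy unfolding perfect_on_def by blast
  then have "e \<in> M \<inter> ?C \<times> ?C" using e w(3) xy by auto
  then show "e \<in> M'" using eq by blast
qed

lemma tame_finite_difference:
  assumes em: "eventually_minimal F a R B M" "eventually_minimal F' a' R B M'" and tame: "tame F a" "tame F' a'"
    and d: "dips R B"
  shows "finite_difference R B M M'"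
proof (rule finite_differenceI)
  fix v assume v: "v \<in> R \<union> B"
  obtain K where K: "1 \<le> K" "\<forall>\<^sub>F \<gamma> in F. concave_cost (power_cost \<gamma> a) \<and>
     gap_dominated K (power_cost \<gamma> a) \<and> gap_subadditive K (power_cost \<gamma> a)" and F: "F \<noteq> bot"
    using tame unfolding tame_def by auto
  obtain K' where K': "1 \<le> K'" "\<forall>\<^sub>F \<gamma> in F'. concave_cost (power_cost \<gamma> a') \<and>
     gap_dominated K' (power_cost \<gamma> a') \<and> gap_subadditive K' (power_cost \<gamma> a')" and F': "F' \<noteq> bot"
    using tame unfolding tame_def by auto
  \<comment> \<open>With the larger of the two constants the same block is closed under both
    matchings.\<close>
  from dips_block[OF d v, of "max K K'"]
  obtain s t G where w: "window R B (PL v) s t G" "max K K' * (t - s) \<le> G" "v \<in> block R B (PL v) s t" by blast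
  have "s < t" using w(1) unfolding window_def by auto
  then have "K * (t - s) \<le> max K K' * (t - s)" "K' * (t - s) \<le> max K K' * (t - s)"
    by (auto intro!: mult_right_mono)
  then have "K * (t - s) \<le> G" "K' * (t - s) \<le> G" using w(2) by linarith+
  then have "perfect_on M (block R B (PL v) s t)" "perfect_on M' (block R B (PL v) s t)"
    using tame_perfect_on_block[OF em(1) F K(2,1) w(1)] tame_perfect_on_block[OF em(2) F' K'(2,1) w(1)] by auto
  then have "\<forall>(x, y)\<in>M \<union> M'. x \<in> block R B (PL v) s t \<longleftrightarrow> y \<in> block R B (PL v) s t"
    unfolding perfect_on_def by auto
  then show "\<exists>C. v \<in> C \<and> finite C \<and> (\<forall>(x, y)\<in>M \<union> M'. x \<in> C \<longleftrightarrow> y \<in> C)"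
    using w(3) finite_block[of "PL v" s t] by (intro exI[of _ "block R B (PL v) s t"]) simp
qed

end

section \<open>Existence by exhaustion\<close>

text \<open>\<open>comparable\<close> turns eventual comparison of costs into a total preorder on
  the finitely many matchings of full size, so there is a least one; finiteness also lets the filter
  treat all competitors at once.\<close>

lemma ex_eventually_minimal_finite:
  assumes fin: "finite R" "finite B" and dis: "R \<inter> B = {}" and cp: "comparable F a R B"
  shows "\<exists>M. eventually_minimal F a R B M"
proof -
  have least: "\<exists>E\<in>A. \<forall>E'\<in>A. \<forall>\<^sub>F \<gamma> in F. cost (power_cost \<gamma> a) E \<le> cost (power_cost \<gamma> a) E'"
    if "finite A" "A \<noteq> {}" "\<And>E. E \<in> A \<Longrightarrow> is_matching R B E" for A
    using that
  proof (induction rule: finite_ne_induct)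
    case (singleton E)
    then show ?case by simp
  next
    case (insert E A)
    then obtain D where D: "D \<in> A" "\<forall>E'\<in>A. \<forall>\<^sub>F \<gamma> in F. cost (power_cost \<gamma> a) D \<le> cost (power_cost \<gamma> a) E'"
      by auto
    have ED: "is_matching R B E" "is_matching R B D" using insert D by auto
    then have "finite E" "finite D" using finite_matching fin by blast+
    then consider "\<forall>\<^sub>F \<gamma> in F. cost (power_cost \<gamma> a) E \<le> cost (power_cost \<gamma> a) D"
      | "\<forall>\<^sub>F \<gamma> in F. cost (power_cost \<gamma> a) D \<le> cost (power_cost \<gamma> a) E"
      using cp ED unfolding comparable_def by blast
    then show ?case
    proof cases
      case 1
      have "\<forall>\<^sub>F \<gamma> in F. cost (power_cost \<gamma> a) E \<le> cost (power_cost \<gamma> a) E'" if "E' \<in> A" for E'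
        using eventually_conj[OF 1 D(2)[rule_format, OF that]] by (rule eventually_mono) linarith
      then show ?thesis by (intro bexI[of _ E]) auto
    next
      case 2
      then show ?thesis using D by (intro bexI[of _ D]) auto
    qed
  qed
  let ?A = "{M. is_matching R B M \<and> card M = min (card R) (card B)}"
  have "finite ?A" using finite_matchings[OF fin] by (rule rev_finite_subset) auto
  moreover have "?A \<noteq> {}" using ex_matching_card[OF fin] by simp
  ultimately obtain E where E: "E \<in> ?A"
    "\<forall>E'\<in>?A. \<forall>\<^sub>F \<gamma> in F. cost (power_cost \<gamma> a) E \<le> cost (power_cost \<gamma> a) E'"
    using least[of ?A] by blast
  have "\<forall>\<^sub>F \<gamma> in F. \<forall>E'\<in>?A. cost (power_cost \<gamma> a) E \<le> cost (power_cost \<gamma> a) E'"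
    using E(2) \<open>finite ?A\<close> by (subst eventually_ball_finite_distrib) auto
  then have "\<forall>\<^sub>F \<gamma> in F. minimal_finite (power_cost \<gamma> a) R B E"
    by (rule eventually_mono) (use E(1) in \<open>auto simp: minimal_finite_iff[OF fin dis]\<close>)
  then show ?thesis using eventually_minimal_finite[OF fin dis] E(1) by blast
qed

context points
begin

lemma points_window: "points (R \<inter> {-n..n}) (B \<inter> {-n..n})"
proof
  show "finite (R \<inter> {- n..n} \<inter> {a..b})" for a b by (rule finite_subset[OF _ finR[of a b]]) auto
  show "finite (B \<inter> {- n..n} \<inter> {a..b})" for a b by (rule finite_subset[OF _ finB[of a b]]) auto
  show "R \<inter> {- n..n} \<inter> (B \<inter> {- n..n}) = {}" using disjoint by auto
qed

text \<open>Levels are counted from 0, so points outside \<open>[-n, n]\<close> have no influence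
  inside.\<close>

lemma lev_window:
  assumes "\<bar>\<tau>\<bar> \<le> n"
  shows "lev (R \<inter> {-n..n}) (B \<inter> {-n..n}) \<tau> = L \<tau>"
proof -
  have "X \<inter> {-n..n} \<inter> {0<..\<tau>} = X \<inter> {0<..\<tau>}" "X \<inter> {-n..n} \<inter> {\<tau><..0} = X \<inter> {\<tau><..0}" for X
    using assms by auto
  then show ?thesis unfolding lev_def by simp
qed

lemma block_window:
  assumes "- n \<le> s" "t \<le> n"
  shows "block (R \<inter> {-n..n}) (B \<inter> {-n..n}) h s t = block R B h s t"
proof (rule set_eqI)
  fix p
  show "p \<in> block (R \<inter> {-n..n}) (B \<inter> {-n..n}) h s t \<longleftrightarrow> p \<in> block R B h s t"
  proof (cases "s < p \<and> p \<le> t")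
    case True
    then have "p \<in> {-n..n}" "\<bar>p\<bar> \<le> n" using assms by auto
    then show ?thesis using lev_window[of p n] unfolding block_def plev_def by simp
  next
    case False
    then show ?thesis unfolding block_def by auto
  qed
qed

lemma window_window:
  assumes "window R B h s t G" "- n \<le> s - G" "t + G \<le> n"
  shows "window (R \<inter> {-n..n}) (B \<inter> {-n..n}) h s t G"
proof -
  have "lev (R \<inter> {-n..n}) (B \<inter> {-n..n}) \<tau> = L \<tau>" if "s - G \<le> \<tau> \<and> \<tau> \<le> s \<or> t \<le> \<tau> \<and> \<tau> \<le> t + G" for \<tau>
    using that assms by (intro lev_window) (auto simp: window_def)
  then show ?thesis using assms(1) unfolding window_def by simp
qed

text \<open>The optimal matchings of the restrictions to \<open>[-n, n]\<close> need not increase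
  with \<open>n\<close>, but on a block they are constant once the block and its flanks fit into
  \<open>[-n, n]\<close>. The limit consists of the edges that are eventually present.\<close>

lemma tame_exists:
  assumes tame: "tame F a" and sep: "separated F a R B" and cp: "comparable F a R B" and d: "dips R B"
  shows "\<exists>M. eventually_minimal F a R B M"
proof -
  define Rn Bn where "Rn n = R \<inter> {- real n..real n}" and "Bn n = B \<inter> {- real n..real n}" for n
  have pn: "points (Rn n) (Bn n)" for n unfolding Rn_def Bn_def using points_window .
  have disn: "Rn n \<inter> Bn n = {}" for n using disjoint unfolding Rn_def Bn_def by auto
  have sub: "Rn n \<subseteq> R" "Bn n \<subseteq> B" for n unfolding Rn_def Bn_def by auto
  have "\<exists>M. eventually_minimal F a (Rn n) (Bn n) M" for n
  proof (rule ex_eventually_minimal_finite)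
    show "finite (Rn n)" "finite (Bn n)" using finR finB unfolding Rn_def Bn_def by auto
    show "Rn n \<inter> Bn n = {}" using disn .
    have "is_matching R B E" if "is_matching (Rn n) (Bn n) E" for E
      using that sub[of n] unfolding is_matching_def by blast
    then show "comparable F a (Rn n) (Bn n)" using cp unfolding comparable_def by meson
  qed
  then obtain Mn where Mn: "\<And>n. eventually_minimal F a (Rn n) (Bn n) (Mn n)" by metis
  have Mm: "is_matching (Rn n) (Bn n) (Mn n)" for n using Mn unfolding eventually_minimal_def by auto
  obtain K where K: "1 \<le> K" "\<forall>\<^sub>F \<gamma> in F. concave_cost (power_cost \<gamma> a) \<and>
     gap_dominated K (power_cost \<gamma> a) \<and> gap_subadditive K (power_cost \<gamma> a)" and F: "F \<noteq> bot"
    using tame unfolding tame_def by auto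
  have stab: "\<exists>C N. p \<in> C \<and> (\<forall>n\<ge>N. fst ` (Mn n \<inter> C \<times> C) = R \<inter> C \<and> snd ` (Mn n \<inter> C \<times> C) = B \<inter> C \<and>
      Mn n \<inter> C \<times> C = Mn N \<inter> C \<times> C \<and> (\<forall>(x, y)\<in>Mn n. x \<in> C \<longleftrightarrow> y \<in> C))" if p: "p \<in> R \<union> B" for p
  proof -
    from dips_block[OF d p, of K]
    obtain s t G where w: "window R B (PL p) s t G" "K * (t - s) \<le> G" "p \<in> block R B (PL p) s t" by blast
    let ?C = "block R B (PL p) s t"
    obtain N :: nat where N: "max (G - s) (t + G) < real N" using reals_Archimedean2 by blast
    have G: "0 < G" "s < t" using w(1) unfolding window_def by auto
    have po: "points.perfect_on (Rn n) (Bn n) (Mn n) ?C" if "n \<ge> N" for n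
    proof -
      have n: "- real n \<le> s - G" "t + G \<le> real n" using N that G by auto
      have "block (Rn n) (Bn n) (PL p) s t = ?C"
        unfolding Rn_def Bn_def using n G by (intro block_window) auto
      moreover have "window (Rn n) (Bn n) (PL p) s t G"
        unfolding Rn_def Bn_def using n by (intro window_window[OF w(1)]) auto
      ultimately show ?thesis
        using points.tame_perfect_on_block[OF pn Mn F K(2,1) _ w(2)] by metis
    qed
    have C: "?C \<subseteq> {-real n..real n}" if "n \<ge> N" for n
      using N that G unfolding block_def by auto
    have f: "fst ` (Mn n \<inter> ?C \<times> ?C) = R \<inter> ?C" "snd ` (Mn n \<inter> ?C \<times> ?C) = B \<inter> ?C"
      "\<forall>(x, y)\<in>Mn n. x \<in> ?C \<longleftrightarrow> y \<in> ?C" if "n \<ge> N" for n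
    proof -
      have "Rn n \<inter> ?C = R \<inter> ?C" "Bn n \<inter> ?C = B \<inter> ?C" using C[OF that] unfolding Rn_def Bn_def by auto
      then show "fst ` (Mn n \<inter> ?C \<times> ?C) = R \<inter> ?C" "snd ` (Mn n \<inter> ?C \<times> ?C) = B \<inter> ?C"
        "\<forall>(x, y)\<in>Mn n. x \<in> ?C \<longleftrightarrow> y \<in> ?C"
        using po[OF that] unfolding points.perfect_on_def[OF pn] by auto
    qed
    have eq: "Mn n \<inter> ?C \<times> ?C = Mn N \<inter> ?C \<times> ?C" if "n \<ge> N" for n
      by (rule perfect_on_unique[OF Mn Mn disn disn sep F]) (use sub f[OF that] f[of N] finite_block in auto)
    show ?thesis
      by (intro exI[of _ ?C] exI[of _ N] conjI allI impI; (rule w(3) f eq | assumption)+)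
  qed
  define M where "M = {e. \<exists>N. \<forall>n\<ge>N. e \<in> Mn n}"
  \<comment> \<open>A finite part of the limit lies in a single \<open>Mn n\<close>; from there it
    inherits both the matching property and minimality.\<close>
  have common: "\<exists>n. E \<subseteq> Mn n" if "E \<subseteq> M" "finite E" for E
  proof -
    have "\<forall>e\<in>E. \<forall>\<^sub>F n in sequentially. e \<in> Mn n" using that(1) unfolding M_def eventually_sequentially by auto
    then have "\<forall>\<^sub>F n in sequentially. \<forall>e\<in>E. e \<in> Mn n" using that(2) by (subst eventually_ball_finite_distrib) auto
    then show ?thesis unfolding eventually_sequentially by blast
  qed
  have "is_matching R B M"
    unfolding is_matching_def
  proof (intro conjI allI impI)
    show "M \<subseteq> R \<times> B"
    proof
      fix e assume "e \<in> M"
      then obtain n where "e \<in> Mn n" using common[of "{e}"] by auto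
      then show "e \<in> R \<times> B" using Mm[of n] sub[of n] unfolding is_matching_def by blast
    qed
    show "y = y'" if xy: "(x, y) \<in> M" "(x, y') \<in> M" for x y y'
    proof -
      obtain n where "{(x, y), (x, y')} \<subseteq> Mn n" using common[of "{(x, y), (x, y')}"] xy by auto
      then show ?thesis using is_matching_unique(1)[OF Mm[of n]] by blast
    qed
    show "x = x'" if xy: "(x, y) \<in> M" "(x', y) \<in> M" for x x' y
    proof -
      obtain n where "{(x, y), (x', y)} \<subseteq> Mn n" using common[of "{(x, y), (x', y)}"] xy by auto
      then show ?thesis using is_matching_unique(2)[OF Mm[of n]] by blast
    qed
  qed
  moreover have um: "unmatched R B M = {}"
  proof (rule ccontr)
    assume "unmatched R B M \<noteq> {}"
    then obtain p where p: "p \<in> unmatched R B M" by blast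
    then have pRB: "p \<in> R \<union> B" unfolding unmatched_def by auto
    from stab[OF this] obtain C N where pC: "p \<in> C"
      and all: "\<forall>n\<ge>N. fst ` (Mn n \<inter> C \<times> C) = R \<inter> C \<and> snd ` (Mn n \<inter> C \<times> C) = B \<inter> C \<and>
      Mn n \<inter> C \<times> C = Mn N \<inter> C \<times> C \<and> (\<forall>(x, y)\<in>Mn n. x \<in> C \<longleftrightarrow> y \<in> C)" by (elim exE conjE)
    have C: "Mn n \<inter> C \<times> C = Mn N \<inter> C \<times> C" if "n \<ge> N" for n using all[rule_format, OF that] by (elim conjE)
    have CN: "fst ` (Mn N \<inter> C \<times> C) = R \<inter> C" "snd ` (Mn N \<inter> C \<times> C) = B \<inter> C"
      using all[rule_format, OF order_refl] by simp_all
    have "Mn N \<inter> C \<times> C \<subseteq> M" unfolding M_def using C by blast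
    moreover have "p \<in> fst ` (Mn N \<inter> C \<times> C) \<union> snd ` (Mn N \<inter> C \<times> C)" unfolding CN using pC pRB by blast
    ultimately have "p \<in> fst ` M \<union> snd ` M" by blast
    moreover have "fst ` M \<subseteq> R" "snd ` M \<subseteq> B" using \<open>is_matching R B M\<close> unfolding is_matching_def by auto
    ultimately show False using p disjoint unfolding unmatched_def by blast
  qed
  moreover have "\<forall>\<^sub>F \<gamma> in F. minimal_on (power_cost \<gamma> a) R B M S" if S: "admissible R B M S" for S
  proof -
    obtain E where E: "finite S" "E \<subseteq> M" "S = fst ` E \<union> snd ` E \<union> {}"
      using S um unfolding admissible_def by blast
    have "E \<subseteq> S \<times> S"
    proof
      fix e assume "e \<in> E"
      then have "fst e \<in> S" "snd e \<in> S" unfolding E(3) by auto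
      then show "e \<in> S \<times> S" by (cases e) simp
    qed
    then have "finite E" by (rule finite_subset) (simp add: E(1))
    then obtain n where n: "E \<subseteq> Mn n" using common E by blast
    have "admissible (Rn n) (Bn n) (Mn n) S" unfolding E(3) by (rule admissibleI) (use n \<open>finite E\<close> in auto)
    then have "\<forall>\<^sub>F \<gamma> in F. minimal_on (power_cost \<gamma> a) (Rn n) (Bn n) (Mn n) S"
      using Mn unfolding eventually_minimal_def by blast
    moreover have "Rn n \<inter> S = R \<inter> S" "Bn n \<inter> S = B \<inter> S" "restrict_matching (Mn n) S = restrict_matching M S"
      using admissible_parts[OF Mm disn n _ E(3)] admissible_parts[OF \<open>is_matching R B M\<close> disjoint E(2) _ E(3)] by auto
    ultimately show ?thesis unfolding minimal_on_def by simp
  qed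
  ultimately show ?thesis unfolding eventually_minimal_def by blast
qed

lemma tame_unique_exists:
  assumes "tame F a" "separated F a R B" "comparable F a R B" "dips R B"
  shows "\<exists>!M. eventually_minimal F a R B M"
  using tame_exists[OF assms] tame_subset[OF _ _ assms(1,2,4)] by blast

end

section \<open>Directed matchings\<close>

text \<open>Forbids an edge inside another of the opposite direction. At \<gamma> = 1 exchanging the
  partners of such a pair saves the cost of both edges along the inner one, while for nested edges
  of equal direction the exchange leaves the cost unchanged.\<close>

definition directed :: "matching \<Rightarrow> bool" where
  "directed M \<longleftrightarrow> (\<forall>x y x' y'. (x, y) \<in> M \<longrightarrow> (x', y') \<in> M \<longrightarrow>
     \<not> (x < y' \<and> y' < x' \<and> x' < y) \<and> \<not> (y < x' \<and> x' < y' \<and> y' < x))"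

lemma noncrossing_converse: "noncrossing (M\<inverse>) \<longleftrightarrow> noncrossing M"
proof -
  have "noncrossing (M\<inverse>)" if "noncrossing M" for M
    unfolding noncrossing_def
  proof clarify
    fix x y x' y' assume "(y, x) \<in> M" "(y', x') \<in> M" "min x y < min x' y'" "min x' y' < max x y" "max x y < max x' y'"
    then show False using noncrossingD[OF that, of y x y' x'] by (simp add: min.commute max.commute)
  qed
  from this[of M] this[of "M\<inverse>"] show ?thesis by auto
qed

lemma directed_converse: "directed (M\<inverse>) \<longleftrightarrow> directed M"
  unfolding directed_def by auto

lemma card_matched_le:
  assumes M: "is_matching R B M" and fin: "finite (R \<inter> I)"
    and p: "\<And>b. b \<in> B \<Longrightarrow> b \<in> J \<Longrightarrow> \<exists>r\<in>I. (r, b) \<in> M"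
  shows "card (B \<inter> J) \<le> card (R \<inter> I)"
proof -
  have "\<exists>g. \<forall>b\<in>B \<inter> J. g b \<in> I \<and> (g b, b) \<in> M" using p by (intro bchoice) auto
  then obtain g where g: "\<forall>b\<in>B \<inter> J. g b \<in> I \<and> (g b, b) \<in> M" by blast
  have "inj_on g (B \<inter> J)"
    using g is_matching_unique(1)[OF M] by (intro inj_onI) metis
  moreover have "g ` (B \<inter> J) \<subseteq> R \<inter> I" using g is_matching_unique(3)[OF M] by auto
  ultimately show ?thesis using fin by (rule card_inj_on_le)
qed

text \<open>If \<open>E2\<close> separates the neighbours \<open>p\<close> and \<open>q\<close>,
  most positions of their partners violate noncrossing or directedness at once. When both edges
  point away from the gap to the left and to the right, a count of the points up to \<open>p\<close>
  produces an edge of \<open>E2\<close> over the gap that conflicts with the edge at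
  \<open>p\<close>.\<close>

lemma adjacent_edge:
  assumes E1: "is_matching X Y E1" "X \<subseteq> fst ` E1" "Y \<subseteq> snd ` E1" "directed E1"
    and E2: "is_matching X Y E2" "X \<subseteq> fst ` E2" "Y \<subseteq> snd ` E2" "directed E2" "noncrossing E2"
    and fin: "finite X" "finite Y" and dis: "X \<inter> Y = {}"
    and pq: "(p, q) \<in> E1" "p < q" and gap: "\<And>z. z \<in> X \<union> Y \<Longrightarrow> p < z \<Longrightarrow> z < q \<Longrightarrow> False"
  shows "(p, q) \<in> E2"
proof (rule ccontr)
  assume n: "(p, q) \<notin> E2"
  have pX: "p \<in> X" "q \<in> Y" using is_matching_unique(3,4)[OF E1(1) pq(1)] .
  obtain y where y: "(p, y) \<in> E2" using pX E2(2) by force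
  obtain x where x: "(x, q) \<in> E2" using pX E2(3) by force
  have mem: "y \<in> Y" "x \<in> X" using is_matching_unique(4)[OF E2(1) y] is_matching_unique(3)[OF E2(1) x] .
  have ne: "y \<noteq> q" "x \<noteq> p" "y \<noteq> p" "x \<noteq> q" "x \<noteq> y" using n x y mem pX dis by blast+
  have ny: "y < p \<or> q < y" and nx: "x < p \<or> q < x" using gap[of y] gap[of x] mem ne by force+
  note dir = E2(4)[unfolded directed_def, rule_format]
  note nc = noncrossingD[OF E2(5)]
  consider "q < y" "q < x" | "y < p" "x < p" | "q < y" "x < p" | "y < p" "q < x" using ny nx by blast
  then show False
  proof cases
    case 1
    then have "x < y" using nc[OF y x] pq(2) ne by fastforce
    then show False using dir[OF y x] 1 pq(2) by simp
  next
    case 2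
    then have "x < y" using nc[OF y x] pq(2) ne by fastforce
    then show False using dir[OF x y] 2 pq(2) by simp
  next
    case 3
    then show False using nc[OF x y] pq(2) by simp
  next
    case 4
    \<comment> \<open>In \<open>E1\<close> the partner of a blue point before \<open>p\<close>
      cannot lie beyond \<open>q\<close>, since that edge would cover \<open>(p, q)\<close> in the
      opposite direction. So up to \<open>p\<close> there are more red than blue points, and
      \<open>E2\<close> must lead some red point across.\<close>
    have "card (Y \<inter> {..p}) \<le> card (X \<inter> {..<p})"
    proof (rule card_matched_le[OF E1(1)])
      show "finite (X \<inter> {..<p})" using fin by simp
      fix b assume b: "b \<in> Y" "b \<in> {..p}"
      then obtain r where r: "(r, b) \<in> E1" using E1(3) by force
      have rX: "r \<in> X" using is_matching_unique(3)[OF E1(1) r] .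
      have "b \<noteq> p" using b(1) pX(1) dis by blast
      have "r \<noteq> p" using is_matching_unique(1)[OF E1(1) r] pq b by force
      moreover have "\<not> p < r"
      proof
        assume "p < r"
        have "r \<noteq> q" using rX pX(2) dis by blast
        then have "q < r" using gap[of r] rX \<open>p < r\<close> by force
        then show False using E1(4)[unfolded directed_def, rule_format, OF r pq(1)] b \<open>b \<noteq> p\<close> pq(2) by auto
      qed
      ultimately show "\<exists>r\<in>{..<p}. (r, b) \<in> E1" using r by force
    qed
    moreover have "card (X \<inter> {..<p}) < card (X \<inter> {..p})"
      using fin pX(1) by (intro psubset_card_mono) auto
    moreover have "card (X \<inter> {..p}) \<le> card (Y \<inter> {..p})" if "\<forall>r\<in>X. r \<le> p \<longrightarrow> (\<exists>b\<le>p. (r, b) \<in> E2)"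
    proof (rule card_matched_le[of Y X "E2\<inverse>"])
      show "is_matching Y X (E2\<inverse>)" using E2(1) converse_matching by blast
      show "finite (Y \<inter> {..p})" using fin by simp
      show "\<exists>r\<in>{..p}. (r, b) \<in> E2\<inverse>" if "b \<in> X" "b \<in> {..p}" for b
        using \<open>\<forall>r\<in>X. r \<le> p \<longrightarrow> (\<exists>b\<le>p. (r, b) \<in> E2)\<close> that by auto
    qed
    ultimately obtain z where z: "z \<in> X" "z \<le> p" "\<not> (\<exists>b\<le>p. (z, b) \<in> E2)" by fastforce
    obtain z' where z': "(z, z') \<in> E2" using z(1) E2(2) by force
    have zY: "z' \<in> Y" using is_matching_unique(4)[OF E2(1) z'] .
    have "p < z'" using z(3) z' by (metis not_le)
    have "z \<noteq> p" using z(3) y 4 by force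
    then have "z < p" using z by simp
    have "z' \<noteq> q" using is_matching_unique(2)[OF E2(1) x] z' \<open>z < p\<close> 4 pq(2) by force
    then have "q < z'" using gap[of z'] zY \<open>p < z'\<close> by force
    have "z \<noteq> y" using z(1) mem dis by blast
    then have "z < y" using nc[OF y z'] 4 \<open>z < p\<close> \<open>q < z'\<close> pq(2) by fastforce
    then show False using dir[OF z' y] 4 \<open>q < z'\<close> pq(2) by simp
  qed
qed

text \<open>A shortest edge of \<open>E1\<close> joins neighbours: a point beneath it would belong
  to a nested, shorter edge. By \<open>adjacent_edge\<close> it also lies in \<open>E2\<close>, and
  it can be removed from both.\<close>

lemma directed_unique:
  assumes "finite E1" "is_matching (fst ` E1) (snd ` E1) E1" "is_matching (fst ` E1) (snd ` E1) E2"
    "fst ` E2 = fst ` E1" "snd ` E2 = snd ` E1" "fst ` E1 \<inter> snd ` E1 = {}"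
    "noncrossing E1" "noncrossing E2" "directed E1" "directed E2"
  shows "E1 = E2"
  using assms
proof (induction "card E1" arbitrary: E1 E2)
  case 0
  then have "E1 = {}" by simp
  then show ?case using "0.prems"(4) by simp
next
  case (Suc n)
  note fin = Suc.prems(1) and m1 = Suc.prems(2) and m2 = Suc.prems(3)
  have "E1 \<noteq> {}" using Suc.hyps(2) by auto
  obtain e where e: "e \<in> E1" "\<And>e'. e' \<in> E1 \<Longrightarrow> \<bar>fst e - snd e\<bar> \<le> \<bar>fst e' - snd e'\<bar>"
    using arg_min_if_finite(1)[OF fin \<open>E1 \<noteq> {}\<close>] arg_min_least[OF fin \<open>E1 \<noteq> {}\<close>, of _ "\<lambda>e. \<bar>fst e - snd e\<bar>"]
    by blast
  obtain p q where pq: "e = (p, q)" by (cases e)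
  have pqE: "(p, q) \<in> E1" and least: "\<And>x y. (x, y) \<in> E1 \<Longrightarrow> \<bar>p - q\<bar> \<le> \<bar>x - y\<bar>"
    using e(1) e(2)[of "(x, y)" for x y] pq by auto
  have gap: False if z: "z \<in> fst ` E1 \<union> snd ` E1" "min p q < z" "z < max p q" for z
  proof -
    obtain x y where xy: "(x, y) \<in> E1" "z = x \<or> z = y" using z(1) by auto
    have zpq: "z \<noteq> p" "z \<noteq> q" using z(2,3) by auto
    have "x \<noteq> p"
    proof
      assume "x = p"
      then have "y = q" using is_matching_unique(1)[OF m1 pqE] xy(1) by simp
      then show False using xy(2) zpq \<open>x = p\<close> by simp
    qed
    have "y \<noteq> q"
    proof
      assume "y = q"
      then have "x = p" using is_matching_unique(2)[OF m1 pqE] xy(1) by simp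
      then show False using xy(2) zpq \<open>y = q\<close> by simp
    qed
    have mem: "x \<in> fst ` E1" "y \<in> snd ` E1" "p \<in> fst ` E1" "q \<in> snd ` E1"
      using is_matching_unique(3,4)[OF m1 pqE] is_matching_unique(3,4)[OF m1 xy(1)] by blast+
    then have "x \<noteq> q" "y \<noteq> p" using Suc.prems(6) by (metis disjoint_iff)+
    have "\<not> (min p q < min x y \<and> min x y < max p q \<and> max p q < max x y)"
      "\<not> (min x y < min p q \<and> min p q < max x y \<and> max x y < max p q)"
      using noncrossingD[OF Suc.prems(7) pqE xy(1)] noncrossingD[OF Suc.prems(7) xy(1) pqE] by blast+
    then have "min p q < min x y \<and> max x y < max p q"
      using z(2,3) xy(2) \<open>x \<noteq> p\<close> \<open>y \<noteq> q\<close> \<open>x \<noteq> q\<close> \<open>y \<noteq> p\<close> by (auto simp: min_def max_def split: if_splits)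
    then show False using least[OF xy(1)] by auto
  qed
  have pq2: "(p, q) \<in> E2"
  proof (cases "p < q")
    case True
    show ?thesis
      by (rule adjacent_edge[OF m1 _ _ Suc.prems(9) m2 _ _ Suc.prems(10,8) _ _ Suc.prems(6) pqE True])
         (use gap True fin Suc.prems(4,5) in auto)
  next
    case False
    have "p \<noteq> q" using is_matching_unique(3,4)[OF m1 pqE] Suc.prems(6) by (metis disjoint_iff)
    then have lt: "q < p" using False by simp
    have f: "fst ` (E1\<inverse>) = snd ` E1" "snd ` (E1\<inverse>) = fst ` E1" "fst ` (E2\<inverse>) = snd ` E2" "snd ` (E2\<inverse>) = fst ` E2"
      by force+
    have "(q, p) \<in> E2\<inverse>"
    proof (rule adjacent_edge[of "snd ` E1" "fst ` E1" "E1\<inverse>" "E2\<inverse>"])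
      show "is_matching (snd ` E1) (fst ` E1) (E1\<inverse>)" "is_matching (snd ` E1) (fst ` E1) (E2\<inverse>)"
        using m1 m2 by (simp_all add: converse_matching)
      show "directed (E1\<inverse>)" "directed (E2\<inverse>)" "noncrossing (E2\<inverse>)"
        using Suc.prems by (simp_all add: directed_converse noncrossing_converse)
      show False if "z \<in> snd ` E1 \<union> fst ` E1" "q < z" "z < p" for z
        using gap[of z] that by auto
    qed (use f pqE lt fin Suc.prems(4,5,6) in auto)
    then show ?thesis by simp
  qed
  let ?D1 = "E1 - {(p, q)}" and ?D2 = "E2 - {(p, q)}"
  have rm: "fst ` (E - {(p, q)}) = fst ` E - {p}" "snd ` (E - {(p, q)}) = snd ` E - {q}"
    if "is_matching X Y E" "(p, q) \<in> E" for E X Y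
    using is_matching_inj[OF that(1)] that(2) inj_on_image_set_diff[of fst E E "{(p, q)}"]
      inj_on_image_set_diff[of snd E E "{(p, q)}"] by auto
  note f1 = rm[OF m1 pqE] and f2 = rm[OF m2 pq2]
  have "?D1 = ?D2"
  proof (rule Suc.hyps(1))
    show "n = card ?D1" using Suc.hyps(2) pqE fin by simp
    show "is_matching (fst ` ?D1) (snd ` ?D1) ?D1" by (rule is_matching_subset[OF m1]) auto
    show "is_matching (fst ` ?D1) (snd ` ?D1) ?D2"
      by (rule is_matching_subset[OF m2]) (auto simp: f1 f2 Suc.prems(4,5))
    show "fst ` ?D2 = fst ` ?D1" "snd ` ?D2 = snd ` ?D1" unfolding f1 f2 Suc.prems(4,5) by auto
    show "fst ` ?D1 \<inter> snd ` ?D1 = {}" unfolding f1 using Suc.prems(6) by auto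
    show "noncrossing ?D1" "noncrossing ?D2" using Suc.prems(7,8) unfolding noncrossing_def by auto
    show "directed ?D1" "directed ?D2" using Suc.prems(9,10) unfolding directed_def by auto
  qed (use fin in simp)
  then show ?case using pqE pq2 by blast
qed

definition unbounded_level :: "real set \<Rightarrow> real set \<Rightarrow> bool" where
  "unbounded_level R B \<longleftrightarrow> (\<forall>p h. (\<exists>t>p. lev R B t > h) \<and> (\<exists>t>p. lev R B t \<le> h) \<and>
     (\<exists>s<p. lev R B s > h) \<and> (\<exists>s<p. lev R B s \<le> h))"

text \<open>Such a set is empty, all of the integers, or a half-line.\<close>

lemma countable_up_closed: "countable {H::int set. \<forall>h\<in>H. h + 1 \<in> H}"
proof (rule countable_subset)
  show "{H::int set. \<forall>h\<in>H. h + 1 \<in> H} \<subseteq> {UNIV, {}} \<union> range (\<lambda>k. {k..})"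
  proof
    fix H :: "int set" assume "H \<in> {H. \<forall>h\<in>H. h + 1 \<in> H}"
    then have step: "\<And>h. h \<in> H \<Longrightarrow> h + 1 \<in> H" by auto
    have up: "h' \<in> H" if "h \<in> H" "h \<le> h'" for h h'
      using that(2,1) by (induction rule: int_ge_induct) (auto intro: step)
    show "H \<in> {UNIV, {}} \<union> range (\<lambda>k. {k..})"
    proof (cases "H = {} \<or> (\<forall>k. \<exists>h\<in>H. h \<le> k)")
      case True
      then show ?thesis using up by blast
    next
      case False
      then obtain k where k: "\<And>h. h \<in> H \<Longrightarrow> k < h" by (auto simp: not_le)
      obtain h0 where h0: "h0 \<in> H" using False by auto
      define m where "m = Min (H \<inter> {..h0})"
      have fin: "finite (H \<inter> {..h0})" by (rule finite_subset[of _ "{k..h0}"]) (use k in force)+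
      have m: "m \<in> H \<inter> {..h0}" unfolding m_def using fin h0 by (intro Min_in) auto
      have "m \<le> h" if "h \<in> H" for h
      proof (cases "h \<le> h0")
        case True
        then show ?thesis unfolding m_def using fin that by (intro Min_le) auto
      next
        case False
        then show ?thesis using m by auto
      qed
      then have "H = {m..}" using up m by auto
      then show ?thesis by blast
    qed
  qed
qed auto

lemma directedD:
  assumes "directed M" "(x, y) \<in> M" "(x', y') \<in> M"
  shows "x < y' \<Longrightarrow> y' < x' \<Longrightarrow> x' < y \<Longrightarrow> False" "y < x' \<Longrightarrow> x' < y' \<Longrightarrow> y' < x \<Longrightarrow> False"
  using assms unfolding directed_def by blast+

section \<open>Crossings of a level and explicit directed matchings\<close>

context points
begin

text \<open>A discrete intermediate value theorem, read off from \<open>card_level\<close>.\<close>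

lemma up_step:
  assumes "s \<le> t" "L s \<le> h" "h < L t"
  shows "\<exists>p\<in>R. s < p \<and> p \<le> t \<and> PL p = h"
proof (rule ccontr)
  assume "\<not> ?thesis"
  then have "{p \<in> R. s < p \<and> p \<le> t \<and> PL p = h} = {}" by blast
  then have "card {p \<in> R. s < p \<and> p \<le> t \<and> PL p = h} = 0" by (simp only: card.empty)
  then show False using card_level[OF assms(1), of h] assms(2,3) by simp
qed

lemma down_step:
  assumes "s \<le> t" "L t \<le> h" "h < L s"
  shows "\<exists>p\<in>B. s < p \<and> p \<le> t \<and> PL p = h"
proof (rule ccontr)
  assume "\<not> ?thesis"
  then have "{p \<in> B. s < p \<and> p \<le> t \<and> PL p = h} = {}" by blast
  then have "card {p \<in> B. s < p \<and> p \<le> t \<and> PL p = h} = 0" by (simp only: card.empty)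
  then show False using card_level[OF assms(1), of h] assms(2,3) by simp
qed

lemma level_at: "p \<in> R \<Longrightarrow> L p = PL p + 1" "p \<in> B \<Longrightarrow> L p = PL p"
  using disjoint unfolding plev_def by auto

lemma before_red: "s < p \<Longrightarrow> p \<in> R \<Longrightarrow> \<exists>q. s \<le> q \<and> q < p \<and> L q = PL p"
  using lev_before[of s p] level_at(1)[of p] by auto

lemma before_blue: "s < p \<Longrightarrow> p \<in> B \<Longrightarrow> \<exists>q. s \<le> q \<and> q < p \<and> L q = PL p + 1"
  using lev_before[of s p] level_at(2)[of p] disjoint by (cases "p \<in> R") auto

lemma first_point:
  assumes "X \<subseteq> R \<union> B" "p \<in> X" "s < p" "p \<le> t" "P p"
  shows "\<exists>p\<in>X. s < p \<and> p \<le> t \<and> P p \<and> (\<forall>r\<in>X. P r \<longrightarrow> s < r \<longrightarrow> r < p \<longrightarrow> False)"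
proof -
  let ?A = "{r \<in> X. s < r \<and> r \<le> t \<and> P r}"
  have fin: "finite ?A" by (rule finite_subset[OF _ finite_points(5)[of s t]]) (use assms(1) in auto)
  have ne: "?A \<noteq> {}" using assms by blast
  have "Min ?A \<in> ?A" using Min_in[OF fin ne] .
  moreover have "r < Min ?A \<Longrightarrow> False" if "r \<in> X" "P r" "s < r" for r
  proof -
    assume r: "r < Min ?A"
    then have "r \<in> ?A" using that calculation by auto
    then show False using Min_le[OF fin] r by force
  qed
  ultimately show ?thesis by blast
qed

lemma last_point:
  assumes "X \<subseteq> R \<union> B" "p \<in> X" "s < p" "p \<le> t" "P p"
  shows "\<exists>p\<in>X. s < p \<and> p \<le> t \<and> P p \<and> (\<forall>r\<in>X. P r \<longrightarrow> p < r \<longrightarrow> r \<le> t \<longrightarrow> False)"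
proof -
  let ?A = "{r \<in> X. s < r \<and> r \<le> t \<and> P r}"
  have fin: "finite ?A" by (rule finite_subset[OF _ finite_points(5)[of s t]]) (use assms(1) in auto)
  have ne: "?A \<noteq> {}" using assms by blast
  have "Max ?A \<in> ?A" using Max_in[OF fin ne] .
  moreover have "r \<le> t \<Longrightarrow> False" if "r \<in> X" "P r" "Max ?A < r" for r
  proof -
    assume r: "r \<le> t"
    then have "r \<in> ?A" using that calculation by auto
    then show False using Max_ge[OF fin] that(3) by force
  qed
  ultimately show ?thesis by blast
qed

text \<open>Every edge is an excursion of the walk: above the common level of its endpoints if it
  points right, not above it if it points left. Levels from \<open>k\<close> on point right. Varying
  \<open>k\<close> provides infinitely many matchings for 1-.\<close>

definition level_matching :: "int \<Rightarrow> matching" where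
  "level_matching k =
     {(x, y). x \<in> R \<and> y \<in> B \<and> x < y \<and> k \<le> PL x \<and> PL y = PL x \<and> (\<forall>t. x \<le> t \<longrightarrow> t < y \<longrightarrow> PL x < L t)} \<union>
     {(x, y). x \<in> R \<and> y \<in> B \<and> y < x \<and> PL x < k \<and> PL y = PL x \<and> (\<forall>t. y \<le> t \<longrightarrow> t < x \<longrightarrow> L t \<le> PL x)}"

lemma level_matchingD:
  assumes "(x, y) \<in> level_matching k"
  shows "x \<in> R" "y \<in> B" "PL y = PL x" "L x = PL x + 1" "L y = PL x"
    "k \<le> PL x \<longleftrightarrow> x < y" "PL x < k \<longleftrightarrow> y < x"
    "x < y \<Longrightarrow> x \<le> t \<Longrightarrow> t < y \<Longrightarrow> PL x < L t" "y < x \<Longrightarrow> y \<le> t \<Longrightarrow> t < x \<Longrightarrow> L t \<le> PL x"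
  using assms level_at[of x] level_at[of y] unfolding level_matching_def by auto

text \<open>Of two edges with a common endpoint, the longer passes over the free endpoint of the
  shorter, and there or just before it the walk leaves the excursion.\<close>

lemma level_matching_is_matching: "is_matching R B (level_matching k)"
  unfolding is_matching_def
proof (intro conjI allI impI)
  show "level_matching k \<subseteq> R \<times> B" unfolding level_matching_def by auto
  have fst_lt: False if e: "(x, y) \<in> level_matching k" "(x, y') \<in> level_matching k" and "y < y'" for x y y'
  proof -
    note a = level_matchingD[OF e(1)] and b = level_matchingD[OF e(2)]
    show False
    proof (cases "k \<le> PL x")
      case True
      then have "x < y" "x < y'" using a b by auto
      then show False using b(8)[of y] a(5) \<open>y < y'\<close> by simp
    next
      case False
      then have lt: "y < x" "y' < x" using a b by auto
      obtain q where "y \<le> q" "q < y'" "L q = PL y' + 1" using before_blue[OF \<open>y < y'\<close> b(2)] by blast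
      then show False using a(9)[of q] b(3) lt by simp
    qed
  qed
  show "y = y'" if "(x, y) \<in> level_matching k" "(x, y') \<in> level_matching k" for x y y'
    using fst_lt that by (metis linorder_neqE)
  have snd_lt: False if e: "(x, y) \<in> level_matching k" "(x', y) \<in> level_matching k" and "x < x'" for x x' y
  proof -
    note a = level_matchingD[OF e(1)] and b = level_matchingD[OF e(2)]
    have eq: "PL x = PL x'" using a b by simp
    show False
    proof (cases "k \<le> PL x")
      case True
      then have lt: "x < y" "x' < y" using a b by auto
      obtain q where "x \<le> q" "q < x'" "L q = PL x'" using before_red[OF \<open>x < x'\<close> b(1)] by blast
      then show False using a(8)[of q] eq lt by simp
    next
      case False
      then have "y < x" "y < x'" using a b eq by auto
      then show False using b(9)[of x] a(4) eq \<open>x < x'\<close> by simp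
    qed
  qed
  show "x = x'" if "(x, y) \<in> level_matching k" "(x', y) \<in> level_matching k" for x x' y
    using snd_lt that by (metis linorder_neqE)
qed

text \<open>An endpoint of one edge lying on the other, or the position just before it, compares the
  two levels. For equal directions the second edge gives the opposite comparison; for different
  directions the threshold \<open>k\<close> does.\<close>

lemma level_matching_separation:
  assumes e: "(x, y) \<in> level_matching k" "(x', y') \<in> level_matching k"
  shows "\<not> (x < y \<and> x < x' \<and> x' < y \<and> x' < y' \<and> y < y')" "\<not> (y < x \<and> y < y' \<and> y' < x \<and> y' < x' \<and> x < x')"
    "\<not> (x < y \<and> y' < x' \<and> x < y' \<and> y' < y)" "\<not> (x < y \<and> y' < x' \<and> y' < x \<and> x < x')"
proof -
  note a = level_matchingD[OF e(1)] and b = level_matchingD[OF e(2)]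
  show "\<not> (x < y \<and> x < x' \<and> x' < y \<and> x' < y' \<and> y < y')"
  proof
    assume l: "x < y \<and> x < x' \<and> x' < y \<and> x' < y' \<and> y < y'"
    obtain q where "x \<le> q" "q < x'" "L q = PL x'" using before_red[of x x'] l b(1) by blast
    then have "PL x < PL x'" using a(8)[of q] l by simp
    then show False using b(8)[of y] a(5) l by simp
  qed
  show "\<not> (y < x \<and> y < y' \<and> y' < x \<and> y' < x' \<and> x < x')"
  proof
    assume l: "y < x \<and> y < y' \<and> y' < x \<and> y' < x' \<and> x < x'"
    obtain q where "y \<le> q" "q < y'" "L q = PL y' + 1" using before_blue[of y y'] l b(2) by blast
    then have "PL x' < PL x" using a(9)[of q] l b(3) by simp
    then show False using b(9)[of x] a(4) l by simp
  qed
  show "\<not> (x < y \<and> y' < x' \<and> x < y' \<and> y' < y)" using a(6) a(8)[of y'] b(5,7) by auto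
  show "\<not> (x < y \<and> y' < x' \<and> y' < x \<and> x < x')"
  proof
    assume l: "x < y \<and> y' < x' \<and> y' < x \<and> x < x'"
    obtain q where "y' \<le> q" "q < x" "L q = PL x" using before_red[of y' x] l a(1) by blast
    then show False using b(9)[of q] b(7) a(6) l by simp
  qed
qed

lemma level_matching_noncrossing: "noncrossing (level_matching k)"
  unfolding noncrossing_def
proof clarify
  fix x y x' y' assume e: "(x, y) \<in> level_matching k" "(x', y') \<in> level_matching k"
    and c: "min x y < min x' y'" "min x' y' < max x y" "max x y < max x' y'"
  have "x \<noteq> y" "x' \<noteq> y'" using level_matchingD(1,2)[OF e(1)] level_matchingD(1,2)[OF e(2)] disjoint by blast+
  then show False
    using c level_matching_separation[OF e(1) e(2)] level_matching_separation[OF e(2) e(1)]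
    by (cases "x < y"; cases "x' < y'") auto
qed

lemma level_matching_directed: "directed (level_matching k)"
  unfolding directed_def
proof (intro allI impI conjI notI)
  fix x y x' y' assume e: "(x, y) \<in> level_matching k" "(x', y') \<in> level_matching k"
  show False if "x < y' \<and> y' < x' \<and> x' < y" using level_matching_separation(3)[OF e(1) e(2)] that by auto
  show False if "y < x' \<and> x' < y' \<and> y' < x" using level_matching_separation(4)[OF e(2) e(1)] that by auto
qed

text \<open>The walk is found on both sides of every level arbitrarily far out in both directions,
  so each excursion ends. The partner is the nearest crossing of the level by the other colour in
  the prescribed direction.\<close>

lemma level_matching_perfect:
  assumes u: "unbounded_level R B"
  shows "unmatched R B (level_matching k) = {}"
proof -
  have red: "\<exists>y. (x, y) \<in> level_matching k" if x: "x \<in> R" for x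
  proof (cases "k \<le> PL x")
    case True
    obtain T where T: "x < T" "L T \<le> PL x" using u unfolding unbounded_level_def by blast
    obtain p where "p \<in> B" "x < p" "p \<le> T" "PL p = PL x"
      using down_step[of x T "PL x"] T level_at(1)[OF x] by auto
    from first_point[of B p x T "\<lambda>p. PL p = PL x", OF _ this]
    obtain y where y: "y \<in> B" "x < y" "y \<le> T" "PL y = PL x"
      "\<And>r. r \<in> B \<Longrightarrow> PL r = PL x \<Longrightarrow> x < r \<Longrightarrow> r < y \<Longrightarrow> False" by blast
    have "PL x < L t" if t: "x \<le> t" "t < y" for t
    proof (rule ccontr)
      assume "\<not> PL x < L t"
      then obtain r where "r \<in> B" "x < r" "r \<le> t" "PL r = PL x"
        using down_step[of x t "PL x"] t level_at(1)[OF x] by auto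
      then show False using y(5)[of r] t by simp
    qed
    then have "(x, y) \<in> level_matching k" unfolding level_matching_def using x y True by auto
    then show ?thesis by blast
  next
    case False
    obtain s where s: "s < x" "L s > PL x" using u unfolding unbounded_level_def by blast
    obtain q where q: "s \<le> q" "q < x" "L q = PL x" using before_red[OF s(1) x] by blast
    obtain p where "p \<in> B" "s < p" "p \<le> q" "PL p = PL x"
      using down_step[of s q "PL x"] q s by auto
    then have "p \<in> B" "s < p" "p \<le> x" "PL p = PL x" using q by auto
    from last_point[of B p s x "\<lambda>p. PL p = PL x", OF _ this]
    obtain y where y: "y \<in> B" "s < y" "y \<le> x" "PL y = PL x"
      "\<And>r. r \<in> B \<Longrightarrow> PL r = PL x \<Longrightarrow> y < r \<Longrightarrow> r \<le> x \<Longrightarrow> False" by blast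
    have "y \<noteq> x" using x y(1) disjoint by blast
    have "L t \<le> PL x" if t: "y \<le> t" "t < x" for t
    proof (rule ccontr)
      assume n: "\<not> L t \<le> PL x"
      obtain q' where q': "t \<le> q'" "q' < x" "L q' = PL x" using before_red[OF t(2) x] by blast
      then obtain r where "r \<in> B" "t < r" "r \<le> q'" "PL r = PL x"
        using down_step[of t q' "PL x"] n by auto
      then show False using y(5)[of r] t q' by simp
    qed
    then have "(x, y) \<in> level_matching k" unfolding level_matching_def using x y False \<open>y \<noteq> x\<close> by auto
    then show ?thesis by blast
  qed
  have blue: "\<exists>x. (x, y) \<in> level_matching k" if y: "y \<in> B" for y
  proof (cases "k \<le> PL y")
    case True
    obtain s where s: "s < y" "L s \<le> PL y" using u unfolding unbounded_level_def by blast
    obtain q where q: "s \<le> q" "q < y" "L q = PL y + 1" using before_blue[OF s(1) y] by blast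
    obtain p where "p \<in> R" "s < p" "p \<le> q" "PL p = PL y"
      using up_step[of s q "PL y"] q s by auto
    then have "p \<in> R" "s < p" "p \<le> y" "PL p = PL y" using q by auto
    from last_point[of R p s y "\<lambda>p. PL p = PL y", OF _ this]
    obtain x where x: "x \<in> R" "s < x" "x \<le> y" "PL x = PL y"
      "\<And>r. r \<in> R \<Longrightarrow> PL r = PL y \<Longrightarrow> x < r \<Longrightarrow> r \<le> y \<Longrightarrow> False" by blast
    have "x \<noteq> y" using y x(1) disjoint by blast
    have "PL y < L t" if t: "x \<le> t" "t < y" for t
    proof (rule ccontr)
      assume n: "\<not> PL y < L t"
      obtain q' where q': "t \<le> q'" "q' < y" "L q' = PL y + 1" using before_blue[OF t(2) y] by blast
      then obtain r where "r \<in> R" "t < r" "r \<le> q'" "PL r = PL y"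
        using up_step[of t q' "PL y"] n by auto
      then show False using x(5)[of r] t q' by simp
    qed
    then have "(x, y) \<in> level_matching k" unfolding level_matching_def using y x True \<open>x \<noteq> y\<close> by auto
    then show ?thesis by blast
  next
    case False
    obtain T where T: "y < T" "L T > PL y" using u unfolding unbounded_level_def by blast
    obtain p where "p \<in> R" "y < p" "p \<le> T" "PL p = PL y"
      using up_step[of y T "PL y"] T level_at(2)[OF y] by auto
    from first_point[of R p y T "\<lambda>p. PL p = PL y", OF _ this]
    obtain x where x: "x \<in> R" "y < x" "x \<le> T" "PL x = PL y"
      "\<And>r. r \<in> R \<Longrightarrow> PL r = PL y \<Longrightarrow> y < r \<Longrightarrow> r < x \<Longrightarrow> False" by blast
    have "L t \<le> PL y" if t: "y \<le> t" "t < x" for t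
    proof (rule ccontr)
      assume "\<not> L t \<le> PL y"
      then obtain r where "r \<in> R" "y < r" "r \<le> t" "PL r = PL y"
        using up_step[of y t "PL y"] t level_at(2)[OF y] by auto
      then show False using x(5)[of r] t by simp
    qed
    then have "(x, y) \<in> level_matching k" unfolding level_matching_def using y x False by auto
    then show ?thesis by blast
  qed
  show ?thesis unfolding unmatched_def using red blue by (force simp: image_iff)
qed

text \<open>Points of level \<open>k\<close> point right for the threshold \<open>k\<close> and left
  for every larger one, and unboundedness ensures that such points exist.\<close>

lemma level_matching_inj:
  assumes u: "unbounded_level R B"
  shows "inj level_matching"
proof -
  have ne: "level_matching k \<noteq> level_matching k'" if lt: "k < k'" for k k'
  proof
    assume eq: "level_matching k = level_matching k'"
    obtain s where s: "L s \<le> k" using u unfolding unbounded_level_def by blast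
    obtain t where t: "s < t" "L t > k" using u unfolding unbounded_level_def by blast
    obtain x where x: "x \<in> R" "PL x = k" using up_step[of s t k] s t by auto
    have "x \<notin> unmatched R B (level_matching k)" using level_matching_perfect[OF u] by auto
    then obtain y where y: "(x, y) \<in> level_matching k" using x(1) unfolding unmatched_def by force
    then have "(x, y) \<in> level_matching k'" using eq by simp
    from level_matchingD(7)[OF this] level_matchingD(6)[OF y] show False using x lt by auto
  qed
  show ?thesis
  proof (rule injI)
    fix k k' assume "level_matching k = level_matching k'"
    then show "k = k'" using ne[of k k'] ne[of k' k] by (metis linorder_neqE)
  qed
qed

end

section \<open>Classification of directed perfect matchings\<close>

context points
begin

definition directed_perfect :: "matching \<Rightarrow> bool" where
  "directed_perfect M \<longleftrightarrow> planar R B M \<and> directed M \<and> unmatched R B M = {}"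

definition right_levels :: "matching \<Rightarrow> int set" where
  "right_levels M = {PL x |x y. (x, y) \<in> M \<and> x < y}"

lemma level_matching_directed_perfect:
  "unbounded_level R B \<Longrightarrow> directed_perfect (level_matching k)"
  unfolding directed_perfect_def planar_def
  using level_matching_is_matching level_matching_noncrossing level_matching_directed level_matching_perfect
  by simp

context
  fixes M assumes dp: "directed_perfect M"
begin

lemma dp_basic:
  shows "planar R B M" "is_matching R B M" "noncrossing M" "directed M"
    "x \<in> R \<Longrightarrow> \<exists>y. (x, y) \<in> M" "y \<in> B \<Longrightarrow> \<exists>x. (x, y) \<in> M"
proof -
  show "planar R B M" "is_matching R B M" "noncrossing M" "directed M"
    using dp unfolding directed_perfect_def planar_def by auto
  have "unmatched R B M = {}" using dp unfolding directed_perfect_def by auto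
  then show "x \<in> R \<Longrightarrow> \<exists>y. (x, y) \<in> M" "y \<in> B \<Longrightarrow> \<exists>x. (x, y) \<in> M"
    unfolding unmatched_def by force+
qed

lemma dp_edge:
  assumes "(x, y) \<in> M"
  shows "x \<in> R" "y \<in> B" "x \<noteq> y" "L x = PL x + 1" "L y = PL x" "PL y = PL x"
proof -
  show xy: "x \<in> R" "y \<in> B" using is_matching_unique(3,4)[OF dp_basic(2) assms] .
  then show "x \<noteq> y" "L x = PL x + 1" using disjoint level_at by blast+
  show "PL y = PL x" using planar_level(1)[OF dp_basic(1) assms] by simp
  then show "L y = PL x" using level_at(2)[OF xy(2)] by simp
qed

text \<open>A blue point beneath a right-pointing edge has its partner beneath it too, and by
  directedness to its left. Counted from \<open>x\<close>, red points therefore never fall behind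
  blue ones.\<close>

lemma dp_above:
  assumes e: "(x, y) \<in> M" and t: "x \<le> t" "t < y"
  shows "PL x < L t"
proof -
  have "card (B \<inter> {x<..t}) \<le> card (R \<inter> {x<..t})"
  proof (rule card_matched_le[OF dp_basic(2) finite_points(1)])
    fix b assume b: "b \<in> B" "b \<in> {x<..t}"
    obtain r where r: "(r, b) \<in> M" "x < r" "r < y"
      using planar_partner(2)[OF dp_basic(1) e, of b] b t by auto
    then have "\<not> b < r" using directedD(1)[OF dp_basic(4) e r(1)] b by auto
    then show "\<exists>r\<in>{x<..t}. (r, b) \<in> M" using r b by (intro bexI[of _ r]) auto
  qed
  then show ?thesis using lev_diff[OF t(1)] dp_edge(4)[OF e] by simp
qed

lemma dp_below:
  assumes e: "(x, y) \<in> M" and t: "y \<le> t" "t < x"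
  shows "L t \<le> PL x"
proof -
  have "card (R \<inter> {y<..t}) \<le> card (B \<inter> {y<..t})"
  proof (rule card_matched_le[of B R "M\<inverse>", OF _ finite_points(2)])
    show "is_matching B R (M\<inverse>)" using dp_basic(2) converse_matching by blast
    fix r assume r: "r \<in> R" "r \<in> {y<..t}"
    obtain b where b: "(r, b) \<in> M" "y < b" "b < x"
      using planar_partner(1)[OF dp_basic(1) e, of r] r t by auto
    then have "\<not> r < b" using directedD(2)[OF dp_basic(4) e b(1)] r by auto
    then show "\<exists>b\<in>{y<..t}. (b, r) \<in> M\<inverse>" using b r by (intro bexI[of _ b]) auto
  qed
  then show ?thesis using lev_diff[OF t(1)] dp_edge(5)[OF e] by simp
qed

text \<open>The points of one level between two oppositely directed edges of that level would be matched
  among themselves, but they are not balanced.\<close>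

lemma dp_same_direction:
  assumes e: "(x, y) \<in> M" "x < y" and e': "(x', y') \<in> M" "y' < x'" and lev: "PL x' = PL x"
  shows False
proof -
  note a = dp_edge[OF e(1)] and b = dp_edge[OF e'(1)]
  note m = dp_basic(2)
  let ?h = "PL x"
  have xx: "x \<noteq> x'" using is_matching_unique(1)[OF m e(1)] e e' by (metis order_less_asym)
  have yy: "y \<noteq> y'" using is_matching_unique(2)[OF m e(1)] e' xx by metis
  have ne: "x \<noteq> y'" "x' \<noteq> y" using a b disjoint by blast+
  consider "x < y'" | "y' < x" using ne by linarith
  then show False
  proof cases
    case 1
    have "\<not> y' < y" using dp_above[OF e(1), of y'] 1 b lev by auto
    then have "y < y'" using yy by simp
    obtain q where q: "y \<le> q" "q < y'" "\<forall>r\<in>R \<union> B. \<not> (q < r \<and> r < y')"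
      using gap_before[OF \<open>y < y'\<close>] by blast
    obtain q' where q': "q \<le> q'" "q' < y'" "L q' = PL y' + 1" using before_blue[OF q(2) b(2)] by blast
    have gap: "z \<le> q' \<or> y' \<le> z" if "z \<in> R \<union> B" for z using q(3) that q'(1) by force
    \<comment> \<open>The walk is at \<open>?h\<close> in \<open>y\<close> and at
      \<open>?h + 1\<close> in \<open>q'\<close>, just before \<open>y'\<close>, so
      \<open>?Z\<close> contains one more red than blue point.\<close>
    let ?Z = "{p. y < p \<and> p \<le> q' \<and> PL p = ?h}"
    have "card (R \<inter> ?Z) = card (B \<inter> ?Z)"
    proof (rule closed_balanced[OF m])
      fix z assume z: "z \<in> R \<inter> ?Z"
      then obtain c where c: "(z, c) \<in> M" using dp_basic(5) by blast
      note d = dp_edge[OF c]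
      have zl: "PL z = ?h" "y < z" "z \<le> q'" "z < y'" using z q' by auto
      have "y < c"
      proof (rule ccontr)
        assume "\<not> y < c"
        moreover have "c \<noteq> y" using is_matching_unique(2)[OF m e(1)] c zl e(2) by force
        ultimately have "c < y" by simp
        show False
        proof (cases "c < x")
          case True
          then show False using dp_below[OF c, of x] a zl e(2) by simp
        next
          case False
          then show False using dp_above[OF e(1), of c] d zl \<open>c < y\<close> by simp
        qed
      qed
      moreover have "c \<le> q'"
      proof (rule ccontr)
        assume "\<not> c \<le> q'"
        moreover have "c \<noteq> y'" using is_matching_unique(2)[OF m e'(1)] c zl e'(2) by force
        ultimately have "y' < c" using gap[of c] d by force
        then show False using dp_above[OF c, of y'] b zl lev by simp
      qed
      ultimately show "\<exists>c\<in>?Z. (z, c) \<in> M" using c d zl by auto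
    next
      fix z assume z: "z \<in> B \<inter> ?Z"
      then obtain r where r: "(r, z) \<in> M" using dp_basic(6) by blast
      note d = dp_edge[OF r]
      have zl: "PL z = ?h" "y < z" "z \<le> q'" "z < y'" using z q' by auto
      have "y < r"
      proof (rule ccontr)
        assume "\<not> y < r"
        then show False using dp_above[OF r, of y] a d zl by simp
      qed
      moreover have "r \<le> q'"
      proof (rule ccontr)
        assume "\<not> r \<le> q'"
        then have "y' < r" using gap[of r] d b disjoint by force
        show False
        proof (cases "x' < r")
          case True
          then show False using dp_below[OF r, of x'] b d zl e' lev by simp
        next
          case False
          moreover have "r \<noteq> x'" using is_matching_unique(1)[OF m e'(1)] r zl by force
          ultimately show False using dp_below[OF e'(1), of r] d zl lev \<open>y' < r\<close> by simp
        qed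
      qed
      ultimately show "\<exists>r\<in>?Z. (r, z) \<in> M" using r d zl by auto
    qed
    moreover have "R \<inter> ?Z = {p \<in> R. y < p \<and> p \<le> q' \<and> PL p = ?h}" "B \<inter> ?Z = {p \<in> B. y < p \<and> p \<le> q' \<and> PL p = ?h}"
      by auto
    ultimately show False using card_level[of y q' ?h] q q' a b lev by simp
  next
    case 2
    have "\<not> x < x'" using dp_below[OF e'(1), of x] 2 a lev by auto
    then have "x' < x" using xx by simp
    obtain q where q: "x' \<le> q" "q < x" "\<forall>r\<in>R \<union> B. \<not> (q < r \<and> r < x)"
      using gap_before[OF \<open>x' < x\<close>] by blast
    obtain q' where q': "q \<le> q'" "q' < x" "L q' = PL x" using before_red[OF q(2) a(1)] by blast
    have gap: "z \<le> q' \<or> x \<le> z" if "z \<in> R \<union> B" for z using q(3) that q'(1) by force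
    \<comment> \<open>Here the walk goes from \<open>?h + 1\<close> in \<open>x'\<close> down to
      \<open>?h\<close> in \<open>q'\<close>, so blue points are in excess by one.\<close>
    let ?Z = "{p. x' < p \<and> p \<le> q' \<and> PL p = ?h}"
    have "card (R \<inter> ?Z) = card (B \<inter> ?Z)"
    proof (rule closed_balanced[OF m])
      fix z assume z: "z \<in> R \<inter> ?Z"
      then obtain c where c: "(z, c) \<in> M" using dp_basic(5) by blast
      note d = dp_edge[OF c]
      have zl: "PL z = ?h" "x' < z" "z \<le> q'" "z < x" using z q' by auto
      have "x' < c"
      proof (rule ccontr)
        assume "\<not> x' < c"
        then show False using dp_below[OF c, of x'] b zl lev by simp
      qed
      moreover have "c \<le> q'"
      proof (rule ccontr)
        assume "\<not> c \<le> q'"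
        then have "x < c" using gap[of c] d a disjoint by force
        have "c \<noteq> y" using is_matching_unique(2)[OF m e(1)] c zl by force
        then show False
          using dp_above[OF c, of y] dp_above[OF e(1), of c] a d zl \<open>x < c\<close> e(2) by (cases "c < y") auto
      qed
      ultimately show "\<exists>c\<in>?Z. (z, c) \<in> M" using c d zl by auto
    next
      fix z assume z: "z \<in> B \<inter> ?Z"
      then obtain r where r: "(r, z) \<in> M" using dp_basic(6) by blast
      note d = dp_edge[OF r]
      have zl: "PL z = ?h" "x' < z" "z \<le> q'" "z < x" using z q' by auto
      have "x' < r"
      proof (rule ccontr)
        assume "\<not> x' < r"
        moreover have "r \<noteq> x'" using is_matching_unique(1)[OF m e'(1)] r zl e'(2) by force
        ultimately have "r < x'" by simp
        moreover have "r \<noteq> y'" using d b disjoint by blast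
        ultimately show False
          using dp_above[OF r, of y'] dp_below[OF e'(1), of r] b d zl lev e'(2) by (cases "r < y'") auto
      qed
      moreover have "r \<le> q'"
      proof (rule ccontr)
        assume "\<not> r \<le> q'"
        moreover have "r \<noteq> x" using is_matching_unique(1)[OF m e(1)] r zl e(2) by force
        ultimately have "x < r" using gap[of r] d by force
        then show False using dp_below[OF r, of x] a d zl by simp
      qed
      ultimately show "\<exists>r\<in>?Z. (r, z) \<in> M" using r d zl by auto
    qed
    moreover have "R \<inter> ?Z = {p \<in> R. x' < p \<and> p \<le> q' \<and> PL p = ?h}" "B \<inter> ?Z = {p \<in> B. x' < p \<and> p \<le> q' \<and> PL p = ?h}"
      by auto
    ultimately show False using card_level[of x' q' ?h] q q' a b lev by simp
  qed
qed

lemma dp_right_levels: "(x, y) \<in> M \<Longrightarrow> PL x \<in> right_levels M \<longleftrightarrow> x < y"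
proof
  assume e: "(x, y) \<in> M" and "PL x \<in> right_levels M"
  then obtain x1 y1 where "(x1, y1) \<in> M" "x1 < y1" "PL x = PL x1" unfolding right_levels_def by auto
  then have "\<not> y < x" using dp_same_direction[of x1 y1 x y] e by auto
  then show "x < y" using dp_edge(3)[OF e] by simp
qed (auto simp: right_levels_def)

text \<open>Suppose a red \<open>z\<close> of level \<open>h + 1\<close> is matched to the left. The
  last red point of level \<open>h\<close> before \<open>z\<close> starts a right-pointing edge that
  passes over \<open>z\<close>, because a return to \<open>h\<close> before \<open>z\<close> would
  require another red point of level \<open>h\<close>. The edge at \<open>z\<close> lies beneath it
  with the opposite direction.\<close>

lemma right_levels_up:
  assumes u: "unbounded_level R B" and h: "h \<in> right_levels M"
  shows "h + 1 \<in> right_levels M"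
proof -
  obtain s0 where s0: "L s0 \<le> h + 1" using u unfolding unbounded_level_def by blast
  obtain t0 where t0: "s0 < t0" "L t0 > h + 1" using u unfolding unbounded_level_def by blast
  obtain z where z: "z \<in> R" "PL z = h + 1" using up_step[of s0 t0 "h + 1"] s0 t0 by auto
  obtain b where b: "(z, b) \<in> M" using dp_basic(5)[OF z(1)] by blast
  have Lz: "L z = h + 2" using level_at(1)[OF z(1)] z by simp
  show ?thesis
  proof (cases "z < b")
    case True
    then have "PL z \<in> right_levels M" unfolding right_levels_def using b by blast
    then show ?thesis using z by simp
  next
    case False
    then have bz: "b < z" using dp_edge(3)[OF b] by simp
    obtain s where s: "s < z" "L s \<le> h" using u unfolding unbounded_level_def by blast
    obtain p where "p \<in> R" "s < p" "p \<le> z" "PL p = h" using up_step[of s z h] s Lz by auto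
    from last_point[of R p s z "\<lambda>p. PL p = h", OF _ this]
    obtain x where x: "x \<in> R" "s < x" "x \<le> z" "PL x = h"
      "\<And>r. r \<in> R \<Longrightarrow> PL r = h \<Longrightarrow> x < r \<Longrightarrow> r \<le> z \<Longrightarrow> False" by blast
    have "x \<noteq> z" using x z by auto
    then have "x < z" using x by simp
    obtain y where y: "(x, y) \<in> M" using dp_basic(5)[OF x(1)] by blast
    have xy: "x < y" using dp_right_levels[OF y] h x(4) by simp
    have "z < y"
    proof (rule ccontr)
      assume n: "\<not> z < y"
      then obtain r where "r \<in> R" "y < r" "r \<le> z" "PL r = h"
        using up_step[of y z h] dp_edge(5)[OF y] x(4) Lz by auto
      then show False using x(5)[of r] xy by simp
    qed
    then obtain b' where "(z, b') \<in> M" "x < b'"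
      using planar_partner(1)[OF dp_basic(1) y, of z] z \<open>x < z\<close> xy by auto
    then have "x < b" using is_matching_unique(1)[OF dp_basic(2) b] by simp
    then show ?thesis using directedD(1)[OF dp_basic(4) y b] bz \<open>z < y\<close> by simp
  qed
qed

end

text \<open>Once the direction is known, an edge is an excursion starting at its left endpoint, and
  this determines where it ends.\<close>

lemma dp_subset:
  assumes dp: "directed_perfect M" "directed_perfect M'" and eq: "right_levels M = right_levels M'"
  shows "M \<subseteq> M'"
proof
  fix e assume e: "e \<in> M"
  obtain x y where xy: "e = (x, y)" by (cases e)
  then have e: "(x, y) \<in> M" using e by simp
  note a = dp_edge[OF dp(1) e]
  obtain y' where y': "(x, y') \<in> M'" using dp_basic(5)[OF dp(2) a(1)] by blast
  obtain x' where x': "(x', y) \<in> M'" using dp_basic(6)[OF dp(2) a(2)] by blast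
  note b = dp_edge[OF dp(2) y'] and c = dp_edge[OF dp(2) x']
  show "e \<in> M'"
  proof (cases "x < y")
    case True
    then have "x < y'" using dp_right_levels[OF dp(1) e] dp_right_levels[OF dp(2) y'] eq by simp
    have "\<not> y < y'" using dp_above[OF dp(2) y', of y] a True by auto
    moreover have "\<not> y' < y" using dp_above[OF dp(1) e, of y'] b \<open>x < y'\<close> by auto
    ultimately show ?thesis using xy y' by simp
  next
    case False
    then have "y < x" using a by simp
    have l: "PL x' = PL x" using a c by simp
    then have "\<not> x' < y" using dp_right_levels[OF dp(1) e] dp_right_levels[OF dp(2) x'] eq False by simp
    then have "y < x'" using c by simp
    have "\<not> x < x'" using dp_below[OF dp(2) x', of x] a l \<open>y < x\<close> by auto
    moreover have "\<not> x' < x" using dp_below[OF dp(1) e, of x'] c l \<open>y < x'\<close> by auto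
    ultimately show ?thesis using xy x' by simp
  qed
qed

text \<open>\<open>right_levels\<close> is injective here and takes only up-closed sets as values,
  which bounds the number from above; the level matchings bound it from below.\<close>

lemma countable_directed_perfect:
  assumes u: "unbounded_level R B"
  shows "countable {M. directed_perfect M}" "infinite {M. directed_perfect M}"
proof -
  have "inj_on right_levels {M. directed_perfect M}"
    using dp_subset by (intro inj_onI) auto
  moreover have "right_levels ` {M. directed_perfect M} \<subseteq> {H. \<forall>h\<in>H. h + 1 \<in> H}"
    using right_levels_up[OF _ u] by auto
  ultimately show "countable {M. directed_perfect M}"
    using countable_image_inj_on[OF countable_subset[OF _ countable_up_closed]] by blast
  have "range level_matching \<subseteq> {M. directed_perfect M}" using level_matching_directed_perfect[OF u] by auto
  moreover have "infinite (range level_matching)"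
    using finite_imageD[OF _ level_matching_inj[OF u]] infinite_UNIV_char_0 by blast
  ultimately show "infinite {M. directed_perfect M}" using finite_subset by blast
qed

section \<open>High windows by exchange of colours, and finite difference\<close>

lemma lev_swap: "lev B R t = - L t"
  unfolding lev_def by simp

lemma swapped: "points B R"
  by (rule points.intro) (use finR finB disjoint in blast)+

text \<open>The exchange of colours negates the walk, so a crossing between \<open>h\<close> and
  \<open>h + 1\<close> becomes one between \<open>- 1 - h\<close> and \<open>- h\<close>.\<close>

lemma plev_swap: "p \<in> R \<union> B \<Longrightarrow> plev B R p = - 1 - PL p"
  using disjoint unfolding plev_def lev_swap by auto

lemma dips_block_high:
  assumes d: "dips B R" and p: "p \<in> R \<union> B"
  shows "\<exists>s t G. window R B (PL p) s t G \<and> K * (t - s) \<le> G \<and> p \<in> block R B (PL p) s t \<and> PL p < L s \<and> PL p < L t"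
proof -
  have w: "window B R (- 1 - h) s t G = window R B h s t G" for h s t G
  proof -
    have "- L \<tau> \<le> - 1 - h \<longleftrightarrow> h < L \<tau>" "- 1 - h < - L \<tau> \<longleftrightarrow> L \<tau> \<le> h" for \<tau> by auto
    then show ?thesis unfolding window_def lev_swap by auto
  qed
  have b: "block B R (- 1 - h) s t = block R B h s t" for h s t
    unfolding block_def using plev_swap by auto
  have "p \<in> B \<union> R" using p by blast
  from points.dips_block[OF swapped d this, of K]
  obtain s t G where "window B R (plev B R p) s t G" "K * (t - s) \<le> G" "p \<in> block B R (plev B R p) s t"
    "lev B R s \<le> plev B R p" "lev B R t \<le> plev B R p" by blast
  then show ?thesis unfolding plev_swap[OF p] w b lev_swap by fastforce
qed

lemma dips_unbounded:
  assumes "dips R B" "dips B R"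
  shows "unbounded_level R B"
  unfolding unbounded_level_def
proof (intro allI)
  fix p :: real and h :: int
  obtain N1 :: nat where "\<bar>p\<bar> < real N1" using reals_Archimedean2 by blast
  then obtain N :: nat where N: "\<bar>p\<bar> < real N" "\<bar>h\<bar> < int N"
    by (intro that[of "max N1 (nat (\<bar>h\<bar> + 1))"]) (auto simp: of_nat_max less_max_iff_disj)
  obtain s t G where st: "s < - real N" "real N < t" "(0::real) < G"
    "\<And>\<tau>. s - G \<le> \<tau> \<and> \<tau> \<le> s \<or> t \<le> \<tau> \<and> \<tau> \<le> t + G \<Longrightarrow> L \<tau> < - int N"
    using assms(1) unfolding dips_def by metis
  obtain s' t' G' where st': "s' < - real N" "real N < t'" "(0::real) < G'"
    "\<And>\<tau>. s' - G' \<le> \<tau> \<and> \<tau> \<le> s' \<or> t' \<le> \<tau> \<and> \<tau> \<le> t' + G' \<Longrightarrow> lev B R \<tau> < - int N"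
    using assms(2) unfolding dips_def by metis
  have "L s < - int N" "L t < - int N" "- L s' < - int N" "- L t' < - int N"
    using st(4)[of s] st(4)[of t] st'(4)[of s'] st'(4)[of t'] st(3) st'(3) unfolding lev_swap by auto
  then have "L s \<le> h" "L t \<le> h" "L s' > h" "L t' > h" using N by auto
  moreover have "s < p" "t > p" "s' < p" "t' > p" using st st' N by auto
  ultimately show "(\<exists>t>p. h < L t) \<and> (\<exists>t>p. L t \<le> h) \<and> (\<exists>s<p. h < L s) \<and> (\<exists>s<p. L s \<le> h)"
    by blast
qed

text \<open>Right-pointing edges of level \<open>h\<close> run above \<open>h\<close> and cannot
  pass an end of a low window; left-pointing ones cannot pass an end of a high window. The direction
  of the level decides which kind of window is taken, and \<open>M\<close> is perfect on
  either.\<close>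

lemma directed_finite_difference:
  assumes em: "eventually_minimal F a R B M" and tame: "tame F a" and dp: "directed_perfect M'"
    and d: "dips R B" "dips B R"
  shows "finite_difference R B M M'"
proof (rule finite_differenceI)
  fix v assume v: "v \<in> R \<union> B"
  obtain K where K: "1 \<le> K" "\<forall>\<^sub>F \<gamma> in F. concave_cost (power_cost \<gamma> a) \<and>
     gap_dominated K (power_cost \<gamma> a) \<and> gap_subadditive K (power_cost \<gamma> a)" and F: "F \<noteq> bot"
    using tame unfolding tame_def by auto
  let ?h = "PL v"
  have "\<exists>s t G. window R B ?h s t G \<and> K * (t - s) \<le> G \<and> v \<in> block R B ?h s t \<and>
      (\<forall>(x, y)\<in>M'. x \<in> block R B ?h s t \<longleftrightarrow> y \<in> block R B ?h s t)"
  proof (cases "?h \<in> right_levels M'")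
    case True
    obtain s t G where w: "window R B ?h s t G" "K * (t - s) \<le> G" "v \<in> block R B ?h s t" "L s \<le> ?h" "L t \<le> ?h"
      using dips_block[OF d(1) v, of K] by blast
    have "x \<in> block R B ?h s t \<longleftrightarrow> y \<in> block R B ?h s t" if e: "(x, y) \<in> M'" for x y
    proof (cases "PL x = ?h")
      case eq: True
      note a = dp_edge[OF dp e]
      have "x < y" using dp_right_levels[OF dp e] eq True by simp
      then have "\<not> (x \<le> t \<and> t < y)" "\<not> (x \<le> s \<and> s < y)"
        using dp_above[OF dp e, of t] dp_above[OF dp e, of s] eq w(4,5) by auto
      then show ?thesis using a eq \<open>x < y\<close> unfolding block_def by auto
    next
      case False
      then show ?thesis using dp_edge(6)[OF dp e] unfolding block_def by auto
    qed
    then show ?thesis using w(1-3) by blast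
  next
    case False
    obtain s t G where w: "window R B ?h s t G" "K * (t - s) \<le> G" "v \<in> block R B ?h s t" "?h < L s" "?h < L t"
      using dips_block_high[OF d(2) v, of K] by blast
    have "x \<in> block R B ?h s t \<longleftrightarrow> y \<in> block R B ?h s t" if e: "(x, y) \<in> M'" for x y
    proof (cases "PL x = ?h")
      case eq: True
      note a = dp_edge[OF dp e]
      have "y < x" using dp_right_levels[OF dp e] eq False a(3) by simp
      then have "\<not> (y \<le> t \<and> t < x)" "\<not> (y \<le> s \<and> s < x)"
        using dp_below[OF dp e, of t] dp_below[OF dp e, of s] eq w(4,5) by auto
      then show ?thesis using a eq \<open>y < x\<close> unfolding block_def by auto
    next
      case False
      then show ?thesis using dp_edge(6)[OF dp e] unfolding block_def by auto
    qed
    then show ?thesis using w(1-3) by blast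
  qed
  then obtain s t G where w: "window R B ?h s t G" "K * (t - s) \<le> G" "v \<in> block R B ?h s t"
    and cl: "\<forall>(x, y)\<in>M'. x \<in> block R B ?h s t \<longleftrightarrow> y \<in> block R B ?h s t" by blast
  have "perfect_on M (block R B ?h s t)" using tame_perfect_on_block[OF em F K(2,1) w(1,2)] .
  then have "\<forall>(x, y)\<in>M \<union> M'. x \<in> block R B ?h s t \<longleftrightarrow> y \<in> block R B ?h s t"
    using cl unfolding perfect_on_def by auto
  then show "\<exists>C. v \<in> C \<and> finite C \<and> (\<forall>(x, y)\<in>M \<union> M'. x \<in> C \<longleftrightarrow> y \<in> C)"
    using w(3) finite_block[of ?h s t] by (intro exI[of _ "block R B ?h s t"]) simp
qed

end

section \<open>Power costs with exponent below 1\<close>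

definition base_cost :: "real \<Rightarrow> real \<Rightarrow> real" where
  "base_cost \<gamma> l = (if \<gamma> > 0 then l powr \<gamma> else if \<gamma> = 0 then ln l else - (l powr \<gamma>))"

lemma power_cost_pos: "0 < l \<Longrightarrow> power_cost \<gamma> a l = base_cost \<gamma> l"
  unfolding power_cost_def base_cost_def by auto

lemma power_cost_neg:
  "0 < l \<Longrightarrow> 0 < a \<Longrightarrow> power_cost \<gamma> a (- l) = (if \<gamma> = 0 then ln a + base_cost \<gamma> l else a * base_cost \<gamma> l)"
  unfolding power_cost_def base_cost_def by (auto simp: ln_mult)

lemma base_cost_deriv:
  assumes "0 < l"
  shows "(base_cost \<gamma> has_real_derivative (if \<gamma> = 0 then 1 / l else \<bar>\<gamma>\<bar> * l powr (\<gamma> - 1))) (at l)"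
proof -
  consider "\<gamma> > 0" | "\<gamma> = 0" | "\<gamma> < 0" by linarith
  then show ?thesis
  proof cases
    case 1
    then have "base_cost \<gamma> = (\<lambda>l. l powr \<gamma>)" unfolding base_cost_def by auto
    then show ?thesis using 1 has_real_derivative_powr[OF assms, of \<gamma>] by simp
  next
    case 2
    then have "base_cost \<gamma> = ln" unfolding base_cost_def by auto
    then show ?thesis using 2 DERIV_ln_divide[OF assms] by simp
  next
    case 3
    then have "base_cost \<gamma> = (\<lambda>l. - (l powr \<gamma>))" unfolding base_cost_def by auto
    then show ?thesis using 3 DERIV_minus[OF has_real_derivative_powr[OF assms, of \<gamma>]] by simp
  qed
qed

lemma base_cost_mono:
  assumes "0 < u" "u < v"
  shows "base_cost \<gamma> u < base_cost \<gamma> v"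
  using assms unfolding base_cost_def by (auto intro: powr_less_mono2 powr_less_mono2_neg)

text \<open>For \<gamma> < 1 the derivative is strictly decreasing, whatever the sign of \<gamma>,
  so the increment over a step of length \<open>a\<close> decreases with the starting point of the
  step.\<close>

lemma base_cost_nested:
  assumes "\<gamma> < 1" "0 < a" "0 < i" "0 < c"
  shows "base_cost \<gamma> (a + i + c) + base_cost \<gamma> i < base_cost \<gamma> (a + i) + base_cost \<gamma> (i + c)"
proof -
  define d where "d l = (if \<gamma> = 0 then 1 / l else \<bar>\<gamma>\<bar> * l powr (\<gamma> - 1))" for l :: real
  have d_less: "d (t + a) < d t" if "0 < t" for t
  proof (cases "\<gamma> = 0")
    case True
    then show ?thesis unfolding d_def using that assms by (simp add: frac_less2)
  next
    case False
    then show ?thesis unfolding d_def using that assms by (auto intro!: mult_strict_left_mono powr_less_mono2_neg)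
  qed
  have "base_cost \<gamma> ((i + c) + a) - base_cost \<gamma> (i + c) < base_cost \<gamma> (i + a) - base_cost \<gamma> i"
  proof (rule DERIV_neg_imp_decreasing[of i "i + c" "\<lambda>t. base_cost \<gamma> (t + a) - base_cost \<gamma> t"])
    show "i < i + c" using assms by simp
    fix t assume t: "i \<le> t" "t \<le> i + c"
    have "((\<lambda>t. base_cost \<gamma> (t + a)) has_real_derivative d (t + a)) (at t)"
      using base_cost_deriv[of "t + a" \<gamma>] t assms unfolding d_def DERIV_shift by simp
    moreover have "(base_cost \<gamma> has_real_derivative d t) (at t)"
      using base_cost_deriv[of t \<gamma>] t assms unfolding d_def by simp
    ultimately have "((\<lambda>t. base_cost \<gamma> (t + a) - base_cost \<gamma> t) has_real_derivative d (t + a) - d t) (at t)"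
      by (rule DERIV_diff)
    then show "\<exists>y. ((\<lambda>t. base_cost \<gamma> (t + a) - base_cost \<gamma> t) has_real_derivative y) (at t) \<and> y < 0"
      using d_less[of t] t assms by (intro exI[of _ "d (t + a) - d t"]) simp
  qed
  then show ?thesis by (simp add: algebra_simps)
qed

lemma power_cost_concave:
  assumes "\<gamma> < 1" "0 < a"
  shows "concave_cost (power_cost \<gamma> a)"
  unfolding concave_cost_def
proof (intro conjI allI impI)
  fix u v :: real assume uv: "0 < u" "u < v"
  then have v: "0 < v" by simp
  show "power_cost \<gamma> a u < power_cost \<gamma> a v"
    unfolding power_cost_pos[OF uv(1)] power_cost_pos[OF v] using base_cost_mono[OF uv] .
  show "power_cost \<gamma> a (- u) < power_cost \<gamma> a (- v)"
    unfolding power_cost_neg[OF uv(1) assms(2)] power_cost_neg[OF v assms(2)]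
    using base_cost_mono[OF uv] assms(2) by simp
next
  fix p i c :: real assume pic: "0 < p" "0 < i" "0 < c"
  then have s: "0 < p + i + c" "0 < p + i" "0 < i + c" by auto
  note n = base_cost_nested[OF assms(1) pic]
  show "power_cost \<gamma> a (p + i + c) + power_cost \<gamma> a i < power_cost \<gamma> a (p + i) + power_cost \<gamma> a (i + c)"
    unfolding power_cost_pos[OF s(1)] power_cost_pos[OF s(2)] power_cost_pos[OF s(3)] power_cost_pos[OF pic(2)]
    using n .
  show "power_cost \<gamma> a (- (p + i + c)) + power_cost \<gamma> a (- i) < power_cost \<gamma> a (- (p + i)) + power_cost \<gamma> a (- (i + c))"
    unfolding power_cost_neg[OF s(1) assms(2)] power_cost_neg[OF s(2) assms(2)] power_cost_neg[OF s(3) assms(2)]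
      power_cost_neg[OF pic(2) assms(2)]
    using n mult_strict_left_mono[OF n assms(2)] by (auto simp: distrib_left)
qed

section \<open>Constants for the gap conditions\<close>

lemma gap_dominated_mono: "gap_dominated K f \<Longrightarrow> K \<le> K' \<Longrightarrow> gap_dominated K' f"
  unfolding gap_dominated_def by (meson mult_right_mono order_trans less_imp_le)

lemma powr_gap_pos:
  assumes "0 < \<gamma>" "0 < w" "K * w \<le> l" "1 \<le> (K::real)"
  shows "K powr \<gamma> * w powr \<gamma> \<le> l powr \<gamma>"
proof -
  have "(K * w) powr \<gamma> \<le> l powr \<gamma>" using assms by (intro powr_mono2) auto
  then show ?thesis using assms by (simp add: powr_mult)
qed

lemma powr_gap_neg:
  assumes "\<gamma> < 0" "0 < w" "K * w \<le> l" "1 \<le> (K::real)"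
  shows "K powr (- \<gamma>) * l powr \<gamma> \<le> w powr \<gamma>"
proof -
  have "0 < K * w" using assms by simp
  then have "l powr \<gamma> \<le> (K * w) powr \<gamma>" using assms by (intro powr_mono2') auto
  also have "\<dots> = K powr \<gamma> * w powr \<gamma>" using assms by (simp add: powr_mult)
  finally have "K powr (- \<gamma>) * l powr \<gamma> \<le> K powr (- \<gamma>) * (K powr \<gamma> * w powr \<gamma>)"
    by (intro mult_left_mono) auto
  then show ?thesis using assms by (simp flip: mult.assoc powr_add)
qed

text \<open>Stretching a length by \<open>K\<close> changes its power by the factor
  \<open>K powr \<gamma>\<close>, and by assumption this outweighs the weight in both directions.
  For negative exponents powers shrink with the length, but they enter with a minus sign.\<close>

lemma gap_dominated_power:
  assumes a: "0 < a" and K: "1 < K" "a < K powr \<bar>\<gamma>\<bar>" "1 / a < K powr \<bar>\<gamma>\<bar>" and \<gamma>: "\<gamma> \<noteq> 0"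
  shows "gap_dominated K (power_cost \<gamma> a)"
  unfolding gap_dominated_def
proof (intro allI impI)
  fix w l :: real assume w: "0 < w" and l: "K * w \<le> l"
  have "1 * w < K * w" using w K(1) by (intro mult_strict_right_mono) auto
  then have wl: "w < l" using l by simp
  then have l0: "0 < l" using w by simp
  have Ka: "1 < a * K powr \<bar>\<gamma>\<bar>" using K(3) a by (simp add: field_simps)
  note m = base_cost_mono[OF w wl, of \<gamma>]
  have "base_cost \<gamma> w < a * base_cost \<gamma> l \<and> a * base_cost \<gamma> w < base_cost \<gamma> l"
  proof (cases "0 < \<gamma>")
    case True
    have g: "K powr \<gamma> * w powr \<gamma> \<le> l powr \<gamma>" using powr_gap_pos[OF True w l] K by simp
    have "1 * w powr \<gamma> < (a * K powr \<gamma>) * w powr \<gamma>" using Ka True w by (intro mult_strict_right_mono) auto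
    also have "\<dots> \<le> a * l powr \<gamma>" using g a by (simp add: mult.assoc)
    finally have 1: "w powr \<gamma> < a * l powr \<gamma>" by simp
    have "a * w powr \<gamma> < K powr \<gamma> * w powr \<gamma>" using K(2) True w by (intro mult_strict_right_mono) auto
    then have "a * w powr \<gamma> < l powr \<gamma>" using g by simp
    then show ?thesis using 1 True unfolding base_cost_def by simp
  next
    case False
    then have neg: "\<gamma> < 0" using \<gamma> by simp
    have g: "K powr (- \<gamma>) * l powr \<gamma> \<le> w powr \<gamma>" using powr_gap_neg[OF neg w l] K by simp
    have "a * l powr \<gamma> < K powr (- \<gamma>) * l powr \<gamma>" using K(2) neg l0 by (intro mult_strict_right_mono) auto
    then have 1: "a * l powr \<gamma> < w powr \<gamma>" using g by simp
    have "1 * l powr \<gamma> < (a * K powr (- \<gamma>)) * l powr \<gamma>" using Ka neg l0 by (intro mult_strict_right_mono) auto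
    also have "\<dots> \<le> a * w powr \<gamma>" using g a by (simp add: mult.assoc)
    finally show ?thesis using 1 neg unfolding base_cost_def by simp
  qed
  then show "power_cost \<gamma> a w < power_cost \<gamma> a l \<and> power_cost \<gamma> a w < power_cost \<gamma> a (- l) \<and>
      power_cost \<gamma> a (- w) < power_cost \<gamma> a l \<and> power_cost \<gamma> a (- w) < power_cost \<gamma> a (- l)"
    using m a \<gamma> unfolding power_cost_pos[OF w] power_cost_pos[OF l0] power_cost_neg[OF w a] power_cost_neg[OF l0 a]
    by simp
qed

text \<open>For the logarithm both conditions compare products. Expanding
  \<open>w * (l + w + l')\<close> gives three terms, each at most \<open>l * l' / K\<close>; this is
  the origin of the factor 3.\<close>

lemma gap_power_zero:
  assumes a: "0 < a" and K: "3 * a + 1 < K" "3 / a + 1 < K"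
  shows "gap_dominated K (power_cost 0 a)" "gap_subadditive K (power_cost 0 a)"
proof -
  have K1: "1 < K" "1 < a * K" "3 < a * K" "a < K"
  proof -
    show "1 < K" "a < K" using K(1) a by linarith+
    have "a * (3 / a + 1) < a * K" using K(2) a by (intro mult_strict_left_mono) auto
    then show "1 < a * K" "3 < a * K" using a by (simp_all add: algebra_simps)
  qed
  have aux: "w < l" "w < a * l" "a * w < l" if w: "0 < w" and l: "K * w \<le> l" for w l
  proof -
    have "1 * w < K * w" "a * w < K * w" using w K1 by (intro mult_strict_right_mono; simp)+
    then show "w < l" "a * w < l" using l by auto
    have "1 * w < (a * K) * w" using w K1 by (intro mult_strict_right_mono) auto
    also have "\<dots> \<le> a * l" using l a by (simp add: mult.assoc)
    finally show "w < a * l" by simp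
  qed
  have pc: "power_cost 0 a l = ln l" "power_cost 0 a (- l) = ln (a * l)" if "0 < l" for l
    using that unfolding power_cost_def by auto
  show "gap_dominated K (power_cost 0 a)"
    unfolding gap_dominated_def
  proof (intro allI impI)
    fix w l :: real assume w: "0 < w" and l: "K * w \<le> l"
    note x = aux[OF w l]
    have l0: "0 < l" using w x by simp
    show "power_cost 0 a w < power_cost 0 a l \<and> power_cost 0 a w < power_cost 0 a (- l) \<and>
      power_cost 0 a (- w) < power_cost 0 a l \<and> power_cost 0 a (- w) < power_cost 0 a (- l)"
      unfolding pc[OF w] pc[OF l0] using x w l0 a by simp
  qed
  show "gap_subadditive K (power_cost 0 a)"
    unfolding gap_subadditive_def
  proof (intro allI impI)
    fix w l l' :: real assume w: "0 < w" and l: "K * w \<le> l" and l': "K * w \<le> l'"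
    have l0: "0 < l" "0 < l'" using aux[OF w l] aux[OF w l'] w by auto
    then have L0: "0 < l + w + l'" using w by simp
    have "K * (w * (l + w + l')) = (K * w) * l + (K * w) * w + (K * w) * l'" by (simp add: algebra_simps)
    also have "\<dots> \<le> l' * l + l' * l + l * l'"
      using l l' w l0 aux(1)[OF w l] by (intro add_mono mult_mono) auto
    finally have A: "K * (w * (l + w + l')) \<le> 3 * (l * l')" by (simp add: mult.commute)
    have p: "0 < w * (l + w + l')" using w L0 by simp
    have "3 * a * (w * (l + w + l')) < K * (w * (l + w + l'))"
      using K(1) p by (intro mult_strict_right_mono) auto
    then have 1: "(a * w) * (l + w + l') < l * l'" using A by simp
    have "3 * (w * (l + w + l')) < (a * K) * (w * (l + w + l'))"
      using K1 p by (intro mult_strict_right_mono) auto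
    also have "\<dots> \<le> a * (3 * (l * l'))" using A a by (simp add: mult.assoc)
    finally have 2: "w * (l + w + l') < a * (l * l')" by simp
    from mult_strict_left_mono[OF this a] have 2: "w * (a * (l + w + l')) < (a * l) * (a * l')"
      by (simp only: mult_ac)
    have "ln (a * w) + ln (l + w + l') < ln l + ln l'"
      using 1 a w L0 l0 by (subst (1 2) ln_mult_pos[symmetric]) (auto simp: ln_less_cancel_iff)
    moreover have "ln w + ln (a * (l + w + l')) < ln (a * l) + ln (a * l')"
    proof -
      have "ln w + ln (a * (l + w + l')) = ln (w * (a * (l + w + l')))" using w a L0 by (intro ln_mult_pos[symmetric]) auto
      also have "\<dots> < ln ((a * l) * (a * l'))" using 2 w a L0 l0 by (subst ln_less_cancel_iff) auto
      also have "\<dots> = ln (a * l) + ln (a * l')" using a l0 by (intro ln_mult_pos) auto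
      finally show ?thesis .
    qed
    ultimately show "power_cost 0 a (- w) + power_cost 0 a (l + w + l') < power_cost 0 a l + power_cost 0 a l' \<and>
       power_cost 0 a w + power_cost 0 a (- (l + w + l')) < power_cost 0 a (- l) + power_cost 0 a (- l')"
      unfolding pc[OF w] pc[OF l0(1)] pc[OF l0(2)] pc[OF L0] by blast
  qed
qed

text \<open>Powers of long lengths are small: each of the two terms given up is at most half of the
  term gained by the short edge, and the new long edge contributes negatively as well.\<close>

lemma gap_subadditive_neg:
  assumes a: "0 < a" and K: "1 \<le> K" "2 * a \<le> K powr (- \<gamma>)" "2 / a \<le> K powr (- \<gamma>)" and \<gamma>: "\<gamma> < 0"
  shows "gap_subadditive K (power_cost \<gamma> a)"
  unfolding gap_subadditive_def
proof (intro allI impI)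
  fix w l l' :: real assume w: "0 < w" and l: "K * w \<le> l" and l': "K * w \<le> l'"
  have "1 * w \<le> K * w" using w K(1) by (intro mult_right_mono) auto
  then have l0: "0 < l" "0 < l'" using w l l' by linarith+
  then have L0: "0 < l + w + l'" using w by simp
  note g = powr_gap_neg[OF \<gamma> w l K(1)] powr_gap_neg[OF \<gamma> w l' K(1)]
  have "2 * a * l powr \<gamma> \<le> K powr (- \<gamma>) * l powr \<gamma>" "2 * a * l' powr \<gamma> \<le> K powr (- \<gamma>) * l' powr \<gamma>"
    using K by (intro mult_right_mono; simp)+
  then have 1: "a * l powr \<gamma> + a * l' powr \<gamma> \<le> w powr \<gamma>" using g by linarith
  have "(2 / a) * l powr \<gamma> \<le> K powr (- \<gamma>) * l powr \<gamma>" "(2 / a) * l' powr \<gamma> \<le> K powr (- \<gamma>) * l' powr \<gamma>"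
    using K by (intro mult_right_mono; simp)+
  then have "(2 / a) * l powr \<gamma> + (2 / a) * l' powr \<gamma> \<le> 2 * w powr \<gamma>" using g by linarith
  then have 2: "l powr \<gamma> + l' powr \<gamma> \<le> a * w powr \<gamma>" using a by (simp add: field_simps)
  have 3: "0 < (l + w + l') powr \<gamma>" "0 < a * (l + w + l') powr \<gamma>" using L0 a by auto
  show "power_cost \<gamma> a (- w) + power_cost \<gamma> a (l + w + l') < power_cost \<gamma> a l + power_cost \<gamma> a l' \<and>
       power_cost \<gamma> a w + power_cost \<gamma> a (- (l + w + l')) < power_cost \<gamma> a (- l) + power_cost \<gamma> a (- l')"
    unfolding power_cost_pos[OF w] power_cost_pos[OF l0(1)] power_cost_pos[OF l0(2)] power_cost_pos[OF L0]
      power_cost_neg[OF w a] power_cost_neg[OF l0(1) a] power_cost_neg[OF l0(2) a] power_cost_neg[OF L0 a]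
    using \<gamma> unfolding base_cost_def by (intro conjI; simp; insert 1 2 3; linarith)
qed

text \<open>With \<open>l\<close> the shorter length, concavity makes
  \<open>(l + w + l') powr \<gamma> - l' powr \<gamma>\<close> largest at \<open>l' = l\<close>.
  Everything is then a multiple of \<open>l powr \<gamma>\<close>, and the second condition on
  \<open>K\<close> compares the factors.\<close>

lemma gap_subadditive_pos:
  assumes a: "0 < a" and \<gamma>: "0 < \<gamma>" "\<gamma> < 1" and K: "1 \<le> K"
    "max a (1 / a) * K powr (- \<gamma>) + (2 + 1 / K) powr \<gamma> < 2"
  shows "gap_subadditive K (power_cost \<gamma> a)"
proof -
  define c where "c = max a (1 / a)"
  have c: "0 < c" "a \<le> c" "1 / a \<le> c" unfolding c_def using a by auto
  have le: "c * w powr \<gamma> + (l + w + l') powr \<gamma> < l powr \<gamma> + l' powr \<gamma>"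
    if w: "0 < w" and l: "K * w \<le> l" and ll: "l \<le> l'" for w l l'
  proof -
    have "1 * w \<le> K * w" using w K(1) by (intro mult_right_mono) auto
    then have l0: "0 < l" "0 < l'" using w l ll by linarith+
    have "(l + w + l') powr \<gamma> - l' powr \<gamma> \<le> (l + w + l) powr \<gamma> - l powr \<gamma>"
    proof (cases "l = l'")
      case False
      then have "base_cost \<gamma> ((l + w) + l + (l' - l)) + base_cost \<gamma> l < base_cost \<gamma> ((l + w) + l) + base_cost \<gamma> (l + (l' - l))"
        using w l0 ll by (intro base_cost_nested[OF \<gamma>(2)]) auto
      then show ?thesis unfolding base_cost_def using \<gamma> by (simp add: algebra_simps)
    qed simp
    moreover have "(l + w + l) powr \<gamma> \<le> (2 + 1 / K) powr \<gamma> * l powr \<gamma>"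
    proof -
      have "w \<le> l / K" using l K(1) by (simp add: field_simps)
      then have "(l + w + l) \<le> (2 + 1 / K) * l" by (simp add: algebra_simps)
      then have "(l + w + l) powr \<gamma> \<le> ((2 + 1 / K) * l) powr \<gamma>" using w l0 \<gamma> by (intro powr_mono2) auto
      then show ?thesis using K(1) l0 by (simp add: powr_mult)
    qed
    moreover have "c * w powr \<gamma> \<le> (c * K powr (- \<gamma>)) * l powr \<gamma>"
    proof -
      have "K powr (- \<gamma>) * (K powr \<gamma> * w powr \<gamma>) \<le> K powr (- \<gamma>) * l powr \<gamma>"
        using powr_gap_pos[OF \<gamma>(1) w l K(1)] by (intro mult_left_mono) auto
      then have "w powr \<gamma> \<le> K powr (- \<gamma>) * l powr \<gamma>" using K(1) by (simp flip: mult.assoc powr_add)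
      then show ?thesis using c by (simp add: mult.assoc)
    qed
    ultimately have "c * w powr \<gamma> + (l + w + l') powr \<gamma> \<le> (c * K powr (- \<gamma>) + (2 + 1 / K) powr \<gamma>) * l powr \<gamma> + l' powr \<gamma> - l powr \<gamma>"
      by (simp add: algebra_simps)
    also have "\<dots> < 2 * l powr \<gamma> + l' powr \<gamma> - l powr \<gamma>"
      using mult_strict_right_mono[OF K(2)[folded c_def], of "l powr \<gamma>"] l0 by simp
    finally show ?thesis by simp
  qed
  have sub: "c * w powr \<gamma> + (l + w + l') powr \<gamma> < l powr \<gamma> + l' powr \<gamma>"
    if w: "0 < w" and l: "K * w \<le> l" "K * w \<le> l'" for w l l'
    using le[OF w l(1), of l'] le[OF w l(2), of l] by (cases "l \<le> l'") (auto simp: add.commute add.left_commute)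
  show ?thesis
    unfolding gap_subadditive_def
  proof (intro allI impI)
    fix w l l' :: real assume w: "0 < w" and l: "K * w \<le> l" and l': "K * w \<le> l'"
    have "1 * w \<le> K * w" using w K(1) by (intro mult_right_mono) auto
    then have l0: "0 < l" "0 < l'" using w l l' by linarith+
    then have L0: "0 < l + w + l'" using w by simp
    note s = sub[OF w l l']
    have "a * w powr \<gamma> \<le> c * w powr \<gamma>" "(1 / a) * w powr \<gamma> \<le> c * w powr \<gamma>"
      using c by (intro mult_right_mono; simp)+
    then have 1: "a * w powr \<gamma> + (l + w + l') powr \<gamma> < l powr \<gamma> + l' powr \<gamma>"
      "(1 / a) * w powr \<gamma> + (l + w + l') powr \<gamma> < l powr \<gamma> + l' powr \<gamma>" using s by linarith+
    have "a * ((1 / a) * w powr \<gamma> + (l + w + l') powr \<gamma>) < a * (l powr \<gamma> + l' powr \<gamma>)"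
      using 1(2) a by (intro mult_strict_left_mono) auto
    then have 2: "w powr \<gamma> + a * (l + w + l') powr \<gamma> < a * l powr \<gamma> + a * l' powr \<gamma>"
      using a by (simp add: distrib_left)
    show "power_cost \<gamma> a (- w) + power_cost \<gamma> a (l + w + l') < power_cost \<gamma> a l + power_cost \<gamma> a l' \<and>
       power_cost \<gamma> a w + power_cost \<gamma> a (- (l + w + l')) < power_cost \<gamma> a (- l) + power_cost \<gamma> a (- l')"
      unfolding power_cost_pos[OF w] power_cost_pos[OF l0(1)] power_cost_pos[OF l0(2)] power_cost_pos[OF L0]
        power_cost_neg[OF w a] power_cost_neg[OF l0(1) a] power_cost_neg[OF l0(2) a] power_cost_neg[OF L0 a]
      using 1 2 \<gamma> unfolding base_cost_def by simp
  qed
qed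

lemma tame_power:
  assumes a: "0 < a" and \<gamma>: "\<gamma> < 1"
  shows "tame (principal {\<gamma>}) a"
proof -
  have "\<exists>K\<ge>1. gap_dominated K (power_cost \<gamma> a) \<and> gap_subadditive K (power_cost \<gamma> a)"
  proof -
    consider "\<gamma> = 0" | "\<gamma> < 0" | "0 < \<gamma>" by linarith
    then show ?thesis
    proof cases
      case 1
      let ?K = "3 * a + 3 / a + 2"
      have "1 \<le> ?K" "3 * a + 1 < ?K" "3 / a + 1 < ?K" using a by (auto simp: add_pos_pos add_nonneg_nonneg less_imp_le)
      then show ?thesis using gap_power_zero[OF a, of ?K] 1 by (intro exI[of _ ?K]) auto
    next
      case 2
      define c where "c = 2 * a + 2 / a + 2"
      have c: "1 < c" "a < c" "1 / a < c" "2 * a \<le> c" "2 / a \<le> c" using a unfolding c_def by (auto simp: field_simps add_pos_pos)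
      define K where "K = c powr (1 / - \<gamma>)"
      have K: "K powr (- \<gamma>) = c" "1 < K" using c 2 unfolding K_def by (auto simp: powr_powr)
      have "gap_dominated K (power_cost \<gamma> a)" using K c 2 a by (intro gap_dominated_power) auto
      moreover have "gap_subadditive K (power_cost \<gamma> a)" using K c 2 a by (intro gap_subadditive_neg) auto
      ultimately show ?thesis using K(2) by (intro exI[of _ K]) auto
    next
      case 3
      define c where "c = max a (1 / a) + 1"
      have c: "1 < c" "a < c" "1 / a < c" using a unfolding c_def by auto
      define K where "K = c powr (1 / \<gamma>)"
      have K: "K powr \<gamma> = c" "1 < K" using c 3 unfolding K_def by (auto simp: powr_powr)
      have gd: "gap_dominated K (power_cost \<gamma> a)" using K c 3 a by (intro gap_dominated_power) auto
      \<comment> \<open>As \<open>K\<close> grows, the left side of the condition tends to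
        \<open>2 powr \<gamma>\<close>, which is below 2.\<close>
      have "((\<lambda>K. max a (1 / a) * K powr (- \<gamma>) + (2 + 1 / K) powr \<gamma>) \<longlongrightarrow> max a (1 / a) * 0 + (2 + 0) powr \<gamma>) at_top"
        using 3 by (intro tendsto_intros tendsto_neg_powr tendsto_divide_0[OF tendsto_const] filterlim_ident filterlim_at_top_imp_at_infinity) auto
      moreover have "max a (1 / a) * 0 + (2 + 0) powr \<gamma> < 2" using powr_less_mono[of \<gamma> 1 2] \<gamma> by simp
      ultimately have "\<forall>\<^sub>F K in at_top. max a (1 / a) * K powr (- \<gamma>) + (2 + 1 / K) powr \<gamma> < 2"
        by (rule order_tendstoD(2))
      then have "\<forall>\<^sub>F K' in at_top. max a (1 / a) * K' powr (- \<gamma>) + (2 + 1 / K') powr \<gamma> < 2 \<and> K \<le> K'"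
        using eventually_ge_at_top by (rule eventually_conj)
      then obtain K' where K': "max a (1 / a) * K' powr (- \<gamma>) + (2 + 1 / K') powr \<gamma> < 2" "K \<le> K'"
        using eventually_happens'[OF trivial_limit_at_top_linorder] by blast
      then show ?thesis using gap_dominated_mono[OF gd K'(2)] gap_subadditive_pos[OF a 3 \<gamma> _ K'(1)] K(2)
        by (intro exI[of _ K']) auto
    qed
  qed
  then show ?thesis unfolding tame_def eventually_principal using power_cost_concave[OF \<gamma> a]
    by (auto simp: principal_eq_bot_iff)
qed

text \<open>For \<open>a = 1\<close> and \<gamma> at most -1 the factor 2 is enough, because
  \<open>2 powr (- \<gamma>)\<close> is at least 2.\<close>

lemma tame_at_bot: "tame at_bot 1"
proof -
  have "\<forall>\<^sub>F \<gamma> in at_bot. (\<gamma>::real) \<le> - 1" by (rule eventually_le_at_bot)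
  then have "\<forall>\<^sub>F \<gamma> in at_bot. concave_cost (power_cost \<gamma> 1) \<and> gap_dominated 2 (power_cost \<gamma> 1) \<and> gap_subadditive 2 (power_cost \<gamma> 1)"
  proof (rule eventually_mono)
    fix \<gamma> :: real assume \<gamma>: "\<gamma> \<le> - 1"
    then have "(2::real) powr 1 \<le> 2 powr (- \<gamma>)" by (intro powr_mono) auto
    then have p: "2 \<le> (2::real) powr (- \<gamma>)" by simp
    then show "concave_cost (power_cost \<gamma> 1) \<and> gap_dominated 2 (power_cost \<gamma> 1) \<and> gap_subadditive 2 (power_cost \<gamma> 1)"
      using \<gamma> by (intro conjI power_cost_concave gap_dominated_power gap_subadditive_neg) auto
  qed
  moreover have "(at_bot :: real filter) \<noteq> bot" by (rule trivial_limit_at_bot_linorder)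
  ultimately show ?thesis unfolding tame_def by (intro conjI exI[of _ 2]) auto
qed

section \<open>The limit of exponents tending to 1 from below\<close>

lemma power_cost_at_one: "power_cost 1 a z = (if z < 0 then a * \<bar>z\<bar> else z)"
  unfolding power_cost_def by simp

lemma power_cost_tendsto_one:
  assumes "z \<noteq> 0"
  shows "((\<lambda>\<gamma>. power_cost \<gamma> a z) \<longlongrightarrow> power_cost 1 a z) (at_left 1)"
proof -
  have "((\<lambda>\<gamma>. if z < 0 then a * \<bar>z\<bar> powr \<gamma> else z powr \<gamma>) \<longlongrightarrow> power_cost 1 a z) (at_left 1)"
  proof (cases "z < 0")
    case True
    then have "((\<lambda>\<gamma>. a * \<bar>z\<bar> powr \<gamma>) \<longlongrightarrow> a * \<bar>z\<bar> powr 1) (at_left 1)"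
      by (intro tendsto_intros) auto
    then show ?thesis using True unfolding power_cost_at_one by simp
  next
    case False
    then have "((\<lambda>\<gamma>. z powr \<gamma>) \<longlongrightarrow> z powr 1) (at_left 1)"
      using assms by (intro tendsto_intros) auto
    then show ?thesis using False unfolding power_cost_at_one by simp
  qed
  moreover have "\<forall>\<^sub>F \<gamma> in at_left (1::real). 0 < \<gamma>"
    using eventually_at_left_real[of 0 1] by (rule eventually_mono) auto
  then have "\<forall>\<^sub>F \<gamma> in at_left 1. (if z < 0 then a * \<bar>z\<bar> powr \<gamma> else z powr \<gamma>) = power_cost \<gamma> a z"
    by (rule eventually_mono) (auto simp: power_cost_def)
  ultimately show ?thesis by (rule Lim_transform_eventually)
qed

text \<open>At \<gamma> = 1 the exchange saves the cost of both edges along the inner one. The gain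
  is strict and the costs are continuous in \<gamma>, so it persists near 1.\<close>

lemma nested_improves:
  assumes a: "0 < a" and o: "x < y' \<and> y' < x' \<and> x' < y \<or> y < x' \<and> x' < y' \<and> y' < x"
  shows "\<forall>\<^sub>F \<gamma> in at_left 1. power_cost \<gamma> a (y' - x) + power_cost \<gamma> a (y - x') <
    power_cost \<gamma> a (y - x) + power_cost \<gamma> a (y' - x')"
proof -
  have ne: "y' - x \<noteq> 0" "y - x' \<noteq> 0" "y - x \<noteq> 0" "y' - x' \<noteq> 0" using o by auto
  let ?d = "\<lambda>\<gamma>. (power_cost \<gamma> a (y - x) + power_cost \<gamma> a (y' - x')) - (power_cost \<gamma> a (y' - x) + power_cost \<gamma> a (y - x'))"
  have "(?d \<longlongrightarrow> ?d 1) (at_left 1)" using ne by (intro tendsto_intros power_cost_tendsto_one)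
  moreover have "?d 1 > 0"
  proof -
    have "0 < a * (x' - y')" if "y' < x'" using a that by simp
    moreover have "0 < a * (y' - x')" if "x' < y'" using a that by simp
    ultimately show ?thesis using o unfolding power_cost_at_one by (auto simp: algebra_simps)
  qed
  ultimately have "\<forall>\<^sub>F \<gamma> in at_left 1. ?d \<gamma> > 0" by (rule order_tendstoD(1))
  then show ?thesis by (rule eventually_mono) simp
qed

lemma eventually_swap:
  assumes em: "eventually_minimal F a R B M" and dis: "R \<inter> B = {}"
    and e: "(x, y) \<in> M" "(x', y') \<in> M" "x \<noteq> x'"
  shows "\<forall>\<^sub>F \<gamma> in F. power_cost \<gamma> a (y - x) + power_cost \<gamma> a (y' - x') \<le>
    power_cost \<gamma> a (y' - x) + power_cost \<gamma> a (y - x')"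
proof -
  have M: "is_matching R B M" using em unfolding eventually_minimal_def by auto
  have ne: "y \<noteq> y'" using is_matching_unique(2)[OF M e(1)] e by metis
  have "\<forall>\<^sub>F \<gamma> in F. cost (power_cost \<gamma> a) {(x, y), (x', y')} \<le> cost (power_cost \<gamma> a) {(x, y'), (x', y)}"
    by (rule eventually_exchange[OF em dis]) (use e ne in \<open>auto simp: is_matching_def\<close>)
  then show ?thesis using e ne unfolding cost_def by simp
qed

text \<open>For exponents above 1/2 the constant \<open>c ^ 2\<close> has a power of at least
  \<open>c\<close>. \<open>gap_subadditive\<close> has no such uniform constant: at \<gamma> = 1 the
  edge over everything already costs more than the two edges it replaces.\<close>

lemma gap_dominated_near_one:
  assumes a: "0 < a"
  shows "\<exists>K\<ge>1. \<forall>\<gamma>. 1 / 2 < \<gamma> \<longrightarrow> \<gamma> < 1 \<longrightarrow> gap_dominated K (power_cost \<gamma> a)"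
proof -
  define c where "c = max a (1 / a) + 1"
  have c: "1 < c" "a < c" "1 / a < c" using a unfolding c_def by auto
  have "gap_dominated (c ^ 2) (power_cost \<gamma> a)" if \<gamma>: "1 / 2 < \<gamma>" for \<gamma>
  proof (rule gap_dominated_power[OF a])
    show c2: "1 < c ^ 2" using c by (simp add: one_less_power)
    have "c = (c ^ 2) powr (1 / 2)" using c by (simp add: powr_half_sqrt)
    also have "\<dots> \<le> (c ^ 2) powr \<bar>\<gamma>\<bar>" using \<gamma> c2 by (intro powr_mono) auto
    finally have "c \<le> (c ^ 2) powr \<bar>\<gamma>\<bar>" .
    then show "a < (c ^ 2) powr \<bar>\<gamma>\<bar>" "1 / a < (c ^ 2) powr \<bar>\<gamma>\<bar>" using c by auto
    show "\<gamma> \<noteq> 0" using \<gamma> by auto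
  qed
  moreover have "1 \<le> c ^ 2" using c by (simp add: less_imp_le one_less_power)
  ultimately show ?thesis by blast
qed

context points
begin

lemma one_minus_imp_directed_perfect:
  assumes em: "eventually_minimal (at_left 1) a R B M" and a: "0 < a" and d: "dips R B"
  shows "directed_perfect M"
proof -
  have M: "is_matching R B M" using em unfolding eventually_minimal_def by auto
  obtain K where K: "1 \<le> K" "\<And>\<gamma>. 1 / 2 < \<gamma> \<Longrightarrow> \<gamma> < 1 \<Longrightarrow> gap_dominated K (power_cost \<gamma> a)"
    using gap_dominated_near_one[OF a] by blast
  have "\<forall>\<^sub>F \<gamma> in at_left (1::real). 1 / 2 < \<gamma> \<and> \<gamma> < 1"
    using eventually_at_left_real[of "1/2" 1] by (rule eventually_mono) auto
  note wm = eventually_minimal_weakly[OF em this trivial_limit_at_left_real]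
  have "planar R B M" by (rule weakly_minimal_planar[OF wm disjoint]) (use power_cost_concave a in auto)
  moreover have "unmatched R B M = {}"
    by (rule no_unmatched[OF d wm _ _ K(1)]) (use power_cost_concave a K(2) in auto)
  moreover have "directed M"
    unfolding directed_def
  proof (intro allI impI)
    fix x y x' y' assume e: "(x, y) \<in> M" "(x', y') \<in> M"
    show "\<not> (x < y' \<and> y' < x' \<and> x' < y) \<and> \<not> (y < x' \<and> x' < y' \<and> y' < x)"
    proof (rule ccontr)
      assume "\<not> ?thesis"
      then have o: "x < y' \<and> y' < x' \<and> x' < y \<or> y < x' \<and> x' < y' \<and> y' < x" by blast
      then have ne: "x \<noteq> x'" by auto
      have "\<forall>\<^sub>F \<gamma> in at_left (1::real). False"
        using eventually_conj[OF nested_improves[OF a o] eventually_swap[OF em disjoint e ne]]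
        by (rule eventually_mono) linarith
      then show False by simp
    qed
  qed
  ultimately show ?thesis unfolding directed_perfect_def by blast
qed

text \<open>Close to 1 a minimizer on the endpoints of a finite part is noncrossing and directed, so
  \<open>directed_unique\<close> identifies it with that part. Only finitely many quadruples of
  endpoints matter, hence one neighbourhood of 1 suffices.\<close>

lemma directed_perfect_imp_one_minus:
  assumes dp: "directed_perfect M" and a: "0 < a"
  shows "eventually_minimal (at_left 1) a R B M"
  unfolding eventually_minimal_def
proof (intro conjI allI impI)
  show M: "is_matching R B M" using dp_basic(2)[OF dp] .
  fix S assume "admissible R B M S"
  then obtain E where E: "finite S" "E \<subseteq> M" "S = fst ` E \<union> snd ` E \<union> {}"
    using dp unfolding admissible_def directed_perfect_def by blast
  have "E \<subseteq> S \<times> S"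
  proof
    fix e assume "e \<in> E"
    then have "fst e \<in> S" "snd e \<in> S" unfolding E(3) by auto
    then show "e \<in> S \<times> S" by (cases e) simp
  qed
  then have fin: "finite E" by (rule finite_subset) (simp add: E(1))
  note parts = admissible_parts[OF M disjoint E(2) _ E(3)]
  let ?X = "fst ` E" and ?Y = "snd ` E"
  have sub: "?X \<subseteq> R" "?Y \<subseteq> B" using M E(2) unfolding is_matching_def by auto
  have mE: "is_matching ?X ?Y E" by (rule is_matching_subset[OF M E(2)]) auto
  have dis: "?X \<inter> ?Y = {}" using sub disjoint by blast
  have cE: "card ?X = card E" "card ?Y = card E" using is_matching_inj[OF mE] by (auto simp: card_image)
  have finXY: "finite ?X" "finite ?Y" using fin by auto
  have ncE: "noncrossing E" using dp_basic(3)[OF dp] E(2) unfolding noncrossing_def by blast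
  have dirE: "directed E" using dp_basic(4)[OF dp] E(2) unfolding directed_def by blast
  let ?Q = "{(x, y, x', y'). (x, y, x', y') \<in> ?X \<times> ?Y \<times> ?X \<times> ?Y \<and>
     (x < y' \<and> y' < x' \<and> x' < y \<or> y < x' \<and> x' < y' \<and> y' < x)}"
  have "finite ?Q" by (rule finite_subset[of _ "?X \<times> ?Y \<times> ?X \<times> ?Y"]) (use fin in auto)
  then have "\<forall>\<^sub>F \<gamma> in at_left 1. \<forall>(x, y, x', y')\<in>?Q. power_cost \<gamma> a (y' - x) + power_cost \<gamma> a (y - x') <
    power_cost \<gamma> a (y - x) + power_cost \<gamma> a (y' - x')"
    by (subst eventually_ball_finite_distrib) (auto intro!: nested_improves[OF a])
  moreover have "\<forall>\<^sub>F \<gamma> in at_left (1::real). \<gamma> < 1" by (simp add: eventually_at_filter)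
  ultimately have "\<forall>\<^sub>F \<gamma> in at_left 1. minimal_finite (power_cost \<gamma> a) ?X ?Y E"
  proof eventually_elim
    case (elim \<gamma>)
    let ?f = "power_cost \<gamma> a"
    obtain D where D: "minimal_finite ?f ?X ?Y D" using ex_minimal_finite[OF finXY dis] by blast
    note Di = D[unfolded minimal_finite_iff[OF finXY dis]]
    have mD: "is_matching ?X ?Y D" and cD: "card D = card E" using Di cE by auto
    have wm: "weakly_minimal {?f} ?X ?Y D" using weakly_minimal_finite[OF finXY dis D] .
    have "planar ?X ?Y D" by (rule weakly_minimal_planar[OF wm dis]) (use power_cost_concave[OF elim(2) a] in auto)
    then have nc: "noncrossing D" unfolding planar_def by auto
    have dir: "directed D"
      unfolding directed_def
    proof (intro allI impI)
      fix x y x' y' assume e: "(x, y) \<in> D" "(x', y') \<in> D"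
      show "\<not> (x < y' \<and> y' < x' \<and> x' < y) \<and> \<not> (y < x' \<and> x' < y' \<and> y' < x)"
      proof (rule ccontr)
        assume "\<not> ?thesis"
        then have o: "x < y' \<and> y' < x' \<and> x' < y \<or> y < x' \<and> x' < y' \<and> y' < x" by blast
        then have ne: "x \<noteq> x'" by auto
        have "(x, y, x', y') \<in> ?Q" using o is_matching_unique(3,4)[OF mD e(1)] is_matching_unique(3,4)[OF mD e(2)] by blast
        then have "?f (y' - x) + ?f (y - x') < ?f (y - x) + ?f (y' - x')" using elim(1) by blast
        then show False using weakly_minimal_swap[OF wm dis e ne] by simp
      qed
    qed
    have "fst ` D = ?X"
    proof (rule card_subset_eq[OF finXY(1)])
      show "fst ` D \<subseteq> ?X" using mD unfolding is_matching_def by auto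
      show "card (fst ` D) = card ?X" using is_matching_inj(1)[OF mD] cD cE by (simp add: card_image)
    qed
    moreover have "snd ` D = ?Y"
    proof (rule card_subset_eq[OF finXY(2)])
      show "snd ` D \<subseteq> ?Y" using mD unfolding is_matching_def by auto
      show "card (snd ` D) = card ?Y" using is_matching_inj(2)[OF mD] cD cE by (simp add: card_image)
    qed
    ultimately have "E = D" using directed_unique[OF fin mE mD _ _ dis ncE nc dirE dir] by simp
    then show ?case using D by simp
  qed
  then show "\<forall>\<^sub>F \<gamma> in at_left 1. minimal_on (power_cost \<gamma> a) R B M S"
    unfolding minimal_on_def using parts by simp
qed

end

section \<open>Stable and altruistic matchings\<close>

definition distinct_lengths :: "real set \<Rightarrow> real set \<Rightarrow> bool" where
  "distinct_lengths R B \<longleftrightarrow> (\<forall>x\<in>R. \<forall>y\<in>B. \<forall>x'\<in>R. \<forall>y'\<in>B. \<bar>x - y\<bar> = \<bar>x' - y'\<bar> \<longrightarrow> x = x' \<and> y = y')"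

lemma power_cost_neg_one: "\<gamma> < 0 \<Longrightarrow> power_cost \<gamma> 1 z = - (\<bar>z\<bar> powr \<gamma>)"
  unfolding power_cost_def by auto

section \<open>Stable matchings as the limit of very negative exponents\<close>

lemma powr_tendsto_at_bot:
  assumes "1 < (c::real)"
  shows "((\<lambda>\<gamma>. c powr \<gamma>) \<longlongrightarrow> 0) at_bot"
proof -
  have "filterlim (\<lambda>\<gamma>. ln c * \<gamma>) at_bot at_bot"
    using assms by (intro filterlim_tendsto_pos_mult_at_bot[OF tendsto_const _ filterlim_ident]) auto
  then have "((\<lambda>\<gamma>. exp (ln c * \<gamma>)) \<longlongrightarrow> 0) at_bot"
    by (rule filterlim_compose[OF exp_at_bot])
  then show ?thesis using assms by (simp add: powr_def mult.commute)
qed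

text \<open>Divided by the power of the smallest length, the sum consists of powers of numbers above
  1, which vanish as \<gamma> tends to minus infinity.\<close>

lemma shortest_dominates:
  assumes "finite D" "0 < (l::real)" "\<And>d. d \<in> D \<Longrightarrow> l < g d"
  shows "\<forall>\<^sub>F \<gamma> in at_bot. (\<Sum>d\<in>D. g d powr \<gamma>) < l powr \<gamma>"
proof -
  have "((\<lambda>\<gamma>. \<Sum>d\<in>D. (g d / l) powr \<gamma>) \<longlongrightarrow> (\<Sum>d\<in>D. 0)) at_bot"
    using assms by (intro tendsto_sum powr_tendsto_at_bot) auto
  then have "\<forall>\<^sub>F \<gamma> in at_bot. (\<Sum>d\<in>D. (g d / l) powr \<gamma>) < 1" by (rule order_tendstoD(2)) simp
  then show ?thesis
  proof (rule eventually_mono)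
    fix \<gamma> assume less: "(\<Sum>d\<in>D. (g d / l) powr \<gamma>) < 1"
    have "(\<Sum>d\<in>D. g d powr \<gamma>) = (\<Sum>d\<in>D. (g d / l) powr \<gamma> * l powr \<gamma>)"
    proof (rule sum.cong[OF refl])
      fix d assume "d \<in> D"
      then have "g d powr \<gamma> = (g d / l * l) powr \<gamma>" using assms by simp
      also have "\<dots> = (g d / l) powr \<gamma> * l powr \<gamma>"
        using assms(2) assms(3)[OF \<open>d \<in> D\<close>] by (intro powr_mult)
      finally show "g d powr \<gamma> = (g d / l) powr \<gamma> * l powr \<gamma>" .
    qed
    also have "\<dots> < 1 * l powr \<gamma>" unfolding sum_distrib_right[symmetric]
      using less assms(2) by (intro mult_strict_right_mono) auto
    finally show "(\<Sum>d\<in>D. g d powr \<gamma>) < l powr \<gamma>" by simp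
  qed
qed

text \<open>Common edges cancel. Of the others, the shortest one alone contributes more, with a
  minus sign, than all the remaining edges of \<open>E'\<close> together.\<close>

lemma cost_less_of_shortest:
  assumes fin: "finite E" "finite E'" and e: "(x, y) \<in> E - E'" "x \<noteq> y"
    and short: "\<And>x' y'. (x', y') \<in> E' - E \<Longrightarrow> \<bar>x - y\<bar> < \<bar>x' - y'\<bar>"
  shows "\<forall>\<^sub>F \<gamma> in at_bot. cost (power_cost \<gamma> 1) E < cost (power_cost \<gamma> 1) E'"
proof -
  let ?g = "\<lambda>(x, y). \<bar>x - y\<bar> :: real"
  have "\<forall>\<^sub>F \<gamma> in at_bot. (\<Sum>d\<in>E' - E. ?g d powr \<gamma>) < \<bar>x - y\<bar> powr \<gamma>"
    by (rule shortest_dominates) (use fin e short in auto)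
  moreover have "\<forall>\<^sub>F \<gamma> in at_bot. (\<gamma>::real) < 0" by (rule eventually_at_bot_dense[THEN iffD2]) auto
  ultimately show ?thesis
  proof eventually_elim
    case (elim \<gamma>)
    have c: "cost (power_cost \<gamma> 1) D = - (\<Sum>d\<in>D. ?g d powr \<gamma>)" for D
      unfolding cost_def using power_cost_neg_one[OF elim(2)]
      by (simp add: sum_negf[symmetric] case_prod_unfold abs_minus_commute)
    have "\<bar>x - y\<bar> powr \<gamma> \<le> (\<Sum>d\<in>E - E'. ?g d powr \<gamma>)"
      using member_le_sum[of "(x, y)" "E - E'" "\<lambda>d. ?g d powr \<gamma>"] e fin by simp
    moreover have "(\<Sum>d\<in>E. ?g d powr \<gamma>) = (\<Sum>d\<in>E - E'. ?g d powr \<gamma>) + (\<Sum>d\<in>E \<inter> E'. ?g d powr \<gamma>)"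
      using fin by (subst sum.Int_Diff[of E _ E']) auto
    moreover have "(\<Sum>d\<in>E'. ?g d powr \<gamma>) = (\<Sum>d\<in>E' - E. ?g d powr \<gamma>) + (\<Sum>d\<in>E \<inter> E'. ?g d powr \<gamma>)"
      using fin by (subst sum.Int_Diff[of E' _ E]) (auto simp: Int_commute)
    ultimately show ?case unfolding c using elim(1) by linarith
  qed
qed

text \<open>Distinct lengths make the shortest edge of the symmetric difference unique; the matching
  that owns it is the winner.\<close>

lemma shortest_of_difference:
  assumes dl: "distinct_lengths R B" and fin: "finite E" "finite E'" and sub: "E \<subseteq> R \<times> B" "E' \<subseteq> R \<times> B" and ne: "E \<noteq> E'"
  shows "(\<exists>(x, y)\<in>E - E'. \<forall>(x', y')\<in>E' - E. \<bar>x - y\<bar> < \<bar>x' - y'\<bar>) \<or>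
    (\<exists>(x, y)\<in>E' - E. \<forall>(x', y')\<in>(E - E'). \<bar>x - y\<bar> < \<bar>x' - y'\<bar>)"
proof -
  let ?D = "(E - E') \<union> (E' - E)"
  have D: "finite ?D" "?D \<noteq> {}" using fin ne by auto
  obtain e where e: "e \<in> ?D" "\<And>e'. e' \<in> ?D \<Longrightarrow> \<bar>fst e - snd e\<bar> \<le> \<bar>fst e' - snd e'\<bar>"
    using arg_min_if_finite(1)[OF D] arg_min_least[OF D, of _ "\<lambda>e. \<bar>fst e - snd e\<bar>"] by blast
  have strict: "\<bar>fst e - snd e\<bar> < \<bar>fst e' - snd e'\<bar>" if e': "e' \<in> ?D" "e' \<noteq> e" for e'
  proof -
    have "e \<in> R \<times> B" "e' \<in> R \<times> B" using e(1) e'(1) sub by auto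
    then have "\<bar>fst e - snd e\<bar> \<noteq> \<bar>fst e' - snd e'\<bar>"
      using dl e'(2) unfolding distinct_lengths_def by (metis mem_Times_iff prod_eqI)
    then show ?thesis using e(2)[OF e'(1)] by simp
  qed
  show ?thesis
  proof (cases "e \<in> E - E'")
    case True
    then have "\<bar>fst e - snd e\<bar> < \<bar>fst e' - snd e'\<bar>" if "e' \<in> E' - E" for e' using strict[of e'] that by auto
    then show ?thesis using True by (intro disjI1 bexI[of _ e]) auto
  next
    case False
    then have "e \<in> E' - E" using e(1) by blast
    then have "\<bar>fst e - snd e\<bar> < \<bar>fst e' - snd e'\<bar>" if "e' \<in> E - E'" for e' using strict[of e'] that by auto
    then show ?thesis using \<open>e \<in> E' - E\<close> by (intro disjI2 bexI[of _ e]) auto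
  qed
qed

lemma distinct_lengths_strict:
  assumes dl: "distinct_lengths R B" and dis: "R \<inter> B = {}" and fin: "finite E" "finite E'"
    and m: "is_matching R B E" "is_matching R B E'" and ne: "E \<noteq> E'"
  shows "(\<forall>\<^sub>F \<gamma> in at_bot. cost (power_cost \<gamma> 1) E < cost (power_cost \<gamma> 1) E') \<or>
     (\<forall>\<^sub>F \<gamma> in at_bot. cost (power_cost \<gamma> 1) E' < cost (power_cost \<gamma> 1) E)"
proof -
  have sub: "E \<subseteq> R \<times> B" "E' \<subseteq> R \<times> B" using m unfolding is_matching_def by auto
  have neq: "x \<noteq> y" if "(x, y) \<in> E \<union> E'" for x y using that sub dis by blast
  from shortest_of_difference[OF dl fin sub ne] show ?thesis
  proof
    assume "\<exists>(x, y)\<in>E - E'. \<forall>(x', y')\<in>E' - E. \<bar>x - y\<bar> < \<bar>x' - y'\<bar>"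
    then obtain x y where "(x, y) \<in> E - E'" "\<And>x' y'. (x', y') \<in> E' - E \<Longrightarrow> \<bar>x - y\<bar> < \<bar>x' - y'\<bar>" by blast
    then show ?thesis using cost_less_of_shortest[OF fin, of x y] neq[of x y] by blast
  next
    assume "\<exists>(x, y)\<in>E' - E. \<forall>(x', y')\<in>E - E'. \<bar>x - y\<bar> < \<bar>x' - y'\<bar>"
    then obtain x y where "(x, y) \<in> E' - E" "\<And>x' y'. (x', y') \<in> E - E' \<Longrightarrow> \<bar>x - y\<bar> < \<bar>x' - y'\<bar>" by blast
    then show ?thesis using cost_less_of_shortest[OF fin(2,1), of x y] neq[of x y] by blast
  qed
qed

lemma distinct_lengths_separated:
  assumes dl: "distinct_lengths R B" and dis: "R \<inter> B = {}"
  shows "separated at_bot 1 R B" "comparable at_bot 1 R B"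
proof -
  show "separated at_bot 1 R B"
    unfolding separated_def
  proof (intro allI impI)
    fix E E' assume a: "finite E" "is_matching R B E" "is_matching R B E'" "fst ` E = fst ` E'" "snd ` E = snd ` E'" "E \<noteq> E'"
    have "finite (fst ` E')" using a(1,4) by (metis finite_imageI)
    then have "finite E'" using is_matching_inj(1)[OF a(3)] finite_imageD by blast
    then show "(\<forall>\<^sub>F \<gamma> in at_bot. cost (power_cost \<gamma> 1) E < cost (power_cost \<gamma> 1) E') \<or>
     (\<forall>\<^sub>F \<gamma> in at_bot. cost (power_cost \<gamma> 1) E' < cost (power_cost \<gamma> 1) E)"
      using distinct_lengths_strict[OF dl dis a(1) _ a(2,3,6)] by blast
  qed
  show "comparable at_bot 1 R B"
    unfolding comparable_def
  proof (intro allI impI)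
    fix E E' assume a: "finite E" "finite E'" "is_matching R B E" "is_matching R B E'"
    show "(\<forall>\<^sub>F \<gamma> in at_bot. cost (power_cost \<gamma> 1) E \<le> cost (power_cost \<gamma> 1) E') \<or>
     (\<forall>\<^sub>F \<gamma> in at_bot. cost (power_cost \<gamma> 1) E' \<le> cost (power_cost \<gamma> 1) E)"
    proof (cases "E = E'")
      case False
      from distinct_lengths_strict[OF dl dis a False] show ?thesis
      proof
        assume "\<forall>\<^sub>F \<gamma> in at_bot. cost (power_cost \<gamma> 1) E < cost (power_cost \<gamma> 1) E'"
        then show ?thesis by (intro disjI1) (auto elim!: eventually_mono)
      next
        assume "\<forall>\<^sub>F \<gamma> in at_bot. cost (power_cost \<gamma> 1) E' < cost (power_cost \<gamma> 1) E"
        then show ?thesis by (intro disjI2) (auto elim!: eventually_mono)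
      qed
    qed simp
  qed
qed

lemma red_dist_eq: "is_matching R B M \<Longrightarrow> (x, y) \<in> M \<Longrightarrow> red_dist M x = ereal \<bar>x - y\<bar>"
proof -
  assume M: "is_matching R B M" and e: "(x, y) \<in> M"
  then have "(THE y. (x, y) \<in> M) = y" using is_matching_unique(1)[OF M] by blast
  then show ?thesis using e unfolding red_dist_def by force
qed

lemma blue_dist_eq: "is_matching R B M \<Longrightarrow> (x, y) \<in> M \<Longrightarrow> blue_dist M y = ereal \<bar>x - y\<bar>"
proof -
  assume M: "is_matching R B M" and e: "(x, y) \<in> M"
  then have "(THE x. (x, y) \<in> M) = x" using is_matching_unique(2)[OF M] by blast
  then show ?thesis using e unfolding blue_dist_def by (force simp: abs_minus_commute)
qed

text \<open>Were the shortest edge of the difference owned by the competitor \<open>D\<close>,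
  stability would give one of its endpoints an edge of \<open>M\<close> that is at most as long;
  that edge lies in \<open>E\<close> but not in \<open>D\<close>, a contradiction. So
  \<open>E\<close> owns it and wins for very negative exponents.\<close>

lemma stable_imp_eventually_minimal:
  assumes st: "stable R B M" and dl: "distinct_lengths R B" and dis: "R \<inter> B = {}"
  shows "eventually_minimal at_bot 1 R B M"
  unfolding eventually_minimal_def
proof (intro conjI allI impI)
  show M: "is_matching R B M" using st unfolding stable_def by auto
  have st: "red_dist M x \<le> ereal \<bar>x - y\<bar> \<or> blue_dist M y \<le> ereal \<bar>x - y\<bar>" if "x \<in> R" "y \<in> B" for x y
    using st that unfolding stable_def by (auto simp: min_le_iff_disj)
  fix S assume "admissible R B M S"
  then obtain E U where E: "finite S" "E \<subseteq> M" "U \<subseteq> unmatched R B M" "S = fst ` E \<union> snd ` E \<union> U"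
    unfolding admissible_def by blast
  note parts = admissible_parts[OF M dis E(2,3,4)]
  have "E \<subseteq> S \<times> S"
  proof
    fix e assume "e \<in> E"
    then have "fst e \<in> S" "snd e \<in> S" unfolding E(4) by auto
    then show "e \<in> S \<times> S" by (cases e) simp
  qed
  then have fin: "finite E" by (rule finite_subset) (simp add: E(1))
  have finU: "finite U" using E(1,4) by simp
  have s: "fst ` E \<subseteq> R" "snd ` E \<subseteq> B" using E M unfolding is_matching_def by auto
  let ?X = "fst ` E \<union> U \<inter> R" and ?Y = "snd ` E \<union> U \<inter> B"
  have finXY: "finite ?X" "finite ?Y" using fin finU by auto
  have disXY: "?X \<inter> ?Y = {}" using s dis by auto
  have um: "u \<notin> fst ` M" "u \<notin> snd ` M" if "u \<in> U" for u
  proof -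
    have "fst ` M \<subseteq> R" "snd ` M \<subseteq> B" using M unfolding is_matching_def by auto
    then show "u \<notin> fst ` M" "u \<notin> snd ` M" using E(3) that dis unfolding unmatched_def by blast+
  qed
  \<comment> \<open>A red and a blue unmatched point would both have infinite distance and so block
    each other.\<close>
  have "U \<inter> R = {} \<or> U \<inter> B = {}"
  proof (rule ccontr)
    assume "\<not> ?thesis"
    then obtain u v where uv: "u \<in> U" "u \<in> R" "v \<in> U" "v \<in> B" by blast
    then have "red_dist M u = \<infinity>" "blue_dist M v = \<infinity>" using um unfolding red_dist_def blue_dist_def by auto
    then show False using st[OF uv(2,4)] by simp
  qed
  have mE: "is_matching ?X ?Y E" by (rule is_matching_subset[OF M E(2)]) auto
  have d: "fst ` E \<inter> (U \<inter> R) = {}" "snd ` E \<inter> (U \<inter> B) = {}" using um E(2) by blast+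
  have "card ?X = card E + card (U \<inter> R)" "card ?Y = card E + card (U \<inter> B)"
    using d fin finU is_matching_inj[OF mE] by (simp_all add: card_Un_disjoint card_image)
  then have cE: "card E = min (card ?X) (card ?Y)" using \<open>U \<inter> R = {} \<or> U \<inter> B = {}\<close> by auto
  have sub: "?X \<subseteq> R" "?Y \<subseteq> B" using s by auto
  have less: "\<forall>\<^sub>F \<gamma> in at_bot. cost (power_cost \<gamma> 1) E \<le> cost (power_cost \<gamma> 1) D" if D: "is_matching ?X ?Y D" for D
  proof (cases "D = E")
    case False
    have finD: "finite D" using finite_matching[OF D finXY] .
    have subRB: "E \<subseteq> R \<times> B" "D \<subseteq> R \<times> B" using mE D sub unfolding is_matching_def by blast+
    have "\<not> (\<exists>(x, y)\<in>D - E. \<forall>(x', y')\<in>E - D. \<bar>x - y\<bar> < \<bar>x' - y'\<bar>)"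
    proof
      assume "\<exists>(x, y)\<in>D - E. \<forall>(x', y')\<in>E - D. \<bar>x - y\<bar> < \<bar>x' - y'\<bar>"
      then obtain x y where xy: "(x, y) \<in> D" "(x, y) \<notin> E" "\<And>x' y'. (x', y') \<in> E - D \<Longrightarrow> \<bar>x - y\<bar> < \<bar>x' - y'\<bar>" by blast
      have x: "x \<in> ?X" "y \<in> ?Y" using is_matching_unique(3,4)[OF D xy(1)] .
      consider "red_dist M x \<le> ereal \<bar>x - y\<bar>" | "blue_dist M y \<le> ereal \<bar>x - y\<bar>" using st[of x y] x sub by blast
      then show False
      proof cases
        case 1
        then have "x \<in> fst ` M" unfolding red_dist_def by (auto split: if_splits)
        then have "x \<in> fst ` E" using x(1) um by blast
        then obtain z where z: "(x, z) \<in> E" by auto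
        then have "\<bar>x - z\<bar> \<le> \<bar>x - y\<bar>" using 1 red_dist_eq[OF M, of x z] E(2) by auto
        moreover have "(x, z) \<notin> D" using is_matching_unique(1)[OF D xy(1)] z xy(2) by blast
        ultimately show False using xy(3)[of x z] z by simp
      next
        case 2
        then have "y \<in> snd ` M" unfolding blue_dist_def by (auto split: if_splits)
        then have "y \<in> snd ` E" using x(2) um by blast
        then obtain z where z: "(z, y) \<in> E" by auto
        then have "\<bar>z - y\<bar> \<le> \<bar>x - y\<bar>" using 2 blue_dist_eq[OF M, of z y] E(2) by auto
        moreover have "(z, y) \<notin> D" using is_matching_unique(2)[OF D xy(1)] z xy(2) by blast
        ultimately show False using xy(3)[of z y] z by simp
      qed
    qed
    then have "\<exists>(x, y)\<in>E - D. \<forall>(x', y')\<in>D - E. \<bar>x - y\<bar> < \<bar>x' - y'\<bar>"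
      using shortest_of_difference[OF dl fin finD subRB] False by blast
    then obtain x y where xy: "(x, y) \<in> E - D" "\<And>x' y'. (x', y') \<in> D - E \<Longrightarrow> \<bar>x - y\<bar> < \<bar>x' - y'\<bar>" by blast
    have "x \<noteq> y" using xy(1) subRB dis by blast
    from cost_less_of_shortest[OF fin finD xy(1) this xy(2)] show ?thesis
      by (auto elim!: eventually_mono)
  qed simp
  have "\<forall>\<^sub>F \<gamma> in at_bot. \<forall>D\<in>{D. is_matching ?X ?Y D}. cost (power_cost \<gamma> 1) E \<le> cost (power_cost \<gamma> 1) D"
    using finite_matchings[OF finXY] less by (subst eventually_ball_finite_distrib) auto
  then show "\<forall>\<^sub>F \<gamma> in at_bot. minimal_on (power_cost \<gamma> 1) R B M S"
    unfolding minimal_on_def parts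
    by (rule eventually_mono) (use mE cE in \<open>auto simp: minimal_finite_iff[OF finXY disXY]\<close>)
qed

text \<open>A blocking pair permits an exchange creating an edge shorter than all those it destroys,
  and for very negative exponents the shortest edge decides.\<close>

lemma eventually_minimal_imp_stable:
  assumes em: "eventually_minimal at_bot 1 R B M" and dis: "R \<inter> B = {}"
  shows "stable R B M"
  unfolding stable_def
proof (intro conjI ballI)
  show M: "is_matching R B M" using em unfolding eventually_minimal_def by auto
  have neg: "\<forall>\<^sub>F \<gamma> in at_bot. (\<gamma>::real) < 0" by (rule eventually_at_bot_dense[THEN iffD2]) auto
  note wm = eventually_minimal_weakly[OF em neg trivial_limit_at_bot_linorder]
  fix x y assume x: "x \<in> R" and y: "y \<in> B"
  have xy: "0 < \<bar>x - y\<bar>" using x y dis by auto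
  show "min (red_dist M x) (blue_dist M y) \<le> ereal \<bar>x - y\<bar>"
  proof (rule ccontr)
    assume "\<not> ?thesis"
    then have n: "ereal \<bar>x - y\<bar> < red_dist M x" "ereal \<bar>x - y\<bar> < blue_dist M y" by (auto simp: not_le)
    have lx: "\<bar>x - y\<bar> < \<bar>x - z\<bar>" if "(x, z) \<in> M" for z using n(1) red_dist_eq[OF M that] by simp
    have ly: "\<bar>x - y\<bar> < \<bar>w - y\<bar>" if "(w, y) \<in> M" for w using n(2) blue_dist_eq[OF M that] by simp
    have less: "power_cost \<gamma> 1 u < power_cost \<gamma> 1 v" if "\<gamma> < 0" "0 < \<bar>u\<bar>" "\<bar>u\<bar> < \<bar>v\<bar>" for \<gamma> u v
      unfolding power_cost_neg_one[OF that(1)] using powr_less_mono2_neg[OF that(1), of "\<bar>u\<bar>" "\<bar>v\<bar>"] that by simp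
    have "x \<in> fst ` M \<Longrightarrow> \<exists>z. (x, z) \<in> M" "y \<in> snd ` M \<Longrightarrow> \<exists>w. (w, y) \<in> M" by auto
    then consider (none) "x \<notin> fst ` M" "y \<notin> snd ` M" | (red) w where "x \<notin> fst ` M" "(w, y) \<in> M"
      | (blue) z where "(x, z) \<in> M" "y \<notin> snd ` M" | (both) z w where "(x, z) \<in> M" "(w, y) \<in> M" by blast
    then show False
    proof cases
      case none
      then show False using weakly_minimal_one_colour[OF wm dis] x y by blast
    next
      case red
      obtain \<gamma> where "\<gamma> < 0" "power_cost \<gamma> 1 (y - w) \<le> power_cost \<gamma> 1 (y - x)"
        using weakly_minimal_red[OF wm dis _ red(2), of x] red(1) x by blast
      then show False using less[of \<gamma> "y - x" "y - w"] ly[OF red(2)] xy by (simp add: abs_minus_commute)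
    next
      case blue
      obtain \<gamma> where "\<gamma> < 0" "power_cost \<gamma> 1 (z - x) \<le> power_cost \<gamma> 1 (y - x)"
        using weakly_minimal_blue[OF wm dis _ blue(1), of y] blue(2) y by blast
      then show False using less[of \<gamma> "y - x" "z - x"] lx[OF blue(1)] xy by (simp add: abs_minus_commute)
    next
      case both
      have "x \<noteq> w" using lx[of y] both by blast
      note sw = eventually_swap[OF em dis both this]
      have "\<forall>\<^sub>F \<gamma> in at_bot. (\<Sum>d\<in>{(x, z), (w, y)}. (\<lambda>(x, y). \<bar>x - y\<bar>) d powr \<gamma>) < \<bar>x - y\<bar> powr \<gamma>"
        by (rule shortest_dominates) (use xy lx ly both in auto)
      then have dom: "\<forall>\<^sub>F \<gamma> in at_bot. \<bar>x - z\<bar> powr \<gamma> + \<bar>w - y\<bar> powr \<gamma> < \<bar>x - y\<bar> powr \<gamma>"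
        using \<open>x \<noteq> w\<close> by simp
      have "\<forall>\<^sub>F \<gamma> in (at_bot :: real filter). False"
        using sw dom neg
      proof eventually_elim
        case (elim \<gamma>)
        have "- (\<bar>z - x\<bar> powr \<gamma>) + - (\<bar>y - w\<bar> powr \<gamma>) \<le> - (\<bar>y - x\<bar> powr \<gamma>) + - (\<bar>z - w\<bar> powr \<gamma>)"
          using elim(1) unfolding power_cost_neg_one[OF elim(3)] by simp
        then have "- (\<bar>x - z\<bar> powr \<gamma>) - \<bar>w - y\<bar> powr \<gamma> \<le> - (\<bar>x - y\<bar> powr \<gamma>) - \<bar>z - w\<bar> powr \<gamma>"
          by (simp add: abs_minus_commute)
        moreover have "0 \<le> \<bar>z - w\<bar> powr \<gamma>" by simp
        ultimately show ?case using elim(2) by linarith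
      qed
      then show False by (simp add: trivial_limit_at_bot_linorder)
    qed
  qed
qed

section \<open>Altruistic matchings as the limit of large exponents\<close>

lemma power_cost_one_pos: "0 < \<gamma> \<Longrightarrow> power_cost \<gamma> 1 z = \<bar>z\<bar> powr \<gamma>"
  unfolding power_cost_def by auto

lemma cost_descending_lengths:
  assumes "finite E" "0 < \<gamma>"
  shows "cost (power_cost \<gamma> 1) E = sum_list (map (\<lambda>l. l powr \<gamma>) (descending_lengths E))"
proof -
  let ?X = "image_mset (\<lambda>(x, y). \<bar>x - y\<bar>) (mset_set E)"
  have "sum_list (map (\<lambda>l. l powr \<gamma>) (descending_lengths E)) = sum_mset (image_mset (\<lambda>l. l powr \<gamma>) (mset (descending_lengths E)))"
    by (simp add: sum_mset_sum_list flip: mset_map)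
  also have "mset (descending_lengths E) = ?X" unfolding descending_lengths_def by simp
  also have "sum_mset (image_mset (\<lambda>l. l powr \<gamma>) ?X) = (\<Sum>e\<in>E. (\<lambda>(x, y). \<bar>x - y\<bar>) e powr \<gamma>)"
    by (simp add: sum_unfold_sum_mset image_mset.compositionality comp_def)
  also have "\<dots> = cost (power_cost \<gamma> 1) E"
    unfolding cost_def using assms(2) by (intro sum.cong) (auto simp: power_cost_one_pos abs_minus_commute)
  finally show ?thesis by simp
qed

lemma descending_lengths_props:
  assumes "finite E"
  shows "length (descending_lengths E) = card E" "sorted_wrt (\<ge>) (descending_lengths E)"
    "l \<in> set (descending_lengths E) \<Longrightarrow> 0 \<le> l"
proof -
  have "length (descending_lengths E) = size (mset (sorted_list_of_multiset (image_mset (\<lambda>(x, y). \<bar>x - y\<bar>) (mset_set E))))"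
    unfolding descending_lengths_def by (simp only: size_mset length_rev)
  then show "length (descending_lengths E) = card E" by simp
  show "sorted_wrt (\<ge>) (descending_lengths E)" unfolding descending_lengths_def by (simp add: sorted_wrt_rev)
  show "l \<in> set (descending_lengths E) \<Longrightarrow> 0 \<le> l"
    unfolding descending_lengths_def using assms by (auto split: prod.splits)
qed

lemma eventually_powr_dominates:
  assumes "0 \<le> a" "a < (b::real)" "0 \<le> n"
  shows "\<forall>\<^sub>F \<gamma> in at_top. n * a powr \<gamma> < b powr \<gamma>"
proof (cases "a = 0")
  case True
  then show ?thesis using assms by simp
next
  case False
  then have ab: "0 < a" "1 < b / a" using assms by auto
  have "filterlim (\<lambda>\<gamma>. ln (b / a) * \<gamma>) at_top at_top"
    using ab by (intro filterlim_tendsto_pos_mult_at_top[OF tendsto_const _ filterlim_ident]) auto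
  then have "filterlim (\<lambda>\<gamma>. exp (ln (b / a) * \<gamma>)) at_top at_top" by (rule filterlim_compose[OF exp_at_top])
  then have "\<forall>\<^sub>F \<gamma> in at_top. n < exp (ln (b / a) * \<gamma>)" unfolding filterlim_at_top_dense by blast
  then show ?thesis
  proof (rule eventually_mono)
    fix \<gamma> assume "n < exp (ln (b / a) * \<gamma>)"
    then have "n < (b / a) powr \<gamma>" using ab by (simp add: powr_def mult.commute)
    then have "n * a powr \<gamma> < (b / a) powr \<gamma> * a powr \<gamma>" using ab by (intro mult_strict_right_mono) auto
    also have "\<dots> = (b / a * a) powr \<gamma>" using ab by (simp only: powr_mult)
    finally show "n * a powr \<gamma> < b powr \<gamma>" using ab by simp
  qed
qed

text \<open>At the first difference the entry \<open>a\<close> of \<open>xs\<close> is below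
  \<open>b\<close>, and all later entries of the sorted list are at most \<open>a\<close>. For large
  \<gamma> the power of \<open>b\<close> exceeds that of \<open>a\<close> times the number of these
  entries.\<close>

lemma lexord_imp_sum_less:
  assumes lex: "(xs, ys) \<in> lexord {(u, v). u < (v::real)}" and len: "length xs = length ys"
    and sorted: "sorted_wrt (\<ge>) xs" and nonneg: "\<And>l. l \<in> set xs \<Longrightarrow> 0 \<le> l"
  shows "\<forall>\<^sub>F \<gamma> in at_top. sum_list (map (\<lambda>l. l powr \<gamma>) xs) < sum_list (map (\<lambda>l. l powr \<gamma>) ys)"
proof -
  obtain u a b v w where uv: "a < b" "xs = u @ a # v" "ys = u @ b # w"
    using lex len unfolding lexord_def by auto
  have v: "0 \<le> l \<and> l \<le> a" if "l \<in> set v" for l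
    using sorted nonneg[of l] that unfolding uv(2) by (auto simp: sorted_wrt_append)
  have a: "0 \<le> a" using nonneg[of a] uv(2) by simp
  have "\<forall>\<^sub>F \<gamma> in at_top. real (Suc (length v)) * a powr \<gamma> < b powr \<gamma>"
    using eventually_powr_dominates[OF a uv(1)] by simp
  moreover have "\<forall>\<^sub>F \<gamma> in at_top. (0::real) < \<gamma>" by (rule eventually_gt_at_top)
  ultimately show ?thesis
  proof eventually_elim
    case (elim \<gamma>)
    have "sum_list (map (\<lambda>l. l powr \<gamma>) v) \<le> sum_list (map (\<lambda>_. a powr \<gamma>) v)"
      using v elim(2) by (intro sum_list_mono powr_mono2) auto
    also have "\<dots> = real (length v) * a powr \<gamma>" by (simp add: sum_list_triv)
    finally have "a powr \<gamma> + sum_list (map (\<lambda>l. l powr \<gamma>) v) < b powr \<gamma>"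
      using elim(1) by (simp add: algebra_simps)
    moreover have "0 \<le> sum_list (map (\<lambda>l. l powr \<gamma>) w)" by (intro sum_list_nonneg) auto
    ultimately show ?case unfolding uv by simp
  qed
qed

text \<open>Equal lists have equal cost for every positive exponent and different ones are ordered
  strictly in the long run, so coinciding edge lengths do no harm.\<close>

lemma lex_le_iff_eventually:
  assumes fin: "finite E" "finite E'" and card: "card E = card E'"
  shows "lex_le (descending_lengths E) (descending_lengths E') \<longleftrightarrow>
    (\<forall>\<^sub>F \<gamma> in at_top. cost (power_cost \<gamma> 1) E \<le> cost (power_cost \<gamma> 1) E')"
proof -
  let ?r = "{(u, v). u < (v::real)}"
  note p = descending_lengths_props
  have pos: "\<forall>\<^sub>F \<gamma> in at_top. (0::real) < \<gamma>" by (rule eventually_gt_at_top)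
  have less: "\<forall>\<^sub>F \<gamma> in at_top. cost (power_cost \<gamma> 1) A < cost (power_cost \<gamma> 1) A'"
    if "(descending_lengths A, descending_lengths A') \<in> lexord ?r" "finite A" "finite A'" "card A = card A'" for A A'
  proof -
    have "\<forall>\<^sub>F \<gamma> in at_top. sum_list (map (\<lambda>l. l powr \<gamma>) (descending_lengths A)) < sum_list (map (\<lambda>l. l powr \<gamma>) (descending_lengths A'))"
      using that p(1)[of A] p(1)[of A'] p(2,3)[of A] by (intro lexord_imp_sum_less) auto
    then show ?thesis using pos by eventually_elim (simp add: cost_descending_lengths that)
  qed
  show ?thesis
  proof
    assume "lex_le (descending_lengths E) (descending_lengths E')"
    then consider "descending_lengths E = descending_lengths E'" | "(descending_lengths E, descending_lengths E') \<in> lexord ?r"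
      unfolding lex_le_def by blast
    then show "\<forall>\<^sub>F \<gamma> in at_top. cost (power_cost \<gamma> 1) E \<le> cost (power_cost \<gamma> 1) E'"
    proof cases
      case 1
      show ?thesis using pos by (rule eventually_mono) (simp add: cost_descending_lengths fin 1)
    next
      case 2
      show ?thesis using less[OF 2 fin card] by (rule eventually_mono) simp
    qed
  next
    assume ev: "\<forall>\<^sub>F \<gamma> in at_top. cost (power_cost \<gamma> 1) E \<le> cost (power_cost \<gamma> 1) E'"
    show "lex_le (descending_lengths E) (descending_lengths E')"
    proof (rule ccontr)
      assume n: "\<not> ?thesis"
      have "(descending_lengths E, descending_lengths E') \<in> lexord ?r \<or> descending_lengths E = descending_lengths E' \<or>
        (descending_lengths E', descending_lengths E) \<in> lexord ?r" by (rule lexord_linear) auto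
      then have "(descending_lengths E', descending_lengths E) \<in> lexord ?r" using n unfolding lex_le_def by blast
      from less[OF this fin(2,1) card[symmetric]] ev
      have "\<forall>\<^sub>F \<gamma> in (at_top :: real filter). False" by eventually_elim simp
      then show False by simp
    qed
  qed
qed

text \<open>An admissible set has finitely many competitors, so quantifying over them commutes with
  passing to large exponents.\<close>

lemma altruistic_iff:
  assumes dis: "R \<inter> B = {}"
  shows "altruistic R B M \<longleftrightarrow> eventually_minimal at_top 1 R B M"
proof -
  have "(fewest_unmatched (R \<inter> S) (B \<inter> S) (restrict_matching M S) \<and>
        (\<forall>M'. fewest_unmatched (R \<inter> S) (B \<inter> S) M' \<longrightarrow>
           lex_le (descending_lengths (restrict_matching M S)) (descending_lengths M'))) \<longleftrightarrow>
      (\<forall>\<^sub>F \<gamma> in at_top. minimal_on (power_cost \<gamma> 1) R B M S)" if S: "admissible R B M S" for S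
  proof -
    let ?X = "R \<inter> S" and ?Y = "B \<inter> S" and ?E = "restrict_matching M S"
    have fin: "finite ?X" "finite ?Y" "?X \<inter> ?Y = {}" using S dis unfolding admissible_def by auto
    note few = fewest_unmatched_iff[OF fin]
    have finF: "finite {M'. fewest_unmatched ?X ?Y M'}"
      using finite_matchings[OF fin(1,2)] by (rule rev_finite_subset) (auto simp: few)
    have fm: "finite D" if "fewest_unmatched ?X ?Y D" for D using that finite_matching[OF _ fin(1,2)] few by blast
    have "(\<forall>\<^sub>F \<gamma> in at_top. minimal_on (power_cost \<gamma> 1) R B M S) \<longleftrightarrow> fewest_unmatched ?X ?Y ?E \<and>
      (\<forall>\<^sub>F \<gamma> in at_top. \<forall>D\<in>{D. fewest_unmatched ?X ?Y D}. cost (power_cost \<gamma> 1) ?E \<le> cost (power_cost \<gamma> 1) D)"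
      unfolding minimal_on_def minimal_finite_def by (simp add: eventually_conj_iff)
    also have "\<dots> \<longleftrightarrow> fewest_unmatched ?X ?Y ?E \<and>
      (\<forall>D\<in>{D. fewest_unmatched ?X ?Y D}. \<forall>\<^sub>F \<gamma> in at_top. cost (power_cost \<gamma> 1) ?E \<le> cost (power_cost \<gamma> 1) D)"
      using finF by (subst eventually_ball_finite_distrib) auto
    also have "\<dots> \<longleftrightarrow> fewest_unmatched ?X ?Y ?E \<and>
      (\<forall>D\<in>{D. fewest_unmatched ?X ?Y D}. lex_le (descending_lengths ?E) (descending_lengths D))"
      using lex_le_iff_eventually[OF fm fm] few by (intro conj_cong refl ball_cong) auto
    finally show ?thesis by blast
  qed
  then show ?thesis unfolding altruistic_def eventually_minimal_def by blast
qed

section \<open>Convex costs\<close>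

text \<open>The second clause is strict convexity on the whole line. Arguments of both signs occur
  in it, so edges of opposite directions are compared as well.\<close>

definition convex_cost :: "(real \<Rightarrow> real) \<Rightarrow> bool" where
  "convex_cost f \<longleftrightarrow> (\<forall>u v. 0 < u \<longrightarrow> u < v \<longrightarrow> f u < f v \<and> f (- u) < f (- v)) \<and>
     (\<forall>u d e. 0 < d \<longrightarrow> 0 < e \<longrightarrow> f (u + d) + f (u + e) < f u + f (u + d + e))"

text \<open>In the application \<alpha> is the slope at \<open>D\<close>: up to \<open>D\<close> the
  cost rises at most that fast, and before \<open>- D\<close> it falls at least \<open>c\<close>
  times as fast. Measuring both against the same \<alpha> makes \<open>c\<close> independent of the
  scale \<open>D\<close>.\<close>

definition steep :: "real \<Rightarrow> (real \<Rightarrow> real) \<Rightarrow> bool" where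
  "steep c f \<longleftrightarrow> (\<forall>D>0. \<exists>\<alpha>>0. (\<forall>q p. q \<le> p \<longrightarrow> p \<le> D \<longrightarrow> f p - f q \<le> \<alpha> * (p - q)) \<and>
     (\<forall>q p. q \<le> p \<longrightarrow> p \<le> - D \<longrightarrow> c * \<alpha> * (p - q) \<le> f q - f p))"

definition monotone_matching :: "matching \<Rightarrow> bool" where
  "monotone_matching M \<longleftrightarrow> (\<forall>x y x' y'. (x, y) \<in> M \<longrightarrow> (x', y') \<in> M \<longrightarrow> x < x' \<longrightarrow> y < y')"

text \<open>The bounds by \<open>D\<close> limit the damage on the initial stretch. From
  \<open>T\<close> on, red points lag and blue points lead by \<open>5 * D\<close>, for a time that
  exceeds \<open>T\<close> by any prescribed factor.\<close>

definition surge :: "real set \<Rightarrow> real set \<Rightarrow> bool" where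
  "surge R B \<longleftrightarrow> (\<forall>(K::real) (N::nat). \<exists>(T::real) (D::real) (G::real). real N \<le> T \<and> real N \<le> D \<and> D \<le> T \<and> K * T \<le> G \<and>
     (\<forall>x. 0 \<le> x \<and> x \<le> T + G \<longrightarrow> real (card (R \<inter> {0<..x})) \<le> x + D \<and> x - D \<le> real (card (B \<inter> {0<..x}))) \<and>
     (\<forall>x. T \<le> x \<and> x \<le> T + G \<longrightarrow> real (card (R \<inter> {0<..x})) \<le> x - 5 * D \<and> x + 5 * D \<le> real (card (B \<inter> {0<..x}))))"

text \<open>The two branches meet at 0 with slope 0 because \<gamma> > 1, in agreement with the
  value \<open>0\<close> of \<open>0 powr (\<gamma> - 1)\<close>.\<close>

lemma power_cost_deriv_above_one:
  assumes \<gamma>: "1 < \<gamma>"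
  shows "(power_cost \<gamma> a has_real_derivative (if z < 0 then - (a * \<gamma> * (- z) powr (\<gamma> - 1)) else \<gamma> * z powr (\<gamma> - 1))) (at z)"
proof -
  have f: "power_cost \<gamma> a = (\<lambda>z. if z < 0 then a * \<bar>z\<bar> powr \<gamma> else z powr \<gamma>)"
    using \<gamma> unfolding power_cost_def by auto
  consider "z < 0" | "z = 0" | "0 < z" by linarith
  then show ?thesis
  proof cases
    case 1
    have "((\<lambda>z. a * (- z) powr \<gamma>) has_real_derivative - (a * \<gamma> * (- z) powr (\<gamma> - 1))) (at z)"
      using 1 by (auto intro!: derivative_eq_intros)
    moreover have "\<forall>\<^sub>F x in nhds z. a * (- x) powr \<gamma> = power_cost \<gamma> a x"
      using eventually_nhds_in_open[of "{..<0}" z] 1 by (auto simp: f elim!: eventually_mono)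
    ultimately show ?thesis using 1 by (subst DERIV_cong_ev[OF refl _ refl, symmetric]) auto
  next
    case 3
    have "((\<lambda>z. z powr \<gamma>) has_real_derivative \<gamma> * z powr (\<gamma> - 1)) (at z)"
      using 3 by (rule has_real_derivative_powr)
    moreover have "\<forall>\<^sub>F x in nhds z. x powr \<gamma> = power_cost \<gamma> a x"
      using eventually_nhds_in_open[of "{0<..}" z] 3 by (auto simp: f elim!: eventually_mono)
    ultimately show ?thesis using 3 by (subst DERIV_cong_ev[OF refl _ refl, symmetric]) auto
  next
    case 2
    have "((\<lambda>h. (power_cost \<gamma> a (0 + h) - power_cost \<gamma> a 0) / h) \<longlongrightarrow> 0) (at 0)"
    proof (rule Lim_null_comparison)
      show "\<forall>\<^sub>F h in at 0. norm ((power_cost \<gamma> a (0 + h) - power_cost \<gamma> a 0) / h) \<le> max 1 \<bar>a\<bar> * \<bar>h\<bar> powr (\<gamma> - 1)"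
        unfolding eventually_at_filter
      proof (intro always_eventually allI impI)
        fix h :: real assume h: "h \<noteq> 0"
        have "\<bar>power_cost \<gamma> a h\<bar> \<le> max 1 \<bar>a\<bar> * \<bar>h\<bar> powr \<gamma>"
          unfolding f by (auto simp: abs_mult intro!: mult_right_mono mult_right_mono[of 1 "max 1 \<bar>a\<bar>", simplified])
        moreover have "\<bar>h\<bar> powr \<gamma> / \<bar>h\<bar> = \<bar>h\<bar> powr (\<gamma> - 1)" using h by (simp add: powr_diff)
        ultimately have "\<bar>power_cost \<gamma> a h\<bar> / \<bar>h\<bar> \<le> max 1 \<bar>a\<bar> * \<bar>h\<bar> powr (\<gamma> - 1)"
          by (metis abs_ge_zero divide_right_mono times_divide_eq_right)
        then show "norm ((power_cost \<gamma> a (0 + h) - power_cost \<gamma> a 0) / h) \<le> max 1 \<bar>a\<bar> * \<bar>h\<bar> powr (\<gamma> - 1)"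
          using \<gamma> by (simp add: f abs_divide)
      qed
      have "((\<lambda>h. \<bar>h\<bar> powr (\<gamma> - 1)) \<longlongrightarrow> \<bar>0\<bar> powr (\<gamma> - 1)) (at (0::real))"
        using \<gamma> by (intro tendsto_powr' tendsto_intros) auto
      then show "((\<lambda>h. max 1 \<bar>a\<bar> * \<bar>h\<bar> powr (\<gamma> - 1)) \<longlongrightarrow> 0) (at 0)"
        using \<gamma> tendsto_mult_right_zero by force
    qed
    then show ?thesis using 2 \<gamma> by (simp add: has_field_derivative_def DERIV_def flip: has_field_derivative_def)
  qed
qed

lemma power_cost_convex:
  assumes \<gamma>: "1 < \<gamma>" and a: "0 < a"
  shows "convex_cost (power_cost \<gamma> a)" "steep (min a (1 / a)) (power_cost \<gamma> a)" "steep (min a (1 / a)) (\<lambda>z. power_cost \<gamma> a (- z))"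
proof -
  define \<phi> where "\<phi> z = (if z < 0 then - (a * \<gamma> * (- z) powr (\<gamma> - 1)) else \<gamma> * z powr (\<gamma> - 1))" for z
  have der: "(power_cost \<gamma> a has_real_derivative \<phi> z) (at z)" for z
    unfolding \<phi>_def by (rule power_cost_deriv_above_one[OF \<gamma>])
  have mono: "\<phi> u < \<phi> v" if "u < v" for u v
  proof -
    consider "v < 0" | "u < 0" "0 \<le> v" | "0 \<le> u" using that by linarith
    then show ?thesis
    proof cases
      case 1
      then have "(- v) powr (\<gamma> - 1) < (- u) powr (\<gamma> - 1)" using that \<gamma> by (intro powr_less_mono2) auto
      then show ?thesis using 1 that a \<gamma> unfolding \<phi>_def by simp
    next
      case 2
      then have "\<phi> u < 0" using a \<gamma> unfolding \<phi>_def by simp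
      moreover have "0 \<le> \<phi> v" using 2 \<gamma> unfolding \<phi>_def by simp
      ultimately show ?thesis by simp
    next
      case 3
      then have "u powr (\<gamma> - 1) < v powr (\<gamma> - 1)" using that \<gamma> by (intro powr_less_mono2) auto
      then show ?thesis using 3 that \<gamma> unfolding \<phi>_def by simp
    qed
  qed
  have monole: "\<phi> u \<le> \<phi> v" if "u \<le> v" for u v using mono[of u v] that by (cases "u = v") auto
  have \<gamma>1: "\<gamma> < 1 \<longleftrightarrow> False" using \<gamma> by simp
  have mvt: "\<exists>\<xi>. q \<le> \<xi> \<and> \<xi> \<le> p \<and> power_cost \<gamma> a p - power_cost \<gamma> a q = (p - q) * \<phi> \<xi>" if "q \<le> p" for p q
  proof (cases "q = p")
    case True
    then show ?thesis by auto
  next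
    case False
    then have "q < p" using that by simp
    from MVT2[OF this, of "power_cost \<gamma> a" \<phi>] der show ?thesis by (meson less_imp_le)
  qed
  show "convex_cost (power_cost \<gamma> a)"
    unfolding convex_cost_def
  proof (intro conjI allI impI)
    fix u v :: real assume uv: "0 < u" "u < v"
    then have "u powr \<gamma> < v powr \<gamma>" using \<gamma> by (intro powr_less_mono2) auto
    then show "power_cost \<gamma> a u < power_cost \<gamma> a v" "power_cost \<gamma> a (- u) < power_cost \<gamma> a (- v)"
      using uv a \<gamma> unfolding power_cost_def by auto
  next
    fix u d e :: real assume de: "0 < d" "0 < e"
    have "power_cost \<gamma> a (u + d) - power_cost \<gamma> a u < power_cost \<gamma> a (u + e + d) - power_cost \<gamma> a (u + e)"
    proof (rule DERIV_pos_imp_increasing[of u "u + e" "\<lambda>t. power_cost \<gamma> a (t + d) - power_cost \<gamma> a t"])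
      show "u < u + e" using de by simp
      fix t
      have "((\<lambda>t. power_cost \<gamma> a (t + d)) has_real_derivative \<phi> (t + d)) (at t)"
        using der[of "t + d"] unfolding DERIV_shift .
      then have "((\<lambda>t. power_cost \<gamma> a (t + d) - power_cost \<gamma> a t) has_real_derivative \<phi> (t + d) - \<phi> t) (at t)"
        using der[of t] by (rule DERIV_diff)
      then show "\<exists>y. ((\<lambda>t. power_cost \<gamma> a (t + d) - power_cost \<gamma> a t) has_real_derivative y) (at t) \<and> 0 < y"
        using mono[of t "t + d"] de by (intro exI[of _ "\<phi> (t + d) - \<phi> t"]) simp
    qed
    then show "power_cost \<gamma> a (u + d) + power_cost \<gamma> a (u + e) < power_cost \<gamma> a u + power_cost \<gamma> a (u + d + e)"
      by (simp add: algebra_simps)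
  qed
  show "steep (min a (1 / a)) (power_cost \<gamma> a)"
    unfolding steep_def
  proof (intro allI impI)
    fix D :: real assume D: "0 < D"
    \<comment> \<open>The slopes at \<open>D\<close> and \<open>- D\<close> differ by the factor
      \<open>- a\<close>; for the reflected cost the factor is \<open>- 1 / a\<close>. The minimum
      of \<open>a\<close> and \<open>1 / a\<close> serves both.\<close>
    have \<phi>D: "0 < \<phi> D" "\<phi> (- D) = - (a * \<phi> D)" using D \<gamma> unfolding \<phi>_def by auto
    show "\<exists>\<alpha>>0. (\<forall>q p. q \<le> p \<longrightarrow> p \<le> D \<longrightarrow> power_cost \<gamma> a p - power_cost \<gamma> a q \<le> \<alpha> * (p - q)) \<and>
     (\<forall>q p. q \<le> p \<longrightarrow> p \<le> - D \<longrightarrow> min a (1 / a) * \<alpha> * (p - q) \<le> power_cost \<gamma> a q - power_cost \<gamma> a p)"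
    proof (intro exI[of _ "\<phi> D"] conjI allI impI)
      show "0 < \<phi> D" using \<phi>D by simp
      fix q p :: real assume qp: "q \<le> p"
      obtain \<xi> where \<xi>: "q \<le> \<xi>" "\<xi> \<le> p" "power_cost \<gamma> a p - power_cost \<gamma> a q = (p - q) * \<phi> \<xi>" using mvt[OF qp] by blast
      show "power_cost \<gamma> a p - power_cost \<gamma> a q \<le> \<phi> D * (p - q)" if "p \<le> D"
        using mult_left_mono[OF monole[of \<xi> D], of "p - q"] \<xi> that qp by (simp add: mult.commute)
      show "min a (1 / a) * \<phi> D * (p - q) \<le> power_cost \<gamma> a q - power_cost \<gamma> a p" if "p \<le> - D"
      proof -
        have "(p - q) * \<phi> \<xi> \<le> (p - q) * \<phi> (- D)" using monole[of \<xi> "- D"] \<xi> that qp by (intro mult_left_mono) auto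
        then have "a * \<phi> D * (p - q) \<le> power_cost \<gamma> a q - power_cost \<gamma> a p" using \<xi>(3) \<phi>D(2) by (simp add: algebra_simps)
        moreover have "min a (1 / a) * \<phi> D * (p - q) \<le> a * \<phi> D * (p - q)" using \<phi>D(1) qp by (intro mult_right_mono) auto
        ultimately show ?thesis by linarith
      qed
    qed
  qed
  show "steep (min a (1 / a)) (\<lambda>z. power_cost \<gamma> a (- z))"
    unfolding steep_def
  proof (intro allI impI)
    fix D :: real assume D: "0 < D"
    have \<phi>D: "0 < a * \<phi> D" "0 < \<phi> D" "\<phi> (- D) = - (a * \<phi> D)" using D \<gamma> a unfolding \<phi>_def by auto
    show "\<exists>\<alpha>>0. (\<forall>q p. q \<le> p \<longrightarrow> p \<le> D \<longrightarrow> power_cost \<gamma> a (- p) - power_cost \<gamma> a (- q) \<le> \<alpha> * (p - q)) \<and>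
     (\<forall>q p. q \<le> p \<longrightarrow> p \<le> - D \<longrightarrow> min a (1 / a) * \<alpha> * (p - q) \<le> power_cost \<gamma> a (- q) - power_cost \<gamma> a (- p))"
    proof (intro exI[of _ "a * \<phi> D"] conjI allI impI)
      show "0 < a * \<phi> D" using \<phi>D by simp
      fix q p :: real assume qp: "q \<le> p"
      then have "- p \<le> - q" by simp
      from mvt[OF this] obtain \<xi> where \<xi>: "- p \<le> \<xi>" "\<xi> \<le> - q"
        "power_cost \<gamma> a (- q) - power_cost \<gamma> a (- p) = (- q - - p) * \<phi> \<xi>" by blast
      show "power_cost \<gamma> a (- p) - power_cost \<gamma> a (- q) \<le> a * \<phi> D * (p - q)" if "p \<le> D"
      proof -
        have "(p - q) * \<phi> (- D) \<le> (p - q) * \<phi> \<xi>" using monole[of "- D" \<xi>] \<xi> that qp by (intro mult_left_mono) auto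
        then show ?thesis using \<xi>(3) \<phi>D(3) by (simp add: algebra_simps)
      qed
      show "min a (1 / a) * (a * \<phi> D) * (p - q) \<le> power_cost \<gamma> a (- q) - power_cost \<gamma> a (- p)" if "p \<le> - D"
      proof -
        have "(p - q) * \<phi> D \<le> (p - q) * \<phi> \<xi>" using monole[of D \<xi>] \<xi> that qp by (intro mult_left_mono) auto
        then have "\<phi> D * (p - q) \<le> power_cost \<gamma> a (- q) - power_cost \<gamma> a (- p)" using \<xi>(3) by (simp add: algebra_simps)
        moreover have "min a (1 / a) * (a * \<phi> D) * (p - q) \<le> (1 / a) * (a * \<phi> D) * (p - q)"
          using \<phi>D(1) qp by (intro mult_right_mono) auto
        ultimately show ?thesis using a by simp
      qed
    qed
  qed
qed

text \<open>The maximum is the predecessor of \<open>x\<close> in \<open>A\<close>, with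
  \<open>u\<close> placed before the smallest element.\<close>

lemma telescope_pred:
  fixes \<Phi> :: "real \<Rightarrow> real"
  assumes "finite A" "\<And>x. x \<in> A \<Longrightarrow> u < x"
  shows "(\<Sum>x\<in>A. \<Phi> x - \<Phi> (Max (insert u {z \<in> A. z < x}))) = \<Phi> (Max (insert u A)) - \<Phi> u"
  using assms
proof (induction A rule: finite_linorder_max_induct)
  case empty
  then show ?case by simp
next
  case (insert b A)
  have "u < b" using insert.prems by auto
  have "b \<notin> A" using insert by auto
  have 1: "{z \<in> insert b A. z < b} = A" using insert by auto
  have 2: "{z \<in> insert b A. z < x} = {z \<in> A. z < x}" if "x \<in> A" for x using insert that by force
  have mx: "Max (insert u (insert b A)) = b"
    using insert \<open>u < b\<close> by (intro Max_eqI) (auto simp: less_imp_le)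
  have "(\<Sum>x\<in>A. \<Phi> x - \<Phi> (Max (insert u {z \<in> insert b A. z < x}))) = \<Phi> (Max (insert u A)) - \<Phi> u"
    using insert 2 by (simp cong: sum.cong)
  moreover have "(\<Sum>x\<in>insert b A. \<Phi> x - \<Phi> (Max (insert u {z \<in> insert b A. z < x}))) =
    (\<Phi> b - \<Phi> (Max (insert u {z \<in> insert b A. z < b}))) + (\<Sum>x\<in>A. \<Phi> x - \<Phi> (Max (insert u {z \<in> insert b A. z < x})))"
    using insert(1) \<open>b \<notin> A\<close> by (rule sum.insert)
  ultimately show ?case unfolding 1 mx by linarith
qed

text \<open>Two edges in the wrong order have the extreme displacements \<open>u\<close> and
  \<open>u + d + e\<close>; exchanging their partners yields the intermediate ones, which are
  cheaper by strict convexity.\<close>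

lemma weakly_minimal_monotone:
  assumes wm: "weakly_minimal Fs R B M" and dis: "R \<inter> B = {}" and cc: "\<And>f. f \<in> Fs \<Longrightarrow> convex_cost f"
  shows "monotone_matching M"
  unfolding monotone_matching_def
proof (intro allI impI)
  fix x y x' y' assume e: "(x, y) \<in> M" "(x', y') \<in> M" "x < x'"
  have M: "is_matching R B M" using wm unfolding weakly_minimal_def by auto
  have "y \<noteq> y'" using is_matching_unique(2)[OF M e(1)] e by force
  show "y < y'"
  proof (rule ccontr)
    assume "\<not> y < y'"
    then have lt: "y' < y" using \<open>y \<noteq> y'\<close> by simp
    obtain f where f: "f \<in> Fs" "f (y - x) + f (y' - x') \<le> f (y' - x) + f (y - x')"
      using weakly_minimal_swap[OF wm dis e(1,2)] e(3) by blast
    have "0 < x' - x" "0 < y - y'" using e(3) lt by auto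
    then have "f ((y' - x') + (x' - x)) + f ((y' - x') + (y - y')) < f (y' - x') + f ((y' - x') + (x' - x) + (y - y'))"
      using cc[OF f(1)] unfolding convex_cost_def by blast
    then show False using f(2) by (simp add: algebra_simps)
  qed
qed

text \<open>A perfect monotone matching preserves ranks, and the rank determines the
  partner.\<close>

lemma monotone_matching_unique:
  assumes E: "is_matching X Y E" "is_matching X Y D" "X \<subseteq> fst ` E" "Y \<subseteq> snd ` E" "X \<subseteq> fst ` D" "Y \<subseteq> snd ` D"
    and mono: "monotone_matching E" "monotone_matching D" and fin: "finite X" "finite Y"
  shows "E = D"
proof -
  have rank: "card (Y \<inter> {..<y}) = card (X \<inter> {..<x})"
    if M: "is_matching X Y M" "X \<subseteq> fst ` M" "Y \<subseteq> snd ` M" "monotone_matching M" and e: "(x, y) \<in> M" for M x y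
  proof (rule antisym)
    note mono = M(4)[unfolded monotone_matching_def, rule_format]
    have iff: "r < x \<longleftrightarrow> b < y" if "(r, b) \<in> M" for r b
      using mono[OF that e] mono[OF e that] is_matching_unique(1)[OF M(1) e] that by (metis linorder_neqE order_less_asym)
    show "card (Y \<inter> {..<y}) \<le> card (X \<inter> {..<x})"
    proof (rule card_matched_le[OF M(1)])
      fix b assume b: "b \<in> Y" "b \<in> {..<y}"
      then obtain r where "(r, b) \<in> M" using M(3) by force
      then show "\<exists>r\<in>{..<x}. (r, b) \<in> M" using iff b by blast
    qed (use fin in simp)
    show "card (X \<inter> {..<x}) \<le> card (Y \<inter> {..<y})"
    proof (rule card_matched_le[of Y X "M\<inverse>"])
      show "is_matching Y X (M\<inverse>)" using M(1) converse_matching by blast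
      fix r assume r: "r \<in> X" "r \<in> {..<x}"
      then obtain b where "(r, b) \<in> M" using M(2) by force
      then show "\<exists>b\<in>{..<y}. (b, r) \<in> M\<inverse>" using iff r by blast
    qed (use fin in simp)
  qed
  have sub: "M \<subseteq> M'"
    if M: "is_matching X Y M" "X \<subseteq> fst ` M" "Y \<subseteq> snd ` M" "monotone_matching M"
      and M': "is_matching X Y M'" "X \<subseteq> fst ` M'" "Y \<subseteq> snd ` M'" "monotone_matching M'" for M M'
  proof clarify
    fix x y assume e: "(x, y) \<in> M"
    have xy: "x \<in> X" "y \<in> Y" using is_matching_unique(3,4)[OF M(1) e] .
    obtain y' where y': "(x, y') \<in> M'" using xy(1) M'(2) by force
    have y'Y: "y' \<in> Y" using is_matching_unique(4)[OF M'(1) y'] .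
    have eq: "card (Y \<inter> {..<y}) = card (Y \<inter> {..<y'})" using rank[OF M e] rank[OF M' y'] by simp
    have lt: "card (Y \<inter> {..<b}) < card (Y \<inter> {..<b'})" if "b \<in> Y" "b < b'" for b b'
      using that fin by (intro psubset_card_mono) auto
    have "y = y'" using lt[of y y'] lt[of y' y] eq xy(2) y'Y by (metis linorder_neqE less_irrefl)
    then show "(x, y) \<in> M'" using y' by simp
  qed
  show ?thesis using sub assms by (intro equalityI) auto
qed

lemma surgeE:
  assumes "surge R B"
  obtains T D G :: real where "real N \<le> T" "real N \<le> D" "D \<le> T" "K * T \<le> G"
    "\<And>x. 0 \<le> x \<Longrightarrow> x \<le> T + G \<Longrightarrow> real (card (R \<inter> {0<..x})) \<le> x + D \<and> x - D \<le> real (card (B \<inter> {0<..x}))"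
    "\<And>x. T \<le> x \<Longrightarrow> x \<le> T + G \<Longrightarrow> real (card (R \<inter> {0<..x})) \<le> x - 5 * D \<and> x + 5 * D \<le> real (card (B \<inter> {0<..x}))"
proof -
  have "\<exists>(T::real) (D::real) (G::real). real N \<le> T \<and> real N \<le> D \<and> D \<le> T \<and> K * T \<le> G \<and>
     (\<forall>x. 0 \<le> x \<and> x \<le> T + G \<longrightarrow> real (card (R \<inter> {0<..x})) \<le> x + D \<and> x - D \<le> real (card (B \<inter> {0<..x}))) \<and>
     (\<forall>x. T \<le> x \<and> x \<le> T + G \<longrightarrow> real (card (R \<inter> {0<..x})) \<le> x - 5 * D \<and> x + 5 * D \<le> real (card (B \<inter> {0<..x})))"
    using assms unfolding surge_def by (elim allE)
  then show thesis by (elim exE conjE) (rule that; blast)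
qed

section \<open>Shifting partners along a surge\<close>

context points
begin

text \<open>Let a red \<open>u\<close> be unmatched. Every matched red point from \<open>u\<close>
  up to some \<open>X\<close> hands its partner to the matched red point before it, the smallest one
  to \<open>u\<close>, so that \<open>X\<close> is left out instead. Per unit of distance the shift
  costs at most \<alpha> on the initial stretch and gains at least \<open>c * \<alpha>\<close>
  afterwards; a long surge makes the gain prevail.\<close>

lemma convex_red_matched:
  assumes su: "surge R B" and wm: "weakly_minimal Fs R B M"
    and cc: "\<And>f. f \<in> Fs \<Longrightarrow> convex_cost f" and st: "\<And>f. f \<in> Fs \<Longrightarrow> steep c f" and c: "0 < c"
  shows "R \<subseteq> fst ` M"
proof (rule ccontr)
  assume "\<not> ?thesis"
  then obtain u where u: "u \<in> R - fst ` M" by blast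
  have M: "is_matching R B M" using wm unfolding weakly_minimal_def by auto
  have blue: "B \<subseteq> snd ` M" using weakly_minimal_one_colour[OF wm disjoint] u by blast
  have "monotone_matching M" using weakly_minimal_monotone[OF wm disjoint cc] .
  note mono = this[unfolded monotone_matching_def, rule_format]
  \<comment> \<open>An edge over \<open>u\<close> could be shortened by taking \<open>u\<close> as
    its red endpoint.\<close>
  have side: "u < x \<longleftrightarrow> u < y" if e: "(x, y) \<in> M" for x y
  proof (rule ccontr)
    assume n: "\<not> ?thesis"
    have xy: "x \<in> R" "y \<in> B" using is_matching_unique(3,4)[OF M e] .
    have "u \<noteq> y" using u xy disjoint by blast
    moreover have "u \<noteq> x" using u e by force
    ultimately have o: "x < u \<and> u < y \<or> y < u \<and> u < x" using n by linarith
    obtain f where f: "f \<in> Fs" "f (y - x) \<le> f (y - u)" using weakly_minimal_red[OF wm disjoint u e] by blast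
    have inc: "0 < p \<Longrightarrow> p < q \<Longrightarrow> f p < f q \<and> f (- p) < f (- q)" for p q using cc[OF f(1)] unfolding convex_cost_def by blast
    show False using o inc[of "y - u" "y - x"] inc[of "u - y" "x - y"] f(2) by auto
  qed
  \<comment> \<open>\<open>c0\<close> bounds the error of counting from 0 instead of from
    \<open>u\<close>; the surge is chosen so that \<open>2 * c0 < D\<close>.\<close>
  define c0 where "c0 = card ((R \<union> B) \<inter> {-\<bar>u\<bar>..\<bar>u\<bar>})"
  have c0: "card (X \<inter> I) \<le> c0" if "X \<subseteq> R \<union> B" "I \<subseteq> {-\<bar>u\<bar>..\<bar>u\<bar>}" for X I
    unfolding c0_def by (rule card_mono[OF finite_points(5)]) (use that in auto)
  obtain N1 :: nat where N1: "\<bar>u\<bar> < real N1" using reals_Archimedean2 by blast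
  obtain T D G :: real where TDG: "real (N1 + 2 * c0 + 1) \<le> T" "real (N1 + 2 * c0 + 1) \<le> D" "D \<le> T" "(5 / c + 4) * T \<le> G"
    and le: "\<And>x. 0 \<le> x \<Longrightarrow> x \<le> T + G \<Longrightarrow> real (card (R \<inter> {0<..x})) \<le> x + D \<and> x - D \<le> real (card (B \<inter> {0<..x}))"
    and le5: "\<And>x. T \<le> x \<Longrightarrow> x \<le> T + G \<Longrightarrow> real (card (R \<inter> {0<..x})) \<le> x - 5 * D \<and> x + 5 * D \<le> real (card (B \<inter> {0<..x}))"
    by (rule surgeE[OF su, of "N1 + 2 * c0 + 1" "5 / c + 4"]) blast
  have T0: "0 < T" "\<bar>u\<bar> < D" "2 * real c0 < D" "\<bar>u\<bar> < T" "0 < D" using TDG N1 by auto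
  have G: "5 * T < c * (G - 3 * T)" "4 * T \<le> G"
  proof -
    have "0 < 5 / c * T" using c T0 by simp
    then show "4 * T \<le> G" using TDG(4) by (simp add: distrib_right)
    have "c * ((5 / c + 4) * T) \<le> c * G" using TDG(4) c by (intro mult_left_mono) auto
    moreover have "c * ((5 / c + 4) * T) = 5 * T + 4 * (c * T)" using c by (simp add: field_simps)
    moreover have "0 < c * T" using c T0 by simp
    ultimately show "5 * T < c * (G - 3 * T)" by (simp add: algebra_simps)
  qed
  define cR cB where "cR r = card (R \<inter> {u<..r})" and "cB r = card (B \<inter> {u<..r})" for r
  have cR: "real (cR r) \<le> card (R \<inter> {0<..r}) + c0" for r
  proof -
    have "cR r \<le> card (R \<inter> {0<..r} \<union> R \<inter> {u<..0})"
      unfolding cR_def using finite_points by (intro card_mono) auto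
    also have "\<dots> \<le> card (R \<inter> {0<..r}) + card (R \<inter> {u<..0})" by (rule card_Un_le)
    also have "\<dots> \<le> card (R \<inter> {0<..r}) + c0" using c0[of R "{u<..0}"] by force
    finally show ?thesis by linarith
  qed
  have cB: "real (card (B \<inter> {0<..r})) - c0 \<le> cB r" for r
  proof -
    have "card (B \<inter> {0<..r}) \<le> card (B \<inter> {u<..r} \<union> B \<inter> {0<..u})"
      using finite_points by (intro card_mono) auto
    also have "\<dots> \<le> cB r + card (B \<inter> {0<..u})" unfolding cB_def by (rule card_Un_le)
    also have "\<dots> \<le> cB r + c0" using c0[of B "{0<..u}"] by force
    finally show ?thesis by linarith
  qed
  have cBmono: "cB r \<le> cB r'" if "r \<le> r'" for r r'
    unfolding cB_def using finite_points that by (intro card_mono) auto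
  \<comment> \<open>Blue points are late by less than \<open>3 * D\<close>, so even on the initial
    stretch a shifted edge points right by at most that much.\<close>
  have early: "cR r < cB (r + 3 * D)" if r: "u \<le> r" "r \<le> T + G" for r
  proof (cases "0 \<le> r")
    case True
    have R1: "real (cR r) \<le> r + D + c0" using le[OF True r(2)] cR[of r] by linarith
    show ?thesis
    proof (cases "r + 3 * D \<le> T + G")
      case True
      then have "r + 3 * D - D \<le> card (B \<inter> {0<..r + 3 * D})" using le[of "r + 3 * D"] \<open>0 \<le> r\<close> T0 by auto
      then show ?thesis using R1 cB[of "r + 3 * D"] T0 by linarith
    next
      case False
      have "T + G + 5 * D \<le> card (B \<inter> {0<..T + G})" using le5[of "T + G"] G T0 by auto
      then have "real (cR r) < cB (T + G)" using R1 r cB[of "T + G"] T0 by linarith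
      then show ?thesis using cBmono[of "T + G" "r + 3 * D"] False by linarith
    qed
  next
    case False
    then have "R \<inter> {0<..r} = {}" by auto
    then have "real (cR r) \<le> c0" using cR[of r] by simp
    moreover have "D \<le> card (B \<inter> {0<..2 * D})" using le[of "2 * D"] T0 G TDG(3) by auto
    then have "real c0 < cB (2 * D)" using cB[of "2 * D"] T0 by linarith
    moreover have "cB (2 * D) \<le> cB (r + 3 * D)" using r T0 by (intro cBmono) auto
    ultimately show ?thesis by linarith
  qed
  \<comment> \<open>Enough blue points have appeared already \<open>3 * D\<close> before
    \<open>r\<close>, so from here on edges point left by at least that much, where the cost is
    steep.\<close>
  have late: "cR r < cB (r - 3 * D)" if r: "T + 3 * D \<le> r" "r \<le> T + G" for r
  proof -
    have "real (cR r) \<le> r - 5 * D + c0" using le5[of r] cR[of r] r T0 by fastforce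
    moreover have "r - 3 * D + 5 * D \<le> card (B \<inter> {0<..r - 3 * D})" using le5[of "r - 3 * D"] r T0 by auto
    ultimately show ?thesis using cB[of "r - 3 * D"] T0 by linarith
  qed
  have finA: "finite {x \<in> R. u < x \<and> x \<le> X}" for X
    by (rule finite_subset[OF _ finite_points(1)[of u X]]) auto
  \<comment> \<open>The blue points of \<open>{u<..T + G}\<close> outnumber the red ones there and
    are all matched to red points right of \<open>u\<close>; some partner must lie beyond
    \<open>T + G\<close>.\<close>
  have "\<exists>x y. (x, y) \<in> M \<and> T + G < x \<and> u < x"
  proof (rule ccontr)
    assume n: "\<not> ?thesis"
    have "cB (T + G) \<le> cR (T + G)"
      unfolding cB_def cR_def
    proof (rule card_matched_le[OF M finite_points(1)])
      fix b assume b: "b \<in> B" "b \<in> {u<..T + G}"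
      then obtain x where x: "(x, b) \<in> M" using blue by force
      then have "u < x" using side b by simp
      then have "x \<le> T + G" using n x by (meson not_le)
      then show "\<exists>r\<in>{u<..T + G}. (r, b) \<in> M" using x \<open>u < x\<close> by auto
    qed
    moreover have "cR (T + G) < cB (T + G - 3 * D)" using late[of "T + G"] G T0 TDG(3) by auto
    moreover have "cB (T + G - 3 * D) \<le> cB (T + G)" using T0 by (intro cBmono) auto
    ultimately show False by linarith
  qed
  then obtain x1 where x1: "x1 \<in> fst ` M" "T + G < x1" "u < x1" by force
  have "x1 \<in> R" using x1(1) is_matching_unique(3)[OF M] by force
  from first_point[of R x1 "T + G" x1 "\<lambda>x. x \<in> fst ` M", OF _ this x1(2) order_refl x1(1)]
  obtain X where X: "X \<in> R" "T + G < X" "X \<in> fst ` M" "\<And>r. r \<in> R \<Longrightarrow> r \<in> fst ` M \<Longrightarrow> T + G < r \<Longrightarrow> r < X \<Longrightarrow> False"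
    by blast
  define A where "A = {x \<in> R. u < x \<and> x \<le> X \<and> x \<in> fst ` M}"
  have A: "finite A" "X \<in> A" "\<And>x. x \<in> A \<Longrightarrow> u < x \<and> x \<le> X"
    using finite_subset[OF _ finA[of X], of A] X T0 G unfolding A_def by auto
  define pred where "pred x = Max (insert u {z \<in> A. z < x})" for x
  have fin: "finite (insert u {z \<in> A. z < x})" for x using A(1) by simp
  have pred_in: "pred x \<in> insert u {z \<in> A. z < x}" for x unfolding pred_def using fin by (intro Max_in) auto
  have pred: "u \<le> pred x" "pred x < x" "pred x \<le> T + G" if "x \<in> A" for x
  proof -
    show "u \<le> pred x" unfolding pred_def using fin by (intro Max_ge) auto
    show lt: "pred x < x" using pred_in[of x] A(3)[OF that] by auto
    show "pred x \<le> T + G"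
    proof (rule ccontr)
      assume n: "\<not> ?thesis"
      then have "pred x \<in> A" using pred_in[of x] T0 G by auto
      then show False using X(4)[of "pred x"] n lt A(3)[OF that] unfolding A_def by auto
    qed
  qed
  have pred_ge: "z \<le> pred x" if "z \<in> A" "z < x" for z x
    unfolding pred_def using fin that by (intro Max_ge) auto
  define E where "E = {(x, y) \<in> M. x \<in> A}"
  have fstE: "fst ` E = A" unfolding E_def A_def by force
  have EM: "E \<subseteq> M" unfolding E_def by auto
  have injE: "inj_on fst E" "inj_on snd E" using is_matching_inj[OF M] EM by (auto elim: inj_on_subset)
  have finE: "finite E" using A(1) injE(1) fstE finite_imageD by metis
  \<comment> \<open>By monotonicity the partners of the blue points in \<open>{u<..y}\<close> are
    \<open>x\<close> itself, which accounts for the successor, and matched red points up to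
    \<open>pred x\<close>.\<close>
  have rank: "cB y \<le> Suc (cR r)" if e: "(x, y) \<in> E" and r: "pred x \<le> r" for x y r
  proof -
    have xA: "x \<in> A" and eM: "(x, y) \<in> M" using e unfolding E_def by auto
    have "cB y \<le> card (R \<inter> insert x (A \<inter> {..pred x}))"
      unfolding cB_def
    proof (rule card_matched_le[OF M])
      show "finite (R \<inter> insert x (A \<inter> {..pred x}))" using A(1) by auto
      fix b assume b: "b \<in> B" "b \<in> {u<..y}"
      then obtain x' where x': "(x', b) \<in> M" using blue by force
      have ux: "u < x'" using side[OF x'] b by simp
      have "\<not> x < x'" using mono[OF eM x'] b by auto
      moreover have "x' \<in> A" if "x' \<le> x"
        unfolding A_def using ux x' that A(3)[OF xA] is_matching_unique(3)[OF M x'] by force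
      ultimately have "x' = x \<or> x' \<in> A \<and> x' \<le> pred x" using pred_ge[of x' x] by (metis linorder_neqE less_imp_le)
      then show "\<exists>x'\<in>insert x (A \<inter> {..pred x}). (x', b) \<in> M" using x' by blast
    qed
    also have "\<dots> \<le> card (insert x (A \<inter> {..pred x}))" using A(1) by (intro card_mono) auto
    also have "\<dots> \<le> Suc (card (A \<inter> {..pred x}))" by (rule card_insert_le_m1[of "Suc _", simplified]) simp
    also have "card (A \<inter> {..pred x}) \<le> cR r"
      unfolding cR_def using r finite_points by (intro card_mono) (auto simp: A_def)
    finally show ?thesis by simp
  qed
  have upper: "y \<le> r'" if e: "(x, y) \<in> E" and r: "pred x \<le> r" "cR r < cB r'" "u \<le> r'" for x y r r'
  proof (rule ccontr)
    assume n: "\<not> y \<le> r'"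
    have "y \<in> B" using e EM is_matching_unique(4)[OF M] by blast
    have "cB r' < cB y"
      unfolding cB_def
    proof (rule psubset_card_mono[OF finite_points(2)])
      show "B \<inter> {u<..r'} \<subset> B \<inter> {u<..y}" using n r(3) \<open>y \<in> B\<close> by auto
    qed
    then show False using rank[OF e r(1)] r(2) by linarith
  qed
  \<comment> \<open>From \<tau> on the estimate \<open>late\<close> applies; up to \<tau> only
    \<open>early\<close> is available.\<close>
  define \<tau> where "\<tau> = T + 3 * D"
  have \<tau>: "\<tau> \<le> T + G" "u \<le> \<tau>" using G T0 TDG(3) unfolding \<tau>_def by auto
  define E' where "E' = (\<lambda>(x, y). (pred x, y)) ` E"
  have pred_less: "pred x < pred x'" if "x \<in> A" "x' \<in> A" "x < x'" for x x'
    using pred_ge[of x x'] pred(2)[of x] that by force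
  have inj': "inj_on (\<lambda>(x, y). (pred x, y)) E"
  proof (rule inj_onI)
    fix d e assume "d \<in> E" "e \<in> E" "(\<lambda>(x, y). (pred x, y)) d = (\<lambda>(x, y). (pred x, y)) e"
    then show "d = e" using is_matching_unique(2)[OF M] EM by (cases d; cases e) (auto dest: subsetD)
  qed
  have uu: "u \<in> unmatched R B M" using u unfolding unmatched_def by auto
  have predinj: "x = x'" if "x \<in> A" "x' \<in> A" "pred x = pred x'" for x x'
    using pred_less[of x x'] pred_less[of x' x] that by (metis linorder_neqE less_irrefl)
  have mE: "is_matching (fst ` E) (snd ` E) E" by (rule is_matching_subset[OF M EM]) auto
  have "is_matching (fst ` E \<union> ({u} \<inter> R)) (snd ` E \<union> ({u} \<inter> B)) E'"
    unfolding is_matching_def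
  proof (intro conjI allI impI)
    show "E' \<subseteq> (fst ` E \<union> {u} \<inter> R) \<times> (snd ` E \<union> {u} \<inter> B)"
    proof
      fix d assume "d \<in> E'"
      then obtain x y where e: "(x, y) \<in> E" "d = (pred x, y)" unfolding E'_def by auto
      have "pred x \<in> insert u A" using pred_in[of x] by blast
      then show "d \<in> (fst ` E \<union> {u} \<inter> R) \<times> (snd ` E \<union> {u} \<inter> B)" unfolding fstE e(2) using u e(1) by force
    qed
    show "y = y'" if xy: "(x, y) \<in> E'" "(x, y') \<in> E'" for x y y'
    proof -
      obtain z z' where z: "(z, y) \<in> E" "(z', y') \<in> E" "x = pred z" "x = pred z'" using xy unfolding E'_def by auto
      have "z \<in> A" "z' \<in> A" using z(1,2) unfolding E_def by auto
      then have "z = z'" using predinj z(3,4) by metis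
      then show ?thesis using is_matching_unique(1)[OF mE z(1)] z(2) by simp
    qed
    show "x = x'" if xy: "(x, y) \<in> E'" "(x', y) \<in> E'" for x x' y
    proof -
      obtain z z' where z: "(z, y) \<in> E" "(z', y) \<in> E" "x = pred z" "x' = pred z'" using xy unfolding E'_def by auto
      then show ?thesis using is_matching_unique(2)[OF mE z(1)] by simp
    qed
  qed
  moreover have "card E' = card E" unfolding E'_def using inj' by (rule card_image)
  ultimately obtain f where f: "f \<in> Fs" "cost f E \<le> cost f E'"
    using weakly_minimal_exchange[OF wm disjoint EM _ finE, of "{u}" E'] uu by auto
  have "0 < 3 * D" using T0 by simp
  then obtain \<alpha> where \<alpha>: "0 < \<alpha>" "\<And>q p. q \<le> p \<Longrightarrow> p \<le> 3 * D \<Longrightarrow> f p - f q \<le> \<alpha> * (p - q)"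
    "\<And>q p. q \<le> p \<Longrightarrow> p \<le> - (3 * D) \<Longrightarrow> c * \<alpha> * (p - q) \<le> f q - f p"
    using st[OF f(1)] unfolding steep_def by blast
  \<comment> \<open>An integral of the slope bounds, rising at rate \<alpha> up to \<tau> and
    falling at rate \<open>c * \<alpha>\<close> afterwards, so that the changes at consecutive red
    points telescope.\<close>
  define \<Phi> where "\<Phi> r = \<alpha> * min r \<tau> - c * \<alpha> * max r \<tau>" for r
  have step: "f (y - pred x) - f (y - x) \<le> \<Phi> x - \<Phi> (pred x)" if e: "(x, y) \<in> E" for x y
  proof -
    have xA: "x \<in> A" using e unfolding E_def by auto
    note p = pred[OF xA]
    have y1: "y \<le> pred x + 3 * D" using upper[OF e order_refl early[OF p(1,3)]] p T0 by auto
    have y2: "y \<le> r - 3 * D" if "pred x \<le> r" "\<tau> \<le> r" "r \<le> T + G" for r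
      using upper[OF e that(1) late[of r]] that T0 unfolding \<tau>_def by auto
    consider "x \<le> \<tau>" | "\<tau> \<le> pred x" | "pred x < \<tau>" "\<tau> < x" by linarith
    then show ?thesis
    proof cases
      case 1
      then show ?thesis using \<alpha>(2)[of "y - x" "y - pred x"] y1 p unfolding \<Phi>_def by (simp add: algebra_simps)
    next
      case 2
      then show ?thesis using \<alpha>(3)[of "y - x" "y - pred x"] y2[of "pred x"] p unfolding \<Phi>_def by (simp add: algebra_simps)
    next
      case 3
      have "f (y - pred x) - f (y - \<tau>) \<le> \<alpha> * (\<tau> - pred x)" using \<alpha>(2)[of "y - \<tau>" "y - pred x"] y1 3 by simp
      moreover have "c * \<alpha> * (x - \<tau>) \<le> f (y - x) - f (y - \<tau>)"
        using \<alpha>(3)[of "y - x" "y - \<tau>"] y2[of \<tau>] 3 \<tau> by simp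
      ultimately show ?thesis using 3 unfolding \<Phi>_def by (simp add: algebra_simps)
    qed
  qed
  have "cost f E' = (\<Sum>(x, y)\<in>E. f (y - pred x))"
    unfolding cost_def E'_def by (subst sum.reindex[OF inj']) (simp add: case_prod_unfold comp_def)
  then have "cost f E' - cost f E = (\<Sum>(x, y)\<in>E. f (y - pred x) - f (y - x))"
    unfolding cost_def by (simp add: sum_subtractf case_prod_unfold)
  also have "\<dots> \<le> (\<Sum>(x, y)\<in>E. \<Phi> x - \<Phi> (pred x))" using step by (intro sum_mono) auto
  also have "\<dots> = (\<Sum>x\<in>A. \<Phi> x - \<Phi> (pred x))"
    unfolding fstE[symmetric] using injE(1) by (simp add: sum.reindex case_prod_unfold)
  also have "\<dots> = \<Phi> (Max (insert u A)) - \<Phi> u"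
    unfolding pred_def using A(3) by (intro telescope_pred[OF A(1)]) auto
  also have "Max (insert u A) = X" using A by (intro Max_eqI) (auto intro: less_imp_le)
  also have "\<Phi> X - \<Phi> u = \<alpha> * ((\<tau> - u) - c * (X - \<tau>))"
    using X(2) \<tau> unfolding \<Phi>_def by (simp add: algebra_simps)
  also have "\<dots> < 0"
  proof -
    have "c * (G - 3 * T) \<le> c * (X - \<tau>)" using X(2) c TDG(3) unfolding \<tau>_def by (intro mult_left_mono) auto
    then have "(\<tau> - u) - c * (X - \<tau>) < 0" using G T0 TDG(3) unfolding \<tau>_def by linarith
    then show ?thesis using \<alpha>(1) by (simp add: mult_pos_neg)
  qed
  finally show False using f(2) by simp
qed

text \<open>Blue points are red points after the exchange of colours. This reflects the cost;
  convexity is symmetric, and steepness is demanded of the reflected cost as well.\<close>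

lemma convex_perfect:
  assumes su: "surge R B" "surge B R" and wm: "weakly_minimal Fs R B M"
    and cc: "\<And>f. f \<in> Fs \<Longrightarrow> convex_cost f" and st: "\<And>f. f \<in> Fs \<Longrightarrow> steep c f \<and> steep c (\<lambda>z. f (- z))" and c: "0 < c"
  shows "unmatched R B M = {}"
proof -
  have r: "R \<subseteq> fst ` M" by (rule convex_red_matched[OF su(1) wm cc _ c]) (use st in auto)
  let ?Gs = "(\<lambda>f z. f (- z)) ` Fs"
  have "(\<lambda>f z. f (- z)) ` ?Gs = Fs" by (auto simp: image_image)
  then have "weakly_minimal ?Gs B R (M\<inverse>)" using wm weakly_minimal_converse[of ?Gs B R M] by simp
  moreover have "convex_cost (\<lambda>z. f (- z))" if "convex_cost f" for f :: "real \<Rightarrow> real"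
    unfolding convex_cost_def
  proof (intro conjI allI impI)
    fix u v :: real assume "0 < u" "u < v"
    then show "f (- u) < f (- v)" "f (- (- u)) < f (- (- v))" using that unfolding convex_cost_def by auto
  next
    fix u d e :: real assume de: "0 < d" "0 < e"
    have "f ((- (u + d + e)) + d) + f ((- (u + d + e)) + e) < f (- (u + d + e)) + f ((- (u + d + e)) + d + e)"
      using that de unfolding convex_cost_def by blast
    then show "f (- (u + d)) + f (- (u + e)) < f (- u) + f (- (u + d + e))" by (simp add: algebra_simps)
  qed
  ultimately have "B \<subseteq> fst ` (M\<inverse>)"
    by (intro points.convex_red_matched[OF swapped su(2) _ _ _ c]) (use cc st in auto)
  moreover have "fst ` (M\<inverse>) = snd ` M" by force
  ultimately show ?thesis using r unfolding unmatched_def by auto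
qed

text \<open>On a finite part every minimizer is monotone and perfect, hence equal to that part. The
  characterization mentions neither the filter nor \<open>a\<close>, which is the claimed invariance
  above exponent 1.\<close>

lemma convex_iff:
  assumes su: "surge R B" "surge B R" and F: "F \<noteq> bot" "\<forall>\<^sub>F \<gamma> in F. 1 < \<gamma>" and a: "0 < a"
  shows "eventually_minimal F a R B M \<longleftrightarrow> is_matching R B M \<and> monotone_matching M \<and> unmatched R B M = {}"
proof
  assume em: "eventually_minimal F a R B M"
  have M: "is_matching R B M" using em unfolding eventually_minimal_def by auto
  note wm = eventually_minimal_weakly[OF em F(2,1)]
  have "monotone_matching M" by (rule weakly_minimal_monotone[OF wm disjoint]) (use power_cost_convex(1) a in auto)
  moreover have "unmatched R B M = {}"
    by (rule convex_perfect[OF su wm, where c = "min a (1 / a)"]) (use power_cost_convex a in auto)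
  ultimately show "is_matching R B M \<and> monotone_matching M \<and> unmatched R B M = {}" using M by blast
next
  assume mp: "is_matching R B M \<and> monotone_matching M \<and> unmatched R B M = {}"
  then have M: "is_matching R B M" by auto
  show "eventually_minimal F a R B M"
    unfolding eventually_minimal_def
  proof (intro conjI allI impI M)
    fix S assume "admissible R B M S"
    then obtain E where E: "finite S" "E \<subseteq> M" "S = fst ` E \<union> snd ` E \<union> {}"
      using mp unfolding admissible_def by blast
    have "E \<subseteq> S \<times> S"
    proof
      fix e assume "e \<in> E"
      then have "fst e \<in> S" "snd e \<in> S" unfolding E(3) by auto
      then show "e \<in> S \<times> S" by (cases e) simp
    qed
    then have fin: "finite E" by (rule finite_subset) (simp add: E(1))
    note parts = admissible_parts[OF M disjoint E(2) _ E(3)]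
    let ?X = "fst ` E" and ?Y = "snd ` E"
    have sub: "?X \<subseteq> R" "?Y \<subseteq> B" using M E(2) unfolding is_matching_def by auto
    have mE: "is_matching ?X ?Y E" by (rule is_matching_subset[OF M E(2)]) auto
    have dis: "?X \<inter> ?Y = {}" using sub disjoint by blast
    have cE: "card ?X = card E" "card ?Y = card E" using is_matching_inj[OF mE] by (auto simp: card_image)
    have finXY: "finite ?X" "finite ?Y" using fin by auto
    have monoE: "monotone_matching E" using mp E(2) unfolding monotone_matching_def by blast
    have "minimal_finite (power_cost \<gamma> a) ?X ?Y E" if \<gamma>: "1 < \<gamma>" for \<gamma>
    proof -
      obtain D where D: "minimal_finite (power_cost \<gamma> a) ?X ?Y D" using ex_minimal_finite[OF finXY dis] by blast
      note Di = D[unfolded minimal_finite_iff[OF finXY dis]]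
      have mD: "is_matching ?X ?Y D" and cD: "card D = card E" using Di cE by auto
      have "monotone_matching D"
        by (rule weakly_minimal_monotone[OF weakly_minimal_finite[OF finXY dis D] dis])
          (use power_cost_convex(1)[OF \<gamma> a] in auto)
      moreover have "fst ` D = ?X"
      proof (rule card_subset_eq[OF finXY(1)])
        show "fst ` D \<subseteq> ?X" using mD unfolding is_matching_def by auto
        show "card (fst ` D) = card ?X" using is_matching_inj(1)[OF mD] cD cE by (simp add: card_image)
      qed
      moreover have "snd ` D = ?Y"
      proof (rule card_subset_eq[OF finXY(2)])
        show "snd ` D \<subseteq> ?Y" using mD unfolding is_matching_def by auto
        show "card (snd ` D) = card ?Y" using is_matching_inj(2)[OF mD] cD cE by (simp add: card_image)
      qed
      ultimately have "E = D" using monotone_matching_unique[OF mE mD _ _ _ _ monoE _ finXY] by simp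
      then show ?thesis using D by simp
    qed
    then have "\<forall>\<^sub>F \<gamma> in F. minimal_finite (power_cost \<gamma> a) ?X ?Y E" using F(2) by (rule eventually_mono[rotated])
    then show "\<forall>\<^sub>F \<gamma> in F. minimal_on (power_cost \<gamma> a) R B M S"
      unfolding minimal_on_def using parts by simp
  qed
qed

end

section \<open>Good configurations\<close>

definition exponent_filter :: "exponent \<Rightarrow> real filter" where
  "exponent_filter \<gamma> = (case \<gamma> of Minus_Infinity \<Rightarrow> at_bot | Exponent g \<Rightarrow> principal {g} | One_Minus \<Rightarrow> at_left 1
     | One_Plus \<Rightarrow> at_right 1 | Plus_Infinity \<Rightarrow> at_top)"

text \<open>Stable and altruistic matchings do not depend on \<open>a\<close>; their description by
  a filter uses weight 1.\<close>

definition exponent_weight :: "exponent \<Rightarrow> real \<Rightarrow> real" where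
  "exponent_weight \<gamma> a = (if \<gamma> = Minus_Infinity \<or> \<gamma> = Plus_Infinity then 1 else a)"

text \<open>The properties that hold almost surely for all exponents and weights at once. Separation
  of costs at a real exponent stays outside, as its null set depends on the exponent and the
  weight.\<close>

locale good_points = points +
  assumes distinct: "distinct_lengths R B" and dips: "dips R B" "dips B R" and surge: "surge R B" "surge B R"
begin

lemma minimal_matchings_eq:
  "minimal_matchings \<gamma> a R B = {M. eventually_minimal (exponent_filter \<gamma>) (exponent_weight \<gamma> a) R B M}"
proof -
  have "stable R B M \<longleftrightarrow> eventually_minimal at_bot 1 R B M" for M
    using stable_imp_eventually_minimal[OF _ distinct disjoint] eventually_minimal_imp_stable[OF _ disjoint] by blast
  moreover have "minimal (power_cost g a) R B M \<longleftrightarrow> eventually_minimal (principal {g}) a R B M" for g M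
    unfolding minimal_def eventually_minimal_def eventually_principal by simp
  ultimately show ?thesis
    unfolding minimal_matchings_def exponent_filter_def exponent_weight_def
    by (cases \<gamma>) (auto simp: altruistic_iff[OF disjoint] eventually_minimal_def)
qed

lemma minimal_matchings_convex:
  assumes "\<gamma> \<in> Exponent ` {1<..} \<union> {Plus_Infinity, One_Plus}" "a > 0"
  shows "minimal_matchings \<gamma> a R B = {M. is_matching R B M \<and> monotone_matching M \<and> unmatched R B M = {}}"
proof -
  have "exponent_filter \<gamma> \<noteq> bot"
    using assms(1) unfolding exponent_filter_def by (auto simp: principal_eq_bot_iff)
  moreover have "\<forall>\<^sub>F g in exponent_filter \<gamma>. 1 < g"
    using assms(1) eventually_gt_at_top[of "1::real"] eventually_at_right_less[of "1::real"]
    unfolding exponent_filter_def by (auto simp: eventually_principal)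
  moreover have "0 < exponent_weight \<gamma> a" using assms unfolding exponent_weight_def by auto
  ultimately show ?thesis unfolding minimal_matchings_eq using convex_iff[OF surge] by auto
qed

lemma tame_exponent:
  assumes "\<gamma> \<in> Exponent ` {..<1} \<union> {Minus_Infinity}" "a > 0"
  shows "tame (exponent_filter \<gamma>) (exponent_weight \<gamma> a)"
  using assms tame_at_bot tame_power[OF assms(2)] unfolding exponent_filter_def exponent_weight_def by auto

lemma minimal_matchings_one_minus:
  assumes "a > 0"
  shows "minimal_matchings One_Minus a R B = {M. directed_perfect M}"
  unfolding minimal_matchings_eq exponent_filter_def exponent_weight_def
  using one_minus_imp_directed_perfect[OF _ assms dips(1)] directed_perfect_imp_one_minus[OF _ assms] by auto

lemma minimal_matchings_unique:
  assumes \<gamma>: "\<gamma> \<in> Exponent ` {..<1} \<union> {Minus_Infinity}" and a: "a > 0"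
    and sep: "\<And>g. \<gamma> = Exponent g \<Longrightarrow> separated (principal {g}) a R B"
  shows "\<exists>!M. M \<in> minimal_matchings \<gamma> a R B"
proof -
  have "comparable (principal {g}) a R B" for g unfolding comparable_def eventually_principal by auto
  then have "separated (exponent_filter \<gamma>) (exponent_weight \<gamma> a) R B" "comparable (exponent_filter \<gamma>) (exponent_weight \<gamma> a) R B"
    using \<gamma> sep distinct_lengths_separated[OF distinct disjoint] unfolding exponent_filter_def exponent_weight_def by auto
  from tame_unique_exists[OF tame_exponent[OF \<gamma> a] this dips(1)] show ?thesis unfolding minimal_matchings_eq by simp
qed

lemma minimal_matchings_finite_difference:
  assumes \<gamma>: "\<gamma> \<in> Exponent ` {..<1} \<union> {Minus_Infinity}" "\<gamma>' \<in> Exponent ` {..<1} \<union> {Minus_Infinity, One_Minus}"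
    and a: "a > 0" "a' > 0" and M: "M \<in> minimal_matchings \<gamma> a R B" "M' \<in> minimal_matchings \<gamma>' a' R B"
  shows "finite_difference R B M M'"
proof (cases "\<gamma>' = One_Minus")
  case True
  then have "directed_perfect M'" using M(2) minimal_matchings_one_minus[OF a(2)] by simp
  then show ?thesis
    using directed_finite_difference[OF _ tame_exponent[OF \<gamma>(1) a(1)] _ dips] M(1) unfolding minimal_matchings_eq by simp
next
  case False
  then have "tame (exponent_filter \<gamma>') (exponent_weight \<gamma>' a')" using tame_exponent[OF _ a(2)] \<gamma>(2) by auto
  then show ?thesis
    using tame_finite_difference[OF _ _ tame_exponent[OF \<gamma>(1) a(1)] _ dips(1)] M unfolding minimal_matchings_eq by simp
qed

lemma minimal_matchings_weight:
  assumes "\<gamma> \<in> {Minus_Infinity, One_Minus, Plus_Infinity}" "a > 0" "a' > 0"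
  shows "minimal_matchings \<gamma> a R B = minimal_matchings \<gamma> a' R B"
proof (cases "\<gamma> = One_Minus")
  case True
  then show ?thesis using assms minimal_matchings_one_minus by simp
next
  case False
  then have "exponent_weight \<gamma> a = exponent_weight \<gamma> a'" using assms(1) unfolding exponent_weight_def by auto
  then show ?thesis unfolding minimal_matchings_eq by simp
qed

end

section \<open>Independent Poisson processes\<close>

text \<open>Independence is given for sets numbered by an initial segment of the naturals; an
  enumeration transfers it to arbitrary finite index sets.\<close>

lemma (in prob_space) poisson_process_prod:
  assumes X: "poisson_process M r X" and J: "finite J" and A: "\<And>j. j \<in> J \<Longrightarrow> A j \<in> sets borel \<and> bounded (A j)"
    and dis: "disjoint_family_on A J"
  shows "prob {\<omega>\<in>space M. \<forall>j\<in>J. card (X \<omega> \<inter> A j) \<in> K j} = (\<Prod>j\<in>J. prob {\<omega>\<in>space M. card (X \<omega> \<inter> A j) \<in> K j})"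
proof (cases "J = {}")
  case True
  then show ?thesis using prob_space by simp
next
  case False
  obtain h where h: "bij_betw h {..<card J} J" using ex_bij_betw_nat_finite[OF J] by (metis lessThan_atLeast0)
  have inj: "inj_on h {..<card J}" and im: "h ` {..<card J} = J" using h unfolding bij_betw_def by auto
  have ne: "{..<card J} \<noteq> {}" using False im by (metis image_empty)
  have hJ: "h i \<in> J" if "i < card J" for i using im that by auto
  have ind: "indep_vars (\<lambda>_. count_space UNIV) (\<lambda>i \<omega>. card (X \<omega> \<inter> A (h i))) {..<card J}"
  proof -
    have dd: "disjoint_family_on (\<lambda>i. A (h i)) {..<card J}"
      unfolding disjoint_family_on_def
    proof (intro ballI impI)
      fix m n assume mn: "m \<in> {..<card J}" "n \<in> {..<card J}" "m \<noteq> n"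
      then have "h m \<noteq> h n" using inj_onD[OF inj] by blast
      then show "A (h m) \<inter> A (h n) = {}" using dis mn hJ unfolding disjoint_family_on_def by auto
    qed
    have ab: "\<forall>i<card J. A (h i) \<in> sets borel \<and> bounded (A (h i))" using A hJ by auto
    have P: "\<forall>(n::nat) A. (\<forall>i<n. A i \<in> sets borel \<and> bounded (A i)) \<longrightarrow> disjoint_family_on A {..<n} \<longrightarrow>
        indep_vars (\<lambda>_. count_space UNIV) (\<lambda>i \<omega>. card (X \<omega> \<inter> A i)) {..<n}"
      using X unfolding poisson_process_def by (elim conjE)
    show ?thesis by (rule P[THEN spec, THEN spec, THEN mp, THEN mp, OF ab dd])
  qed
  have "prob {\<omega>\<in>space M. \<forall>j\<in>J. card (X \<omega> \<inter> A j) \<in> K j} =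
      prob (\<Inter>i\<in>{..<card J}. (\<lambda>\<omega>. card (X \<omega> \<inter> A (h i))) -` K (h i) \<inter> space M)"
  proof (rule arg_cong[where f = prob])
    have "(\<forall>j\<in>J. Q j) \<longleftrightarrow> (\<forall>i\<in>{..<card J}. Q (h i))" for Q
      using hJ im by (metis imageE lessThan_iff)
    then have "{\<omega>\<in>space M. \<forall>j\<in>J. card (X \<omega> \<inter> A j) \<in> K j} =
        {\<omega>\<in>space M. \<forall>i\<in>{..<card J}. card (X \<omega> \<inter> A (h i)) \<in> K (h i)}" by (simp only:)
    also have "\<dots> = (\<Inter>i\<in>{..<card J}. (\<lambda>\<omega>. card (X \<omega> \<inter> A (h i))) -` K (h i) \<inter> space M)"
      using ne by blast
    finally show "{\<omega>\<in>space M. \<forall>j\<in>J. card (X \<omega> \<inter> A j) \<in> K j} =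
      (\<Inter>i\<in>{..<card J}. (\<lambda>\<omega>. card (X \<omega> \<inter> A (h i))) -` K (h i) \<inter> space M)" .
  qed
  also have "\<dots> = (\<Prod>i\<in>{..<card J}. prob ((\<lambda>\<omega>. card (X \<omega> \<inter> A (h i))) -` K (h i) \<inter> space M))"
    by (rule indep_varsD_finite[OF ind ne]) auto
  also have "\<dots> = (\<Prod>j\<in>J. prob ((\<lambda>\<omega>. card (X \<omega> \<inter> A j)) -` K j \<inter> space M))"
    by (subst im[symmetric], subst prod.reindex[OF inj]) simp
  also have "\<dots> = (\<Prod>j\<in>J. prob {\<omega>\<in>space M. card (X \<omega> \<inter> A j) \<in> K j})"
    by (intro prod.cong refl arg_cong[where f = prob]) auto
  finally show ?thesis .
qed

lemma process_events_card:
  assumes "finite J" "\<And>j. j \<in> J \<Longrightarrow> A j \<in> sets borel \<and> bounded (A j)"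
  shows "{\<omega>\<in>space P. \<forall>j\<in>J. card (X \<omega> \<inter> A j) \<in> K j} \<in> process_events P X"
proof -
  let ?G = "{{\<omega> \<in> space P. card (X \<omega> \<inter> A) = k} | A k. A \<in> sets borel \<and> bounded A}"
  have "?G \<subseteq> Pow (space P)" by auto
  then interpret sigma_algebra "space P" "process_events P X"
    unfolding process_events_def by (rule sigma_algebra_sigma_sets)
  have one: "{\<omega>\<in>space P. card (X \<omega> \<inter> A j) \<in> K j} \<in> process_events P X" if "j \<in> J" for j
  proof -
    have "{\<omega>\<in>space P. card (X \<omega> \<inter> A j) = k} \<in> process_events P X" for k
      unfolding process_events_def using assms(2)[OF that] by (intro sigma_sets.Basic) blast
    then have "(\<Union>k\<in>K j. {\<omega>\<in>space P. card (X \<omega> \<inter> A j) = k}) \<in> process_events P X"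
      by (intro countable_UN'') auto
    moreover have "(\<Union>k\<in>K j. {\<omega>\<in>space P. card (X \<omega> \<inter> A j) = k}) = {\<omega>\<in>space P. card (X \<omega> \<inter> A j) \<in> K j}" by auto
    ultimately show ?thesis by simp
  qed
  show ?thesis using assms(1) one
    by (intro sets_Collect_finite_All) auto
qed

text \<open>The colour is an index, \<open>True\<close> for the first process, so statements
  involving points of both colours are uniform and exchanging colours is negating the index.\<close>

locale two_processes = prob_space M for M :: "'w measure" +
  fixes C :: "bool \<Rightarrow> 'w \<Rightarrow> real set"
  assumes poisson: "poisson_process M 1 (C c)" and indep: "indep_processes M (C True) (C False)"
begin

section \<open>Joint independence of counts of both colours\<close>

lemma point_process: "point_process M (C c)"
  using poisson unfolding poisson_process_def by auto

lemma locally_finite: "\<omega> \<in> space M \<Longrightarrow> bounded A \<Longrightarrow> finite (C c \<omega> \<inter> A)"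
  using point_process unfolding point_process_def by auto

lemma measurable_count: "A \<in> sets borel \<Longrightarrow> bounded A \<Longrightarrow> (\<lambda>\<omega>. card (C c \<omega> \<inter> A)) \<in> measurable M (count_space UNIV)"
  using point_process unfolding point_process_def by auto

lemma sets_count: "A \<in> sets borel \<Longrightarrow> bounded A \<Longrightarrow> {\<omega>\<in>space M. card (C c \<omega> \<inter> A) \<in> K} \<in> events"
  using measurable_sets[OF measurable_count[of A c], of K] by (simp add: vimage_def Int_def conj_commute)

lemma prob_count:
  "A \<in> sets borel \<Longrightarrow> bounded A \<Longrightarrow>
   prob {\<omega>\<in>space M. card (C c \<omega> \<inter> A) = k} = exp (- measure lborel A) * measure lborel A ^ k / fact k"
  using poisson[of c] unfolding poisson_process_def by auto

text \<open>Grouping by colour leaves independence within each process, which needs disjointness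
  inside one colour only, and independence between the two.\<close>

lemma prob_prod:
  assumes J: "finite J" and A: "\<And>j. j \<in> J \<Longrightarrow> A j \<in> sets borel \<and> bounded (A j)"
    and dis: "\<And>i j. i \<in> J \<Longrightarrow> j \<in> J \<Longrightarrow> i \<noteq> j \<Longrightarrow> col i = col j \<Longrightarrow> A i \<inter> A j = {}"
  shows "prob {\<omega>\<in>space M. \<forall>j\<in>J. card (C (col j) \<omega> \<inter> A j) \<in> K j} =
    (\<Prod>j\<in>J. prob {\<omega>\<in>space M. card (C (col j) \<omega> \<inter> A j) \<in> K j})"
proof -
  define J' where "J' c = {j\<in>J. col j = c}" for c
  let ?E = "\<lambda>c. {\<omega>\<in>space M. \<forall>j\<in>J' c. card (C c \<omega> \<inter> A j) \<in> K j}"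
  have fin: "finite (J' c)" for c unfolding J'_def using J by auto
  have AJ: "A j \<in> sets borel \<and> bounded (A j)" if "j \<in> J' c" for c j using that A unfolding J'_def by auto
  have 1: "prob (?E c) = (\<Prod>j\<in>J' c. prob {\<omega>\<in>space M. card (C c \<omega> \<inter> A j) \<in> K j})" for c
    by (rule poisson_process_prod[OF poisson fin]) (use AJ dis in \<open>auto simp: disjoint_family_on_def J'_def\<close>)
  have E: "?E c \<in> process_events M (C c)" for c by (rule process_events_card[OF fin AJ])
  have "{\<omega>\<in>space M. \<forall>j\<in>J. card (C (col j) \<omega> \<inter> A j) \<in> K j} = ?E True \<inter> ?E False"
    unfolding J'_def by (auto, (metis (full_types))+)
  also have "prob (?E True \<inter> ?E False) = prob (?E True) * prob (?E False)"
    using indep E unfolding indep_processes_def by (intro indep_setD) auto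
  also have "\<dots> = (\<Prod>j\<in>J' True. prob {\<omega>\<in>space M. card (C (col j) \<omega> \<inter> A j) \<in> K j}) *
     (\<Prod>j\<in>J' False. prob {\<omega>\<in>space M. card (C (col j) \<omega> \<inter> A j) \<in> K j})"
    unfolding 1 by (intro arg_cong2[where f = "(*)"] prod.cong) (auto simp: J'_def)
  also have "\<dots> = (\<Prod>j\<in>J' True \<union> J' False. prob {\<omega>\<in>space M. card (C (col j) \<omega> \<inter> A j) \<in> K j})"
    by (rule prod.union_disjoint[symmetric, OF fin fin]) (auto simp: J'_def)
  also have "J' True \<union> J' False = J" unfolding J'_def by auto
  finally show ?thesis .
qed

lemma indep_counts:
  assumes A: "\<And>j. j \<in> J \<Longrightarrow> A j \<in> sets borel \<and> bounded (A j)"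
    and dis: "\<And>i j. i \<in> J \<Longrightarrow> j \<in> J \<Longrightarrow> i \<noteq> j \<Longrightarrow> col i = col j \<Longrightarrow> A i \<inter> A j = {}"
  shows "indep_vars (\<lambda>_. count_space UNIV) (\<lambda>j \<omega>. card (C (col j) \<omega> \<inter> A j)) J"
  unfolding indep_vars_def2
proof (intro conjI ballI)
  show "random_variable (count_space UNIV) (\<lambda>\<omega>. card (C (col j) \<omega> \<inter> A j))" if "j \<in> J" for j
    using measurable_count A that by auto
  show "indep_sets (\<lambda>i. {(\<lambda>\<omega>. card (C (col i) \<omega> \<inter> A i)) -` K \<inter> space M |K. K \<in> sets (count_space UNIV)}) J"
    unfolding indep_sets_def
  proof (intro conjI ballI allI impI)
    show "{(\<lambda>\<omega>. card (C (col i) \<omega> \<inter> A i)) -` K \<inter> space M |K. K \<in> sets (count_space UNIV)} \<subseteq> events" if "i \<in> J" for i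
      using measurable_sets[OF measurable_count] A[OF that] by auto
    fix I E assume I: "I \<subseteq> J" "I \<noteq> {}" "finite I"
      and E: "E \<in> (\<Pi> i\<in>I. {(\<lambda>\<omega>. card (C (col i) \<omega> \<inter> A i)) -` K \<inter> space M |K. K \<in> sets (count_space UNIV)})"
    then have "\<forall>i\<in>I. \<exists>K. E i = (\<lambda>\<omega>. card (C (col i) \<omega> \<inter> A i)) -` K \<inter> space M" by (auto simp: Pi_iff)
    then obtain K where K: "\<And>i. i \<in> I \<Longrightarrow> E i = (\<lambda>\<omega>. card (C (col i) \<omega> \<inter> A i)) -` K i \<inter> space M"
      using bchoice[of I "\<lambda>i K. E i = (\<lambda>\<omega>. card (C (col i) \<omega> \<inter> A i)) -` K \<inter> space M"] by auto
    have E': "E i = {\<omega>\<in>space M. card (C (col i) \<omega> \<inter> A i) \<in> K i}" if "i \<in> I" for i using K[OF that] by auto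
    have "prob (\<Inter>j\<in>I. E j) = prob {\<omega>\<in>space M. \<forall>j\<in>I. card (C (col j) \<omega> \<inter> A j) \<in> K j}"
      using E' I(2) by (intro arg_cong[where f = prob]) auto
    also have "\<dots> = (\<Prod>j\<in>I. prob {\<omega>\<in>space M. card (C (col j) \<omega> \<inter> A j) \<in> K j})"
    proof (rule prob_prod[OF I(3)])
      show "A j \<in> sets borel \<and> bounded (A j)" if "j \<in> I" for j using A that I(1) by blast
      show "A i \<inter> A j = {}" if "i \<in> I" "j \<in> I" "i \<noteq> j" "col i = col j" for i j using dis[of i j] that I(1) by blast
    qed
    also have "\<dots> = (\<Prod>j\<in>I. prob (E j))" using E' by simp
    finally show "prob (\<Inter>j\<in>I. E j) = (\<Prod>j\<in>I. prob (E j))" .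
  qed
qed

text \<open>The leftmost point in an interval has an atomless law, and every point of a configuration is
  the leftmost one of some interval with rational endpoints.\<close>

definition leftmost :: "bool \<Rightarrow> real \<Rightarrow> real \<Rightarrow> 'w \<Rightarrow> real" where
  "leftmost c p q \<omega> = (if C c \<omega> \<inter> {p<..q} = {} then q + 1 else Min (C c \<omega> \<inter> {p<..q}))"

lemma finite_interval: "\<omega> \<in> space M \<Longrightarrow> finite (C c \<omega> \<inter> {p<..q})"
  by (rule locally_finite) auto

lemma leftmost_in:
  assumes "\<omega> \<in> space M" "leftmost c p q \<omega> \<le> q"
  shows "leftmost c p q \<omega> \<in> C c \<omega> \<inter> {p<..q}"
  using assms Min_in[OF finite_interval[OF assms(1), of c p q]] unfolding leftmost_def by (auto split: if_splits)

text \<open>The value \<open>q + 1\<close> for an empty interval lies beyond \<open>q\<close>, so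
  for every \<open>t\<close> the event is expressed by one count; from \<open>t = q + 1\<close> on
  it is certain. Measurability and independence of counts carry over in this way.\<close>

lemma leftmost_le_iff:
  assumes \<omega>: "\<omega> \<in> space M"
  shows "leftmost c p q \<omega> \<le> t \<longleftrightarrow> card (C c \<omega> \<inter> {p<..min t q}) \<in> (if q + 1 \<le> t then UNIV else {0<..})"
proof (cases "q + 1 \<le> t")
  case True
  have "leftmost c p q \<omega> \<le> q + 1"
  proof (cases "C c \<omega> \<inter> {p<..q} = {}")
    case False
    then show ?thesis using Min_in[OF finite_interval[OF \<omega>] False] unfolding leftmost_def by simp
  qed (simp add: leftmost_def)
  then show ?thesis using True by simp
next
  case False
  have fin: "finite (C c \<omega> \<inter> {p<..min t q})" using finite_interval[OF \<omega>] .
  have "leftmost c p q \<omega> \<le> t \<longleftrightarrow> C c \<omega> \<inter> {p<..min t q} \<noteq> {}"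
  proof
    assume l: "leftmost c p q \<omega> \<le> t"
    then have "leftmost c p q \<omega> \<le> q" using False Min_in[OF finite_interval[OF \<omega>, of c p q]]
      unfolding leftmost_def by (auto split: if_splits)
    from leftmost_in[OF \<omega> this] l show "C c \<omega> \<inter> {p<..min t q} \<noteq> {}" by auto
  next
    assume "C c \<omega> \<inter> {p<..min t q} \<noteq> {}"
    then obtain z where z: "z \<in> C c \<omega>" "p < z" "z \<le> t" "z \<le> q" by auto
    then have "Min (C c \<omega> \<inter> {p<..q}) \<le> z" using finite_interval[OF \<omega>] by (intro Min_le) auto
    then show "leftmost c p q \<omega> \<le> t" using z unfolding leftmost_def by auto
  qed
  then show ?thesis using False fin by (auto simp: card_gt_0_iff)
qed

lemma leftmost_le_events:
  "{\<omega>\<in>space M. leftmost c p q \<omega> \<le> t} =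
    {\<omega>\<in>space M. card (C c \<omega> \<inter> {p<..min t q}) \<in> (if q + 1 \<le> t then UNIV else {0<..})}"
  using leftmost_le_iff by blast

lemma measurable_leftmost [measurable]: "leftmost c p q \<in> borel_measurable M"
  unfolding borel_measurable_iff_le leftmost_le_events
  by (intro allI sets_count) auto

lemma indep_leftmost:
  fixes J :: "'i set"
  assumes J: "finite J"
    and dis: "\<And>i j. i \<in> J \<Longrightarrow> j \<in> J \<Longrightarrow> i \<noteq> j \<Longrightarrow> col i = col j \<Longrightarrow> {p i<..q i} \<inter> {p j<..q j} = {}"
  shows "indep_vars (\<lambda>_. borel) (\<lambda>j. leftmost (col j) (p j) (q j)) J"
proof (cases "J = {}")
  case True
  then show ?thesis by (simp add: indep_vars_def2 indep_sets_def)
next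
  case False
  \<comment> \<open>\<open>UNIV\<close> is included so that a coordinate may be left free in the
    product formula.\<close>
  let ?G = "insert UNIV (range (\<lambda>t::real. {..t}))"
  have gen: "sets (borel :: real measure) = sigma_sets UNIV ?G"
  proof -
    have "sets (borel :: real measure) = sigma_sets UNIV (range (\<lambda>t::real. {..t}))"
      by (subst borel_eq_atMost) (simp add: sets_measure_of)
    also have "\<dots> = sigma_sets UNIV ?G"
    proof (rule sigma_sets_eqI)
      fix A assume "A \<in> ?G"
      then show "A \<in> sigma_sets UNIV (range (\<lambda>t::real. {..t}))"
        using sigma_sets_top[of UNIV "range (\<lambda>t::real. {..t})"] by auto
    qed auto
    finally show ?thesis .
  qed
  have "\<forall>A\<in>(\<Pi> i\<in>J. ?G). prob (\<Inter>j\<in>J. leftmost (col j) (p j) (q j) -` A j \<inter> space M) =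
      (\<Prod>j\<in>J. prob (leftmost (col j) (p j) (q j) -` A j \<inter> space M))"
  proof
    fix A assume A: "A \<in> (\<Pi> i\<in>J. ?G)"
    have "\<exists>tK. leftmost (col j) (p j) (q j) -` A j \<inter> space M =
        {\<omega>\<in>space M. card (C (col j) \<omega> \<inter> {p j<..min (fst tK) (q j)}) \<in> snd tK}"
      if j: "j \<in> J" for j
    proof (cases "A j = UNIV")
      case True
      then show ?thesis by (intro exI[of _ "(0, UNIV)"]) auto
    next
      case False
      then obtain t where "A j = {..t}" using A j by (auto simp: Pi_iff)
      then have "leftmost (col j) (p j) (q j) -` A j \<inter> space M = {\<omega>\<in>space M. leftmost (col j) (p j) (q j) \<omega> \<le> t}" by auto
      then show ?thesis
        unfolding leftmost_le_events by (intro exI[of _ "(t, if q j + 1 \<le> t then UNIV else {0<..})"]) simp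
    qed
    then have "\<forall>j\<in>J. \<exists>tK. leftmost (col j) (p j) (q j) -` A j \<inter> space M =
        {\<omega>\<in>space M. card (C (col j) \<omega> \<inter> {p j<..min (fst tK) (q j)}) \<in> snd tK}" by blast
    from bchoice[OF this] obtain tK where tK': "\<forall>j\<in>J. leftmost (col j) (p j) (q j) -` A j \<inter> space M =
        {\<omega>\<in>space M. card (C (col j) \<omega> \<inter> {p j<..min (fst (tK j)) (q j)}) \<in> snd (tK j)}" ..
    define t K where "t j = fst (tK j)" and "K j = snd (tK j)" for j
    have tK: "leftmost (col j) (p j) (q j) -` A j \<inter> space M =
        {\<omega>\<in>space M. card (C (col j) \<omega> \<inter> {p j<..min (t j) (q j)}) \<in> K j}" if "j \<in> J" for j
      using tK' that unfolding t_def K_def by blast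
    have "(\<Inter>j\<in>J. leftmost (col j) (p j) (q j) -` A j \<inter> space M) =
        (\<Inter>j\<in>J. {\<omega>\<in>space M. card (C (col j) \<omega> \<inter> {p j<..min (t j) (q j)}) \<in> K j})"
      by (intro INF_cong refl tK)
    also have "\<dots> = {\<omega>\<in>space M. \<forall>j\<in>J. card (C (col j) \<omega> \<inter> {p j<..min (t j) (q j)}) \<in> K j}"
      using False by blast
    finally have "prob (\<Inter>j\<in>J. leftmost (col j) (p j) (q j) -` A j \<inter> space M) =
        prob {\<omega>\<in>space M. \<forall>j\<in>J. card (C (col j) \<omega> \<inter> {p j<..min (t j) (q j)}) \<in> K j}"
      by (rule arg_cong)
    also have "\<dots> = (\<Prod>j\<in>J. prob {\<omega>\<in>space M. card (C (col j) \<omega> \<inter> {p j<..min (t j) (q j)}) \<in> K j})"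
    proof (rule prob_prod[OF J])
      fix i j assume ij: "i \<in> J" "j \<in> J" "i \<noteq> j" "col i = col j"
      show "{p i<..min (t i) (q i)} \<inter> {p j<..min (t j) (q j)} = {}" using dis[OF ij] by auto
    qed auto
    also have "\<dots> = (\<Prod>j\<in>J. prob (leftmost (col j) (p j) (q j) -` A j \<inter> space M))" using tK by simp
    finally show "prob (\<Inter>j\<in>J. leftmost (col j) (p j) (q j) -` A j \<inter> space M) =
      (\<Prod>j\<in>J. prob (leftmost (col j) (p j) (q j) -` A j \<inter> space M))" .
  qed
  note prod = this
  have stable: "Int_stable ?G" unfolding Int_stable_def by (auto simp: image_iff)
  show ?thesis
  proof (rule iffD2[OF indep_vars_finite[OF False J, where E = "\<lambda>_. ?G"]])
    show "sets borel = sigma_sets (space borel) ?G" for i :: 'i using gen by simp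
    show "Int_stable ?G" for i :: 'i by (rule stable)
    show "?G \<subseteq> Pow (space borel)" for i :: 'i by simp
  qed (use prod in \<open>simp_all add: measurable_leftmost\<close>)
qed

text \<open>The count of a single position vanishes almost surely, having mean 0, and countably many
  null events have a null union.\<close>

lemma leftmost_atomless:
  assumes "countable A"
  shows "prob {\<omega>\<in>space M. leftmost c p q \<omega> \<in> A \<inter> {..q}} = 0"
proof -
  have one: "{\<omega>\<in>space M. leftmost c p q \<omega> = x \<and> x \<le> q} \<in> null_sets M" for x
  proof (rule null_setsI)
    have s: "{\<omega>\<in>space M. card (C c \<omega> \<inter> {x}) \<noteq> 0} \<in> events"
      using sets_count[where A = "{x}" and c = c and K = "- {0}"] by simp
    have s0: "{\<omega>\<in>space M. card (C c \<omega> \<inter> {x}) = 0} \<in> events"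
      using sets_count[where A = "{x}" and c = c and K = "{0}"] by simp
    have "prob {\<omega>\<in>space M. card (C c \<omega> \<inter> {x}) \<noteq> 0} = 1 - prob {\<omega>\<in>space M. card (C c \<omega> \<inter> {x}) = 0}"
      using s0 by (subst prob_neg[symmetric]) auto
    also have "\<dots> = 0" using prob_count[of "{x}" c 0] by simp
    finally have "prob {\<omega>\<in>space M. card (C c \<omega> \<inter> {x}) \<noteq> 0} = 0" .
    moreover have "{\<omega>\<in>space M. leftmost c p q \<omega> = x \<and> x \<le> q} \<subseteq> {\<omega>\<in>space M. card (C c \<omega> \<inter> {x}) \<noteq> 0}"
      using leftmost_in by auto
    ultimately have "prob {\<omega>\<in>space M. leftmost c p q \<omega> = x \<and> x \<le> q} \<le> 0"
      using finite_measure_mono[OF _ s] by simp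
    then show "emeasure M {\<omega>\<in>space M. leftmost c p q \<omega> = x \<and> x \<le> q} = 0"
      unfolding emeasure_eq_measure by (simp add: ennreal_neg)
  qed measurable
  have "(\<Union>x\<in>A. {\<omega>\<in>space M. leftmost c p q \<omega> = x \<and> x \<le> q}) \<in> null_sets M"
    using assms one by (rule null_sets_UN')
  moreover have "(\<Union>x\<in>A. {\<omega>\<in>space M. leftmost c p q \<omega> = x \<and> x \<le> q}) = {\<omega>\<in>space M. leftmost c p q \<omega> \<in> A \<inter> {..q}}" by auto
  ultimately show ?thesis by (simp add: null_sets_def measure_def)
qed

end

section \<open>Absence of coincidences\<close>

text \<open>As a function of \<open>x\<close> the difference is strictly monotone on each of the
  three intervals cut out by \<open>y1\<close> and \<open>y2\<close>: by nesting on the outer two,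
  by monotonicity of both costs on the middle one. So it takes each value at most once on each of
  them.\<close>

lemma concave_section_countable:
  assumes cc: "concave_cost f" and ne: "y1 \<noteq> y2"
  shows "countable {x. f (y1 - x) - f (y2 - x) = C}"
proof -
  have main: "countable {x. f (y1 - x) - f (y2 - x) = C}" if lt: "y1 < y2" for y1 y2 C
  proof -
    let ?h = "\<lambda>x. f (y1 - x) - f (y2 - x)"
    have c: "countable {x \<in> I. ?h x = C}" if inj: "\<And>x x'. x \<in> I \<Longrightarrow> x' \<in> I \<Longrightarrow> x < x' \<Longrightarrow> ?h x \<noteq> ?h x'" for I
    proof (cases "{x \<in> I. ?h x = C} = {}")
      case False
      then obtain x0 where x0: "x0 \<in> I" "?h x0 = C" by blast
      have "x = x0" if x: "x \<in> I" "?h x = C" for x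
        using inj[OF x(1) x0(1)] inj[OF x0(1) x(1)] x(2) x0(2) by (cases x x0 rule: linorder_cases) simp_all
      then have "{x \<in> I. ?h x = C} \<subseteq> {x0}" by blast
      then show ?thesis by (rule countable_subset) simp
    next
      case True
      then show ?thesis by (simp only: countable_empty)
    qed
    have 1: "?h x \<noteq> ?h x'" if "x \<in> {..<y1}" "x' \<in> {..<y1}" "x < x'" for x x'
    proof -
      have "f (y2 - x) + f (y1 - x') < f (y1 - x) + f (y2 - x')"
        using concave_cost_nested(1)[OF cc, of x x' y1 y2] that lt by simp
      then show ?thesis by linarith
    qed
    have 2: "?h x \<noteq> ?h x'" if "x \<in> {y1<..<y2}" "x' \<in> {y1<..<y2}" "x < x'" for x x'
    proof -
      have "f (- (x - y1)) < f (- (x' - y1))" "f (y2 - x') < f (y2 - x)"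
        using concave_cost_mono(2)[OF cc, of "x - y1" "x' - y1"] concave_cost_mono(1)[OF cc, of "y2 - x'" "y2 - x"] that by auto
      then show ?thesis by simp
    qed
    have 3: "?h x \<noteq> ?h x'" if "x \<in> {y2<..}" "x' \<in> {y2<..}" "x < x'" for x x'
    proof -
      have "f (y1 - x') + f (y2 - x) < f (y1 - x) + f (y2 - x')"
        using concave_cost_nested(2)[OF cc, of y1 y2 x x'] that lt by simp
      then show ?thesis by linarith
    qed
    have "{x. ?h x = C} \<subseteq> {y1, y2} \<union> {x \<in> {..<y1}. ?h x = C} \<union> {x \<in> {y1<..<y2}. ?h x = C} \<union> {x \<in> {y2<..}. ?h x = C}"
      by auto
    moreover have "countable ({y1, y2} \<union> {x \<in> {..<y1}. ?h x = C} \<union> {x \<in> {y1<..<y2}. ?h x = C} \<union> {x \<in> {y2<..}. ?h x = C})"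
      by (intro countable_Un c 1 2 3) auto
    ultimately show ?thesis by (rule countable_subset)
  qed
  show ?thesis
  proof (cases "y1 < y2")
    case False
    then have "y2 < y1" using ne by simp
    moreover have "{x. f (y1 - x) - f (y2 - x) = C} = {x. f (y2 - x) - f (y1 - x) = - C}" by auto
    ultimately show ?thesis using main[of y2 y1 "- C"] by simp
  qed (rule main)
qed

text \<open>Rational endpoints keep the sites countable, so the null sets belonging to all finite
  families of sites can be united.\<close>

type_synonym site = "bool \<times> rat \<times> rat"

definition lower_end :: "site \<Rightarrow> real" where "lower_end j = of_rat (fst (snd j))"
definition upper_end :: "site \<Rightarrow> real" where "upper_end j = of_rat (snd (snd j))"

definition spread :: "site set \<Rightarrow> bool" where
  "spread J \<longleftrightarrow> finite J \<and> (\<forall>i\<in>J. \<forall>j\<in>J. i \<noteq> j \<longrightarrow> fst i = fst j \<longrightarrow>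
     {lower_end i<..upper_end i} \<inter> {lower_end j<..upper_end j} = {})"

section \<open>Conditioning on all sites but one\<close>

context two_processes
begin

definition site_point :: "site \<Rightarrow> 'w \<Rightarrow> real" where
  "site_point j = leftmost (fst j) (lower_end j) (upper_end j)"

definition occupied :: "site set \<Rightarrow> 'w \<Rightarrow> bool" where
  "occupied J \<omega> \<longleftrightarrow> (\<forall>j\<in>J. site_point j \<omega> \<le> upper_end j)"

text \<open>Given the points at the other sites, which are independent of the one at
  \<open>j0\<close>, the relation confines the latter to a countable set; integrating over the
  others gives probability 0. \<open>occupied\<close> discards the default value of
  \<open>leftmost\<close>, which may be an atom.\<close>

lemma null_relation:
  fixes \<Psi> :: "real \<Rightarrow> (site \<Rightarrow> real) \<Rightarrow> bool"
  assumes J: "spread J" and j0: "j0 \<in> J"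
    and meas: "Measurable.pred (borel \<Otimes>\<^sub>M PiM (J - {j0}) (\<lambda>_. borel)) (\<lambda>z. \<Psi> (fst z) (snd z))"
    and cnt: "\<And>v. countable {x. \<Psi> x v}"
  shows "AE \<omega> in M. occupied J \<omega> \<longrightarrow> \<not> \<Psi> (site_point j0 \<omega>) (restrict (\<lambda>j. site_point j \<omega>) (J - {j0}))"
proof -
  let ?N = "PiM (J - {j0}) (\<lambda>_. borel :: real measure)"
  let ?Y = "\<lambda>\<omega>. restrict (\<lambda>j. site_point j \<omega>) (J - {j0})"
  have ind: "indep_vars (\<lambda>_. borel) site_point J"
    unfolding site_point_def by (rule indep_leftmost) (use J in \<open>auto simp: spread_def\<close>)
  let ?S = "PiM {j0} (\<lambda>_. borel :: real measure)"
  let ?X = "\<lambda>\<omega>. restrict (\<lambda>j. site_point j \<omega>) {j0}"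
  have "indep_var ?S ?X ?N ?Y"
    by (rule indep_var_restrict[OF ind]) (use j0 in auto)
  note rv = this[unfolded indep_var_distribution_eq]
  let ?\<mu> = "distr M ?S ?X" and ?\<nu> = "distr M ?N ?Y"
  have m1[measurable]: "?X \<in> measurable M ?S" and m2[measurable]: "?Y \<in> measurable M ?N" using rv by auto
  interpret mu: prob_space ?\<mu> by (rule prob_space_distr[OF m1])
  interpret nu: prob_space ?\<nu> by (rule prob_space_distr[OF m2])
  interpret mn: pair_prob_space ?\<mu> ?\<nu> ..
  let ?Z = "{z \<in> space (?S \<Otimes>\<^sub>M ?N). \<Psi> (fst z j0) (snd z) \<and> fst z j0 \<le> upper_end j0}"
  have comp: "(\<lambda>z. (fst z j0, snd z)) \<in> measurable (?S \<Otimes>\<^sub>M ?N) (borel \<Otimes>\<^sub>M ?N)" by measurable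
  have [measurable]: "Measurable.pred (?S \<Otimes>\<^sub>M ?N) (\<lambda>z. \<Psi> (fst z j0) (snd z))"
    using measurable_compose[OF comp meas] by simp
  have Z: "?Z \<in> sets (?S \<Otimes>\<^sub>M ?N)" by measurable
  have "emeasure (distr M (?S \<Otimes>\<^sub>M ?N) (\<lambda>\<omega>. (?X \<omega>, ?Y \<omega>))) ?Z = emeasure (?\<mu> \<Otimes>\<^sub>M ?\<nu>) ?Z"
    using rv by simp
  also have "\<dots> = (\<integral>\<^sup>+v. emeasure ?\<mu> ((\<lambda>x. (x, v)) -` ?Z) \<partial>?\<nu>)"
    by (rule mn.emeasure_pair_measure_alt2) (use Z in \<open>simp cong: sets_pair_measure_cong\<close>)
  also have "\<dots> = (\<integral>\<^sup>+v. 0 \<partial>?\<nu>)"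
  proof (rule nn_integral_cong)
    fix v
    let ?A = "{x. \<Psi> x v} \<inter> {..upper_end j0}"
    have c: "countable ?A" using cnt[of v] by (rule countable_subset[rotated]) auto
    have b: "?A \<in> sets borel" using c by (rule sets.countable[rotated]) auto
    have b': "{f \<in> space ?S. f j0 \<in> ?A} \<in> sets ?S" using b by measurable
    have "emeasure ?\<mu> ((\<lambda>x. (x, v)) -` ?Z) \<le> emeasure ?\<mu> {f \<in> space ?S. f j0 \<in> ?A}"
      using b' by (intro emeasure_mono) (auto simp: space_pair_measure)
    also have "\<dots> = emeasure M (?X -` {f \<in> space ?S. f j0 \<in> ?A} \<inter> space M)"
      by (rule emeasure_distr[OF m1 b'])
    also have "?X -` {f \<in> space ?S. f j0 \<in> ?A} \<inter> space M = {\<omega>\<in>space M. site_point j0 \<omega> \<in> ?A}"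
      using measurable_space[OF m1] by auto
    also have "emeasure M \<dots> = 0"
      using leftmost_atomless[OF cnt[of v], of "fst j0" "lower_end j0" "upper_end j0"]
      unfolding site_point_def by (simp add: emeasure_eq_measure)
    finally show "emeasure ?\<mu> ((\<lambda>x. (x, v)) -` ?Z) = 0" unfolding le_zero_eq .
  qed
  finally have "emeasure (distr M (?S \<Otimes>\<^sub>M ?N) (\<lambda>\<omega>. (?X \<omega>, ?Y \<omega>))) ?Z = 0" by simp
  then have "emeasure M ((\<lambda>\<omega>. (?X \<omega>, ?Y \<omega>)) -` ?Z \<inter> space M) = 0"
    using Z by (subst (asm) emeasure_distr) auto
  moreover have "(\<lambda>\<omega>. (?X \<omega>, ?Y \<omega>)) -` ?Z \<inter> space M \<in> events"
    by (rule measurable_sets[OF _ Z]) measurable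
  ultimately have "(\<lambda>\<omega>. (?X \<omega>, ?Y \<omega>)) -` ?Z \<inter> space M \<in> null_sets M" by auto
  then show ?thesis
  proof (rule AE_I')
    show "{\<omega> \<in> space M. \<not> (occupied J \<omega> \<longrightarrow> \<not> \<Psi> (site_point j0 \<omega>) (?Y \<omega>))} \<subseteq> (\<lambda>\<omega>. (?X \<omega>, ?Y \<omega>)) -` ?Z \<inter> space M"
      using j0 measurable_space[OF m1] measurable_space[OF m2] unfolding occupied_def by (auto simp: space_pair_measure)
  qed
qed

text \<open>Each point is alone in its colour within some radius. Rational endpoints closer than
  half that radius isolate the point and also keep the intervals of different points of a colour
  disjoint.\<close>

lemma ex_sites:
  assumes \<omega>: "\<omega> \<in> space M" and P: "\<And>c. finite (P c)" "\<And>c. P c \<subseteq> C c \<omega>"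
  shows "\<exists>\<sigma>. (\<forall>c. \<forall>x\<in>P c. fst (\<sigma> c x) = c \<and> site_point (\<sigma> c x) \<omega> = x \<and> x \<le> upper_end (\<sigma> c x)) \<and>
    (\<forall>c. \<forall>x\<in>P c. \<forall>x'\<in>P c. x \<noteq> x' \<longrightarrow>
       {lower_end (\<sigma> c x)<..upper_end (\<sigma> c x)} \<inter> {lower_end (\<sigma> c x')<..upper_end (\<sigma> c x')} = {})"
proof -
  have iso: "\<exists>\<delta>>0. \<forall>y\<in>C c \<omega>. \<bar>y - x\<bar> < \<delta> \<longrightarrow> y = x" for c x
  proof -
    let ?A = "C c \<omega> \<inter> {x - 1..x + 1} - {x}"
    have fin: "finite ?A" using locally_finite[OF \<omega>, of "{x - 1..x + 1}" c] by auto
    define \<delta> where "\<delta> = Min (insert 1 ((\<lambda>y. \<bar>y - x\<bar>) ` ?A))"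
    have "\<delta> > 0" unfolding \<delta>_def using fin by (subst Min_gr_iff) auto
    moreover have "y = x" if y: "y \<in> C c \<omega>" "\<bar>y - x\<bar> < \<delta>" for y
    proof (rule ccontr)
      assume "y \<noteq> x"
      have "\<delta> \<le> 1" unfolding \<delta>_def using fin by (intro Min_le) auto
      then have "y \<in> ?A" using y \<open>y \<noteq> x\<close> by auto
      then have "\<delta> \<le> \<bar>y - x\<bar>" unfolding \<delta>_def using fin by (intro Min_le) auto
      then show False using y by simp
    qed
    ultimately show ?thesis by blast
  qed
  obtain \<delta> where \<delta>: "\<And>c x. \<delta> c x > 0" "\<And>c x y. y \<in> C c \<omega> \<Longrightarrow> \<bar>y - x\<bar> < \<delta> c x \<Longrightarrow> y = x"
    using iso by metis
  have "\<exists>r. x - \<delta> c x / 2 < of_rat r \<and> of_rat r < x" for c x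
    using of_rat_dense[of "x - \<delta> c x / 2" x] \<delta>(1)[of c x] by auto
  note ex_p = this
  define p where "p c x = (SOME r. x - \<delta> c x / 2 < of_rat r \<and> of_rat r < x)" for c x
  have p: "x - \<delta> c x / 2 < of_rat (p c x) \<and> of_rat (p c x) < x" for c x
    unfolding p_def by (rule someI_ex[OF ex_p])
  have "\<exists>r. x < of_rat r \<and> of_rat r < x + \<delta> c x / 2" for c x
    using of_rat_dense[of x "x + \<delta> c x / 2"] \<delta>(1)[of c x] by auto
  note ex_q = this
  define q where "q c x = (SOME r. x < of_rat r \<and> of_rat r < x + \<delta> c x / 2)" for c x
  have q: "x < of_rat (q c x) \<and> of_rat (q c x) < x + \<delta> c x / 2" for c x
    unfolding q_def by (rule someI_ex[OF ex_q])
  define \<sigma> where "\<sigma> c x = (c, p c x, q c x)" for c x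
  have ends: "x - \<delta> c x / 2 < lower_end (\<sigma> c x) \<and> lower_end (\<sigma> c x) < x \<and> x < upper_end (\<sigma> c x) \<and> upper_end (\<sigma> c x) < x + \<delta> c x / 2" for c x
    using p q unfolding \<sigma>_def lower_end_def upper_end_def by auto
  have pt: "site_point (\<sigma> c x) \<omega> = x" if x: "x \<in> P c" for c x
  proof -
    have "y = x" if y: "y \<in> C c \<omega> \<inter> {lower_end (\<sigma> c x)<..upper_end (\<sigma> c x)}" for y
    proof -
      have "\<bar>y - x\<bar> < \<delta> c x" using y ends[of x c] by auto
      then show ?thesis using \<delta>(2) y by blast
    qed
    moreover have "x \<in> C c \<omega> \<inter> {lower_end (\<sigma> c x)<..upper_end (\<sigma> c x)}" using ends[of x c] x P(2)[of c] by auto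
    ultimately have "C c \<omega> \<inter> {lower_end (\<sigma> c x)<..upper_end (\<sigma> c x)} = {x}" by blast
    moreover have "fst (\<sigma> c x) = c" unfolding \<sigma>_def by simp
    ultimately show ?thesis unfolding site_point_def leftmost_def by simp
  qed
  have "{lower_end (\<sigma> c x)<..upper_end (\<sigma> c x)} \<inter> {lower_end (\<sigma> c x')<..upper_end (\<sigma> c x')} = {}"
    if x: "x \<in> P c" "x' \<in> P c" "x < x'" for c x x'
  proof -
    have "\<not> \<bar>x' - x\<bar> < \<delta> c x" "\<not> \<bar>x - x'\<bar> < \<delta> c x'"
      using \<delta>(2)[of x' c x] \<delta>(2)[of x c x'] x P(2)[of c] by auto
    then show ?thesis using ends[of x c] ends[of x' c] x(3) by auto
  qed
  then have dis: "{lower_end (\<sigma> c x)<..upper_end (\<sigma> c x)} \<inter> {lower_end (\<sigma> c x')<..upper_end (\<sigma> c x')} = {}"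
    if "x \<in> P c" "x' \<in> P c" "x \<noteq> x'" for c x x'
    using that by (metis Int_commute linorder_neqE)
  show ?thesis
    using pt dis ends unfolding \<sigma>_def by (intro exI[of _ \<sigma>]) (auto simp: \<sigma>_def less_imp_le)
qed

lemma AE_disjoint: "AE \<omega> in M. C True \<omega> \<inter> C False \<omega> = {}"
proof -
  have "AE \<omega> in M. occupied {j, k} \<omega> \<longrightarrow> site_point j \<omega> \<noteq> site_point k \<omega>" if jk: "fst j" "\<not> fst k" for j k
  proof -
    have ne: "j \<noteq> k" using jk by auto
    have k: "k \<in> {j, k} - {j}" using ne by simp
    have sp: "spread {j, k}" unfolding spread_def using jk by auto
    have "Measurable.pred (borel \<Otimes>\<^sub>M PiM ({j, k} - {j}) (\<lambda>_. borel)) (\<lambda>z. fst z = (snd z k :: real))"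
      using k by measurable
    from null_relation[OF sp _ this] have "AE \<omega> in M. occupied {j, k} \<omega> \<longrightarrow> \<not> site_point j \<omega> = restrict (\<lambda>j. site_point j \<omega>) ({j, k} - {j}) k"
      by simp
    then show ?thesis by eventually_elim (use ne in auto)
  qed
  then have "AE \<omega> in M. \<forall>j k. fst j \<longrightarrow> \<not> fst k \<longrightarrow> occupied {j, k} \<omega> \<longrightarrow> site_point j \<omega> \<noteq> site_point k \<omega>"
    unfolding AE_all_countable by auto
  moreover have "AE \<omega> in M. \<omega> \<in> space M" by simp
  ultimately show ?thesis
  proof eventually_elim
    case (elim \<omega>)
    have False if x: "x \<in> C True \<omega>" "x \<in> C False \<omega>" for x
    proof -
      have "\<And>c. {x} \<subseteq> C c \<omega>" using x by (metis (full_types) empty_subsetI insert_subset)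
      then obtain \<sigma> where \<sigma>: "\<And>c y. y \<in> {x} \<Longrightarrow> fst (\<sigma> c y) = c \<and> site_point (\<sigma> c y) \<omega> = y \<and> y \<le> upper_end (\<sigma> c y)"
        using ex_sites[OF elim(2), of "\<lambda>_. {x}"] by auto
      have "occupied {\<sigma> True x, \<sigma> False x} \<omega>" unfolding occupied_def using \<sigma> by auto
      then show False using elim(1)[rule_format, of "\<sigma> True x" "\<sigma> False x"] \<sigma> by simp
    qed
    then show ?case by blast
  qed
qed

lemma AE_distinct_lengths: "AE \<omega> in M. distinct_lengths (C True \<omega>) (C False \<omega>)"
proof -
  have two: "countable {x::real. \<bar>c - x\<bar> = d}" for c d
    by (rule countable_subset[of _ "{c - d, c + d}"]) auto
  have one: "AE \<omega> in M. occupied {j, k, j', k'} \<omega> \<longrightarrow> \<bar>site_point j \<omega> - site_point k \<omega>\<bar> \<noteq> \<bar>site_point j' \<omega> - site_point k' \<omega>\<bar>"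
    if jk: "fst j" "\<not> fst k" "fst j'" "\<not> fst k'" "spread {j, k, j', k'}" "j \<noteq> j' \<or> k \<noteq> k'" for j k j' k'
  \<comment> \<open>A site at which the two pairs differ is released: \<open>k\<close> if the blue
    sites differ, otherwise \<open>j\<close>. With the other points fixed, its position has at most
    two possible values.\<close>
  proof (cases "k = k'")
    case False
    let ?J = "{j, k, j', k'}"
    have m: "j \<in> ?J - {k}" "j' \<in> ?J - {k}" "k' \<in> ?J - {k}" using jk False by auto
    have "Measurable.pred (borel \<Otimes>\<^sub>M PiM (?J - {k}) (\<lambda>_. borel)) (\<lambda>z. \<bar>snd z j - fst z\<bar> = \<bar>snd z j' - snd z k' :: real\<bar>)"
      using m by measurable
    from null_relation[OF jk(5) _ this two]
    have "AE \<omega> in M. occupied ?J \<omega> \<longrightarrow> \<not> \<bar>restrict (\<lambda>j. site_point j \<omega>) (?J - {k}) j - site_point k \<omega>\<bar> =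
      \<bar>restrict (\<lambda>j. site_point j \<omega>) (?J - {k}) j' - restrict (\<lambda>j. site_point j \<omega>) (?J - {k}) k'\<bar>" by simp
    then show ?thesis by eventually_elim (use m in auto)
  next
    case True
    let ?J = "{j, k, j', k'}"
    have m: "k \<in> ?J - {j}" "j' \<in> ?J - {j}" "k' \<in> ?J - {j}" using jk True by auto
    have "Measurable.pred (borel \<Otimes>\<^sub>M PiM (?J - {j}) (\<lambda>_. borel)) (\<lambda>z. \<bar>snd z k - fst z\<bar> = \<bar>snd z j' - snd z k' :: real\<bar>)"
      using m by measurable
    from null_relation[OF jk(5) _ this two]
    have "AE \<omega> in M. occupied ?J \<omega> \<longrightarrow> \<not> \<bar>restrict (\<lambda>j. site_point j \<omega>) (?J - {j}) k - site_point j \<omega>\<bar> =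
      \<bar>restrict (\<lambda>j. site_point j \<omega>) (?J - {j}) j' - restrict (\<lambda>j. site_point j \<omega>) (?J - {j}) k'\<bar>" by simp
    then show ?thesis by eventually_elim (use m in \<open>auto simp: abs_minus_commute\<close>)
  qed
  then have "AE \<omega> in M. \<forall>j k j' k'. fst j \<longrightarrow> \<not> fst k \<longrightarrow> fst j' \<longrightarrow> \<not> fst k' \<longrightarrow> spread {j, k, j', k'} \<longrightarrow> j \<noteq> j' \<or> k \<noteq> k' \<longrightarrow>
      occupied {j, k, j', k'} \<omega> \<longrightarrow> \<bar>site_point j \<omega> - site_point k \<omega>\<bar> \<noteq> \<bar>site_point j' \<omega> - site_point k' \<omega>\<bar>"
    unfolding AE_all_countable by auto
  moreover have "AE \<omega> in M. \<omega> \<in> space M" by simp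
  ultimately show ?thesis
  proof eventually_elim
    case (elim \<omega>)
    show ?case
      unfolding distinct_lengths_def
    proof (intro ballI impI)
      fix x y x' y' assume xy: "x \<in> C True \<omega>" "y \<in> C False \<omega>" "x' \<in> C True \<omega>" "y' \<in> C False \<omega>"
        and eq: "\<bar>x - y\<bar> = \<bar>x' - y'\<bar>"
      define P where "P c = (if c then {x, x'} else {y, y'})" for c
      have P: "\<And>c. finite (P c)" "\<And>c. P c \<subseteq> C c \<omega>" using xy unfolding P_def by auto
      obtain \<sigma> where \<sigma>: "\<And>c y. y \<in> P c \<Longrightarrow> fst (\<sigma> c y) = c \<and> site_point (\<sigma> c y) \<omega> = y \<and> y \<le> upper_end (\<sigma> c y)"
        and dis: "\<And>c x x'. x \<in> P c \<Longrightarrow> x' \<in> P c \<Longrightarrow> x \<noteq> x' \<Longrightarrow>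
          {lower_end (\<sigma> c x)<..upper_end (\<sigma> c x)} \<inter> {lower_end (\<sigma> c x')<..upper_end (\<sigma> c x')} = {}"
        using ex_sites[OF elim(2) P] by metis
      have mem: "x \<in> P True" "x' \<in> P True" "y \<in> P False" "y' \<in> P False" unfolding P_def by auto
      note s = \<sigma>[OF mem(1)] \<sigma>[OF mem(2)] \<sigma>[OF mem(3)] \<sigma>[OF mem(4)]
      let ?J = "{\<sigma> True x, \<sigma> False y, \<sigma> True x', \<sigma> False y'}"
      have occ: "occupied ?J \<omega>" unfolding occupied_def using s by auto
      have sp: "spread ?J"
        unfolding spread_def using s dis[OF mem(1,2)] dis[OF mem(2,1)] dis[OF mem(3,4)] dis[OF mem(4,3)] by auto
      have "\<not> (\<sigma> True x \<noteq> \<sigma> True x' \<or> \<sigma> False y \<noteq> \<sigma> False y')"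
        using elim(1)[rule_format, of "\<sigma> True x" "\<sigma> False y" "\<sigma> True x'" "\<sigma> False y'"] s sp occ eq by auto
      then show "x = x' \<and> y = y'" using s by metis
    qed
  qed
qed

end

section \<open>Distinct costs at a fixed exponent\<close>

lemma measurable_power_cost [measurable]: "power_cost \<gamma> a \<in> borel_measurable borel"
  unfolding power_cost_def[abs_def] by measurable

text \<open>The two finite sets of edges between sites give \<open>j\<close> different partners, so
  the position at \<open>j\<close> enters the equality of costs in a nontrivial way.\<close>

definition discordant :: "(site \<times> site) set \<Rightarrow> (site \<times> site) set \<Rightarrow> site \<Rightarrow> site \<Rightarrow> site \<Rightarrow> bool" where
  "discordant E E' j k k' \<longleftrightarrow> (\<forall>(i, l)\<in>E \<union> E'. fst i \<and> \<not> fst l) \<and> (j, k) \<in> E \<and> (j, k') \<in> E' \<and> k \<noteq> k' \<and>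
     (\<forall>l. (j, l) \<in> E \<longrightarrow> l = k) \<and> (\<forall>l. (j, l) \<in> E' \<longrightarrow> l = k') \<and>
     spread (Domain (E \<union> E') \<union> Range (E \<union> E'))"

context two_processes
begin

lemma site_point_in:
  assumes "\<omega> \<in> space M" "site_point j \<omega> \<le> upper_end j"
  shows "site_point j \<omega> \<in> {lower_end j<..upper_end j}"
  using leftmost_in[of \<omega> "fst j" "lower_end j" "upper_end j"] assms unfolding site_point_def by auto

text \<open>With all other points fixed, equality of costs prescribes the difference of
  \<open>power_cost \<gamma> a\<close> at \<open>y - x\<close> and \<open>y' - x\<close> for the
  position \<open>x\<close> at \<open>j\<close>. The two blue positions differ, so strict concavity
  leaves countably many solutions.\<close>

lemma AE_separated_sites:
  assumes \<gamma>: "\<gamma> < 1" and a: "0 < a" and fin: "finite E" "finite E'"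
    and dc: "discordant E E' j k k'"
  shows "AE \<omega> in M. occupied (Domain (E \<union> E') \<union> Range (E \<union> E')) \<omega> \<longrightarrow>
    (\<Sum>p\<in>E. power_cost \<gamma> a (site_point (snd p) \<omega> - site_point (fst p) \<omega>)) \<noteq>
    (\<Sum>p\<in>E'. power_cost \<gamma> a (site_point (snd p) \<omega> - site_point (fst p) \<omega>))"
proof -
  let ?J = "Domain (E \<union> E') \<union> Range (E \<union> E')" and ?f = "power_cost \<gamma> a"
  let ?D = "E - {(j, k)}" and ?D' = "E' - {(j, k')}"
  let ?N = "PiM (?J - {j}) (\<lambda>_. borel :: real measure)"
  let ?\<Psi> = "\<lambda>x v. v k \<noteq> v k' \<and> ?f (v k - x) + (\<Sum>p\<in>?D. ?f (v (snd p) - v (fst p))) =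
     ?f (v k' - x) + (\<Sum>p\<in>?D'. ?f (v (snd p) - v (fst p)))"
  note d = dc[unfolded discordant_def]
  note col = conjunct1[OF d] and d1 = conjunct2[OF d]
  note e1 = conjunct1[OF d1] and d2 = conjunct2[OF d1]
  note e2 = conjunct1[OF d2] and d3 = conjunct2[OF d2]
  note e3 = conjunct1[OF d3] and d4 = conjunct2[OF d3]
  note e = e1 e2 e3 and uni1 = conjunct1[OF d4] and d5 = conjunct2[OF d4]
  note uni = uni1 conjunct1[OF d5] and J = conjunct2[OF d5]
  have colr: "fst i" "\<not> fst l" if "(i, l) \<in> E \<union> E'" for i l using bspec[OF col that] by simp_all
  have j: "fst j" "j \<in> ?J" using colr[of j k] e(1) by auto
  have off: "fst p \<in> ?J - {j} \<and> snd p \<in> ?J - {j}" if "p \<in> ?D \<union> ?D'" for p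
  proof -
    obtain i l where p: "p = (i, l)" by (cases p)
    have m: "(i, l) \<in> E \<union> E'" using that p by auto
    have "i \<noteq> j"
    proof
      assume "i = j"
      then have "p = (j, k) \<or> p = (j, k')" using uni m p by blast
      moreover have "(j, k) \<notin> E'" "(j, k') \<notin> E" using uni e by blast+
      ultimately show False using that by blast
    qed
    moreover have "l \<noteq> j" using colr(2)[OF m] j(1) by auto
    ultimately show ?thesis using m p by auto
  qed
  have "k \<noteq> j" "k' \<noteq> j" using colr(2)[of j k] colr(2)[of j k'] e j(1) by auto
  then have kk: "k \<in> ?J - {j}" "k' \<in> ?J - {j}" using e by auto
  have comp: "(\<lambda>z. snd z i) \<in> borel_measurable (borel \<Otimes>\<^sub>M ?N)" if "i \<in> ?J - {j}" for i
    using measurable_compose[OF measurable_snd measurable_component_singleton[OF that]] .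
  have cf: "(\<lambda>z. ?f (g z)) \<in> borel_measurable (borel \<Otimes>\<^sub>M ?N)" if "g \<in> borel_measurable (borel \<Otimes>\<^sub>M ?N)" for g
    using measurable_compose[OF that measurable_power_cost] .
  have sums: "(\<lambda>z. \<Sum>p\<in>F. ?f (snd z (snd p) - snd z (fst p))) \<in> borel_measurable (borel \<Otimes>\<^sub>M ?N)"
    if F: "F \<subseteq> ?D \<union> ?D'" for F
  proof (rule borel_measurable_sum)
    fix p assume "p \<in> F"
    then have p: "p \<in> ?D \<union> ?D'" by (rule subsetD[OF F])
    show "(\<lambda>z. ?f (snd z (snd p) - snd z (fst p))) \<in> borel_measurable (borel \<Otimes>\<^sub>M ?N)"
      by (intro cf borel_measurable_diff comp) (use off[OF p] in \<open>simp_all only: simp_thms\<close>)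
  qed
  have eqp: "Measurable.pred (borel \<Otimes>\<^sub>M ?N) (\<lambda>z. g z = h z)"
    if "g \<in> borel_measurable (borel \<Otimes>\<^sub>M ?N)" "h \<in> borel_measurable (borel \<Otimes>\<^sub>M ?N)" for g h :: "_ \<Rightarrow> real"
    using borel_measurable_eq[OF that] by (simp only: pred_def)
  have meas: "Measurable.pred (borel \<Otimes>\<^sub>M ?N) (\<lambda>z. ?\<Psi> (fst z) (snd z))"
    by (rule pred_intros_logic(3)[OF pred_intros_logic(2)[OF eqp[OF comp comp]] eqp[OF borel_measurable_add borel_measurable_add]],
      rule kk, rule kk, (rule cf borel_measurable_diff comp sums measurable_fst kk Un_upper1 Un_upper2)+)
  have cnt: "countable {x. ?\<Psi> x v}" for v
  proof (cases "v k = v k'")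
    case False
    let ?c = "(\<Sum>p\<in>?D'. ?f (v (snd p) - v (fst p))) - (\<Sum>p\<in>?D. ?f (v (snd p) - v (fst p)))"
    have "countable {x. ?f (v k - x) - ?f (v k' - x) = ?c}"
      by (rule concave_section_countable[OF power_cost_concave[OF \<gamma> a] False])
    then show ?thesis by (rule countable_subset[rotated]) auto
  qed simp
  have "AE \<omega> in M. \<omega> \<in> space M" by simp
  with null_relation[OF J j(2) meas cnt] show ?thesis
  proof eventually_elim
    case (elim \<omega>)
    show ?case
    proof (intro impI notI)
      assume occ: "occupied ?J \<omega>"
        and eq: "(\<Sum>p\<in>E. ?f (site_point (snd p) \<omega> - site_point (fst p) \<omega>)) =
          (\<Sum>p\<in>E'. ?f (site_point (snd p) \<omega> - site_point (fst p) \<omega>))"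
      let ?v = "restrict (\<lambda>j. site_point j \<omega>) (?J - {j})"
      have v: "?v i = site_point i \<omega>" if "i \<in> ?J - {j}" for i using that by simp
      have ne: "site_point k \<omega> \<noteq> site_point k' \<omega>"
      proof -
        have "site_point i \<omega> \<in> {lower_end i<..upper_end i}" if "i \<in> ?J" for i
          using site_point_in[OF elim(2), of i] occ that unfolding occupied_def by blast
        then have "site_point k \<omega> \<in> {lower_end k<..upper_end k}" "site_point k' \<omega> \<in> {lower_end k'<..upper_end k'}"
          using kk by auto
        moreover have "{lower_end k<..upper_end k} \<inter> {lower_end k'<..upper_end k'} = {}"
        proof -
          have "fst k = fst k'" using col e by auto
          then show ?thesis using J kk e(3) unfolding spread_def by blast
        qed
        ultimately show ?thesis by (metis disjoint_iff)
      qed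
      have s: "(\<Sum>p\<in>F. ?f (?v (snd p) - ?v (fst p))) = (\<Sum>p\<in>F. ?f (site_point (snd p) \<omega> - site_point (fst p) \<omega>))"
        if "F \<subseteq> ?D \<union> ?D'" for F
      proof (rule sum.cong[OF refl])
        fix p assume "p \<in> F"
        then have "p \<in> ?D \<union> ?D'" by (rule subsetD[OF that])
        note o = off[OF this]
        show "?f (?v (snd p) - ?v (fst p)) = ?f (site_point (snd p) \<omega> - site_point (fst p) \<omega>)"
          unfolding v[OF conjunct1[OF o]] v[OF conjunct2[OF o]] ..
      qed
      have "\<not> ?\<Psi> (site_point j \<omega>) ?v" using elim(1) occ by (rule mp)
      then have n: "\<not> (site_point k \<omega> \<noteq> site_point k' \<omega> \<and>
          ?f (site_point k \<omega> - site_point j \<omega>) + (\<Sum>p\<in>?D. ?f (site_point (snd p) \<omega> - site_point (fst p) \<omega>)) =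
          ?f (site_point k' \<omega> - site_point j \<omega>) + (\<Sum>p\<in>?D'. ?f (site_point (snd p) \<omega> - site_point (fst p) \<omega>)))"
        unfolding s[OF Un_upper1] s[OF Un_upper2] v[OF kk(1)] v[OF kk(2)] .
      from eq have "?f (site_point k \<omega> - site_point j \<omega>) + (\<Sum>p\<in>?D. ?f (site_point (snd p) \<omega> - site_point (fst p) \<omega>)) =
          ?f (site_point k' \<omega> - site_point j \<omega>) + (\<Sum>p\<in>?D'. ?f (site_point (snd p) \<omega> - site_point (fst p) \<omega>))"
        unfolding sum.remove[OF fin(1) e(1)] sum.remove[OF fin(2) e(2)] fst_conv snd_conv .
      with n ne show False by iprover
    qed
  qed
qed

text \<open>Different matchings of the same points disagree at some red point, and there are only
  countably many pairs of finite sets of edges between sites.\<close>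

lemma AE_separated:
  assumes \<gamma>: "\<gamma> < 1" and a: "0 < a"
  shows "AE \<omega> in M. separated (principal {\<gamma>}) a (C True \<omega>) (C False \<omega>)"
proof -
  let ?f = "power_cost \<gamma> a"
  let ?dom = "\<lambda>E E' :: (site \<times> site) set. Domain (E \<union> E') \<union> Range (E \<union> E')"
  let ?cost = "\<lambda>E \<omega>. \<Sum>p\<in>E. ?f (site_point (snd p) \<omega> - site_point (fst p) \<omega>)"
  have "AE \<omega> in M. discordant E E' j k k' \<longrightarrow> occupied (?dom E E') \<omega> \<longrightarrow> ?cost E \<omega> \<noteq> ?cost E' \<omega>"
    if "E \<in> Collect finite" "E' \<in> Collect finite" for E E' j k k'
  proof (cases "discordant E E' j k k'")
    case True
    show ?thesis by (rule eventually_mono[OF AE_separated_sites[OF \<gamma> a CollectD[OF that(1)] CollectD[OF that(2)] True]]) iprover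
  next
    case False
    show ?thesis by (rule AE_I2) (use False in iprover)
  qed
  then have "\<forall>E\<in>Collect finite. \<forall>E'\<in>Collect finite. \<forall>j k k'. AE \<omega> in M. discordant E E' j k k' \<longrightarrow> occupied (?dom E E') \<omega> \<longrightarrow> ?cost E \<omega> \<noteq> ?cost E' \<omega>"
    by (intro ballI allI)
  then have "AE \<omega> in M. \<forall>E\<in>Collect finite. \<forall>E'\<in>Collect finite. \<forall>j k k'. discordant E E' j k k' \<longrightarrow> occupied (?dom E E') \<omega> \<longrightarrow> ?cost E \<omega> \<noteq> ?cost E' \<omega>"
    by (simp only: AE_ball_countable[OF countable_Collect_finite] AE_all_countable)
  moreover have "AE \<omega> in M. \<omega> \<in> space M" by simp
  ultimately show ?thesis
  proof eventually_elim
    case (elim \<omega>)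
    show ?case
      unfolding separated_def
    proof (intro allI impI)
      fix E E' assume E: "finite E" "is_matching (C True \<omega>) (C False \<omega>) E" "is_matching (C True \<omega>) (C False \<omega>) E'"
        and im: "fst ` E = fst ` E'" "snd ` E = snd ` E'" and ne: "E \<noteq> E'"
      have "E' \<subseteq> fst ` E \<times> snd ` E" unfolding im by force
      then have finE': "finite E'" using E(1) by (meson finite_SigmaI finite_imageI finite_subset)
      have uE: "y = y'" if "(x, y) \<in> E" "(x, y') \<in> E" for x y y' using E(2) that unfolding is_matching_def by blast
      have uE': "y = y'" if "(x, y) \<in> E'" "(x, y') \<in> E'" for x y y' using E(3) that unfolding is_matching_def by blast
      have "\<exists>x y y'. (x, y) \<in> E \<and> (x, y') \<in> E' \<and> y \<noteq> y'"
      proof (rule ccontr)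
        assume no: "\<not> ?thesis"
        have "(x, y) \<in> E \<longleftrightarrow> (x, y) \<in> E'" for x y
        proof
          assume xy: "(x, y) \<in> E"
          then have "x \<in> fst ` E'" using im(1) by force
          then obtain y' where "(x, y') \<in> E'" by force
          then show "(x, y) \<in> E'" using no xy by metis
        next
          assume xy: "(x, y) \<in> E'"
          then have "x \<in> fst ` E" using im(1) by force
          then obtain y' where "(x, y') \<in> E" by force
          then show "(x, y) \<in> E" using no xy by metis
        qed
        then show False using ne by auto
      qed
      then obtain x y y' where xy: "(x, y) \<in> E" "(x, y') \<in> E'" "y \<noteq> y'" by blast
      define P where "P c = (if c then fst ` E else snd ` E)" for c
      have P: "\<And>c. finite (P c)" "\<And>c. P c \<subseteq> C c \<omega>" using E(1,2) unfolding P_def is_matching_def by auto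
      obtain \<sigma> where \<sigma>: "\<And>c y. y \<in> P c \<Longrightarrow> fst (\<sigma> c y) = c \<and> site_point (\<sigma> c y) \<omega> = y \<and> y \<le> upper_end (\<sigma> c y)"
        and dis: "\<And>c x x'. x \<in> P c \<Longrightarrow> x' \<in> P c \<Longrightarrow> x \<noteq> x' \<Longrightarrow>
          {lower_end (\<sigma> c x)<..upper_end (\<sigma> c x)} \<inter> {lower_end (\<sigma> c x')<..upper_end (\<sigma> c x')} = {}"
        using ex_sites[OF elim(2) P] by metis
      have mem: "u \<in> P True" "v \<in> P False" if "(u, v) \<in> E \<union> E'" for u v
      proof -
        have "u \<in> fst ` E \<union> fst ` E'" "v \<in> snd ` E \<union> snd ` E'" using that by force+
        then show "u \<in> P True" "v \<in> P False" unfolding P_def using im by auto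
      qed
      \<comment> \<open>Transports edges between points to edges between isolating sites;
        \<open>pts\<close> recovers the points, so costs are preserved.\<close>
      define \<phi> where "\<phi> = map_prod (\<sigma> True) (\<sigma> False)"
      have \<phi>: "\<phi> (u, v) = (\<sigma> True u, \<sigma> False v)" for u v unfolding \<phi>_def by simp
      have pts: "site_point (fst (\<phi> p)) \<omega> = fst p \<and> site_point (snd (\<phi> p)) \<omega> = snd p" if "p \<in> E \<union> E'" for p
        using \<sigma> mem[of "fst p" "snd p"] that by (cases p) (simp add: \<phi>)
      have inj: "inj_on \<phi> (E \<union> E')"
        by (rule inj_onI) (metis pts prod.collapse)
      have cost: "?cost (\<phi> ` F) \<omega> = cost ?f F" if F: "F \<subseteq> E \<union> E'" for F
      proof -
        have "?cost (\<phi> ` F) \<omega> = (\<Sum>p\<in>F. ?f (site_point (snd (\<phi> p)) \<omega> - site_point (fst (\<phi> p)) \<omega>))"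
          by (subst sum.reindex[OF inj_on_subset[OF inj F]]) simp
        also have "\<dots> = (\<Sum>p\<in>F. ?f (snd p - fst p))"
          by (rule sum.cong[OF refl]) (use pts F in auto)
        also have "\<dots> = cost ?f F" unfolding cost_def by (simp add: case_prod_beta)
        finally show ?thesis .
      qed
      have dom: "?dom (\<phi> ` E) (\<phi> ` E') \<subseteq> \<sigma> True ` P True \<union> \<sigma> False ` P False"
      proof
        fix i assume "i \<in> ?dom (\<phi> ` E) (\<phi> ` E')"
        then obtain q where q: "q \<in> \<phi> ` (E \<union> E')" "i = fst q \<or> i = snd q"
          unfolding image_Un by (metis DomainE RangeE UnE fst_conv snd_conv)
        then obtain p where p: "p \<in> E \<union> E'" "i = fst (\<phi> p) \<or> i = snd (\<phi> p)" by blast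
        obtain u v where uv: "p = (u, v)" by (cases p)
        show "i \<in> \<sigma> True ` P True \<union> \<sigma> False ` P False"
          using p(2) mem[of u v] p(1) unfolding uv \<phi> by auto
      qed
      have ex: "\<exists>c u. i = \<sigma> c u \<and> u \<in> P c" if "i \<in> ?dom (\<phi> ` E) (\<phi> ` E')" for i
        using subsetD[OF dom that] by blast
      have occ: "occupied (?dom (\<phi> ` E) (\<phi> ` E')) \<omega>"
        unfolding occupied_def
      proof
        fix i assume "i \<in> ?dom (\<phi> ` E) (\<phi> ` E')"
        from ex[OF this] obtain c u where i: "i = \<sigma> c u" "u \<in> P c" by blast
        show "site_point i \<omega> \<le> upper_end i" unfolding i(1) using \<sigma>[OF i(2)] by simp
      qed
      have sp: "spread (?dom (\<phi> ` E) (\<phi> ` E'))"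
        unfolding spread_def
      proof (intro conjI ballI impI)
        show "finite (?dom (\<phi> ` E) (\<phi> ` E'))"
          by (rule finite_subset[OF dom]) (use P(1) in auto)
        fix i l assume il: "i \<in> ?dom (\<phi> ` E) (\<phi> ` E')" "l \<in> ?dom (\<phi> ` E) (\<phi> ` E')" "i \<noteq> l" "fst i = fst l"
        obtain c u where i: "i = \<sigma> c u" "u \<in> P c" using ex[OF il(1)] by blast
        obtain c' u' where l: "l = \<sigma> c' u'" "u' \<in> P c'" using ex[OF il(2)] by blast
        have cc: "c' = c" using il(4) \<sigma> i l by metis
        have "u \<noteq> u'" using il(3) i(1) l(1) cc by auto
        then show "{lower_end i<..upper_end i} \<inter> {lower_end l<..upper_end l} = {}"
          using dis[of u c u'] i l cc by simp
      qed
      have mxy: "x \<in> P True" "y \<in> P False" "y' \<in> P False" using mem xy by auto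
      have ok: "discordant (\<phi> ` E) (\<phi> ` E') (\<sigma> True x) (\<sigma> False y) (\<sigma> False y')"
        unfolding discordant_def
      proof (intro conjI sp)
        show "\<forall>(i, l)\<in>\<phi> ` E \<union> \<phi> ` E'. fst i \<and> \<not> fst l"
        proof
          fix q assume "q \<in> \<phi> ` E \<union> \<phi> ` E'"
          then obtain u v where uv: "(u, v) \<in> E \<union> E'" "q = \<phi> (u, v)" by fastforce
          show "case q of (i, l) \<Rightarrow> fst i \<and> \<not> fst l" unfolding uv(2) \<phi> using \<sigma>[OF mem(1)[OF uv(1)]] \<sigma>[OF mem(2)[OF uv(1)]] by simp
        qed
        show "(\<sigma> True x, \<sigma> False y) \<in> \<phi> ` E" "(\<sigma> True x, \<sigma> False y') \<in> \<phi> ` E'"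
          using imageI[OF xy(1), of \<phi>] imageI[OF xy(2), of \<phi>] unfolding \<phi> .
        show "\<sigma> False y \<noteq> \<sigma> False y'" using \<sigma> mxy xy(3) by metis
        have inj1: "u = x" if "(u, v) \<in> E \<union> E'" "\<sigma> True x = \<sigma> True u" for u v
          using \<sigma> mxy mem(1)[OF that(1)] that(2) by metis
        show "\<forall>l. (\<sigma> True x, l) \<in> \<phi> ` E \<longrightarrow> l = \<sigma> False y"
        proof (intro allI impI)
          fix l assume "(\<sigma> True x, l) \<in> \<phi> ` E"
          then obtain p where p: "p \<in> E" "(\<sigma> True x, l) = \<phi> p" by blast
          obtain u v where "p = (u, v)" by (cases p)
          then have uv: "(u, v) \<in> E" "\<sigma> True x = \<sigma> True u" "l = \<sigma> False v" using p unfolding \<phi>_def map_prod_def by simp_all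
          then have "u = x" using inj1 by blast
          then show "l = \<sigma> False y" using uE uv xy by blast
        qed
        show "\<forall>l. (\<sigma> True x, l) \<in> \<phi> ` E' \<longrightarrow> l = \<sigma> False y'"
        proof (intro allI impI)
          fix l assume "(\<sigma> True x, l) \<in> \<phi> ` E'"
          then obtain p where p: "p \<in> E'" "(\<sigma> True x, l) = \<phi> p" by blast
          obtain u v where "p = (u, v)" by (cases p)
          then have uv: "(u, v) \<in> E'" "\<sigma> True x = \<sigma> True u" "l = \<sigma> False v" using p unfolding \<phi>_def map_prod_def by simp_all
          then have "u = x" using inj1 by blast
          then show "l = \<sigma> False y'" using uE' uv xy by blast
        qed
      qed
      have "\<phi> ` E \<in> Collect finite" "\<phi> ` E' \<in> Collect finite" using E(1) finE' by auto
      from elim(1)[THEN bspec, OF this(1), THEN bspec, OF this(2), THEN spec, THEN spec, THEN spec, THEN mp, OF ok, THEN mp, OF occ]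
      have "cost ?f E \<noteq> cost ?f E'" unfolding cost[OF Un_upper1] cost[OF Un_upper2] .
      then show "(\<forall>\<^sub>F \<gamma> in principal {\<gamma>}. cost (power_cost \<gamma> a) E < cost (power_cost \<gamma> a) E') \<or>
          (\<forall>\<^sub>F \<gamma> in principal {\<gamma>}. cost (power_cost \<gamma> a) E' < cost (power_cost \<gamma> a) E)"
        unfolding eventually_principal by auto
    qed
  qed
qed

end

section \<open>Drift\<close>

lemma (in prob_space) indep_blocks:
  assumes ind: "indep_vars (\<lambda>_. borel) X I" and L: "finite L"
    and K: "\<And>l. l \<in> L \<Longrightarrow> K l \<subseteq> I" "disjoint_family_on K L"
    and Q: "\<And>l. l \<in> L \<Longrightarrow> Measurable.pred (PiM (K l) (\<lambda>_. borel)) (Q l)"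
  shows "prob {\<omega>\<in>space M. \<forall>l\<in>L. Q l (restrict (\<lambda>i. X i \<omega>) (K l))} =
    (\<Prod>l\<in>L. prob {\<omega>\<in>space M. Q l (restrict (\<lambda>i. X i \<omega>) (K l))})"
proof (cases "L = {}")
  case True
  then show ?thesis using prob_space by simp
next
  case False
  let ?Y = "\<lambda>l \<omega>. restrict (\<lambda>i. X i \<omega>) (K l)" and ?N = "\<lambda>l. PiM (K l) (\<lambda>_. borel)"
  let ?A = "\<lambda>l. {f \<in> space (?N l). Q l f}"
  have iv: "indep_vars ?N ?Y L" by (rule indep_vars_restrict[OF ind K])
  have A: "?A l \<in> sets (?N l)" if "l \<in> L" for l using Q[OF that] by (simp only: pred_def)
  have Y: "?Y l \<omega> \<in> space (?N l)" if "\<omega> \<in> space M" "l \<in> L" for l \<omega>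
    using iv that unfolding indep_vars_def by (auto dest: measurable_space)
  have e: "?Y l -` ?A l \<inter> space M = {\<omega>\<in>space M. Q l (?Y l \<omega>)}" if "l \<in> L" for l
    using Y[OF _ that] by auto
  have "{\<omega>\<in>space M. \<forall>l\<in>L. Q l (?Y l \<omega>)} = (\<Inter>l\<in>L. {\<omega>\<in>space M. Q l (?Y l \<omega>)})" using False by blast
  also have "\<dots> = (\<Inter>l\<in>L. ?Y l -` ?A l \<inter> space M)" by (rule INF_cong[OF refl]) (rule e[symmetric])
  also have "prob \<dots> = (\<Prod>l\<in>L. prob (?Y l -` ?A l \<inter> space M))"
    by (rule indep_varsD_finite[OF iv False L A])
  also have "\<dots> = (\<Prod>l\<in>L. prob {\<omega>\<in>space M. Q l (?Y l \<omega>)})" by (rule prod.cong[OF refl]) (simp only: e)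
  finally show ?thesis .
qed

text \<open>Freezing the walk once its modulus reaches \<open>\<kappa>\<close> preserves the second moment bound and turns the
  maximum into the last value.\<close>

fun stopped :: "real \<Rightarrow> (nat \<Rightarrow> real) \<Rightarrow> nat \<Rightarrow> real" where
  "stopped \<kappa> y 0 = 0"
| "stopped \<kappa> y (Suc n) = (if \<kappa> \<le> \<bar>stopped \<kappa> y n\<bar> then stopped \<kappa> y n else stopped \<kappa> y n + y n)"

lemma stopped_cases:
  assumes "0 < \<kappa>"
  shows "\<kappa> \<le> \<bar>stopped \<kappa> y n\<bar> \<or> (stopped \<kappa> y n = (\<Sum>j<n. y j) \<and> (\<forall>m\<le>n. \<bar>\<Sum>j<m. y j\<bar> < \<kappa>))"
proof (induction n)
  case (Suc n)
  show ?case
  proof (cases "\<kappa> \<le> \<bar>stopped \<kappa> y n\<bar>")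
    case False
    with Suc have s: "stopped \<kappa> y n = (\<Sum>j<n. y j)" "\<forall>m\<le>n. \<bar>\<Sum>j<m. y j\<bar> < \<kappa>" by auto
    have "stopped \<kappa> y (Suc n) = (\<Sum>j<Suc n. y j)" using False s(1) by simp
    then show ?thesis using s(2) by (metis le_Suc_eq not_le)
  qed simp
qed (use assms in simp)

lemma stopped_restrict: "stopped \<kappa> (restrict y {..<n}) n = stopped \<kappa> y n"
proof -
  have "m \<le> n \<Longrightarrow> stopped \<kappa> (restrict y {..<n}) m = stopped \<kappa> y m" for m
    by (induction m) auto
  then show ?thesis by simp
qed

lemma measurable_stopped:
  assumes "\<And>i. i < n \<Longrightarrow> (\<lambda>x. f x i) \<in> borel_measurable N"
  shows "(\<lambda>x. stopped \<kappa> (f x) n) \<in> borel_measurable N"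
  using assms
proof (induction n)
  case (Suc n)
  have [measurable]: "(\<lambda>x. stopped \<kappa> (f x) n) \<in> borel_measurable N" "(\<lambda>x. f x n) \<in> borel_measurable N"
    using Suc by auto
  show ?case by simp
qed simp

lemma (in prob_space) kolmogorov_maximal_inequality:
  fixes X :: "nat \<Rightarrow> 'a \<Rightarrow> real"
  assumes ind: "indep_vars (\<lambda>_. borel) X {..<n}"
    and sq: "\<And>i. i < n \<Longrightarrow> integrable M (\<lambda>\<omega>. (X i \<omega>)\<^sup>2)"
    and mean: "\<And>i. i < n \<Longrightarrow> expectation (X i) = 0"
    and var: "\<And>i. i < n \<Longrightarrow> expectation (\<lambda>\<omega>. (X i \<omega>)\<^sup>2) \<le> v"
    and \<kappa>: "0 < \<kappa>"
  shows "prob {\<omega>\<in>space M. \<exists>m\<le>n. \<kappa> \<le> \<bar>\<Sum>j<m. X j \<omega>\<bar>} \<le> real n * v / \<kappa>\<^sup>2"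
proof -
  have rv[measurable]: "X i \<in> borel_measurable M" if "i < n" for i
    using ind that unfolding indep_vars_def by auto
  let ?Z = "\<lambda>m \<omega>. stopped \<kappa> (\<lambda>j. X j \<omega>) m"
  have Zm: "?Z m \<in> borel_measurable M" if "m \<le> n" for m
    by (rule measurable_stopped) (use that rv in auto)
  have key: "integrable M (\<lambda>\<omega>. (?Z m \<omega>)\<^sup>2) \<and> expectation (\<lambda>\<omega>. (?Z m \<omega>)\<^sup>2) \<le> real m * v" if "m \<le> n" for m
    using that
  proof (induction m)
    case (Suc m)
    then have mn: "m < n" and IH: "integrable M (\<lambda>\<omega>. (?Z m \<omega>)\<^sup>2)" "expectation (\<lambda>\<omega>. (?Z m \<omega>)\<^sup>2) \<le> real m * v" by auto
    \<comment> \<open>\<open>g\<close> is the current value while the walk still moves and 0 once it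
      is frozen, and \<open>h\<close> indicates that it moves. Being bounded by \<kappa>,
      \<open>g\<close> has an integrable product with the next step.\<close>
    define g where "g z = (if \<kappa> \<le> \<bar>z\<bar> then 0 else z)" for z :: real
    define h where "h z = (if \<kappa> \<le> \<bar>z\<bar> then 0 else 1 :: real)" for z :: real
    have gm[measurable]: "g \<in> borel_measurable borel" and hm[measurable]: "h \<in> borel_measurable borel"
      unfolding g_def[abs_def] h_def[abs_def] by measurable
    note [measurable] = Zm[OF less_imp_le[OF mn]] rv[OF mn]
    have "indep_var (PiM {..<m} (\<lambda>_. borel)) (\<lambda>\<omega>. restrict (\<lambda>i. X i \<omega>) {..<m}) (PiM {m} (\<lambda>_. borel)) (\<lambda>\<omega>. restrict (\<lambda>i. X i \<omega>) {m})"
      by (rule indep_var_restrict[OF ind]) (use mn in auto)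
    moreover have "(\<lambda>y. g (stopped \<kappa> y m)) \<in> measurable (PiM {..<m} (\<lambda>_. borel)) borel"
      by (rule measurable_compose[OF _ gm], rule measurable_stopped) measurable
    moreover have "(\<lambda>y. y m) \<in> measurable (PiM {m} (\<lambda>_. borel :: real measure)) borel"
      by (rule measurable_component_singleton) simp
    ultimately have "indep_var borel ((\<lambda>y. g (stopped \<kappa> y m)) \<circ> (\<lambda>\<omega>. restrict (\<lambda>i. X i \<omega>) {..<m}))
        borel ((\<lambda>y. y m) \<circ> (\<lambda>\<omega>. restrict (\<lambda>i. X i \<omega>) {m}))"
      by (rule indep_var_compose)
    then have iv: "indep_var borel (\<lambda>\<omega>. g (?Z m \<omega>)) borel (X m)"
      by (simp add: comp_def stopped_restrict)
    have Xi: "integrable M (X m)" by (rule square_integrable_imp_integrable[OF rv[OF mn] sq[OF mn]])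
    have gi: "integrable M (\<lambda>\<omega>. g (?Z m \<omega>))"
    proof (rule Bochner_Integration.integrable_bound[of M "\<lambda>_. \<kappa>"])
      show "AE \<omega> in M. norm (g (?Z m \<omega>)) \<le> norm \<kappa>" unfolding g_def using \<kappa> by auto
    qed auto
    have gX: "integrable M (\<lambda>\<omega>. g (?Z m \<omega>) * X m \<omega>)" "expectation (\<lambda>\<omega>. g (?Z m \<omega>) * X m \<omega>) = 0"
      using indep_var_integrable[OF iv gi Xi] indep_var_lebesgue_integral[OF iv gi Xi] mean[OF mn] by auto
    have hX: "integrable M (\<lambda>\<omega>. h (?Z m \<omega>) * (X m \<omega>)\<^sup>2)"
      by (rule Bochner_Integration.integrable_bound[OF sq[OF mn]]) (auto simp: h_def)
    have "expectation (\<lambda>\<omega>. h (?Z m \<omega>) * (X m \<omega>)\<^sup>2) \<le> expectation (\<lambda>\<omega>. (X m \<omega>)\<^sup>2)"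
      by (rule integral_mono[OF hX sq[OF mn]]) (auto simp: h_def)
    then have hv: "expectation (\<lambda>\<omega>. h (?Z m \<omega>) * (X m \<omega>)\<^sup>2) \<le> v" using var[OF mn] by simp
    have eq: "(?Z (Suc m) \<omega>)\<^sup>2 = (?Z m \<omega>)\<^sup>2 + 2 * (g (?Z m \<omega>) * X m \<omega>) + h (?Z m \<omega>) * (X m \<omega>)\<^sup>2" for \<omega>
      by (simp add: g_def h_def power2_eq_square algebra_simps)
    show ?case
      unfolding eq using IH gX hX hv by (simp add: algebra_simps)
  qed simp
  have Zn[measurable]: "?Z n \<in> borel_measurable M" by (rule Zm) simp
  have ev: "{\<omega>\<in>space M. \<kappa>\<^sup>2 \<le> (?Z n \<omega>)\<^sup>2} \<in> events" by measurable
  have "prob {\<omega>\<in>space M. \<exists>m\<le>n. \<kappa> \<le> \<bar>\<Sum>j<m. X j \<omega>\<bar>} \<le> prob {\<omega>\<in>space M. \<kappa>\<^sup>2 \<le> (?Z n \<omega>)\<^sup>2}"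
  proof (rule finite_measure_mono[OF _ ev], safe)
    fix \<omega> m assume "m \<le> n" "\<kappa> \<le> \<bar>\<Sum>j<m. X j \<omega>\<bar>"
    then have "\<kappa> \<le> \<bar>?Z n \<omega>\<bar>" using stopped_cases[OF \<kappa>, of "\<lambda>j. X j \<omega>" n] by (meson not_le)
    then show "\<kappa>\<^sup>2 \<le> (?Z n \<omega>)\<^sup>2" using \<kappa> by (metis less_imp_le power2_abs power_mono)
  qed
  also have "\<dots> \<le> expectation (\<lambda>\<omega>. (?Z n \<omega>)\<^sup>2) / \<kappa>\<^sup>2"
    using key[of n] \<kappa> by (intro integral_Markov_inequality_measure[where A = "{}"]) auto
  also have "\<dots> \<le> real n * v / \<kappa>\<^sup>2"
    using key[of n] by (intro divide_right_mono) auto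
  finally show ?thesis .
qed

section \<open>Moments of a unit Poisson count and the normal limit\<close>

lemma poisson_sums:
  "(\<lambda>n. 1 / fact n) sums exp (1::real)"
  "(\<lambda>n. real n / fact n) sums exp 1"
  "(\<lambda>n. (real n)\<^sup>2 / fact n) sums (2 * exp 1)"
proof -
  show a: "(\<lambda>n. 1 / fact n) sums exp (1::real)" using exp_converges[of "1::real"] by (simp add: divide_inverse)
  have "(\<lambda>n. real (Suc n) / fact (Suc n)) = (\<lambda>n. 1 / fact n)" by (auto simp: fun_eq_iff divide_simps)
  then have "(\<lambda>n. real (Suc n) / fact (Suc n)) sums exp 1" using a by simp
  from sums_Suc[OF this] show b: "(\<lambda>n. real n / fact n) sums exp 1" by simp
  have "(real (Suc n))\<^sup>2 / fact (Suc n) = real n / fact n + 1 / fact n" for n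
    by (simp add: power2_eq_square divide_simps)
  then have "(\<lambda>n. (real (Suc n))\<^sup>2 / fact (Suc n)) sums (exp 1 + exp 1)" using sums_add[OF b a] by simp
  from sums_Suc[OF this] show "(\<lambda>n. (real n)\<^sup>2 / fact n) sums (2 * exp 1)" by simp
qed

lemma (in prob_space) poisson_moments:
  fixes N :: "'a \<Rightarrow> nat"
  assumes N[measurable]: "N \<in> measurable M (count_space UNIV)"
    and law: "\<And>k. prob {\<omega>\<in>space M. N \<omega> = k} = exp (-1) / fact k"
  shows "integrable M (\<lambda>\<omega>. (real (N \<omega>) - 1)\<^sup>2)" "expectation (\<lambda>\<omega>. real (N \<omega>) - 1) = 0"
    "expectation (\<lambda>\<omega>. (real (N \<omega>) - 1)\<^sup>2) = 1" "expectation (\<lambda>\<omega>. real (N \<omega>)) = 1" "integrable M (\<lambda>\<omega>. real (N \<omega>))"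
proof -
  let ?p = "\<lambda>k::nat. exp (-1) / fact k :: real"
  have d: "distr M (count_space UNIV) N = density (count_space UNIV) (\<lambda>k. ennreal (?p k))"
  proof (rule measure_eqI_countable[where A = UNIV])
    fix k :: nat
    have "emeasure (distr M (count_space UNIV) N) {k} = ennreal (prob {\<omega>\<in>space M. N \<omega> = k})"
      by (subst emeasure_distr) (auto simp: emeasure_eq_measure intro!: arg_cong[where f = prob])
    then show "emeasure (distr M (count_space UNIV) N) {k} = emeasure (density (count_space UNIV) (\<lambda>k. ennreal (?p k))) {k}"
      unfolding law by (subst emeasure_density) (auto simp: nn_integral_count_space_indicator[symmetric])
  qed auto
  have gen: "integrable M (\<lambda>\<omega>. g (N \<omega>))" "expectation (\<lambda>\<omega>. g (N \<omega>)) = s"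
    if s: "(\<lambda>k. ?p k * g k) sums s" "summable (\<lambda>k. norm (?p k * g k))" for g :: "nat \<Rightarrow> real" and s
  proof -
    have c: "integrable (count_space UNIV) (\<lambda>k. ?p k * g k)" using s(2) by (simp only: integrable_count_space_nat_iff)
    have "integrable (density (count_space UNIV) (\<lambda>k. ennreal (?p k))) g"
      using c by (subst integrable_density) auto
    then have "integrable (distr M (count_space UNIV) N) g" using d by simp
    then show "integrable M (\<lambda>\<omega>. g (N \<omega>))" by (subst (asm) integrable_distr_eq) auto
    have "expectation (\<lambda>\<omega>. g (N \<omega>)) = integral\<^sup>L (distr M (count_space UNIV) N) g"
      by (subst integral_distr) auto
    also have "\<dots> = integral\<^sup>L (count_space UNIV) (\<lambda>k. ?p k * g k)"
      unfolding d by (subst integral_density) auto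
    also have "\<dots> = (\<Sum>k. ?p k * g k)" by (rule integral_count_space_nat[OF c])
    also have "\<dots> = s" using s(1) by (rule sums_unique[symmetric])
    finally show "expectation (\<lambda>\<omega>. g (N \<omega>)) = s" .
  qed
  have e: "exp (-1) * exp 1 = (1::real)" by (simp add: exp_minus)
  have 1: "(\<lambda>k. ?p k * real k) sums 1"
    using sums_mult[OF poisson_sums(2), of "exp (-1)"] e by simp
  have 0: "?p sums 1"
    using sums_mult[OF poisson_sums(1), of "exp (-1)"] e by simp
  have "(\<lambda>k. exp (-1) * ((real k)\<^sup>2 / fact k) - 2 * (exp (-1) * (real k / fact k)) + exp (-1) * (1 / fact k)) sums
      (exp (-1) * (2 * exp 1) - 2 * (exp (-1) * exp 1) + exp (-1) * exp 1)"
    by (intro sums_add sums_diff sums_mult poisson_sums)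
  also have "(\<lambda>k. exp (-1) * ((real k)\<^sup>2 / fact k) - 2 * (exp (-1) * (real k / fact k)) + exp (-1) * (1 / fact k)) =
      (\<lambda>k. ?p k * (real k - 1)\<^sup>2)"
    by (auto simp: fun_eq_iff power2_eq_square field_simps)
  also have "exp (-1) * (2 * exp 1) - 2 * (exp (-1) * exp 1) + exp (-1) * exp 1 = (1::real)" using e by simp
  finally have 2: "(\<lambda>k. ?p k * (real k - 1)\<^sup>2) sums 1" .
  show "integrable M (\<lambda>\<omega>. (real (N \<omega>) - 1)\<^sup>2)" "expectation (\<lambda>\<omega>. (real (N \<omega>) - 1)\<^sup>2) = 1"
    using gen[OF 2] sums_summable[OF 2] by auto
  show i: "expectation (\<lambda>\<omega>. real (N \<omega>)) = 1" "integrable M (\<lambda>\<omega>. real (N \<omega>))"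
    using gen[OF 1] sums_summable[OF 1] by auto
  show "expectation (\<lambda>\<omega>. real (N \<omega>) - 1) = 0" using i by (simp add: prob_space)
qed

lemma (in prob_space) indep_vars_reindex:
  assumes ind: "indep_vars (\<lambda>_. N) X I" and h: "inj_on h J" "h ` J \<subseteq> I"
  shows "indep_vars (\<lambda>_. N) (\<lambda>j. X (h j)) J"
proof -
  have "indep_vars (\<lambda>j. PiM {h j} (\<lambda>_. N)) (\<lambda>j \<omega>. restrict (\<lambda>i. X i \<omega>) {h j}) J"
    by (rule indep_vars_restrict[OF ind]) (use h in \<open>auto simp: disjoint_family_on_def inj_on_def\<close>)
  from indep_vars_compose2[OF this, where Y = "\<lambda>j f. f (h j)" and N = "\<lambda>_. N"]
  show ?thesis by simp
qed

text \<open>The density is positive everywhere, so the law has the null sets of Lebesgue measure: no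
  atoms, and positive mass in both tails.\<close>

lemma std_normal_cdf:
  "isCont (cdf std_normal_distribution) x" "0 < cdf std_normal_distribution x" "cdf std_normal_distribution x < 1"
proof -
  interpret real_distribution std_normal_distribution by (rule real_dist_normal_dist)
  have null: "A \<in> null_sets std_normal_distribution \<longleftrightarrow> A \<in> null_sets lborel" if "A \<in> sets borel" for A
  proof -
    have "A \<in> null_sets std_normal_distribution \<longleftrightarrow> A \<in> sets lborel \<and> (AE x in lborel. x \<in> A \<longrightarrow> ennreal (std_normal_density x) = 0)"
      by (rule null_sets_density_iff) measurable
    also have "\<dots> \<longleftrightarrow> A \<in> sets lborel \<and> (AE x in lborel. x \<notin> A)"
      by (intro conj_cong refl AE_cong) (simp add: normal_density_def)
    also have "\<dots> \<longleftrightarrow> A \<in> null_sets lborel" using AE_iff_null_sets[of A lborel] that by auto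
    finally show ?thesis .
  qed
  have pos: "0 < prob A" if A: "A \<in> sets borel" "emeasure lborel A \<noteq> 0" for A
  proof (rule ccontr)
    assume "\<not> 0 < prob A"
    then have "prob A = 0" using measure_nonneg[of _ A] by (simp add: not_less antisym)
    then have "A \<in> null_sets std_normal_distribution" using A by (simp add: null_sets_def emeasure_eq_measure)
    then show False using null A by (auto simp: null_sets_def)
  qed
  have "{x} \<in> null_sets std_normal_distribution" using null[of "{x}"] by auto
  then show "isCont (cdf std_normal_distribution) x" unfolding isCont_cdf by (simp add: null_sets_def measure_def)
  have "emeasure lborel {x - 1..x} \<le> emeasure lborel {..x}" by (rule emeasure_mono) auto
  then have "emeasure lborel {..x} \<noteq> 0" by auto
  then show "0 < cdf std_normal_distribution x" unfolding cdf_def by (intro pos) auto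
  have "emeasure lborel {x + 1..x + 2} \<le> emeasure lborel {x<..}" by (rule emeasure_mono) auto
  then have "emeasure lborel {x<..} \<noteq> 0" by (auto simp: emeasure_lborel_Icc)
  then have "0 < prob {x<..}" by (intro pos) auto
  moreover have "prob {x<..} = 1 - prob {..x}"
    by (subst prob_compl[symmetric]) (auto intro!: arg_cong[where f = prob])
  ultimately show "cdf std_normal_distribution x < 1" unfolding cdf_def by simp
qed

text \<open>The intervals on the left are open on the same side as those on the right, to agree with
  the intervals in \<open>lev\<close>.\<close>

definition stretch :: "bool \<Rightarrow> nat \<Rightarrow> nat \<Rightarrow> real set" where
  "stretch side a b = (if side then {real a<..real b} else {- real b<..- real a})"

lemma stretch_borel: "stretch side a b \<in> sets borel \<and> bounded (stretch side a b)"
  unfolding stretch_def by auto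

lemma measure_stretch: "a \<le> b \<Longrightarrow> measure lborel (stretch side a b) = real (b - a)"
  unfolding stretch_def by (simp add: of_nat_diff)

lemma stretch_disjoint: "b \<le> c \<Longrightarrow> stretch side a b \<inter> stretch side c d = {}"
  unfolding stretch_def by auto

lemma stretch_union: "a \<le> b \<Longrightarrow> b \<le> c \<Longrightarrow> stretch side a c = stretch side a b \<union> stretch side b c"
  unfolding stretch_def by auto

definition heading :: "bool \<times> bool \<Rightarrow> real" where
  "heading i = (if fst i = snd i then - 1 else 1)"

text \<open>Diffusive scaling: in time \<open>v\<^sup>2\<close> the walk rises by its typical size
  \<open>v\<close> and never strays further than \<open>A\<close> typical sizes. The probability of
  this is bounded below independently of \<open>v\<close>.\<close>

definition climbs :: "real \<Rightarrow> (nat \<Rightarrow> real) \<Rightarrow> nat \<Rightarrow> bool" where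
  "climbs A y v \<longleftrightarrow> real v \<le> (\<Sum>j<v\<^sup>2. y j) \<and> (\<forall>m\<le>v\<^sup>2. \<bar>\<Sum>j<m. y j\<bar> < A * real v)"

context two_processes
begin

text \<open>The four walks run away from the origin in both directions and for both colours. Red points
  come late on the right and early on the left, blue points the other way round; the sign
  \<open>heading\<close> turns each of these tendencies into an upward drift.\<close>

definition step :: "(bool \<times> bool) \<times> nat \<Rightarrow> 'w \<Rightarrow> real" where
  "step ij \<omega> = heading (fst ij) *
     (real (card (C (fst (fst ij)) \<omega> \<inter> stretch (snd (fst ij)) (snd ij) (Suc (snd ij)))) - 1)"

lemma card_stretch_union:
  assumes "\<omega> \<in> space M" "a \<le> b" "b \<le> c"
  shows "card (C col \<omega> \<inter> stretch side a c) = card (C col \<omega> \<inter> stretch side a b) + card (C col \<omega> \<inter> stretch side b c)"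
proof -
  have fin: "finite (C col \<omega> \<inter> stretch side a b)" for a b
    using locally_finite[OF assms(1)] stretch_borel by blast
  have "C col \<omega> \<inter> stretch side a c = (C col \<omega> \<inter> stretch side a b) \<union> (C col \<omega> \<inter> stretch side b c)"
    using stretch_union[OF assms(2,3), of side] by blast
  moreover have "(C col \<omega> \<inter> stretch side a b) \<inter> (C col \<omega> \<inter> stretch side b c) = {}"
    using stretch_disjoint[of b b side a c] by auto
  ultimately show ?thesis using card_Un_disjoint[OF fin fin] by simp
qed

lemma step_sum:
  assumes "\<omega> \<in> space M"
  shows "(\<Sum>j<n. step (i, b + j) \<omega>) = heading i * (real (card (C (fst i) \<omega> \<inter> stretch (snd i) b (b + n))) - real n)"
proof (induction n)
  case 0
  have "stretch (snd i) b b = {}" unfolding stretch_def by auto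
  then show ?case by simp
next
  case (Suc n)
  show ?case
    using Suc card_stretch_union[OF assms, of b "b + n" "b + Suc n" "fst i" "snd i"]
    by (simp add: step_def algebra_simps)
qed

lemma indep_steps: "indep_vars (\<lambda>_. borel) step UNIV"
proof -
  have "indep_vars (\<lambda>_. count_space UNIV)
    (\<lambda>ij \<omega>. card (C (fst (fst ij)) \<omega> \<inter> stretch (snd (fst ij)) (snd ij) (Suc (snd ij)))) (UNIV :: ((bool \<times> bool) \<times> nat) set)"
  proof (rule indep_counts)
    fix p q :: "(bool \<times> bool) \<times> nat" assume ne: "p \<noteq> q" and c: "fst (fst p) = fst (fst q)"
    show "stretch (snd (fst p)) (snd p) (Suc (snd p)) \<inter> stretch (snd (fst q)) (snd q) (Suc (snd q)) = {}"
    proof (cases "snd (fst p) = snd (fst q)")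
      case True
      then have "snd p \<noteq> snd q" using ne c by (auto simp: prod_eq_iff)
      then show ?thesis using True stretch_disjoint[of "Suc (snd p)" "snd q" "snd (fst q)" "snd p" "Suc (snd q)"]
          stretch_disjoint[of "Suc (snd q)" "snd p" "snd (fst q)" "snd q" "Suc (snd p)"] by (cases "snd p" "snd q" rule: linorder_cases) auto
    next
      case False
      then show ?thesis unfolding stretch_def by auto
    qed
  qed (rule stretch_borel)
  from indep_vars_compose2[OF this, where Y = "\<lambda>ij n. heading (fst ij) * (real n - 1)" and N = "\<lambda>_. borel"]
  show ?thesis unfolding step_def[abs_def] by simp
qed

lemma measurable_step [measurable]: "step ij \<in> borel_measurable M"
  using indep_steps unfolding indep_vars_def by blast

lemma step_moments:
  "integrable M (\<lambda>\<omega>. (step ij \<omega>)\<^sup>2)" "expectation (step ij) = 0" "expectation (\<lambda>\<omega>. (step ij \<omega>)\<^sup>2) = 1"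
proof -
  let ?N = "\<lambda>\<omega>. card (C (fst (fst ij)) \<omega> \<inter> stretch (snd (fst ij)) (snd ij) (Suc (snd ij)))"
  have N: "?N \<in> measurable M (count_space UNIV)" using measurable_count stretch_borel by blast
  have law: "prob {\<omega>\<in>space M. ?N \<omega> = k} = exp (-1) / fact k" for k
    using prob_count[of "stretch (snd (fst ij)) (snd ij) (Suc (snd ij))" "fst (fst ij)" k] stretch_borel by (simp add: measure_stretch)
  note m = poisson_moments[OF N law]
  have sq: "(step ij \<omega>)\<^sup>2 = (real (?N \<omega>) - 1)\<^sup>2" for \<omega>
    unfolding step_def heading_def by (simp add: power_mult_distrib)
  show "integrable M (\<lambda>\<omega>. (step ij \<omega>)\<^sup>2)" "expectation (\<lambda>\<omega>. (step ij \<omega>)\<^sup>2) = 1" unfolding sq using m by auto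
  show "expectation (step ij) = 0" unfolding step_def[abs_def] using m(2) by simp
qed

lemma count_law:
  assumes "A \<in> sets borel" "bounded A" "A' \<in> sets borel" "bounded A'" "measure lborel A = measure lborel A'"
  shows "distr M (count_space UNIV) (\<lambda>\<omega>. card (C c \<omega> \<inter> A)) = distr M (count_space UNIV) (\<lambda>\<omega>. card (C c' \<omega> \<inter> A'))"
proof (rule measure_eqI_countable[where A = UNIV])
  fix k :: nat
  have e: "emeasure (distr M (count_space UNIV) (\<lambda>\<omega>. card (C c \<omega> \<inter> A))) {k} =
      ennreal (exp (- measure lborel A) * measure lborel A ^ k / fact k)"
    if "A \<in> sets borel" "bounded A" for A c
  proof -
    have "emeasure (distr M (count_space UNIV) (\<lambda>\<omega>. card (C c \<omega> \<inter> A))) {k} = ennreal (prob {\<omega>\<in>space M. card (C c \<omega> \<inter> A) = k})"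
      using measurable_count[OF that] by (subst emeasure_distr) (auto simp: emeasure_eq_measure intro!: arg_cong[where f = prob])
    then show ?thesis unfolding prob_count[OF that] .
  qed
  show "emeasure (distr M (count_space UNIV) (\<lambda>\<omega>. card (C c \<omega> \<inter> A))) {k} =
      emeasure (distr M (count_space UNIV) (\<lambda>\<omega>. card (C c' \<omega> \<inter> A'))) {k}"
    unfolding e[OF assms(1,2)] e[OF assms(3,4)] assms(5) ..
qed auto

lemma prob_count_cong:
  assumes "A \<in> sets borel" "bounded A" "A' \<in> sets borel" "bounded A'" "measure lborel A = measure lborel A'"
  shows "prob {\<omega>\<in>space M. card (C c \<omega> \<inter> A) \<in> K} = prob {\<omega>\<in>space M. card (C c' \<omega> \<inter> A') \<in> K}"
proof -
  have e: "prob {\<omega>\<in>space M. card (C c \<omega> \<inter> A) \<in> K} = measure (distr M (count_space UNIV) (\<lambda>\<omega>. card (C c \<omega> \<inter> A))) K"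
    if "A \<in> sets borel" "bounded A" for A c
    using measurable_count[OF that] by (subst measure_distr) (auto intro!: arg_cong[where f = prob])
  show ?thesis unfolding e[OF assms(1,2)] e[OF assms(3,4)] by (simp only: count_law[OF assms, of c c'])
qed

lemma step_distr: "distr M borel (\<lambda>\<omega>. step (i, j) \<omega>) = distr M borel (\<lambda>\<omega>. step (i, k) \<omega>)"
proof -
  let ?N = "\<lambda>j \<omega>. card (C (fst i) \<omega> \<inter> stretch (snd i) j (Suc j))"
  have "distr M borel (\<lambda>\<omega>. step (i, j) \<omega>) = distr (distr M (count_space UNIV) (?N j)) borel (\<lambda>n. heading i * (real n - 1))" for j
  proof -
    have m: "?N j \<in> measurable M (count_space UNIV)" using measurable_count stretch_borel by blast
    show ?thesis by (subst distr_distr[OF _ m]) (simp_all add: step_def[abs_def] comp_def)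
  qed
  moreover have "distr M (count_space UNIV) (?N j) = distr M (count_space UNIV) (?N k)"
    by (rule count_law) (auto simp: stretch_borel measure_stretch)
  ultimately show ?thesis by simp
qed

text \<open>The law of a count depends on the length of the interval only, so the central limit
  theorem for one walk from 0 covers all walks and starting points; walks of the other heading use
  the other tail.\<close>

lemma rises_prob:
  "\<exists>\<eta>>0. \<exists>v0. \<forall>v\<ge>v0. \<forall>i b. \<eta> \<le> prob {\<omega>\<in>space M. real v \<le> (\<Sum>j<v\<^sup>2. step (i, b + j) \<omega>)}"
proof -
  let ?i = "(False, True)"
  let ?X = "\<lambda>j. step (?i, j)"
  let ?S = "\<lambda>n \<omega>. (\<Sum>j<n. ?X j \<omega>)"
  have ind: "indep_vars (\<lambda>_. borel) ?X UNIV"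
    by (rule indep_vars_reindex[OF indep_steps]) (auto simp: inj_on_def)
  have "weak_conv_m (\<lambda>n. distr M borel (\<lambda>\<omega>. ?S n \<omega> / sqrt (real n * 1\<^sup>2))) std_normal_distribution"
    by (rule central_limit_theorem_zero_mean[OF ind]) (use step_moments step_distr in auto)
  then have lim: "(\<lambda>n. cdf (distr M borel (\<lambda>\<omega>. ?S n \<omega> / sqrt (real n))) x) \<longlonglongrightarrow> cdf std_normal_distribution x" for x
    unfolding weak_conv_m_def weak_conv_def using std_normal_cdf(1) by auto
  have rv[measurable]: "?X j \<in> borel_measurable M" for j using ind unfolding indep_vars_def by auto
  have cdf: "cdf (distr M borel (\<lambda>\<omega>. ?S n \<omega> / sqrt (real n))) x = prob {\<omega>\<in>space M. ?S n \<omega> / sqrt (real n) \<le> x}" for n x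
    unfolding cdf_def by (subst measure_distr) (auto intro!: arg_cong[where f = prob])
  let ?F = "cdf std_normal_distribution"
  \<comment> \<open>Half of the smaller tail probability beyond one standard deviation; halving
    leaves room for the convergence.\<close>
  define \<eta> where "\<eta> = min (?F (-1)) (1 - ?F 1) / 2"
  have \<eta>: "0 < \<eta>" "\<eta> < ?F (-1)" "?F 1 < 1 - \<eta>"
    using std_normal_cdf(2)[of "-1"] std_normal_cdf(3)[of 1] unfolding \<eta>_def by (auto simp: min_def field_simps)
  have "\<forall>\<^sub>F n in sequentially. \<eta> < prob {\<omega>\<in>space M. ?S n \<omega> / sqrt (real n) \<le> -1} \<and> prob {\<omega>\<in>space M. ?S n \<omega> / sqrt (real n) \<le> 1} < 1 - \<eta>"
    using order_tendstoD(1)[OF lim \<eta>(2)] order_tendstoD(2)[OF lim \<eta>(3)] unfolding cdf by (rule eventually_conj)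
  then obtain n0 where n0: "\<And>n. n \<ge> n0 \<Longrightarrow> \<eta> < prob {\<omega>\<in>space M. ?S n \<omega> / sqrt (real n) \<le> -1} \<and> prob {\<omega>\<in>space M. ?S n \<omega> / sqrt (real n) \<le> 1} < 1 - \<eta>"
    unfolding eventually_sequentially by blast
  have "\<eta> \<le> prob {\<omega>\<in>space M. real v \<le> (\<Sum>j<v\<^sup>2. step (i, b + j) \<omega>)}" if v: "v \<ge> n0 + 1" for v i b
  proof -
    have "n0 \<le> v\<^sup>2" using v by (metis add_leD1 le_trans power2_nat_le_imp_le power2_nat_le_eq_le self_le_power le_add2 zero_less_numeral)
    note n = n0[OF this]
    have sq: "sqrt (real (v\<^sup>2)) = real v" "real v > 0" using v by auto
    have cong: "prob {\<omega>\<in>space M. card (C c \<omega> \<inter> stretch side b (b + v\<^sup>2)) \<in> K} = prob {\<omega>\<in>space M. card (C False \<omega> \<inter> stretch True 0 (v\<^sup>2)) \<in> K}" for c side K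
      by (rule prob_count_cong) (auto simp: stretch_borel measure_stretch)
    have S: "?S (v\<^sup>2) \<omega> = real (card (C False \<omega> \<inter> stretch True 0 (v\<^sup>2))) - real (v\<^sup>2)" if "\<omega> \<in> space M" for \<omega>
      using step_sum[OF that, of ?i 0 "v\<^sup>2"] by (simp add: heading_def)
    show ?thesis
    proof (cases "fst i = snd i")
      case True
      have "{\<omega>\<in>space M. real v \<le> (\<Sum>j<v\<^sup>2. step (i, b + j) \<omega>)} =
          {\<omega>\<in>space M. card (C (fst i) \<omega> \<inter> stretch (snd i) b (b + v\<^sup>2)) \<in> {k. real k - real (v\<^sup>2) \<le> - real v}}"
        using True by (auto simp: step_sum heading_def)
      also have "prob \<dots> = prob {\<omega>\<in>space M. card (C False \<omega> \<inter> stretch True 0 (v\<^sup>2)) \<in> {k. real k - real (v\<^sup>2) \<le> - real v}}"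
        by (rule cong)
      also have "{\<omega>\<in>space M. card (C False \<omega> \<inter> stretch True 0 (v\<^sup>2)) \<in> {k. real k - real (v\<^sup>2) \<le> - real v}} =
          {\<omega>\<in>space M. ?S (v\<^sup>2) \<omega> / sqrt (real (v\<^sup>2)) \<le> -1}"
        unfolding sq using S sq(2) by (auto simp: divide_simps)
      finally show ?thesis using n by simp
    next
      case False
      have "{\<omega>\<in>space M. real v \<le> (\<Sum>j<v\<^sup>2. step (i, b + j) \<omega>)} =
          {\<omega>\<in>space M. card (C (fst i) \<omega> \<inter> stretch (snd i) b (b + v\<^sup>2)) \<in> {k. real v \<le> real k - real (v\<^sup>2)}}"
        using False by (auto simp: step_sum heading_def)
      also have "prob \<dots> = prob {\<omega>\<in>space M. card (C False \<omega> \<inter> stretch True 0 (v\<^sup>2)) \<in> {k. real v \<le> real k - real (v\<^sup>2)}}"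
        by (rule cong)
      also have "{\<omega>\<in>space M. card (C False \<omega> \<inter> stretch True 0 (v\<^sup>2)) \<in> {k. real v \<le> real k - real (v\<^sup>2)}} =
          {\<omega>\<in>space M. 1 \<le> ?S (v\<^sup>2) \<omega> / sqrt (real (v\<^sup>2))}"
        unfolding sq using S sq(2) by (auto simp: divide_simps)
      finally have "prob {\<omega>\<in>space M. real v \<le> (\<Sum>j<v\<^sup>2. step (i, b + j) \<omega>)} = prob {\<omega>\<in>space M. 1 \<le> ?S (v\<^sup>2) \<omega> / sqrt (real (v\<^sup>2))}" .
      moreover have "prob {\<omega>\<in>space M. \<not> ?S (v\<^sup>2) \<omega> / sqrt (real (v\<^sup>2)) \<le> 1} \<le> prob {\<omega>\<in>space M. 1 \<le> ?S (v\<^sup>2) \<omega> / sqrt (real (v\<^sup>2))}"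
        by (rule finite_measure_mono) auto
      moreover have "prob {\<omega>\<in>space M. \<not> ?S (v\<^sup>2) \<omega> / sqrt (real (v\<^sup>2)) \<le> 1} = 1 - prob {\<omega>\<in>space M. ?S (v\<^sup>2) \<omega> / sqrt (real (v\<^sup>2)) \<le> 1}"
        by (rule prob_neg) measurable
      ultimately show ?thesis using n by simp
    qed
  qed
  then show ?thesis using \<eta>(1) by blast
qed

text \<open>The maximal inequality bounds the chance of straying beyond \<open>A * v\<close> by
  \<open>1 / A\<^sup>2\<close>, uniformly in \<open>v\<close>. \<open>A\<close> is chosen to make
  this at most half the chance of rising.\<close>

lemma climbs_prob:
  "\<exists>A \<eta> v0. 1 \<le> A \<and> 0 < \<eta> \<and> (\<forall>v\<ge>v0. \<forall>i b. \<eta> \<le> prob {\<omega>\<in>space M. climbs A (\<lambda>j. step (i, b + j) \<omega>) v})"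
proof -
  from rises_prob obtain \<eta> v0 where \<eta>0: "0 < \<eta>"
    "\<forall>v\<ge>v0. \<forall>i b. \<eta> \<le> prob {\<omega>\<in>space M. real v \<le> (\<Sum>j<v\<^sup>2. step (i, b + j) \<omega>)}"
    by (elim exE conjE)
  note \<eta> = \<eta>0(1) \<eta>0(2)[rule_format]
  define A where "A = max 1 (sqrt (2 / \<eta>))"
  have A: "1 \<le> A" unfolding A_def by simp
  have "2 / \<eta> = (sqrt (2 / \<eta>))\<^sup>2" using \<eta>(1) by simp
  also have "\<dots> \<le> A\<^sup>2" unfolding A_def using \<eta>(1) by (intro power_mono) auto
  finally have A2: "1 / A\<^sup>2 \<le> \<eta> / 2" using \<eta>(1) A by (simp add: field_simps)
  have "\<eta> / 2 \<le> prob {\<omega>\<in>space M. climbs A (\<lambda>j. step (i, b + j) \<omega>) v}" if v: "v \<ge> max 1 v0" for v i b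
  proof -
    let ?X = "\<lambda>j. step (i, b + j)"
    let ?R = "{\<omega>\<in>space M. real v \<le> (\<Sum>j<v\<^sup>2. ?X j \<omega>)}" and ?O = "{\<omega>\<in>space M. \<exists>m\<le>v\<^sup>2. A * real v \<le> \<bar>\<Sum>j<m. ?X j \<omega>\<bar>}"
      and ?C = "{\<omega>\<in>space M. climbs A (\<lambda>j. ?X j \<omega>) v}"
    have "indep_vars (\<lambda>_. borel) ?X {..<v\<^sup>2}"
      by (rule indep_vars_reindex[OF indep_steps]) (auto simp: inj_on_def)
    then have "prob ?O \<le> real (v\<^sup>2) * 1 / (A * real v)\<^sup>2"
      by (rule kolmogorov_maximal_inequality) (use step_moments v A in auto)
    also have "\<dots> = 1 / A\<^sup>2" using v by (simp add: power_mult_distrib)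
    finally have O: "prob ?O \<le> \<eta> / 2" using A2 by simp
    have ev: "?R \<in> events" "?O \<in> events" "?C \<in> events" unfolding climbs_def by measurable
    have "?R \<subseteq> ?C \<union> ?O" unfolding climbs_def by (auto simp: not_less)
    then have "prob ?R \<le> prob (?C \<union> ?O)" using ev by (intro finite_measure_mono) auto
    also have "\<dots> \<le> prob ?C + prob ?O" using ev by (intro measure_Un_le) auto
    finally show ?thesis using O \<eta>(2)[of v i b] v by simp
  qed
  then show ?thesis using A \<eta>(1) by (intro exI[of _ A] exI[of _ "\<eta> / 2"] exI[of _ "max 1 v0"]) auto
qed

end

section \<open>Ascents on blocks of growing length\<close>

lemma climbs_mono:
  assumes "climbs A y v" "A \<le> A'"
  shows "climbs A' y v"
proof -
  have "A * real v \<le> A' * real v" using assms(2) by (rule mult_right_mono) simp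
  then show ?thesis using assms(1) less_le_trans unfolding climbs_def by blast
qed

lemma climbs_cong:
  assumes "\<And>j. j < v\<^sup>2 \<Longrightarrow> y j = y' j"
  shows "climbs A y v \<longleftrightarrow> climbs A y' v"
proof -
  have "(\<Sum>j<m. y j) = (\<Sum>j<m. y' j)" if "m \<le> v\<^sup>2" for m
    by (rule sum.cong) (use assms that in auto)
  then show ?thesis unfolding climbs_def by auto
qed

lemma pred_climbs:
  assumes f: "\<And>j. j < v\<^sup>2 \<Longrightarrow> (\<lambda>x. f x j) \<in> borel_measurable N"
  shows "Measurable.pred N (\<lambda>x. climbs A (f x) v)"
proof -
  let ?g = "\<lambda>x j. if j < v\<^sup>2 then f x j else 0"
  have [measurable]: "(\<lambda>x. ?g x j) \<in> borel_measurable N" for j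
    by (cases "j < v\<^sup>2") (simp_all add: f)
  have "Measurable.pred N (\<lambda>x. climbs A (?g x) v)" unfolding climbs_def by measurable
  also have "(\<lambda>x. climbs A (?g x) v) = (\<lambda>x. climbs A (f x) v)"
    by (intro ext climbs_cong) simp
  finally show ?thesis .
qed

text \<open>The pieces before number \<open>p\<close> have size \<open>u\<close> and produce the
  climb. The last one has size \<open>s * u\<close>: it may fluctuate more but lasts far
  longer.\<close>

definition piece_size :: "nat \<Rightarrow> nat \<Rightarrow> nat \<Rightarrow> nat \<Rightarrow> nat" where
  "piece_size p s u r = (if r < p then u else s * u)"

text \<open>All four walks have to comply at the same times, so that a single scale serves both
  colours on both sides of the origin.\<close>

definition ascent :: "real \<Rightarrow> nat \<Rightarrow> nat \<Rightarrow> nat \<Rightarrow> nat \<Rightarrow> ((bool \<times> bool) \<times> nat \<Rightarrow> real) \<Rightarrow> bool" where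
  "ascent A p s b u y \<longleftrightarrow> (\<forall>r\<le>p. \<forall>i. climbs A (\<lambda>j. y (i, b + r * u\<^sup>2 + j)) (piece_size p s u r))"

lemma piece_inside:
  assumes "r \<le> p" "j < (piece_size p s u r)\<^sup>2"
  shows "b + r * u\<^sup>2 + j < b + (p + s\<^sup>2) * u\<^sup>2"
proof (cases "r < p")
  case True
  then have "(r + 1) * u\<^sup>2 \<le> p * u\<^sup>2" by (intro mult_right_mono) auto
  then show ?thesis using assms(2) True unfolding piece_size_def by (simp add: algebra_simps)
next
  case False
  then show ?thesis using assms unfolding piece_size_def by (simp add: algebra_simps power_mult_distrib)
qed

text \<open>The event is decided by the steps inside the block, which makes the events of disjoint
  blocks independent.\<close>

lemma ascent_restrict:
  "ascent A p s b u (restrict y (UNIV \<times> {b..<b + (p + s\<^sup>2) * u\<^sup>2})) \<longleftrightarrow> ascent A p s b u y"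
  unfolding ascent_def
proof (intro all_cong1 imp_cong refl climbs_cong)
  fix r i j assume "r \<le> p" "j < (piece_size p s u r)\<^sup>2"
  from piece_inside[OF this, of b]
  show "restrict y (UNIV \<times> {b..<b + (p + s\<^sup>2) * u\<^sup>2}) (i, b + r * u\<^sup>2 + j) = y (i, b + r * u\<^sup>2 + j)" by simp
qed

lemma pred_ascent:
  assumes f: "\<And>i j. b \<le> j \<Longrightarrow> j < b + (p + s\<^sup>2) * u\<^sup>2 \<Longrightarrow> (\<lambda>x. f x (i, j)) \<in> borel_measurable N"
  shows "Measurable.pred N (\<lambda>x. ascent A p s b u (f x))"
proof -
  have "Measurable.pred N (\<lambda>x. \<forall>r\<in>{..p}. \<forall>i\<in>UNIV. climbs A (\<lambda>j. f x (i, b + r * u\<^sup>2 + j)) (piece_size p s u r))"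
    by (intro pred_intros_finite(3) finite_atMost finite_class.finite_UNIV pred_climbs f) (use piece_inside in auto)
  then show ?thesis unfolding ascent_def by (simp only: Ball_def atMost_iff UNIV_I simp_thms)
qed

context two_processes
begin

text \<open>The \<open>Suc p\<close> pieces of each of the four walks use disjoint sets of steps;
  hence the exponent.\<close>

lemma ascent_prob:
  assumes p: "\<And>v i b. v \<ge> v0 \<Longrightarrow> \<eta> \<le> prob {\<omega>\<in>space M. climbs A (\<lambda>j. step (i, b + j) \<omega>) v}" "0 \<le> \<eta>"
    and u: "v0 \<le> u" "1 \<le> s"
  shows "\<eta> ^ (4 * Suc p) \<le> prob {\<omega>\<in>space M. ascent A p s b u (\<lambda>ij. step ij \<omega>)}"
proof -
  let ?L = "{..p} \<times> (UNIV :: (bool \<times> bool) set)"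
  let ?v = "\<lambda>l. piece_size p s u (fst l)" and ?b = "\<lambda>l. b + fst l * u\<^sup>2"
  let ?K = "\<lambda>l. {snd l} \<times> {?b l..<?b l + (?v l)\<^sup>2}"
  let ?Q = "\<lambda>l y. climbs A (\<lambda>j. y (snd l, ?b l + j)) (?v l)"
  let ?step = "\<lambda>\<omega> ij. step ij \<omega>"
  have Q: "?Q l (restrict y (?K l)) \<longleftrightarrow> ?Q l y" for l y by (rule climbs_cong) simp
  have "prob {\<omega>\<in>space M. \<forall>l\<in>?L. ?Q l (restrict (?step \<omega>) (?K l))} = (\<Prod>l\<in>?L. prob {\<omega>\<in>space M. ?Q l (restrict (?step \<omega>) (?K l))})"
  proof (rule indep_blocks[OF indep_steps])
    show "disjoint_family_on ?K ?L"
      unfolding disjoint_family_on_def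
    proof (intro ballI impI)
      fix l l' assume l: "l \<in> ?L" "l' \<in> ?L" "l \<noteq> l'"
      have lt: "?K l \<inter> ?K l' = {}" if "fst l < fst l'" "l' \<in> ?L" for l l' :: "nat \<times> bool \<times> bool"
      proof -
        have "fst l < p" using that by auto
        then have "?b l + (?v l)\<^sup>2 = b + Suc (fst l) * u\<^sup>2" unfolding piece_size_def by simp
        also have "\<dots> \<le> ?b l'" using that by (intro add_left_mono mult_right_mono) auto
        finally show ?thesis by auto
      qed
      show "?K l \<inter> ?K l' = {}"
      proof (cases "fst l" "fst l'" rule: linorder_cases)
        case less
        show ?thesis by (rule lt[OF less l(2)])
      next
        case equal
        then have "snd l \<noteq> snd l'" using l(3) by (simp add: prod_eq_iff)
        then show ?thesis by blast
      next
        case greater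
        show ?thesis using lt[OF greater l(1)] by (simp only: Int_commute)
      qed
    qed
    show "Measurable.pred (PiM (?K l) (\<lambda>_. borel)) (?Q l)" for l
      by (intro pred_climbs measurable_component_singleton) auto
  qed auto
  also have "{\<omega>\<in>space M. \<forall>l\<in>?L. ?Q l (restrict (?step \<omega>) (?K l))} = {\<omega>\<in>space M. ascent A p s b u (?step \<omega>)}"
    unfolding Q ascent_def by auto
  finally have eq: "prob {\<omega>\<in>space M. ascent A p s b u (?step \<omega>)} = (\<Prod>l\<in>?L. prob {\<omega>\<in>space M. ?Q l (?step \<omega>)})"
    unfolding Q .
  have "v0 \<le> ?v l" for l using u unfolding piece_size_def by (auto intro: order_trans)
  then have "(\<Prod>l\<in>?L. \<eta>) \<le> (\<Prod>l\<in>?L. prob {\<omega>\<in>space M. ?Q l (?step \<omega>)})"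
    using p by (intro prod_mono) auto
  moreover have "(\<Prod>l\<in>?L. \<eta>) = \<eta> ^ (4 * Suc p)"
  proof -
    have "card ?L = 4 * Suc p"
      by (simp add: card_cartesian_product flip: UNIV_Times_UNIV)
    then show ?thesis by (simp only: prod_constant)
  qed
  ultimately show ?thesis unfolding eq by simp
qed

end

text \<open>Block \<open>k\<close> starts at \<open>start p s t k\<close> and has unit \<open>2 ^ k * start p s t k\<close>, so that everything
  before it is negligible on its own scale.\<close>

fun start :: "nat \<Rightarrow> nat \<Rightarrow> nat \<Rightarrow> nat \<Rightarrow> nat" where
  "start p s t 0 = t"
| "start p s t (Suc k) = start p s t k + (p + s\<^sup>2) * (2 ^ k * start p s t k)\<^sup>2"

lemma start_mono: "k \<le> l \<Longrightarrow> start p s t k \<le> start p s t l"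
  by (rule lift_Suc_mono_le[of "start p s t"]) simp_all

context two_processes
begin

text \<open>The blocks are independent and each succeeds with probability at least \<rho>, so
  \<open>l\<close> failures in a row have probability at most
  \<open>(1 - \<rho>) ^ l\<close>.\<close>

lemma AE_ascent:
  assumes p: "\<And>v i b. v \<ge> v0 \<Longrightarrow> \<eta> \<le> prob {\<omega>\<in>space M. climbs A (\<lambda>j. step (i, b + j) \<omega>) v}" "0 < \<eta>"
    and t: "v0 \<le> t" "1 \<le> s"
  shows "AE \<omega> in M. \<forall>n. \<exists>k\<ge>n. ascent A p s (start p s t k) (2 ^ k * start p s t k) (\<lambda>ij. step ij \<omega>)"
proof -
  let ?W = "\<lambda>k. ascent A p s (start p s t k) (2 ^ k * start p s t k)"
  let ?K = "\<lambda>k. UNIV \<times> {start p s t k..<start p s t (Suc k)} :: ((bool \<times> bool) \<times> nat) set"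
  let ?step = "\<lambda>\<omega> ij. step ij \<omega>"
  define \<rho> where "\<rho> = \<eta> ^ (4 * Suc p)"
  have \<rho>: "0 < \<rho>" unfolding \<rho>_def using p(2) by simp
  have Wk: "?W k (restrict y (?K k)) \<longleftrightarrow> ?W k y" for k y using ascent_restrict by simp
  have m: "Measurable.pred M (\<lambda>\<omega>. ?W k (?step \<omega>))" for k by (intro pred_ascent measurable_step)
  have W: "\<rho> \<le> prob {\<omega>\<in>space M. ?W k (?step \<omega>)}" for k
    unfolding \<rho>_def
  proof (rule ascent_prob)
    have "start p s t 0 \<le> start p s t k" by (rule start_mono) simp
    then have "v0 \<le> 1 * start p s t k" using t by simp
    also have "\<dots> \<le> 2 ^ k * start p s t k" by (intro mult_right_mono) auto
    finally show "v0 \<le> 2 ^ k * start p s t k" .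
  qed (use p t in auto)
  have "AE \<omega> in M. \<exists>k\<ge>n. ?W k (?step \<omega>)" for n
  proof -
    let ?E = "{\<omega>\<in>space M. \<forall>k\<ge>n. \<not> ?W k (?step \<omega>)}"
    have E: "?E \<in> events" using m by measurable
    have "prob ?E \<le> (1 - \<rho>) ^ l" for l
    proof -
      let ?L = "{n..<n + l}"
      have "prob ?E \<le> prob {\<omega>\<in>space M. \<forall>k\<in>?L. \<not> ?W k (restrict (?step \<omega>) (?K k))}"
        unfolding Wk using m by (intro finite_measure_mono) auto
      also have "\<dots> = (\<Prod>k\<in>?L. prob {\<omega>\<in>space M. \<not> ?W k (restrict (?step \<omega>) (?K k))})"
      proof (rule indep_blocks[OF indep_steps])
        show "disjoint_family_on ?K ?L"
          unfolding disjoint_family_on_def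
        proof (intro ballI impI)
          fix k l :: nat assume "k \<noteq> l"
          then have "Suc k \<le> l \<or> Suc l \<le> k" by linarith
          then have "start p s t (Suc k) \<le> start p s t l \<or> start p s t (Suc l) \<le> start p s t k"
            using start_mono by blast
          then show "?K k \<inter> ?K l = {}" by auto
        qed
        show "Measurable.pred (PiM (?K k) (\<lambda>_. borel)) (\<lambda>y. \<not> ?W k y)" for k
          by (intro pred_intros_logic(2) pred_ascent measurable_component_singleton) auto
      qed auto
      also have "\<dots> \<le> (\<Prod>k\<in>?L. 1 - \<rho>)"
      proof (rule prod_mono)
        fix k
        have "prob {\<omega>\<in>space M. \<not> ?W k (?step \<omega>)} = 1 - prob {\<omega>\<in>space M. ?W k (?step \<omega>)}"
          by (rule prob_neg) (use m in measurable)
        then show "0 \<le> prob {\<omega>\<in>space M. \<not> ?W k (restrict (?step \<omega>) (?K k))} \<and>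
            prob {\<omega>\<in>space M. \<not> ?W k (restrict (?step \<omega>) (?K k))} \<le> 1 - \<rho>"
          unfolding Wk using W[of k] by simp
      qed
      also have "\<dots> = (1 - \<rho>) ^ l" by simp
      finally show ?thesis .
    qed
    moreover have "(\<lambda>l. (1 - \<rho>) ^ l) \<longlonglongrightarrow> 0"
    proof (rule LIMSEQ_realpow_zero)
      show "0 \<le> 1 - \<rho>" using order_trans[OF W[of 0] prob_le_1] by simp
    qed (use \<rho> in simp)
    ultimately have "prob ?E \<le> 0" by (intro LIMSEQ_le_const) auto
    then have "prob ?E = 0" unfolding measure_le_0_iff .
    then have "?E \<in> null_sets M" using E by (intro null_setsI) (simp_all only: emeasure_eq_measure ennreal_0)
    then show ?thesis by (rule AE_I') blast
  qed
  then show ?thesis unfolding AE_all_countable ..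
qed

text \<open>The mean count is the length \<open>start p s t k\<close>. By Markov's inequality it is
  exceeded by the factor \<open>2 ^ k\<close> with probability at most \<open>(1 / 2) ^ k\<close>,
  which is summable.\<close>

lemma AE_early_counts:
  assumes t: "1 \<le> t"
  shows "AE \<omega> in M. \<forall>\<^sub>F k in sequentially. \<forall>i. card (C (fst i) \<omega> \<inter> stretch (snd i) 0 (start p s t k)) \<le> 2 ^ k * start p s t k"
proof -
  have "AE \<omega> in M. \<forall>\<^sub>F k in sequentially. card (C c \<omega> \<inter> stretch side 0 (start p s t k)) \<le> 2 ^ k * start p s t k" for c side
  proof -
    let ?N = "\<lambda>n \<omega>. real (card (C c \<omega> \<inter> stretch side 0 n))"
    have N: "integrable M (?N n)" "expectation (?N n) = real n" for n
    proof -
      have h: "heading (c, side) * heading (c, side) = 1" by (simp add: heading_def)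
      have "?N n \<omega> = real n + heading (c, side) * (\<Sum>j<n. step ((c, side), j) \<omega>)" if "\<omega> \<in> space M" for \<omega>
      proof -
        have "heading (c, side) * (\<Sum>j<n. step ((c, side), j) \<omega>) = ?N n \<omega> - real n"
          using step_sum[OF that, of "(c, side)" 0 n] h by (simp flip: mult.assoc)
        then show ?thesis by simp
      qed
      note eq = this
      have s: "integrable M (step ij)" for ij by (rule square_integrable_imp_integrable[OF measurable_step step_moments(1)])
      have i: "integrable M (\<lambda>\<omega>. real n + heading (c, side) * (\<Sum>j<n. step ((c, side), j) \<omega>))" using s by auto
      show "integrable M (?N n)" by (rule iffD2[OF Bochner_Integration.integrable_cong[OF refl eq] i])
      have "expectation (?N n) = expectation (\<lambda>\<omega>. real n + heading (c, side) * (\<Sum>j<n. step ((c, side), j) \<omega>))"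
        by (rule Bochner_Integration.integral_cong[OF refl eq])
      also have "\<dots> = real n" using s step_moments(2) by (simp add: prob_space)
      finally show "expectation (?N n) = real n" .
    qed
    let ?t = "start p s t"
    have tk: "1 \<le> ?t k" for k using start_mono[of 0 k p s t] t by simp
    let ?B = "\<lambda>k. {\<omega>\<in>space M. real (2 ^ k * ?t k) \<le> ?N (?t k) \<omega>}"
    have [measurable]: "?N n \<in> borel_measurable M" for n by (rule borel_measurable_integrable[OF N(1)])
    have B: "?B k \<in> events" for k by measurable
    have "prob (?B k) \<le> (1 / 2) ^ k" for k
    proof -
      have "prob (?B k) \<le> expectation (?N (?t k)) / real (2 ^ k * ?t k)"
        using N tk[of k] by (intro integral_Markov_inequality_measure[where A = "{}"]) auto
      also have "\<dots> = (1 / 2) ^ k" using tk[of k] unfolding N by (simp add: power_divide)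
      finally show ?thesis .
    qed
    then have "summable (\<lambda>k. prob (?B k))"
      by (intro summable_comparison_test[OF _ summable_geometric[of "1 / 2 :: real"]]) auto
    with B have "AE \<omega> in M. \<forall>\<^sub>F k in sequentially. \<omega> \<in> space M - ?B k"
      by (intro borel_cantelli_AE1) (auto simp: emeasure_eq_measure)
    then show ?thesis
    proof (rule eventually_mono)
      fix \<omega> assume "\<forall>\<^sub>F k in sequentially. \<omega> \<in> space M - ?B k"
      then show "\<forall>\<^sub>F k in sequentially. card (C c \<omega> \<inter> stretch side 0 (?t k)) \<le> 2 ^ k * ?t k"
      proof (rule eventually_mono)
        fix k assume "\<omega> \<in> space M - ?B k"
        then have "\<not> real (2 ^ k * ?t k) \<le> ?N (?t k) \<omega>" by blast
        then show "card (C c \<omega> \<inter> stretch side 0 (?t k)) \<le> 2 ^ k * ?t k" unfolding of_nat_le_iff by (simp only: not_le less_imp_le)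
      qed
    qed
  qed
  then have "AE \<omega> in M. \<forall>i. \<forall>\<^sub>F k in sequentially. card (C (fst i) \<omega> \<inter> stretch (snd i) 0 (start p s t k)) \<le> 2 ^ k * start p s t k"
    unfolding AE_all_countable by (rule allI)
  then show ?thesis
  proof (rule eventually_mono)
    fix \<omega>
    assume "\<forall>i. \<forall>\<^sub>F k in sequentially. card (C (fst i) \<omega> \<inter> stretch (snd i) 0 (start p s t k)) \<le> 2 ^ k * start p s t k"
    then show "\<forall>\<^sub>F k in sequentially. \<forall>i. card (C (fst i) \<omega> \<inter> stretch (snd i) 0 (start p s t k)) \<le> 2 ^ k * start p s t k"
      using eventually_all_finite[of "\<lambda>k i. card (C (fst i) \<omega> \<inter> stretch (snd i) 0 (start p s t k)) \<le> 2 ^ k * start p s t k" sequentially] by iprover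
  qed
qed

end

text \<open>After \<open>r\<close> pieces the walk has gained at least \<open>r * u\<close> over a
  start not below \<open>- u\<close>. Inside a piece it loses less than \<open>A * u\<close>, in the
  last piece less than \<open>A * s * u\<close>, which the climb through \<open>p\<close> pieces
  compensates.\<close>

lemma ascent_walk:
  fixes y :: "nat \<Rightarrow> real"
  assumes cl: "\<And>r. r \<le> p \<Longrightarrow> climbs A (\<lambda>j. y (b + r * u\<^sup>2 + j)) (piece_size p s u r)"
    and W: "- real u \<le> (\<Sum>j<b. y j)" and A: "1 \<le> A" "A * real s \<le> real p" and u: "1 \<le> u"
    and n: "b \<le> n" "n \<le> b + (p + s\<^sup>2) * u\<^sup>2"
  shows "- 2 * A * real u \<le> (\<Sum>j<n. y j)"
    "b + p * u\<^sup>2 \<le> n \<Longrightarrow> (real p - 1 - A * real s) * real u \<le> (\<Sum>j<n. y j)"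
proof -
  define S where "S n = (\<Sum>j<n. y j)" for n
  have split: "S (a + m) = S a + (\<Sum>j<m. y (a + j))" for a m
    by (induction m) (simp_all add: S_def)
  have ends: "(real r - 1) * real u \<le> S (b + r * u\<^sup>2)" if "r \<le> p" for r
    using that
  proof (induction r)
    case 0
    then show ?case using W by (simp add: S_def)
  next
    case (Suc r)
    have "real u \<le> (\<Sum>j<u\<^sup>2. y (b + r * u\<^sup>2 + j))"
      using cl[of r] Suc.prems unfolding climbs_def piece_size_def by simp
    moreover have "S (b + Suc r * u\<^sup>2) = S (b + r * u\<^sup>2) + (\<Sum>j<u\<^sup>2. y (b + r * u\<^sup>2 + j))"
      using split[of "b + r * u\<^sup>2" "u\<^sup>2"] by (simp add: algebra_simps)
    ultimately show ?case using Suc by (simp add: algebra_simps)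
  qed
  have last: "(real p - 1 - A * real s) * real u \<le> S n" if "b + p * u\<^sup>2 \<le> n"
  proof -
    define m where "m = n - (b + p * u\<^sup>2)"
    have m: "n = b + p * u\<^sup>2 + m" "m \<le> (s * u)\<^sup>2"
      using that n unfolding m_def by (simp_all add: algebra_simps power_mult_distrib)
    have "\<bar>\<Sum>j<m. y (b + p * u\<^sup>2 + j)\<bar> < A * real (s * u)"
      using cl[of p] m(2) unfolding climbs_def piece_size_def by simp
    moreover have "S n = S (b + p * u\<^sup>2) + (\<Sum>j<m. y (b + p * u\<^sup>2 + j))" unfolding m(1) by (rule split)
    ultimately show ?thesis using ends[of p] by (simp add: algebra_simps)
  qed
  then show "b + p * u\<^sup>2 \<le> n \<Longrightarrow> (real p - 1 - A * real s) * real u \<le> (\<Sum>j<n. y j)"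
    by (simp add: S_def)
  have Au: "real u \<le> A * real u" using A(1) mult_right_mono[of 1 A "real u"] by simp
  show "- 2 * A * real u \<le> (\<Sum>j<n. y j)"
  proof (cases "b + p * u\<^sup>2 \<le> n")
    case True
    have "0 \<le> (real p - A * real s) * real u" using A(2) by simp
    moreover have "(real p - 1 - A * real s) * real u = (real p - A * real s) * real u - real u" by (simp add: algebra_simps)
    moreover have "0 \<le> A * real u" using Au by simp
    ultimately show ?thesis using last[OF True] Au unfolding S_def by linarith
  next
    case False
    define r m where "r = (n - b) div u\<^sup>2" and "m = (n - b) mod u\<^sup>2"
    have eq: "n = b + r * u\<^sup>2 + m" using n(1) div_mult_mod_eq[of "n - b" "u\<^sup>2"] unfolding r_def m_def by linarith
    have m: "m \<le> u\<^sup>2" using u unfolding m_def by (simp add: less_imp_le)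
    have "r * u\<^sup>2 < p * u\<^sup>2" using False eq by linarith
    then have r: "r < p" by simp
    have "\<bar>\<Sum>j<m. y (b + r * u\<^sup>2 + j)\<bar> < A * real u"
      using cl[of r] m r unfolding climbs_def piece_size_def by simp
    moreover have "0 \<le> real r * real u" by simp
    moreover have "S n = S (b + r * u\<^sup>2) + (\<Sum>j<m. y (b + r * u\<^sup>2 + j))" unfolding eq by (rule split)
    ultimately have "- 2 * A * real u \<le> S n"
      using ends[OF less_imp_le[OF r]] Au unfolding left_diff_distrib by linarith
    then show ?thesis unfolding S_def .
  qed
qed

definition half :: "bool \<Rightarrow> real \<Rightarrow> real set" where
  "half side x = (if side then {0<..x} else {- x<..0})"

definition excess :: "real set \<Rightarrow> bool \<Rightarrow> real \<Rightarrow> real" where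
  "excess X side x = real (card (X \<inter> half side x)) - x"

text \<open>One common scale for all four counts with their signs corrected. Both
  \<open>dips\<close> and \<open>surge\<close> are deterministic consequences.\<close>

definition drifts :: "(bool \<Rightarrow> real set) \<Rightarrow> bool" where
  "drifts Z \<longleftrightarrow> (\<forall>(K::nat) (N::nat). \<exists>T D G. real N \<le> D \<and> D \<le> T \<and> real K * T \<le> G \<and> 0 < D \<and> 0 < G \<and>
     (\<forall>i x. 0 \<le> x \<longrightarrow> x \<le> T + G \<longrightarrow> - D \<le> heading i * excess (Z (fst i)) (snd i) x) \<and>
     (\<forall>i x. T \<le> x \<longrightarrow> x \<le> T + G \<longrightarrow> 5 * D \<le> heading i * excess (Z (fst i)) (snd i) x))"

section \<open>From walks at integer times to counts at real positions\<close>

context two_processes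
begin

text \<open>Counts are monotone. For a lagging count the next integer bounds the value at
  \<open>x\<close>, for a leading one the previous integer does; the distance to the integer costs
  at most 1.\<close>

lemma excess_interpolate:
  assumes \<omega>: "\<omega> \<in> space M" and x: "0 \<le> x"
  shows "heading i * excess (C (fst i) \<omega>) (snd i) x \<ge>
    (\<Sum>j<(if fst i = snd i then nat \<lceil>x\<rceil> else nat \<lfloor>x\<rfloor>). step (i, j) \<omega>) - 1"
proof -
  have fin: "finite (C c \<omega> \<inter> half side x)" for c side x
    using locally_finite[OF \<omega>] unfolding half_def by auto
  have st: "half side (real n) = stretch side 0 n" for side n unfolding half_def stretch_def by auto
  have mono: "card (C c \<omega> \<inter> half side x) \<le> card (C c \<omega> \<inter> half side x')" if "x \<le> x'" for c side x x'
    using that fin by (intro card_mono) (auto simp: half_def)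
  show ?thesis
  proof (cases "fst i = snd i")
    case True
    define n where "n = nat \<lceil>x\<rceil>"
    have n: "x \<le> real n" "real n \<le> x + 1" using x unfolding n_def by linarith+
    have "(\<Sum>j<n. step (i, j) \<omega>) - 1 \<le> heading i * excess (C (fst i) \<omega>) (snd i) x"
      using True n mono[OF n(1), of "fst i" "snd i"] step_sum[OF \<omega>, of i 0 n]
      by (simp add: heading_def excess_def st)
    then show ?thesis using True unfolding n_def by simp
  next
    case False
    define n where "n = nat \<lfloor>x\<rfloor>"
    have n: "real n \<le> x" "x \<le> real n + 1" using x unfolding n_def by linarith+
    have "(\<Sum>j<n. step (i, j) \<omega>) - 1 \<le> heading i * excess (C (fst i) \<omega>) (snd i) x"
      using False n mono[OF n(1), of "fst i" "snd i"] step_sum[OF \<omega>, of i 0 n]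
      by (simp add: heading_def excess_def st)
    then show ?thesis using False unfolding n_def by simp
  qed
qed

text \<open>\<open>D\<close> absorbs the dip of \<open>2 * A * u\<close> and the interpolation error
  1. The height after the climb is at least \<open>(22 * A - 1) * u\<close>, and subtracting the
  error leaves at least \<open>20 * A * u\<close>, which is \<open>5 * D\<close>.\<close>

lemma ascent_drift:
  assumes \<omega>: "\<omega> \<in> space M" and asc: "ascent A p s b u (\<lambda>ij. step ij \<omega>)"
    and early: "\<And>i. card (C (fst i) \<omega> \<inter> stretch (snd i) 0 b) \<le> u"
    and A: "1 \<le> A" "A * real s + 22 * A \<le> real p" and u: "1 \<le> u" "b \<le> u"
  defines "D \<equiv> 4 * A * real u" and "T \<equiv> real b + real p * (real u)\<^sup>2" and "G \<equiv> (real s * real u)\<^sup>2"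
  shows "0 \<le> x \<Longrightarrow> x \<le> T + G \<Longrightarrow> - D \<le> heading i * excess (C (fst i) \<omega>) (snd i) x"
    "T \<le> x \<Longrightarrow> x \<le> T + G \<Longrightarrow> 5 * D \<le> heading i * excess (C (fst i) \<omega>) (snd i) x"
proof -
  have Au: "real u \<le> A * real u" using A(1) mult_right_mono[of 1 A "real u"] by simp
  have Au1: "1 \<le> A * real u" using Au u(1) by linarith
  have W: "- real u \<le> (\<Sum>j<b. step (i, j) \<omega>)" for i
    using step_sum[OF \<omega>, of i 0 b] early[of i] u(2) unfolding heading_def by auto
  have p: "A * real s \<le> real p" using A by simp
  let ?n = "\<lambda>i x. if fst i = snd i then nat \<lceil>x\<rceil> else nat \<lfloor>x\<rfloor>"
  have TG: "T = real (b + p * u\<^sup>2)" "T + G = real (b + (p + s\<^sup>2) * u\<^sup>2)"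
    unfolding T_def G_def by (simp_all add: algebra_simps power_mult_distrib)
  have nat_le: "k \<le> ?n i x" if "real k \<le> x" for k x and i :: "bool \<times> bool" using that by (auto; linarith)
  have nat_ge: "?n i x \<le> k" if "x \<le> real k" for k x and i :: "bool \<times> bool" using that by (auto; linarith)
  note walk = ascent_walk[OF _ W A(1) p u(1)]
  have cl: "climbs A (\<lambda>j. step (i, b + r * u\<^sup>2 + j) \<omega>) (piece_size p s u r)" if "r \<le> p" for i r
    using asc that unfolding ascent_def by blast
  show "- D \<le> heading i * excess (C (fst i) \<omega>) (snd i) x" if x: "0 \<le> x" "x \<le> T + G"
  proof (cases "x < real b")
    case False
    then have "- 2 * A * real u \<le> (\<Sum>j<?n i x. step (i, j) \<omega>)"
      using x(2) TG(2) by (intro walk(1) cl nat_le nat_ge) auto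
    then show ?thesis using excess_interpolate[OF \<omega> x(1), of i] Au1 unfolding D_def by linarith
  next
    case True
    \<comment> \<open>Before the block nothing is known about the walk, but the count and
      \<open>x\<close> itself are both at most \<open>u\<close>.\<close>
    let ?c = "card (C (fst i) \<omega> \<inter> half (snd i) x)"
    have "?c \<le> card (C (fst i) \<omega> \<inter> stretch (snd i) 0 b)"
      using True locally_finite[OF \<omega>] stretch_borel by (intro card_mono) (auto simp: half_def stretch_def)
    then have "real ?c \<le> real u" using early[of i] by linarith
    moreover have "x \<le> real u" using True u(2) by linarith
    moreover have "real u \<le> D" unfolding D_def using Au Au1 by linarith
    ultimately show ?thesis using x(1) unfolding heading_def excess_def by auto
  qed
  show "5 * D \<le> heading i * excess (C (fst i) \<omega>) (snd i) x" if x: "T \<le> x" "x \<le> T + G"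
  proof -
    have "0 \<le> real p * (real u)\<^sup>2" by simp
    then have x1: "real b \<le> x" using x(1) unfolding T_def by linarith
    then have x0: "0 \<le> x" by linarith
    have "(real p - 1 - A * real s) * real u \<le> (\<Sum>j<?n i x. step (i, j) \<omega>)"
      using x x1 TG by (intro walk(2) cl nat_le nat_ge) auto
    moreover have "(22 * A - 1) * real u \<le> (real p - 1 - A * real s) * real u"
      using A by (intro mult_right_mono) auto
    ultimately show ?thesis using excess_interpolate[OF \<omega> x0, of i] Au1 Au unfolding D_def
      by (simp add: left_diff_distrib)
  qed
qed

lemma AE_drifts: "AE \<omega> in M. drifts (\<lambda>c. C c \<omega>)"
proof -
  from climbs_prob obtain A0 \<eta> v0 where A0: "1 \<le> A0" "0 < \<eta>"
    "\<forall>v\<ge>v0. \<forall>i b. \<eta> \<le> prob {\<omega>\<in>space M. climbs A0 (\<lambda>j. step (i, b + j) \<omega>) v}"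
    by (elim exE conjE)
  define A where "A = nat \<lceil>A0\<rceil>"
  have A: "1 \<le> A" "A0 \<le> real A" using A0(1) unfolding A_def by linarith+
  have "AE \<omega> in M. \<forall>N. \<exists>T D G. real N \<le> D \<and> D \<le> T \<and> real K * T \<le> G \<and> 0 < D \<and> 0 < G \<and>
     (\<forall>i x. 0 \<le> x \<longrightarrow> x \<le> T + G \<longrightarrow> - D \<le> heading i * excess (C (fst i) \<omega>) (snd i) x) \<and>
     (\<forall>i x. T \<le> x \<longrightarrow> x \<le> T + G \<longrightarrow> 5 * D \<le> heading i * excess (C (fst i) \<omega>) (snd i) x)" for K :: nat
  proof -
    \<comment> \<open>These values give \<open>p + 1 \<le> 24 * A * s\<close> and hence
      \<open>K * (p + 1) \<le> s\<^sup>2\<close>: the last piece outlasts everything before it by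
      the factor \<open>K\<close>.\<close>
    define s where "s = K * (24 * A) + 1"
    define p where "p = A * s + 22 * A"
    define t where "t = v0 + 1"
    let ?t = "start p s t"
    let ?u = "\<lambda>k. 2 ^ k * ?t k"
    have Ks: "K * (p + 1) \<le> s\<^sup>2"
    proof -
      have "p + 1 \<le> 24 * A * s" using A(1) unfolding p_def s_def by (simp add: algebra_simps)
      then have "K * (p + 1) \<le> K * (24 * A * s)" by (rule mult_left_mono) simp
      also have "\<dots> \<le> s * s" unfolding s_def by (simp add: algebra_simps)
      finally show ?thesis by (simp add: power2_eq_square)
    qed
    have asc: "AE \<omega> in M. \<forall>n. \<exists>k\<ge>n. ascent A0 p s (?t k) (?u k) (\<lambda>ij. step ij \<omega>)"
      by (rule AE_ascent[OF A0(3)[rule_format] A0(2)]) (auto simp: t_def s_def)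
    have early: "AE \<omega> in M. \<forall>\<^sub>F k in sequentially. \<forall>i. card (C (fst i) \<omega> \<inter> stretch (snd i) 0 (?t k)) \<le> ?u k"
      by (rule AE_early_counts) (simp add: t_def)
    have sp: "AE \<omega> in M. \<omega> \<in> space M" by simp
    from asc early sp show ?thesis
    proof eventually_elim
      case (elim \<omega>)
      from elim(2) obtain k0 where k0: "\<And>k i. k \<ge> k0 \<Longrightarrow> card (C (fst i) \<omega> \<inter> stretch (snd i) 0 (?t k)) \<le> ?u k"
        unfolding eventually_sequentially by blast
      show ?case
      proof
        fix N :: nat
        obtain k where k: "k \<ge> max k0 N" and asc0: "ascent A0 p s (?t k) (?u k) (\<lambda>ij. step ij \<omega>)" using elim(1) by blast
        let ?b = "?t k"
        define u where "u = ?u k"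
        have asc: "ascent (real A) p s ?b u (\<lambda>ij. step ij \<omega>)"
          using asc0 climbs_mono[OF _ A(2)] unfolding ascent_def u_def by blast
        have b: "1 \<le> ?b" using start_mono[of 0 k p s t] unfolding t_def by simp
        have "1 * ?b \<le> ?u k" by (intro mult_right_mono) auto
        then have u: "1 \<le> u" "?b \<le> u" using b unfolding u_def by auto
        have "k < 2 ^ k" by simp
        also have "2 ^ k * 1 \<le> u" unfolding u_def using b by (intro mult_left_mono) auto
        finally have Nu: "N \<le> u" using k by simp
        have Ap: "real A * real s + 22 * real A \<le> real p" unfolding p_def by simp
        have ear: "card (C (fst i) \<omega> \<inter> stretch (snd i) 0 ?b) \<le> u" for i using k0[of k i] k unfolding u_def by simp
        have A1: "1 \<le> real A" using A(1) by simp
        note dr = ascent_drift[OF elim(3) asc ear A1 Ap u]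
        let ?D = "4 * real A * real u" and ?T = "real ?b + real p * (real u)\<^sup>2" and ?G = "(real s * real u)\<^sup>2"
        have Au: "u \<le> A * u" using A(1) by simp
        have uu: "u \<le> u\<^sup>2" using u(1) by (simp add: power2_eq_square)
        have "N \<le> 4 * A * u" using Nu Au by linarith
        then have 1: "real N \<le> ?D" by (metis of_nat_le_iff of_nat_mult of_nat_numeral)
        have "4 * A * u \<le> p * u\<^sup>2" using uu unfolding p_def by (intro mult_mono) auto
        then have "4 * A * u \<le> ?b + p * u\<^sup>2" by simp
        then have 2: "?D \<le> ?T" by (metis of_nat_add of_nat_le_iff of_nat_mult of_nat_numeral of_nat_power)
        have "?b + p * u\<^sup>2 \<le> (p + 1) * u\<^sup>2" using u(2) uu by simp
        then have "K * (?b + p * u\<^sup>2) \<le> K * ((p + 1) * u\<^sup>2)" by (rule mult_left_mono) simp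
        also have "\<dots> \<le> (s * u)\<^sup>2" using mult_right_mono[OF Ks, of "u\<^sup>2"] by (simp only: power_mult_distrib mult.assoc zero_le)
        finally have 3: "real K * ?T \<le> ?G" by (metis of_nat_add of_nat_le_iff of_nat_mult of_nat_power)
        have "0 < s" unfolding s_def by simp
        then have 4: "0 < ?D" "0 < ?G" using A(1) u(1) by auto
        show "\<exists>T D G. real N \<le> D \<and> D \<le> T \<and> real K * T \<le> G \<and> 0 < D \<and> 0 < G \<and>
           (\<forall>i x. 0 \<le> x \<longrightarrow> x \<le> T + G \<longrightarrow> - D \<le> heading i * excess (C (fst i) \<omega>) (snd i) x) \<and>
           (\<forall>i x. T \<le> x \<longrightarrow> x \<le> T + G \<longrightarrow> 5 * D \<le> heading i * excess (C (fst i) \<omega>) (snd i) x)"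
          by (rule exI[of _ ?T], rule exI[of _ ?D], rule exI[of _ ?G]) (intro conjI 1 2 3 4 allI impI dr)
      qed
    qed
  qed
  then show ?thesis unfolding drifts_def AE_all_countable by (rule allI)
qed

end

section \<open>Almost sure properties\<close>

text \<open>On the right, late red and early blue points lower the level. On the left the level is
  blue minus red and the tendencies are reversed as well, so it is low there too.\<close>

lemma drifts_dips:
  assumes dr: "drifts Z"
  shows "dips (Z True) (Z False)"
  unfolding dips_def
proof (intro allI)
  fix K :: real and N :: nat
  \<comment> \<open>The factor 2 pays for the symmetric window, whose length is
    \<open>2 * T\<close>.\<close>
  define K' where "K' = 2 * nat \<lceil>K\<rceil>"
  have K': "2 * K \<le> real K'" unfolding K'_def by simp linarith
  from dr obtain T D G where N: "real (Suc N) \<le> D" "D \<le> T" and KT: "real K' * T \<le> G" and pos: "0 < D" "0 < G"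
    and e: "\<And>i x. T \<le> x \<Longrightarrow> x \<le> T + G \<Longrightarrow> 5 * D \<le> heading i * excess (Z (fst i)) (snd i) x"
    unfolding drifts_def by meson
  have "(2 * K) * T \<le> real K' * T" using K' N pos by (intro mult_right_mono) auto
  then have K: "K * (T - - T) \<le> G" using KT by (simp add: algebra_simps)
  have right: "lev (Z True) (Z False) \<tau> < - int N" if \<tau>: "T \<le> \<tau>" "\<tau> \<le> T + G" for \<tau>
  proof -
    have "5 * D \<le> - excess (Z True) True \<tau>" "5 * D \<le> excess (Z False) True \<tau>"
      using e[OF \<tau>, of "(True, True)"] e[OF \<tau>, of "(False, True)"] by (simp_all add: heading_def)
    moreover have "0 \<le> \<tau>" using \<tau> N pos by linarith
    ultimately have "real_of_int (lev (Z True) (Z False) \<tau>) \<le> - 10 * D"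
      unfolding lev_def excess_def half_def by simp
    also have "\<dots> < real_of_int (- int N)" using N pos by simp
    finally show ?thesis by linarith
  qed
  have left: "lev (Z True) (Z False) \<tau> < - int N" if \<tau>: "- T - G \<le> \<tau>" "\<tau> \<le> - T" for \<tau>
  proof -
    have x: "T \<le> - \<tau>" "- \<tau> \<le> T + G" using \<tau> by auto
    have "5 * D \<le> - excess (Z False) False (- \<tau>)" "5 * D \<le> excess (Z True) False (- \<tau>)"
      using e[OF x, of "(True, False)"] e[OF x, of "(False, False)"] by (simp_all add: heading_def)
    moreover have "\<tau> < 0" using \<tau> N pos by linarith
    ultimately have "real_of_int (lev (Z True) (Z False) \<tau>) \<le> - 10 * D"
      unfolding lev_def excess_def half_def by simp
    also have "\<dots> < real_of_int (- int N)" using N pos by simp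
    finally show ?thesis by linarith
  qed
  show "\<exists>s t G. s < - real N \<and> real N < t \<and> 0 < G \<and> K * (t - s) \<le> G \<and>
     (\<forall>\<tau>. s - G \<le> \<tau> \<and> \<tau> \<le> s \<or> t \<le> \<tau> \<and> \<tau> \<le> t + G \<longrightarrow> lev (Z True) (Z False) \<tau> < - int N)"
    using N pos K left right by (intro exI[of _ "- T"] exI[of _ T] exI[of _ G]) auto
qed

lemma drifts_surge:
  assumes dr: "drifts Z"
  shows "surge (Z True) (Z False)"
  unfolding surge_def
proof (intro allI)
  fix K :: real and N :: nat
  from dr obtain T D G where N: "real N \<le> D" "D \<le> T" and KT: "real (nat \<lceil>K\<rceil>) * T \<le> G" and pos: "0 < D" "0 < G"
    and b: "\<And>i x. 0 \<le> x \<Longrightarrow> x \<le> T + G \<Longrightarrow> - D \<le> heading i * excess (Z (fst i)) (snd i) x"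
    and e: "\<And>i x. T \<le> x \<Longrightarrow> x \<le> T + G \<Longrightarrow> 5 * D \<le> heading i * excess (Z (fst i)) (snd i) x"
    unfolding drifts_def by meson
  have "K * T \<le> real (nat \<lceil>K\<rceil>) * T" using N pos by (intro mult_right_mono) linarith+
  then have K: "K * T \<le> G" using KT by simp
  have "real (card (Z True \<inter> {0<..x})) \<le> x + D" "x - D \<le> real (card (Z False \<inter> {0<..x}))" if "0 \<le> x" "x \<le> T + G" for x
    using b[OF that, of "(True, True)"] b[OF that, of "(False, True)"] by (simp_all add: heading_def excess_def half_def)
  moreover have "real (card (Z True \<inter> {0<..x})) \<le> x - 5 * D" "x + 5 * D \<le> real (card (Z False \<inter> {0<..x}))" if "T \<le> x" "x \<le> T + G" for x
    using e[OF that, of "(True, True)"] e[OF that, of "(False, True)"] by (simp_all add: heading_def excess_def half_def)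
  ultimately show "\<exists>T D G. real N \<le> T \<and> real N \<le> D \<and> D \<le> T \<and> K * T \<le> G \<and>
     (\<forall>x. 0 \<le> x \<and> x \<le> T + G \<longrightarrow> real (card (Z True \<inter> {0<..x})) \<le> x + D \<and> x - D \<le> real (card (Z False \<inter> {0<..x}))) \<and>
     (\<forall>x. T \<le> x \<and> x \<le> T + G \<longrightarrow> real (card (Z True \<inter> {0<..x})) \<le> x - 5 * D \<and> x + 5 * D \<le> real (card (Z False \<inter> {0<..x})))"
    using N K by (intro exI[of _ T] exI[of _ D] exI[of _ G]) auto
qed

text \<open>Applied to the exchanged processes, \<open>AE_drifts\<close> supplies the opposite
  tendencies, needed for \<open>dips\<close> and \<open>surge\<close> with the colours
  interchanged.\<close>

lemma two_processes_swap:
  assumes "two_processes M C"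
  shows "two_processes M (\<lambda>c. C (\<not> c))"
proof -
  interpret two_processes M C by (rule assms)
  have ind: "indep_set (process_events M (C True)) (process_events M (C False))"
    using indep unfolding indep_processes_def .
  have "indep_set (process_events M (C False)) (process_events M (C True))"
  proof (rule indep_setI)
    show "process_events M (C False) \<subseteq> events" "process_events M (C True) \<subseteq> events"
      using indep_setD_ev1[OF ind] indep_setD_ev2[OF ind] by auto
    show "prob (A \<inter> B) = prob A * prob B" if "A \<in> process_events M (C False)" "B \<in> process_events M (C True)" for A B
      using indep_setD[OF ind that(2,1)] by (simp add: Int_commute mult.commute)
  qed
  then show ?thesis
    by unfold_locales (simp_all add: poisson indep_processes_def)
qed

lemma AE_good_points:
  assumes "prob_space P" "poisson_process P 1 R" "poisson_process P 1 B" "indep_processes P R B"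
  shows "AE \<omega> in P. good_points (R \<omega>) (B \<omega>)"
proof -
  interpret prob_space P by (fact assms)
  interpret two_processes P "\<lambda>c. if c then R else B"
    by unfold_locales (use assms in auto)
  interpret swap: two_processes P "\<lambda>c. if \<not> c then R else B"
    by (rule two_processes_swap) unfold_locales
  have "AE \<omega> in P. \<omega> \<in> space P" by simp
  with AE_disjoint AE_distinct_lengths AE_drifts swap.AE_drifts show ?thesis
  proof eventually_elim
    case (elim \<omega>)
    show ?case
    proof
      show "finite (R \<omega> \<inter> {a..b})" "finite (B \<omega> \<inter> {a..b})" for a b
        using locally_finite[OF elim(5), of "{a..b}" True] locally_finite[OF elim(5), of "{a..b}" False] by auto
      show "dips (R \<omega>) (B \<omega>)" "surge (R \<omega>) (B \<omega>)"
        using drifts_dips[OF elim(3)] drifts_surge[OF elim(3)] by simp_all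
      show "dips (B \<omega>) (R \<omega>)" "surge (B \<omega>) (R \<omega>)"
        using drifts_dips[OF elim(4)] drifts_surge[OF elim(4)] by simp_all
    qed (use elim(1,2) in auto)
  qed
qed

lemma AE_separated:
  assumes "prob_space P" "poisson_process P 1 R" "poisson_process P 1 B" "indep_processes P R B" "\<gamma> < 1" "0 < a"
  shows "AE \<omega> in P. separated (principal {\<gamma>}) a (R \<omega>) (B \<omega>)"
proof -
  interpret prob_space P by (fact assms)
  interpret two_processes P "\<lambda>c. if c then R else B"
    by unfold_locales (use assms in auto)
  show ?thesis using AE_separated[OF assms(5,6)] by simp
qed

text \<open>Uniqueness is stated for each \<gamma> and \<open>a\<close> separately, since its null
  set comes from coincidences of costs. The other claims hold for all parameters on the event
  \<open>good_points\<close>; there finite difference speaks of the matchings that are unique,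
  expressed by singleton sets.\<close>

theorem corollary2:
  fixes P :: "'w measure" and R B :: "'w \<Rightarrow> real set"
  assumes "prob_space P"
    and "poisson_process P 1 R" and "poisson_process P 1 B"
    and "indep_processes P R B"
  shows
    "(AE \<omega> in P.
        \<forall>\<gamma> \<in> Exponent ` {1<..} \<union> {Plus_Infinity, One_Plus}.
        \<forall>\<gamma>' \<in> Exponent ` {1<..} \<union> {Plus_Infinity, One_Plus}. \<forall>a>0. \<forall>a'>0.
          minimal_matchings \<gamma> a (R \<omega>) (B \<omega>) = minimal_matchings \<gamma>' a' (R \<omega>) (B \<omega>))
   \<and> (AE \<omega> in P.
        \<forall>\<gamma> \<in> {Minus_Infinity, One_Minus, Plus_Infinity}. \<forall>a>0. \<forall>a'>0. a \<noteq> a' \<longrightarrow>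
          minimal_matchings \<gamma> a (R \<omega>) (B \<omega>) = minimal_matchings \<gamma> a' (R \<omega>) (B \<omega>))
   \<and> (\<forall>\<gamma> \<in> Exponent ` {..<1} \<union> {Minus_Infinity}. \<forall>a>0.
        AE \<omega> in P. \<exists>!M. M \<in> minimal_matchings \<gamma> a (R \<omega>) (B \<omega>))
   \<and> (AE \<omega> in P. \<forall>a>0.
        countable (minimal_matchings One_Minus a (R \<omega>) (B \<omega>)) \<and>
        infinite (minimal_matchings One_Minus a (R \<omega>) (B \<omega>)))
   \<and> (AE \<omega> in P.
        \<forall>\<gamma> \<in> Exponent ` {..<1} \<union> {Minus_Infinity}.
        \<forall>\<gamma>' \<in> Exponent ` {..<1} \<union> {Minus_Infinity, One_Minus}. \<forall>a>0. \<forall>a'>0. \<forall>M M'.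
          minimal_matchings \<gamma> a (R \<omega>) (B \<omega>) = {M} \<longrightarrow>
          (if \<gamma>' = One_Minus then M' \<in> minimal_matchings \<gamma>' a' (R \<omega>) (B \<omega>)
           else minimal_matchings \<gamma>' a' (R \<omega>) (B \<omega>) = {M'}) \<longrightarrow>
          finite_difference (R \<omega>) (B \<omega>) M M')"
proof -
  note good = AE_good_points[OF assms]
  show ?thesis
  proof (intro conjI ballI allI impI)
    show "AE \<omega> in P.
        \<forall>\<gamma> \<in> Exponent ` {1<..} \<union> {Plus_Infinity, One_Plus}.
        \<forall>\<gamma>' \<in> Exponent ` {1<..} \<union> {Plus_Infinity, One_Plus}. \<forall>a>0. \<forall>a'>0.
          minimal_matchings \<gamma> a (R \<omega>) (B \<omega>) = minimal_matchings \<gamma>' a' (R \<omega>) (B \<omega>)"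
      using good
    proof (rule AE_mp, intro AE_I2 impI ballI allI)
      fix \<omega> \<gamma> \<gamma>' and a a' :: real
      assume g: "good_points (R \<omega>) (B \<omega>)" and c: "\<gamma> \<in> Exponent ` {1<..} \<union> {Plus_Infinity, One_Plus}"
        "\<gamma>' \<in> Exponent ` {1<..} \<union> {Plus_Infinity, One_Plus}" "0 < a" "0 < a'"
      show "minimal_matchings \<gamma> a (R \<omega>) (B \<omega>) = minimal_matchings \<gamma>' a' (R \<omega>) (B \<omega>)"
        using good_points.minimal_matchings_convex[OF g c(1,3)] good_points.minimal_matchings_convex[OF g c(2,4)] by simp
    qed
    show "AE \<omega> in P.
        \<forall>\<gamma> \<in> {Minus_Infinity, One_Minus, Plus_Infinity}. \<forall>a>0. \<forall>a'>0. a \<noteq> a' \<longrightarrow>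
          minimal_matchings \<gamma> a (R \<omega>) (B \<omega>) = minimal_matchings \<gamma> a' (R \<omega>) (B \<omega>)"
      using good
    proof (rule AE_mp, intro AE_I2 impI ballI allI)
      fix \<omega> \<gamma> and a a' :: real
      assume g: "good_points (R \<omega>) (B \<omega>)" and c: "\<gamma> \<in> {Minus_Infinity, One_Minus, Plus_Infinity}" "0 < a" "0 < a'"
      show "minimal_matchings \<gamma> a (R \<omega>) (B \<omega>) = minimal_matchings \<gamma> a' (R \<omega>) (B \<omega>)"
        by (rule good_points.minimal_matchings_weight[OF g c])
    qed
    show "AE \<omega> in P. \<exists>!M. M \<in> minimal_matchings \<gamma> a (R \<omega>) (B \<omega>)"
      if \<gamma>: "\<gamma> \<in> Exponent ` {..<1} \<union> {Minus_Infinity}" and a: "0 < a" for \<gamma> a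
    proof -
      have "AE \<omega> in P. \<forall>g. \<gamma> = Exponent g \<longrightarrow> separated (principal {g}) a (R \<omega>) (B \<omega>)"
        using AE_separated[OF assms _ a] \<gamma> by (cases \<gamma>) auto
      with good show ?thesis
      proof eventually_elim
        case (elim \<omega>)
        then show ?case using good_points.minimal_matchings_unique[OF elim(1) \<gamma> a] by blast
      qed
    qed
    show "AE \<omega> in P. \<forall>a>0.
        countable (minimal_matchings One_Minus a (R \<omega>) (B \<omega>)) \<and>
        infinite (minimal_matchings One_Minus a (R \<omega>) (B \<omega>))"
      using good
    proof (rule AE_mp, intro AE_I2 impI allI)
      fix \<omega> and a :: real
      assume g: "good_points (R \<omega>) (B \<omega>)" and a: "0 < a"
      interpret good_points "R \<omega>" "B \<omega>" by (fact g)
      show "countable (minimal_matchings One_Minus a (R \<omega>) (B \<omega>)) \<and> infinite (minimal_matchings One_Minus a (R \<omega>) (B \<omega>))"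
        using countable_directed_perfect[OF dips_unbounded[OF dips]] minimal_matchings_one_minus[OF a] by simp
    qed
    show "AE \<omega> in P.
        \<forall>\<gamma> \<in> Exponent ` {..<1} \<union> {Minus_Infinity}.
        \<forall>\<gamma>' \<in> Exponent ` {..<1} \<union> {Minus_Infinity, One_Minus}. \<forall>a>0. \<forall>a'>0. \<forall>M M'.
          minimal_matchings \<gamma> a (R \<omega>) (B \<omega>) = {M} \<longrightarrow>
          (if \<gamma>' = One_Minus then M' \<in> minimal_matchings \<gamma>' a' (R \<omega>) (B \<omega>)
           else minimal_matchings \<gamma>' a' (R \<omega>) (B \<omega>) = {M'}) \<longrightarrow>
          finite_difference (R \<omega>) (B \<omega>) M M'"
      using good
    proof (rule AE_mp, intro AE_I2 impI ballI allI)
      fix \<omega> \<gamma> \<gamma>' and a a' :: real and M M'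
      assume g: "good_points (R \<omega>) (B \<omega>)" and c: "\<gamma> \<in> Exponent ` {..<1} \<union> {Minus_Infinity}"
        "\<gamma>' \<in> Exponent ` {..<1} \<union> {Minus_Infinity, One_Minus}" "0 < a" "0 < a'"
        and M: "minimal_matchings \<gamma> a (R \<omega>) (B \<omega>) = {M}"
          "if \<gamma>' = One_Minus then M' \<in> minimal_matchings \<gamma>' a' (R \<omega>) (B \<omega>)
           else minimal_matchings \<gamma>' a' (R \<omega>) (B \<omega>) = {M'}"
      have "M' \<in> minimal_matchings \<gamma>' a' (R \<omega>) (B \<omega>)" using M(2) by (auto split: if_splits)
      then show "finite_difference (R \<omega>) (B \<omega>) M M'"
        using good_points.minimal_matchings_finite_difference[OF g c] M(1) by blast
    qed
  qed
qed

end
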